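(* Let $n\le m$, let $\Omega\subset\mathbb{R}^n$ be a domain, let $\omega$ be a constant coefficient $n$-volume form in $\mathbb{R}^m$, and let $f:\Omega\to\mathbb{R}^m$ be a finite distortion $\omega$-curve with distortion function $K_f$. There exists a constant $c_2=c_2(n)>0$, depending only on $n$, such that if $\exp(\lambda K_f)\in L^1_{loc}(\Omega)$ for some $\lambda>c_2$, then $f$ has a continuous and almost everywhere differentiable representative. Moreover, this representative has Lusin's (N) property, that is, it maps sets of zero $n$-dimensional Lebesgue measure to sets of zero $n$-dimensional measure.
   Context: An $n$-volume form on $\mathbb{R}^m$ is a smooth, non-vanishing, closed differential $n$-form $\omega=\sum_I\phi_I\,dx_I$, the sum being over multi-indices $I=(i_1,\dots,i_n)$, $1\le i_1<\dots<i_n\le m$, with $dx_I=dx_{i_1}\wedge\dots\wedge dx_{i_n}$. It is a constant coefficient form if all $\phi_I$ are constant. The pointwise comass norm is $\|\omega\|(p)=\sup\{|\omega_p(v_1,\dots,v_n)|: v_1,\dots,v_n\in\mathbb{R}^m,\ |v_i|\le 1\}$. For a Sobolev map $f$, $\star f^*\omega$ denotes the real-valued function with $(\star f^*\omega)\,dx_1\wedge\dots\wedge dx_n=f^*\omega$ (pullback computed with weak derivatives). $|Df(x)|$ is the operator norm of the weak differential. Finite distortion $\omega$-curve: a map $f\in W^{1,1}_{loc}(\Omega,\mathbb{R}^m)$ such that $\star f^*\omega\in L^1_{loc}(\Omega)$ and there is a measurable function $K_f\ge 1$, finite almost everywhere (the distortion function), with $(\|\omega\|\circ f)(x)\,|Df(x)|^n\le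 K_f(x)\,(\star f^*\omega)(x)$ for almost every $x\in\Omega$. In the target $\mathbb{R}^m$, $n$-dimensional measure means the Hausdorff measure $\mathcal{H}^n$. *)

theory Defs
  imports "HOL-Analysis.Analysis"
begin

text \<open>
  The constant in the theorem depends on the dimension \<open>n\<close> of the domain but not on the dimension
  \<open>m\<close> of the target, so \<open>m\<close> has to be quantified inside the statement and cannot be a type.
  The domain lies in \<open>real ^ 'n\<close> with \<open>n = CARD('n)\<close>, the order of \<open>'n\<close> being the order of the
  coordinates \<open>x\<^sub>1, ..., x\<^sub>n\<close>; the numeral types provide a \<open>{finite,wellorder}\<close> type for every \<open>n \<ge> 1\<close>.  The target is the library's \<^const>\<open>Euclidean_space\<close> \<open>m\<close>, whose points
  are the \<open>x :: nat \<Rightarrow> real\<close> with \<open>x i = 0\<close> for all \<open>i \<ge> m\<close>; its coordinates have the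
  indices \<open>0, ..., m - 1\<close>, and its Euclidean norm is \<open>L2_set x {..<m}\<close>.
\<close>

section \<open>Differential forms on the target\<close>

definition multi_indices :: "nat \<Rightarrow> ('n::{finite,wellorder} \<Rightarrow> nat) set" where
  "multi_indices m = {I. strict_mono I \<and> range I \<subseteq> {..<m}}"

text \<open>An \<open>n\<close>-form is given by its coefficient functions, \<open>\<omega> I\<close> being the coefficient of \<open>dx\<^sub>I\<close>.
  Only the values at \<open>I \<in> multi_indices m\<close> and at points of \<open>Euclidean_space m\<close> matter.\<close>

type_synonym 'n form = "('n \<Rightarrow> nat) \<Rightarrow> (nat \<Rightarrow> real) \<Rightarrow> real"

definition form_apply ::
    "nat \<Rightarrow> 'n::{finite,wellorder} form \<Rightarrow> (nat \<Rightarrow> real) \<Rightarrow> ('n \<Rightarrow> nat \<Rightarrow> real) \<Rightarrow> real" where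
  "form_apply m \<omega> p v = (\<Sum>I\<in>multi_indices m. \<omega> I p * det (\<chi> k j. v j (I k)))"

definition coord_deriv :: "nat \<Rightarrow> ((nat \<Rightarrow> real) \<Rightarrow> real) \<Rightarrow> (nat \<Rightarrow> real) \<Rightarrow> real" where
  "coord_deriv j \<phi> p = deriv (\<lambda>t. \<phi> (p(j := t))) (p j)"

primrec C_diff_target :: "nat \<Rightarrow> nat \<Rightarrow> ((nat \<Rightarrow> real) \<Rightarrow> real) \<Rightarrow> bool" where
  "C_diff_target m 0 \<phi> \<longleftrightarrow> continuous_map (Euclidean_space m) euclideanreal \<phi>"
| "C_diff_target m (Suc k) \<phi> \<longleftrightarrow>
     continuous_map (Euclidean_space m) euclideanreal \<phi> \<and>
     (\<forall>j<m. (\<forall>p\<in>topspace (Euclidean_space m). (\<lambda>t. \<phi> (p(j := t))) differentiable (at (p j))) \<and>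
            C_diff_target m k (coord_deriv j \<phi>))"

definition smooth_target :: "nat \<Rightarrow> ((nat \<Rightarrow> real) \<Rightarrow> real) \<Rightarrow> bool" where
  "smooth_target m \<phi> \<longleftrightarrow> (\<forall>k. C_diff_target m k \<phi>)"

text \<open>The coefficient of \<open>dx\<^sub>J\<close>, for an \<open>(n+1)\<close>-element set \<open>J\<close>, in
  \<open>d\<omega> = (\<Sum>I. \<Sum>j. \<partial>\<^sub>j \<omega>\<^sub>I dx\<^sub>j \<and> dx\<^sub>I)\<close>; the sign comes from moving \<open>dx\<^sub>j\<close> past the factors of
  \<open>dx\<^sub>I\<close> with a smaller index.\<close>

definition ext_deriv_coeff ::
    "nat \<Rightarrow> 'n::{finite,wellorder} form \<Rightarrow> nat set \<Rightarrow> (nat \<Rightarrow> real) \<Rightarrow> real" where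
  "ext_deriv_coeff m \<omega> J p =
     (\<Sum>(I, j)\<in>{(I, j). I \<in> multi_indices m \<and> j < m \<and> j \<notin> range I \<and> insert j (range I) = J}.
        (- 1) ^ card {k. I k < j} * coord_deriv j (\<omega> I) p)"

definition closed_form :: "nat \<Rightarrow> 'n::{finite,wellorder} form \<Rightarrow> bool" where
  "closed_form m \<omega> \<longleftrightarrow>
     (\<forall>J. J \<subseteq> {..<m} \<and> card J = CARD('n) + 1 \<longrightarrow>
        (\<forall>p\<in>topspace (Euclidean_space m). ext_deriv_coeff m \<omega> J p = 0))"

definition volume_form :: "nat \<Rightarrow> 'n::{finite,wellorder} form \<Rightarrow> bool" where
  "volume_form m \<omega> \<longleftrightarrow>
     (\<forall>I\<in>multi_indices m. smooth_target m (\<omega> I)) \<and>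
     (\<forall>p\<in>topspace (Euclidean_space m).
        \<exists>v. (\<forall>j. v j \<in> topspace (Euclidean_space m)) \<and> form_apply m \<omega> p v \<noteq> 0) \<and>
     closed_form m \<omega>"

definition constant_coefficients :: "nat \<Rightarrow> 'n::{finite,wellorder} form \<Rightarrow> bool" where
  "constant_coefficients m \<omega> \<longleftrightarrow>
     (\<forall>I\<in>multi_indices m. \<exists>c. \<forall>p\<in>topspace (Euclidean_space m). \<omega> I p = c)"

definition comass :: "nat \<Rightarrow> 'n::{finite,wellorder} form \<Rightarrow> (nat \<Rightarrow> real) \<Rightarrow> real" where
  "comass m \<omega> p =
     Sup {\<bar>form_apply m \<omega> p v\<bar> | v. \<forall>j. v j \<in> topspace (Euclidean_space m) \<and> L2_set (v j) {..<m} \<le> 1}"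

section \<open>Sobolev maps\<close>

definition locally_integrable :: "(real ^ 'n::finite) set \<Rightarrow> (real ^ 'n::_ \<Rightarrow> real) \<Rightarrow> bool" where
  "locally_integrable \<Omega> g \<longleftrightarrow> (\<forall>C. compact C \<and> C \<subseteq> \<Omega> \<longrightarrow> g absolutely_integrable_on C)"

primrec C_diff :: "nat \<Rightarrow> ('a::euclidean_space \<Rightarrow> real) \<Rightarrow> bool" where
  "C_diff 0 \<phi> \<longleftrightarrow> continuous_on UNIV \<phi>"
| "C_diff (Suc k) \<phi> \<longleftrightarrow>
     \<phi> differentiable_on UNIV \<and> (\<forall>b\<in>Basis. C_diff k (\<lambda>x. frechet_derivative \<phi> (at x) b))"

definition test_function :: "'a::euclidean_space set \<Rightarrow> ('a \<Rightarrow> real) \<Rightarrow> bool" where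
  "test_function \<Omega> \<phi> \<longleftrightarrow>
     (\<forall>k. C_diff k \<phi>) \<and> compact (closure {x. \<phi> x \<noteq> 0}) \<and> closure {x. \<phi> x \<noteq> 0} \<subseteq> \<Omega>"

definition weak_partial_deriv ::
    "(real ^ 'n::finite) set \<Rightarrow> 'n \<Rightarrow> (real ^ 'n::_ \<Rightarrow> real) \<Rightarrow> (real ^ 'n::_ \<Rightarrow> real) \<Rightarrow> bool" where
  "weak_partial_deriv \<Omega> j g h \<longleftrightarrow>
     (\<forall>\<phi>. test_function \<Omega> \<phi> \<longrightarrow>
        (LINT x:\<Omega>|lebesgue. g x * frechet_derivative \<phi> (at x) (axis j 1)) =
        - (LINT x:\<Omega>|lebesgue. h x * \<phi> x))"

text \<open>\<open>W11_loc \<Omega> m f D\<close>: the map \<open>f : \<Omega> \<rightarrow> \<real>\<^sup>m\<close> is in \<open>W\<^sup>1\<^sup>,\<^sup>1\<^sub>l\<^sub>o\<^sub>c\<close> with weak differential \<open>D\<close>,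
  where \<open>D x i\<close> is the weak gradient of the \<open>i\<close>-th component of \<open>f\<close> at \<open>x\<close>.\<close>

definition W11_loc ::
    "(real ^ 'n::finite) set \<Rightarrow> nat \<Rightarrow> (real ^ 'n::_ \<Rightarrow> nat \<Rightarrow> real) \<Rightarrow>
     (real ^ 'n::_ \<Rightarrow> nat \<Rightarrow> real ^ 'n::_) \<Rightarrow> bool" where
  "W11_loc \<Omega> m f D \<longleftrightarrow>
     f ` \<Omega> \<subseteq> topspace (Euclidean_space m) \<and>
     (\<forall>i<m. locally_integrable \<Omega> (\<lambda>x. f x i) \<and>
        (\<forall>j. locally_integrable \<Omega> (\<lambda>x. D x i $ j) \<and>
             weak_partial_deriv \<Omega> j (\<lambda>x. f x i) (\<lambda>x. D x i $ j)))"

definition op_norm :: "nat \<Rightarrow> (nat \<Rightarrow> real ^ 'n::finite) \<Rightarrow> real" where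
  "op_norm m A = (SUP h\<in>cball 0 1. L2_set (\<lambda>i. A i \<bullet> h) {..<m})"

text \<open>\<open>\<star>f\<^sup>*\<omega>\<close> at \<open>x\<close>, that is, \<open>(f\<^sup>*\<omega>)\<^sub>x\<close> evaluated on the standard basis.\<close>

definition star_pullback ::
    "nat \<Rightarrow> 'n::{finite,wellorder} form \<Rightarrow> (real ^ 'n::_ \<Rightarrow> nat \<Rightarrow> real) \<Rightarrow>
     (real ^ 'n::_ \<Rightarrow> nat \<Rightarrow> real ^ 'n::_) \<Rightarrow> real ^ 'n::_ \<Rightarrow> real" where
  "star_pullback m \<omega> f D x = form_apply m \<omega> (f x) (\<lambda>j i. D x i $ j)"

text \<open>Weak differentials are unique up to null sets, so it does not matter which one is chosen.
  The distortion function \<open>K\<close> may be infinite on a null set; \<^const>\<open>real_of_ereal\<close> sends \<open>\<infinity>\<close> to \<open>0\<close>,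
  so \<open>exp (\<lambda> * real_of_ereal (K x))\<close> is \<open>exp (\<lambda>K)\<close> almost everywhere.\<close>

definition finite_distortion_curve ::
    "(real ^ 'n::{finite,wellorder}) set \<Rightarrow> nat \<Rightarrow> 'n form \<Rightarrow> (real ^ 'n::_ \<Rightarrow> nat \<Rightarrow> real) \<Rightarrow>
     (real ^ 'n::_ \<Rightarrow> ereal) \<Rightarrow> bool" where
  "finite_distortion_curve \<Omega> m \<omega> f K \<longleftrightarrow>
     (\<exists>D. W11_loc \<Omega> m f D \<and>
        locally_integrable \<Omega> (star_pullback m \<omega> f D) \<and>
        K \<in> borel_measurable (lebesgue_on \<Omega>) \<and>
        (\<forall>x\<in>\<Omega>. 1 \<le> K x) \<and>
        (AE x in lebesgue_on \<Omega>. K x < \<infinity>) \<and>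
        (AE x in lebesgue_on \<Omega>.
           ereal (comass m \<omega> (f x) * op_norm m (D x) ^ CARD('n))
             \<le> K x * ereal (star_pullback m \<omega> f D x)))"

section \<open>Properties of the representative\<close>

definition differentiable_target :: "nat \<Rightarrow> (real ^ 'n::finite \<Rightarrow> nat \<Rightarrow> real) \<Rightarrow> real ^ 'n::_ \<Rightarrow> bool" where
  "differentiable_target m g x \<longleftrightarrow>
     (\<exists>A :: nat \<Rightarrow> real ^ 'n.
        ((\<lambda>h. L2_set (\<lambda>i. g (x + h) i - g x i - A i \<bullet> h) {..<m} / norm h) \<longlongrightarrow> 0) (at 0))"

definition ediam :: "nat \<Rightarrow> (nat \<Rightarrow> real) set \<Rightarrow> ennreal" where
  "ediam m U = (SUP x\<in>U. SUP y\<in>U. ennreal (L2_set (\<lambda>i. x i - y i) {..<m}))"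

text \<open>The \<open>s\<close>-dimensional Hausdorff (outer) measure on \<open>\<real>\<^sup>m\<close>, normalised to agree with
  Lebesgue measure for \<open>s = m\<close>.  Meant for \<open>s \<ge> 1\<close>: for \<open>s = 0\<close> the empty set would contribute
  \<open>0 ^ 0 = 1\<close>.\<close>

definition hausdorff_premeasure :: "nat \<Rightarrow> nat \<Rightarrow> ennreal \<Rightarrow> (nat \<Rightarrow> real) set \<Rightarrow> ennreal" where
  "hausdorff_premeasure m s \<delta> A =
     (INF U \<in> {U :: nat \<Rightarrow> (nat \<Rightarrow> real) set.
                 A \<subseteq> (\<Union>i. U i) \<and> (\<forall>i. U i \<subseteq> topspace (Euclidean_space m) \<and> ediam m (U i) \<le> \<delta>)}.
        (\<Sum>i. ennreal (unit_ball_vol (real s) / 2 ^ s) * ediam m (U i) ^ s))"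

definition hausdorff_measure :: "nat \<Rightarrow> nat \<Rightarrow> (nat \<Rightarrow> real) set \<Rightarrow> ennreal" where
  "hausdorff_measure m s A = (SUP \<delta>\<in>{0<..}. hausdorff_premeasure m s \<delta> A)"

definition lusin_N :: "(real ^ 'n::finite) set \<Rightarrow> nat \<Rightarrow> (real ^ 'n::_ \<Rightarrow> nat \<Rightarrow> real) \<Rightarrow> bool" where
  "lusin_N \<Omega> m g \<longleftrightarrow>
     (\<forall>E. E \<subseteq> \<Omega> \<and> E \<in> null_sets lebesgue \<longrightarrow> hausdorff_measure m CARD('n) (g ` E) = 0)"

end

theory Submission
 imports Defs "HOL-Computational_Algebra.Polynomial"
begin

text \<open>
Let \<open>v\<close> dominate the cut-off gradient \<open>|Df|\<close>. Off the super-level set \<open>{Mv > t}\<close> of the maximal function, \<open>f\<close> is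
replaced by a mollification of variable radius, comparable to the distance to that set, whose gradient is
at most a constant times \<open>t\<close>. Minors of a compactly supported gradient integrate to zero, so the integral
of the pullback of \<open>\<omega>\<close> over \<open>{Mv \<le> t}\<close> is bounded by \<open>t\<^sup>n\<close> times the measure of \<open>{Mv > t}\<close>, which is at most
a constant times \<open>t\<^sup>n\<^sup>-\<^sup>1\<close> times the integral of \<open>v\<close> over \<open>{v > t/2}\<close>. Summing over \<open>t = 2\<^sup>k\<close> with weights
\<open>k\<^sup>2\<^sup>n\<close> and absorbing the right-hand side by means of the exponential integrability of the distortion gives
local integrability of \<open>|Df|\<^sup>n log\<^sup>2\<^sup>n (1 + |Df|)\<close>. The comass bound on the form keeps all constants free
of the target dimension. A dyadic chain of Poincare inequalities turns this integrability into an
oscillation bound on cubes, \<open>osc\<^sub>Q f \<le> C (s + \<beta>)\<close> with \<open>s\<close> the side of \<open>Q\<close> and \<open>\<beta>\<^sup>n\<close> the mass of the weighted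
gradient on \<open>Q\<close>; continuity, differentiability at Lebesgue points and property (N) are read off from it.
\<close>

text \<open>The distortion inequality yields only \<open>u ^ n <= (1 + ln (1 + u)) * H\<close> with
  integrable \<open>H\<close>. The gradient misses \<open>L^n\<close> by a logarithm, so even the
  vanishing of the integral of the pullback is in doubt. It survives because \<open>t ^ n\<close>
  times the measure of the super-level set cannot stay away from 0 along \<open>t = 2 ^ k\<close>:
  otherwise the harmonic series would converge. The cut-off contributes
  \<open>|grad \<eta>| |f|\<close>, which is controlled because the components of \<open>f\<close>
  turn out to lie locally in \<open>L^{n+1}\<close>. Absorption is legitimate since the weights are
  cut at \<open>N\<close>: the absorbed quantity is finite and the other bounds are uniform in
  \<open>N\<close>. Where the distortion exceeds \<open>\<epsilon>\<close> times the dyadic level of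
  \<open>v\<close>, absorption fails and \<open>exp (3 n K / \<epsilon>)\<close> takes over;
  \<open>\<epsilon>\<close> is fixed by the weak type and truncation constants, and
  \<open>3 n / \<epsilon>\<close> is the constant of the theorem. The weight exponent
  \<open>2 n\<close> leaves a factor \<open>1 / (j + 1)^2\<close> at the scale \<open>2^-j\<close>
  of the oscillation estimate. In dimension one the fundamental theorem of calculus replaces the
  dyadic chain.\<close>

abbreviation L1 :: "('a::euclidean_space => 'b::{banach,second_countable_topology}) => bool" where
 "L1 f \<equiv> integrable lborel f"

abbreviation vol :: "'a::euclidean_space set => real" where
 "vol A \<equiv> measure lborel A"

abbreviation almost_all :: "('a::euclidean_space => bool) => bool" (binder "AE " 10) where
 "almost_all P \<equiv> AE x in lborel. P x"

abbreviation borel_funs :: "('a::topological_space => 'b::topological_space) set" where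
 "borel_funs \<equiv> borel_measurable borel"

lemmas integrable_dominated = Bochner_Integration.integrable_bound
 and measurable_L1 = borel_measurable_integrable and set_integral_def = set_lebesgue_integral_def

section \<open>Maximal functions and Lebesgue points\<close>

text \<open>The set where the centred Hardy-Littlewood maximal function of \<open>v\<close> exceeds
  \<open>t\<close>, written without forming the supremum. Strictness makes the set open, and the
  negation is a growth bound on every ball about a point of the complement.\<close>

definition maximal_set :: "('a::euclidean_space => real) => real => 'a set" where
 "maximal_set v t = {x. \<exists>r>0. t * vol (ball x r) < (LBINT y:ball x r. v y)}"

lemma not_maximal_set:
 "x \<notin> maximal_set v t ==> r > 0 ==> (LBINT y:ball x r. v y) <= t * vol (ball x r)"
 by (force simp: maximal_set_def)

lemma integrable_majorant:
 fixes f :: "'a::euclidean_space => real"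
 assumes "L1 g" "!!x. abs (f x) <= g x" "f \<in> borel_funs"
 shows "L1 f"
 by (rule integrable_dominated[OF assms(1)]) (use assms(2,3) in \<open>auto intro: order_trans[OF _ abs_ge_self]\<close>)

lemma set_integrable_lborel:
 fixes f :: "'a::euclidean_space => real"
 shows "L1 f ==> A \<in> sets borel ==> set_integrable lborel A f"
 unfolding set_integrable_def by (rule integrable_mult_indicator) auto

lemma set_integral_mono_set_nonneg:
 fixes f :: "'a::euclidean_space => real"
 assumes "L1 f" "!!x. 0 <= f x" "A \<in> sets borel" "B \<in> sets borel" "A \<subseteq> B"
 shows "(LBINT x:A. f x) <= (LBINT x:B. f x)"
 unfolding set_integral_def
 by (rule integral_mono)
  (use assms set_integrable_lborel in \<open>auto simp: set_integrable_def indicator_def subset_iff\<close>)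

lemma set_integral_le_integral:
 fixes f :: "'a::euclidean_space => real"
 assumes "L1 f" "!!x. 0 <= f x" "A \<in> sets borel"
 shows "(LBINT x:A. f x) <= (LBINT x. f x)"
 using set_integral_mono_set_nonneg[of f A UNIV] assms by (simp add: set_integral_def)

lemma set_integral_nonneg':
 fixes f :: "'a => real"
 assumes "!!x. 0 <= f x"
 shows "0 <= (LINT x:A|M. f x)"
 unfolding set_integral_def by (rule integral_nonneg_AE) (auto simp: assms)

lemma measure_lborel_ball:
 fixes x :: "'a::euclidean_space"
 shows "r >= 0 ==> vol (ball x r) = unit_ball_vol DIM('a) * r ^ DIM('a)"
 by (simp add: content_ball)

text \<open>The strict inequality leaves room to enlarge the radius by some \<open>e\<close>. For
  \<open>y\<close> within \<open>e\<close> of \<open>x\<close> the ball of radius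
  \<open>r + e\<close> about \<open>y\<close> contains \<open>ball x r\<close>, and its mean is
  still above \<open>t\<close>.\<close>

lemma open_maximal_set:
 fixes v :: "'a::euclidean_space => real"
 assumes v: "L1 v" "!!x. 0 <= v x"
 shows "open (maximal_set v t)"
 unfolding open_dist
proof
 fix x assume "x \<in> maximal_set v t"
 then obtain r where r: "r > 0" "t * (unit_ball_vol DIM('a) * r ^ DIM('a)) < (LBINT y:ball x r. v y)" (is "_ < ?I")
  by (auto simp: maximal_set_def measure_lborel_ball)
 have "((%e. t * (unit_ball_vol DIM('a) * (r + e) ^ DIM('a))) \<longlongrightarrow> t * (unit_ball_vol DIM('a) * (r + 0) ^ DIM('a))) (at_right 0)"
  by (intro tendsto_intros)
 then have "\<forall>\<^sub>F e in at_right 0. t * (unit_ball_vol DIM('a) * (r + e) ^ DIM('a)) < ?I"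
  using r by (intro order_tendstoD) auto
 then obtain e where e: "e > 0" "t * (unit_ball_vol DIM('a) * (r + e) ^ DIM('a)) < ?I"
  by (metis (mono_tags, lifting) eventually_at_right_field field_sum_of_halves half_gt_zero less_add_same_cancel1)
 show "\<exists>e>0. \<forall>y. dist y x < e --> y \<in> maximal_set v t"
 proof (intro exI conjI allI impI)
  fix y assume y: "dist y x < e"
  have "?I <= (LBINT z:ball y (r + e). v z)"
  proof (rule set_integral_mono_set_nonneg[OF v])
   show "ball x r \<subseteq> ball y (r + e)"
    using y by (smt (verit) dist_triangle mem_ball subset_iff dist_commute)
  qed auto
  with e r show "y \<in> maximal_set v t"
   unfolding maximal_set_def by (intro CollectI exI[of _ "r + e"]) (auto simp: measure_lborel_ball)
 qed fact
qed

lemma sets_maximal_set [measurable]: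
 assumes v: "L1 v" "!!x. 0 <= v x"
 shows "maximal_set v t \<in> sets borel"
 using open_maximal_set[OF assms] by simp

lemma nn_set_integral_eq:
 fixes f :: "'a::euclidean_space => real"
 assumes "L1 f" "!!x. 0 <= f x" "A \<in> sets borel"
 shows "emeasure (density lborel f) A = ennreal (LBINT x:A. f x)"
proof -
 have [measurable]: "f \<in> borel_funs" using assms(1) by (simp add: measurable_L1)
 have "emeasure (density lborel f) A = (\<integral>\<^sup>+x. ennreal (indicator A x *\<^sub>R f x) \<partial>lborel)"
  using assms by (subst emeasure_density) (auto intro!: nn_integral_cong simp: indicator_def)
 also have "... = ennreal (LBINT x:A. f x)"
  unfolding set_integral_def using assms
  by (intro nn_integral_eq_integral) (auto simp: set_integrable_lborel[unfolded set_integrable_def real_scaleR_def])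
 finally show ?thesis .
qed

text \<open>Vitali's covering lemma extracts disjoint balls whose fivefold dilations still cover. On
  each of them \<open>t\<close> times the volume is below the integral of \<open>v\<close>, and by
  disjointness these integrals add up to at most the total mass.\<close>

lemma maximal_weak_type:
 fixes v :: "'a::euclidean_space => real"
 assumes v: "L1 v" "!!x. 0 <= v x" and t: "t > 0"
 shows "emeasure lborel (maximal_set v t) <= ennreal (5 ^ DIM('a) / t * (LBINT x. v x))"
proof -
 define I where "I = (LBINT x. v x)"
 define V where "V = unit_ball_vol DIM('a)"
 have V: "V > 0" by (simp add: V_def)
 have "\<forall>x\<in>maximal_set v t. \<exists>r>0. t * vol (ball x r) < (LBINT y:ball x r. v y)"
  by (auto simp: maximal_set_def)
 then obtain r where r: "!!x. x \<in> maximal_set v t ==> r x > 0 & t * vol (ball x (r x)) < (LBINT y:ball x (r x). v y)"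
  by metis
 \<comment> \<open>Vitali's lemma asks for bounded radii. A ball with mean above \<open>t\<close>
   cannot be large, because the total mass is finite; a bound on \<open>r ^ n\<close> bounds
   \<open>r\<close> itself once \<open>r >= 1\<close>.\<close>
 have bd: "0 < r x & r x <= max 1 (I / (t * V))" if "x \<in> maximal_set v t" for x
 proof -
  have "t * (V * r x ^ DIM('a)) < I"
   using r[OF that] set_integral_le_integral[OF v, of "ball x (r x)"] measure_lborel_ball[of "r x" x]
   by (simp add: I_def V_def)
  then have "r x ^ DIM('a) < I / (t * V)"
   using t V by (simp add: field_simps)
  moreover have "r x <= r x ^ DIM('a)" if "r x >= 1"
   using that by (intro self_le_power) auto
  ultimately show ?thesis using r[OF that] by linarith
 qed
 have cov0: "maximal_set v t \<subseteq> (\<Union>i\<in>maximal_set v t. ball i (r i))"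
  using bd by fastforce
 obtain C where C: "countable C" "C \<subseteq> maximal_set v t"
  "pairwise (%i j. disjnt (ball i (r i)) (ball j (r j))) C"
  "maximal_set v t \<subseteq> (\<Union>i\<in>C. ball i (5 * r i))"
  by (rule Vitali_covering_lemma_balls[OF cov0 bd])
 \<comment> \<open>The countable subfamily is enumerated by naturals, with empty sets outside
   \<open>J\<close>; \<open>A k n\<close> is the n-th ball dilated by \<open>k\<close>, used for
   \<open>k = 1\<close> and \<open>k = 5\<close>.\<close>
 define J where "J = to_nat_on C ` C"
 define A where "A k n = (if n \<in> J then ball (from_nat_into C n) (k * r (from_nat_into C n)) else {})" for k n
 have frC: "from_nat_into C n \<in> C" if "n \<in> J" for n
  using that C(1) by (auto simp: J_def)
 have "disjoint_family (A 1)"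
  unfolding disjoint_family_on_def A_def
 proof (intro ballI impI)
  fix m n :: nat assume "m ~= n"
  show "(if m \<in> J then ball (from_nat_into C m) (1 * r (from_nat_into C m)) else {}) \<inter>
     (if n \<in> J then ball (from_nat_into C n) (1 * r (from_nat_into C n)) else {}) = {}"
  proof (cases "m \<in> J & n \<in> J")
   case True
   then have "from_nat_into C m ~= from_nat_into C n"
    using \<open>m ~= n\<close> C(1) by (auto simp: J_def)
   with True C(3) frC show ?thesis by (auto simp: pairwise_def disjnt_def)
  qed auto
 qed
 have sets: "A k n \<in> sets borel" for k n by (auto simp: A_def)
 have "maximal_set v t \<subseteq> (\<Union>n. A 5 n)"
  using C(4) C(1) by (fastforce simp: A_def J_def)
 then have "emeasure lborel (maximal_set v t) <= emeasure lborel (\<Union>n. A 5 n)"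
  by (rule emeasure_mono) (use sets in auto)
 also have "... <= (\<Sum>n. emeasure lborel (A 5 n))"
  by (rule emeasure_subadditive_countably) (use sets in auto)
 also have "... <= (\<Sum>n. ennreal (5 ^ DIM('a) / t) * emeasure (density lborel v) (A 1 n))"
 proof (rule suminf_le)
  fix n
  show "emeasure lborel (A 5 n) <= ennreal (5 ^ DIM('a) / t) * emeasure (density lborel v) (A 1 n)"
  proof (cases "n \<in> J")
   case True
   define x where "x = from_nat_into C n"
   have x: "x \<in> maximal_set v t" using True frC C(2) by (auto simp: x_def)
   note rx = r[OF x]
   have "emeasure lborel (A 5 n) = ennreal (V * (5 * r x) ^ DIM('a))"
    using True rx by (simp add: A_def x_def[symmetric] emeasure_ball V_def)
   also have "V * (5 * r x) ^ DIM('a) <= 5 ^ DIM('a) / t * (LBINT y:ball x (r x). v y)"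
    using conjunct1[OF rx] conjunct2[OF rx] t by (simp add: measure_lborel_ball V_def field_simps power_mult_distrib)
   also have "ennreal ... = ennreal (5 ^ DIM('a) / t) * emeasure (density lborel v) (ball x (r x))"
    using t by (subst nn_set_integral_eq[OF v]) (auto simp: ennreal_mult'[symmetric])
   finally show ?thesis using True by (simp add: A_def x_def ennreal_leI)
  qed (simp add: A_def)
 qed auto
 also have "... = ennreal (5 ^ DIM('a) / t) * emeasure (density lborel v) (\<Union>n. A 1 n)"
  using \<open>disjoint_family (A 1)\<close> sets by (simp add: suminf_emeasure image_subset_iff)
 also have "... = ennreal (5 ^ DIM('a) / t * (LBINT x:(\<Union>n. A 1 n). v x))"
  using t sets by (subst nn_set_integral_eq[OF v]) (auto simp: ennreal_mult'[symmetric])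
 also have "... <= ennreal (5 ^ DIM('a) / t * I)"
  unfolding I_def using t sets
  by (intro ennreal_leI mult_left_mono set_integral_le_integral[OF v]) auto
 finally show ?thesis unfolding I_def .
qed

text \<open>Discarding the part of \<open>v\<close> below \<open>t/2\<close> lowers every mean by at
  most \<open>t/2\<close>. The weak type bound then involves only the mass of \<open>v\<close> on
  \<open>{v > t/2}\<close>, which can be summed over dyadic levels.\<close>

lemma maximal_set_level_subset:
 assumes v: "L1 v" "!!x. 0 <= v x" and t: "t > 0"
 shows "maximal_set v t \<subseteq> maximal_set (%x. v x * indicator {x. v x > t/2} x) (t/2)"
proof
 have [measurable]: "v \<in> borel_funs" using v(1) by (simp add: measurable_L1)
 let ?w = "%x. v x * indicator {x. v x > t/2} x"
 have w: "L1 ?w"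
  using v by (intro integrable_dominated[OF v(1)]) (auto simp: indicator_def)
 fix x assume "x \<in> maximal_set v t"
 then obtain r where r: "r > 0" "t * vol (ball x r) < (LBINT y:ball x r. v y)"
  by (auto simp: maximal_set_def)
 have ib: "set_integrable lborel (ball x r) (%y. t/2)"
  unfolding set_integrable_def by (auto intro!: integrable_mult_left integrable_real_indicator simp: emeasure_ball r less_imp_le)
 have "(LBINT y:ball x r. v y) <= (LBINT y:ball x r. ?w y + t/2)"
 proof (rule set_integral_mono)
  show "set_integrable lborel (ball x r) v" using v by (intro set_integrable_lborel) auto
  show "set_integrable lborel (ball x r) (%y. ?w y + t / 2)"
   by (rule set_integral_add(1)[OF set_integrable_lborel[OF w] ib]) auto
  show "v y <= ?w y + t / 2" for y using t by (auto simp: indicator_def)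
 qed
 also have "... = (LBINT y:ball x r. ?w y) + (LBINT y:ball x r. t/2)"
  by (rule set_integral_add(2)[OF set_integrable_lborel[OF w] ib]) auto
 also have "(LBINT y:ball x r. t/2) = t/2 * vol (ball x r)"
  using r by (simp add: set_integral_def)
 finally show "x \<in> maximal_set ?w (t/2)"
  using r by (auto simp: maximal_set_def intro!: exI[of _ r])
qed

lemma maximal_weak_type':
 fixes v :: "'a::euclidean_space => real"
 assumes v: "L1 v" "!!x. 0 <= v x" and t: "t > 0"
 shows "emeasure lborel (maximal_set v t) <= ennreal (2 * 5 ^ DIM('a) / t * (LBINT x:{x. v x > t/2}. v x))"
proof -
 have [measurable]: "v \<in> borel_funs" using v(1) by (simp add: measurable_L1)
 let ?w = "%x. v x * indicator {x. v x > t/2} x"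
 have w: "L1 ?w"
  using v by (intro integrable_dominated[OF v(1)]) (auto simp: indicator_def)
 have "emeasure lborel (maximal_set v t) <= emeasure lborel (maximal_set ?w (t/2))"
  by (intro emeasure_mono maximal_set_level_subset[OF v t]) (use w v in auto)
 also have "... <= ennreal (5 ^ DIM('a) / (t/2) * (LBINT x. ?w x))"
  by (rule maximal_weak_type) (use w v t in auto)
 finally show ?thesis by (simp add: set_integral_def mult.commute)
qed

lemma measure_maximal_set:
 fixes v :: "'a::euclidean_space => real"
 assumes v: "L1 v" "!!x. 0 <= v x" and t: "t > 0"
 shows "emeasure lborel (maximal_set v t) < \<infinity>"
  "vol (maximal_set v t) <= 2 * 5 ^ DIM('a) / t * (LBINT x:{x. v x > t/2}. v x)"
  "vol (maximal_set v t) <= 5 ^ DIM('a) / t * (LBINT x. v x)"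
proof -
 show "emeasure lborel (maximal_set v t) < \<infinity>"
  using maximal_weak_type[OF assms] by (rule le_less_trans) simp
 then have *: "emeasure lborel (maximal_set v t) = ennreal (vol (maximal_set v t))"
  by (intro emeasure_eq_ennreal_measure) auto
 show "vol (maximal_set v t) <= 2 * 5 ^ DIM('a) / t * (LBINT x:{x. v x > t/2}. v x)"
 proof -
  have "0 <= 2 * 5 ^ DIM('a) / t * (LBINT x:{x. v x > t/2}. v x)"
   using t by (intro mult_nonneg_nonneg set_integral_nonneg' v) auto
  from ennreal_le_iff[OF this] show ?thesis using maximal_weak_type'[OF assms] * by metis
 qed
 show "vol (maximal_set v t) <= 5 ^ DIM('a) / t * (LBINT x. v x)"
 proof -
  have "0 <= 5 ^ DIM('a) / t * (LBINT x. v x)"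
   using t v by (intro mult_nonneg_nonneg Bochner_Integration.integral_nonneg) auto
  from ennreal_le_iff[OF this] show ?thesis using maximal_weak_type[OF assms] * by metis
 qed
qed

section \<open>Lebesgue points\<close>

text \<open>An open set from outside and a closed set from inside are joined by an Urysohn function,
  which differs from the indicator only between the two sets.\<close>

lemma indicator_approx_continuous:
 fixes A :: "'a::euclidean_space set" and e :: real
 assumes A: "A \<in> sets borel" "emeasure lborel A < \<infinity>" and e: "e > 0"
 shows "\<exists>g. continuous_on UNIV g & L1 g & (LBINT x. abs (indicator A x - g x)) < e"
proof -
 obtain U where U: "open U" "A \<subseteq> U" "emeasure lborel (U - A) < ennreal (e/2)"
  using outer_regular_lborel[OF A(1), of "e/2"] e by auto
 have AL: "A \<in> sets lebesgue" using A by simp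
 obtain T where T: "closed T" "T \<subseteq> A" "A - T \<in> lmeasurable" "emeasure lebesgue (A - T) < ennreal (e/2)"
  using sets_lebesgue_inner_closed[OF AL, of "e/2"] e by auto
 have Tb: "emeasure lborel (A - T) < ennreal (e/2)" "A - T \<in> sets borel"
  using T A by auto
 have "- U \<inter> T = {}" using T U by auto
 then obtain g :: "'a => real" where g: "continuous_on UNIV g" "!!x. g x \<in> closed_segment 0 1"
  "!!x. x \<in> - U ==> g x = 0" "!!x. x \<in> T ==> g x = 1"
  using Urysohn[of "- U" T 0 1] T U by (metis closed_Compl)
 have g01: "0 <= g x" "g x <= 1" for x
  using g(2)[of x] by (auto simp: closed_segment_eq_real_ivl)
 have [measurable]: "g \<in> borel_funs" using g(1) by (simp add: borel_measurable_continuous_onI)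
 have UA: "U = (U - A) \<union> A" using U by auto
 have UAs: "U - A \<in> sets borel" "U \<in> sets borel" using U A by auto
 have Uf: "emeasure lborel U < \<infinity>"
 proof -
  have "emeasure lborel U <= emeasure lborel (U - A) + emeasure lborel A"
   by (subst UA, rule emeasure_subadditive) (use UAs A in auto)
  also have "... < \<infinity>" using U(3) A(2) by (auto simp: less_top[symmetric])
  finally show ?thesis .
 qed
 have gi: "L1 g"
 proof (rule integrable_dominated)
  show "L1 (%x. indicator U x :: real)" using UAs Uf by (intro integrable_real_indicator) auto
  show "AE x. norm (g x) <= norm (indicator U x :: real)"
   using g01 g(3) by (auto simp: indicator_def)
 qed simp
 have mf': "vol X < e/2" if "emeasure lborel X < ennreal (e/2)" for X :: "'a set"
 proof -
  have "emeasure lborel X = ennreal (vol X)"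
   using that by (intro emeasure_eq_ennreal_measure) auto
  then show ?thesis using that by (simp add: ennreal_less_iff)
 qed
 have mf: "vol (U - A) < e/2" "vol (A - T) < e/2"
  using mf' U(3) Tb by blast+
 have "(LBINT x. abs (indicator A x - g x)) <= (LBINT x. indicator (U - A) x + indicator (A - T) x)"
 proof (rule integral_mono)
  show "L1 (%x. abs (indicator A x - g x))"
   using gi A by (intro integrable_abs Bochner_Integration.integrable_diff integrable_real_indicator) auto
  show "L1 (%x. indicator (U - A) x + indicator (A - T) x :: real)"
   using UAs Tb A U(3) by (intro Bochner_Integration.integrable_add integrable_real_indicator) (auto simp: less_top[symmetric])
  show "abs (indicator A x - g x) <= indicator (U - A) x + indicator (A - T) x" for x
   using g01[of x] g(3,4)[of x] U T by (auto simp: indicator_def)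
 qed
 also have "... = vol (U - A) + vol (A - T)"
  using UAs Tb A U(3) by (subst Bochner_Integration.integral_add) (auto simp: less_top[symmetric] intro!: integrable_real_indicator)
 also have "... < e" using mf by simp
 finally show ?thesis using g gi by blast
qed

lemma integrable_approx_continuous:
 fixes f :: "'a::euclidean_space => real" and e :: real
 assumes "L1 f" "e > 0"
 shows "\<exists>g. continuous_on UNIV g & L1 g & (LBINT x. abs (f x - g x)) < e"
 using assms
proof (induction arbitrary: e rule: integrable_induct)
 case (base A c)
 show ?case
 proof (cases "c = 0")
  case True
  with base show ?thesis by (intro exI[of _ "%_. 0"]) auto
 next
  case False
  obtain g where g: "continuous_on UNIV g" "L1 g" "(LBINT x. abs (indicator A x - g x)) < e / abs c"
   using indicator_approx_continuous[of A "e / abs c"] base False by auto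
  have "(LBINT x. abs (indicator A x *\<^sub>R c - c * g x)) = abs c * (LBINT x. abs (indicator A x - g x))"
   by (subst Bochner_Integration.integral_mult_right_zero[symmetric])
    (auto intro!: Bochner_Integration.integral_cong simp: abs_mult[symmetric] algebra_simps)
  also have "... < e" using g(3) False by (simp add: field_simps)
  finally show ?thesis using g by (intro exI[of _ "%x. c * g x"]) (auto intro!: continuous_intros)
 qed
next
 case (add f g)
 obtain f' where f': "continuous_on UNIV f'" "L1 f'" "(LBINT x. abs (f x - f' x)) < e/2"
  using add.IH(1)[of "e/2"] add.prems by auto
 obtain g' where g': "continuous_on UNIV g'" "L1 g'" "(LBINT x. abs (g x - g' x)) < e/2"
  using add.IH(2)[of "e/2"] add.prems by auto
 have "(LBINT x. abs (f x + g x - (f' x + g' x))) <= (LBINT x. abs (f x - f' x) + abs (g x - g' x))"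
  using add.hyps f' g' by (intro integral_mono) auto
 also have "... < e"
  using add.hyps f' g' by (subst Bochner_Integration.integral_add) auto
 finally show ?case using f' g' by (intro exI[of _ "%x. f' x + g' x"]) (auto intro!: continuous_intros)
next
 case (lim f s)
 have [measurable]: "f \<in> borel_measurable lborel" "!!i. s i \<in> borel_measurable lborel"
  using lim.hyps by (auto simp: measurable_L1)
 have "(%i. LBINT x. abs (f x - s i x)) \<longlonglongrightarrow> (LINT x|(lborel::'a measure). abs (0 :: real))"
 proof (rule integral_dominated_convergence[where w="%x. 3 * abs (f x)"])
  show "AE x. (%i. abs (f x - s i x)) \<longlonglongrightarrow> \<bar>0\<bar>"
  proof (intro AE_I2 tendsto_rabs)
   fix x
   show "(%i. f x - s i x) \<longlonglongrightarrow> 0"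
    using tendsto_diff[OF tendsto_const[of "f x"] lim.hyps(2)[of x]] by simp
  qed
  show "AE x. norm \<bar>f x - s i x\<bar> <= 3 * abs (f x)" for i
  proof (intro AE_I2)
   fix x
   have "abs (s i x) <= 2 * abs (f x)" using lim.hyps(3)[of x i] by simp
   then show "norm \<bar>f x - s i x\<bar> <= 3 * abs (f x)" by simp
  qed
 qed (use lim.hyps in auto)
 then have "\<forall>\<^sub>F i in sequentially. (LBINT x. abs (f x - s i x)) < e/2"
  using lim.prems by (intro order_tendstoD) auto
 then obtain i where i: "(LBINT x. abs (f x - s i x)) < e/2"
  by (auto simp: eventually_sequentially)
 obtain g where g: "continuous_on UNIV g" "L1 g" "(LBINT x. abs (s i x - g x)) < e/2"
  using lim.IH[of "e/2" i] lim.prems by auto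
 have "(LBINT x. abs (f x - g x)) <= (LBINT x. abs (f x - s i x) + abs (s i x - g x))"
  using lim.hyps g by (intro integral_mono) auto
 also have "... < e"
  using lim.hyps g i by (subst Bochner_Integration.integral_add) auto
 finally show ?case using g by blast
qed

definition avg_ball :: "('a::euclidean_space => real) => 'a => real => real" where
 "avg_ball f x r = (LBINT y:ball x r. f y) / vol (ball x r)"

lemma set_integrable_const_ball:
 shows "set_integrable lborel (ball x r) (%y. c)"
proof (cases "r > 0")
 case True
 then show ?thesis unfolding set_integrable_def by (auto intro!: integrable_mult_left integrable_real_indicator simp: emeasure_ball)
next
 case False
 then have "ball x r = {}" by simp
 then show ?thesis by (simp only: set_integrable_def indicator_simps) simp
qed

lemma avg_ball_continuous:
 assumes "isCont g x" "L1 g" "e > 0"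
 shows "\<forall>\<^sub>F r in at_right 0. avg_ball (%y. abs (g y - g x)) x r <= e"
proof -
 obtain d where d: "d > 0" "!!y. dist y x < d ==> abs (g y - g x) < e"
  using assms by (auto simp: continuous_at_eps_delta dist_real_def)
 show ?thesis unfolding eventually_at_right_field
 proof (intro exI[of _ d] conjI allI impI)
  fix r assume r: "0 < r" "r < d"
  have "(LBINT y:ball x r. abs (g y - g x)) <= (LBINT y:ball x r. e)"
  proof (rule set_integral_mono)
   show "set_integrable lborel (ball x r) (%y. abs (g y - g x))"
    by (intro set_integrable_abs set_integral_diff(1)[OF set_integrable_lborel[OF assms(2)] set_integrable_const_ball]) auto
   show "abs (g y - g x) <= e" if "y \<in> ball x r" for y using d(2)[of y] that r by (auto simp: dist_commute)
  qed (rule set_integrable_const_ball)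
  also have "... = e * vol (ball x r)" using r by (simp add: set_integral_def)
  finally show "avg_ball (%y. abs (g y - g x)) x r <= e"
   using r by (simp add: avg_ball_def divide_le_eq measure_lborel_ball)
 qed fact
qed

text \<open>Continuous functions pose no problem, and passing from \<open>f\<close> to a continuous
  \<open>g\<close> matters only where \<open>|f - g|\<close> or its maximal function is large. The
  Markov and weak type bounds make that set arbitrarily small, so each exceptional set
  \<open>E s\<close> is negligible.\<close>

theorem lebesgue_points:
 fixes f :: "'a::euclidean_space => real"
 assumes f: "L1 f"
 shows "AE x. ((%r. avg_ball (%y. abs (f y - f x)) x r) \<longlongrightarrow> 0) (at_right 0)"
proof -
 define E where "E s = {x. \<not> (\<forall>\<^sub>F r in at_right 0. avg_ball (%y. abs (f y - f x)) x r <= 3 * s)}" for s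
 have negl: "negligible (E s)" if s: "s > 0" for s
 proof (subst negligible_outer_le, intro allI impI)
  fix e :: real assume e: "e > 0"
  \<comment> \<open>With this choice each of the two parts of \<open>T\<close> has measure at most
    \<open>5 ^ n / s * e' = e / 2\<close>.\<close>
  define e' where "e' = e / (2 * 5 ^ DIM('a) / s)"
  obtain g where g: "continuous_on UNIV g" "L1 g" "(LBINT x. abs (f x - g x)) < e'"
   using integrable_approx_continuous[OF f, of e'] e s by (auto simp: e'_def)
  have [measurable]: "f \<in> borel_funs" "g \<in> borel_funs"
   using f g by (auto simp: measurable_L1)
  let ?h = "%x. abs (f x - g x)"
  have h: "L1 ?h" "!!x. 0 <= ?h x" using f g by auto
  define T where "T = maximal_set ?h s \<union> {x. ?h x >= s}"
  have m1: "emeasure lborel (maximal_set ?h s) <= ennreal (5 ^ DIM('a) / s * e')"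
   using maximal_weak_type[OF h s] g(3) s
   by (elim order_trans) (auto intro!: ennreal_leI divide_right_mono mult_left_mono)
  have "emeasure lborel {x. ?h x >= s} <= ennreal (1 / s * (LBINT x. ?h x))"
   using integral_Markov_inequality[OF h(1), of s] s by simp
  also have "... <= ennreal (1 / s * e')"
   using s g(3) by (intro ennreal_leI mult_left_mono) auto
  also have "... <= ennreal (5 ^ DIM('a) / s * e')"
   using e s by (intro ennreal_leI mult_right_mono divide_right_mono) (auto simp: e'_def)
  finally have m2: "emeasure lborel {x. ?h x >= s} <= ennreal (5 ^ DIM('a) / s * e')" .
  have Ts: "T \<in> sets borel" unfolding T_def using h by measurable
  have "emeasure lborel T <= emeasure lborel (maximal_set ?h s) + emeasure lborel {x. ?h x >= s}"
   unfolding T_def by (rule emeasure_subadditive) (use h in auto)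
  also have "... <= ennreal (5 ^ DIM('a) / s * e') + ennreal (5 ^ DIM('a) / s * e')"
   by (intro add_mono m1 m2)
  also have "... = ennreal e"
   using e s by (subst ennreal_plus[symmetric]) (auto simp: e'_def field_simps)
  finally have Tm: "emeasure lborel T <= ennreal e" .
  have "E s \<subseteq> T"
  proof
   fix x assume x: "x \<in> E s"
   show "x \<in> T"
   proof (rule ccontr)
    assume "x \<notin> T"
    then have x1: "x \<notin> maximal_set ?h s" and x2: "?h x < s" by (auto simp: T_def)
    have "\<forall>\<^sub>F r in at_right 0. avg_ball (%y. abs (g y - g x)) x r <= s"
     using g s by (intro avg_ball_continuous) (auto simp: continuous_on_eq_continuous_at)
    moreover have "\<forall>\<^sub>F r :: real in at_right 0. r > 0" by (simp add: eventually_at_right_less)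
    ultimately have "\<forall>\<^sub>F r in at_right 0. avg_ball (%y. abs (f y - f x)) x r <= 3 * s"
    proof eventually_elim
     case (elim r)
     let ?B = "ball x r"
     have i1: "set_integrable lborel ?B ?h" using h by (intro set_integrable_lborel) auto
     have i2: "set_integrable lborel ?B (%y. abs (g y - g x))" "set_integrable lborel ?B (%y. abs (f y - f x))"
      by (intro set_integrable_abs set_integral_diff(1)[OF set_integrable_lborel[OF g(2)] set_integrable_const_ball]
        set_integral_diff(1)[OF set_integrable_lborel[OF f] set_integrable_const_ball]; simp)+
     have "(LBINT y:?B. abs (f y - f x)) <= (LBINT y:?B. (?h y + abs (g y - g x)) + ?h x)"
      by (rule set_integral_mono[OF i2(2) set_integral_add(1)[OF set_integral_add(1)[OF i1 i2(1)] set_integrable_const_ball]]) auto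
     also have "... = (LBINT y:?B. ?h y) + (LBINT y:?B. abs (g y - g x)) + (LBINT y:?B. ?h x)"
      by (simp only: set_integral_add(2)[OF set_integral_add(1)[OF i1 i2(1)] set_integrable_const_ball] set_integral_add(2)[OF i1 i2(1)])
     also have "(LBINT y:?B. ?h x) = ?h x * vol ?B"
      using elim by (simp add: set_integral_def)
     finally have fin: "(LBINT y:?B. abs (f y - f x)) <= (LBINT y:?B. ?h y) + (LBINT y:?B. abs (g y - g x)) + ?h x * vol ?B" .
     \<comment> \<open>One \<open>s\<close> comes from the mean of \<open>|f - g|\<close>, one from
       the continuity of \<open>g\<close>, one from \<open>|f x - g x|\<close>; this is the factor 3
       in \<open>E\<close>.\<close>
     have "(LBINT y:?B. abs (f y - f x)) <= s * vol ?B + s * vol ?B + s * vol ?B"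
     proof -
      have "?h x * vol ?B <= s * vol ?B"
       using x2 by (intro mult_right_mono) auto
      moreover have "(LBINT y:?B. abs (g y - g x)) <= s * vol ?B"
       using elim by (simp add: avg_ball_def divide_le_eq measure_lborel_ball)
      moreover note not_maximal_set[OF x1 elim(2)]
      ultimately show ?thesis using fin by linarith
     qed
     then show ?case using elim by (simp add: avg_ball_def divide_le_eq measure_lborel_ball)
    qed
    with x show False by (simp add: E_def)
   qed
  qed
  then show "\<exists>T. E s \<subseteq> T & T \<in> lmeasurable & measure lebesgue T <= e"
  proof (intro exI[of _ T] conjI)
   show "T \<in> lmeasurable" using Ts Tm by (auto simp: fmeasurable_def less_top[symmetric] top_unique)
   show "measure lebesgue T <= e"
    using Ts Tm e by (simp add: measure_def enn2real_leI)
  qed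
 qed
 have "negligible (\<Union>k. E (1 / real (Suc k)))"
  by (intro negligible_Union_nat negl) auto
 then have "(\<Union>k. E (1 / real (Suc k))) \<in> null_sets lebesgue"
  by (simp add: negligible_iff_null_sets)
 then have "AE x in lebesgue. x \<notin> (\<Union>k. E (1 / real (Suc k)))" by (rule AE_not_in)
 then have ae: "AE x. x \<notin> (\<Union>k. E (1 / real (Suc k)))" by (simp add: AE_completion_iff)
 show ?thesis
 proof (rule AE_mp[OF ae], intro AE_I2 impI)
  fix x assume x: "x \<notin> (\<Union>k. E (1 / real (Suc k)))"
  show "((%r. avg_ball (%y. abs (f y - f x)) x r) \<longlongrightarrow> 0) (at_right 0)"
  proof (rule tendstoI)
   fix e :: real assume "e > 0"
   then obtain k where "3 * (1 / real (Suc k)) < e"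
    using reals_Archimedean[of "e/3"] by (auto simp: field_simps)
   moreover have "\<forall>\<^sub>F r in at_right 0. avg_ball (%y. abs (f y - f x)) x r <= 3 * (1 / real (Suc k))"
    using x by (auto simp: E_def)
   ultimately show "\<forall>\<^sub>F r in at_right 0. dist (avg_ball (%y. abs (f y - f x)) x r) 0 < e"
    by (auto elim!: eventually_mono simp: avg_ball_def set_integral_nonneg' abs_of_nonneg divide_nonneg_nonneg)
  qed
 qed
qed

section \<open>Test functions and mollification\<close>

lemma C_diff_continuous: "C_diff k \<phi> ==> continuous_on UNIV \<phi>"
 by (cases k) (auto intro: differentiable_imp_continuous_on)

lemma C_diff_Suc_imp: "C_diff (Suc k) \<phi> ==> C_diff k \<phi>"
proof (induction k arbitrary: \<phi>)
 case 0
 then show ?case by (auto intro: differentiable_imp_continuous_on)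
next
 case (Suc k)
 then show ?case by simp
qed

lemma C_diff_const [simp]: "C_diff k (%x. c)"
 by (induction k arbitrary: c) auto

lemma C_diff_add:
 "C_diff k f ==> C_diff k g ==> C_diff k (%x. f x + g x)"
proof (induction k arbitrary: f g)
 case 0
 then show ?case by (auto intro: continuous_intros)
next
 case (Suc k)
 then have d: "f differentiable at x" "g differentiable at x" for x
  by (auto simp: differentiable_on_def)
 have eq: "frechet_derivative (%x. f x + g x) (at x) = (%h. frechet_derivative f (at x) h + frechet_derivative g (at x) h)" for x
  by (rule frechet_derivative_at[symmetric]) (intro has_derivative_add d[THEN frechet_derivative_works[THEN iffD1]])
 show ?case using Suc by (auto simp: eq)
qed

lemma C_diff_mult:
 "C_diff k f ==> C_diff k g ==> C_diff k (%x. f x * g x)"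
proof (induction k arbitrary: f g)
 case 0
 then show ?case by (auto intro: continuous_intros)
next
 case (Suc k)
 then have d: "f differentiable at x" "g differentiable at x" for x
  by (auto simp: differentiable_on_def)
 have eq: "frechet_derivative (%x. f x * g x) (at x) = (%h. f x * frechet_derivative g (at x) h + frechet_derivative f (at x) h * g x)" for x
  by (rule frechet_derivative_at[symmetric]) (intro has_derivative_mult d[THEN frechet_derivative_works[THEN iffD1]])
 have "C_diff k f" "C_diff k g" using Suc.prems C_diff_Suc_imp by blast+
 then show ?case using Suc by (auto simp: eq intro!: C_diff_add differentiable_on_mult)
qed

lemma C_diff_sum:
 "finite A ==> (!!i. i \<in> A ==> C_diff k (f i)) ==> C_diff k (%x. \<Sum>i\<in>A. f i x)"
 by (induction A rule: finite_induct) (auto intro: C_diff_add)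

lemma C_diff_inner: "C_diff k (%x. x \<bullet> b)"
proof (cases k)
 case (Suc l)
 have d: "((%x. x \<bullet> b) has_derivative (%h. h \<bullet> b)) (at x)" for x :: 'a
  by (intro derivative_eq_intros) auto
 have eq: "frechet_derivative (%x. x \<bullet> b) (at x) = (%h. h \<bullet> b)" for x :: 'a
  by (rule frechet_derivative_at[symmetric, OF d])
 show ?thesis using Suc d by (auto simp: eq differentiable_on_def differentiable_def)
qed (auto intro!: continuous_intros)

text \<open>A whole sequence of successive derivatives \<open>F j\<close> is carried along, because
  differentiating \<open>F j (q x)\<close> produces \<open>F (Suc j) (q x)\<close>; the induction on
  \<open>k\<close> runs for all \<open>j\<close> at once.\<close>

lemma C_diff_chain:
 assumes F: "!!j t. ((F j :: real => real) has_field_derivative F (Suc j) t) (at t)"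
  and q: "!!k. C_diff k q"
 shows "C_diff k (%x. F j (q x))"
proof (induction k arbitrary: j)
 case 0
 have "continuous_on UNIV (F j)" using F by (intro DERIV_continuous_on) (auto intro: DERIV_subset)
 then show ?case using C_diff_continuous[OF q] by (auto intro: continuous_on_compose2)
next
 case (Suc k)
 have d: "((%x. F j (q x)) has_derivative (%h. F (Suc j) (q x) * frechet_derivative q (at x) h)) (at x)" for x
 proof -
  have "q differentiable at x" using q[of 1] by (auto simp: differentiable_on_def)
  from has_derivative_compose[OF frechet_derivative_works[THEN iffD1, OF this] F[of j, unfolded has_field_derivative_def]]
  show ?thesis by (simp add: o_def)
 qed
 have eq: "frechet_derivative (%x. F j (q x)) (at x) = (%h. F (Suc j) (q x) * frechet_derivative q (at x) h)" for x
  by (rule frechet_derivative_at[symmetric, OF d])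
 have "C_diff k (%x. frechet_derivative q (at x) b)" if "b \<in> Basis" for b
  using q[of "Suc k"] that by auto
 then show ?case using d Suc by (auto simp: eq differentiable_on_def differentiable_def intro!: C_diff_mult)
qed

section \<open>Smooth bumps with compact support\<close>

text \<open>The functions \<open>p(1/t) exp(-1/t)\<close>, extended by 0 to \<open>t <= 0\<close>.
  The family is closed under differentiation, so a single derivative computation yields derivatives
  of every order.\<close>

definition flat_exp :: "real poly => real => real" where
 "flat_exp p t = (if t > 0 then poly p (1/t) * exp (-1/t) else 0)"

lemma poly_mult_exp_tendsto_0: "((%s. poly p s * exp (- s)) \<longlongrightarrow> 0) at_top" for p :: "real poly"
proof -
 have "((%s. \<Sum>i\<le>degree p. coeff p i * (s ^ i / exp s)) \<longlongrightarrow> (\<Sum>i\<le>degree p. coeff p i * 0)) at_top"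
  by (intro tendsto_intros tendsto_power_div_exp_0)
 moreover have "(%s. \<Sum>i\<le>degree p. coeff p i * (s ^ i / exp s)) = (%s. poly p s * exp (- s))"
  by (simp add: poly_altdef sum_distrib_right exp_minus divide_inverse mult.assoc)
 ultimately show ?thesis by simp
qed

text \<open>For \<open>t > 0\<close> differentiation replaces \<open>p\<close> by
  \<open>x^2 (p - p')\<close>. At 0 the right-hand difference quotient is
  \<open>s p(s) exp(-s)\<close> with \<open>s = 1/h\<close>, which tends to 0 as \<open>h\<close>
  does; the additional factor \<open>s\<close> is the polynomial \<open>[:0,1:]\<close>.\<close>

lemma DERIV_flat_exp:
 "(flat_exp p has_field_derivative flat_exp ([:0,0,1:] * (p - pderiv p)) t) (at t)"
proof (cases t "0 :: real" rule: linorder_cases)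
 case less
 have "((%_. 0) has_field_derivative 0) (at t)" by simp
 then have "(flat_exp p has_field_derivative 0) (at t)"
  by (rule has_field_derivative_transform_within_open[of _ _ _ "{..<0}"]) (use less in \<open>auto simp: flat_exp_def\<close>)
 with less show ?thesis by (simp add: flat_exp_def)
next
 case greater
 have "((%t. poly p (1/t) * exp (-1/t)) has_field_derivative
     (poly (pderiv p) (1/t) * (- 1/t^2)) * exp (-1/t) + (exp (-1/t) * (1/t^2)) * poly p (1/t)) (at t)"
  using greater
  by (auto intro!: derivative_eq_intros DERIV_chain2[OF poly_DERIV] simp: power2_eq_square divide_inverse)
 then have "(flat_exp p has_field_derivative
     (poly (pderiv p) (1/t) * (- 1/t^2)) * exp (-1/t) + (exp (-1/t) * (1/t^2)) * poly p (1/t)) (at t)"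
  by (rule has_field_derivative_transform_within_open[of _ _ _ "{0<..}"]) (use greater in \<open>auto simp: flat_exp_def\<close>)
 moreover have "(poly (pderiv p) (1/t) * (- 1/t^2)) * exp (-1/t) + (exp (-1/t) * (1/t^2)) * poly p (1/t)
   = flat_exp ([:0,0,1:] * (p - pderiv p)) t"
  using greater by (simp add: flat_exp_def power2_eq_square field_simps)
 ultimately show ?thesis by simp
next
 case equal
 have "((%t. poly ([:0,1:] * p) (inverse t) * exp (- inverse t)) \<longlongrightarrow> 0) (at_right 0)"
  by (rule filterlim_compose[OF poly_mult_exp_tendsto_0 filterlim_inverse_at_top_right])
 then have "((%h. (flat_exp p (0 + h) - flat_exp p 0) / h) \<longlongrightarrow> 0) (at_right 0)"
  by (rule Lim_transform_eventually)
   (auto simp: eventually_at_right_field flat_exp_def field_simps intro!: exI[of _ 1])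
 moreover have "((%h. (flat_exp p (0 + h) - flat_exp p 0) / h) \<longlongrightarrow> 0) (at_left 0)"
  by (rule Lim_transform_eventually[OF tendsto_const])
   (auto simp: eventually_at_left_field flat_exp_def intro!: exI[of _ "-1"])
 ultimately have "((%h. (flat_exp p (0 + h) - flat_exp p 0) / h) \<longlongrightarrow> 0) (at 0)"
  by (simp add: filterlim_split_at)
 then show ?thesis using equal by (simp add: DERIV_def flat_exp_def)
qed

text \<open>Inside the ball this is \<open>exp (-1 / (1 - |z - x|^2 / r^2))\<close>. The squared
  norm is a polynomial in the coordinates, so the centre causes no singularity.\<close>

definition bump :: "'a::euclidean_space => real => 'a => real" where
 "bump x r z = flat_exp 1 (1 - (norm (z - x) / r)\<^sup>2)"

lemma C_diff_bump: "C_diff k (bump x r)"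
proof -
 define F where "F j = flat_exp (((%p. [:0,0,1:] * (p - pderiv p)) ^^ j) 1)" for j
 have F: "(F j has_field_derivative F (Suc j) t) (at t)" for j t
  unfolding F_def using DERIV_flat_exp by simp
 define q where "q z = 1 + (\<Sum>b\<in>Basis. (z \<bullet> b + (- (x \<bullet> b))) * (z \<bullet> b + (- (x \<bullet> b)))) * (- 1 / r\<^sup>2)" for z
 have q: "C_diff k q" for k
  unfolding q_def by (intro C_diff_add C_diff_mult C_diff_sum C_diff_const C_diff_inner) auto
 have "bump x r = (%z. F 0 (q z))"
 proof
  fix z
  have "(norm (z - x))\<^sup>2 = (\<Sum>b\<in>Basis. (z \<bullet> b + (- (x \<bullet> b))) * (z \<bullet> b + (- (x \<bullet> b))))"
   by (subst power2_norm_eq_inner, subst euclidean_inner) (simp add: inner_diff_left)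
  then show "bump x r z = F 0 (q z)"
   by (simp add: bump_def F_def q_def power_divide)
 qed
 moreover have "C_diff k (%z. F 0 (q z))"
  by (rule C_diff_chain[of F q, OF F q])
 ultimately show ?thesis by simp
qed

lemma bump_nonneg: "0 <= bump x r z"
 by (simp add: bump_def flat_exp_def)

lemma bump_le_1: "bump x r z <= 1"
 by (auto simp: bump_def flat_exp_def)

lemma bump_pos_iff: "r > 0 ==> bump x r z > 0 \<longleftrightarrow> z \<in> ball x r"
proof -
 assume r: "r > 0"
 have "1 - (norm (z - x) / r)\<^sup>2 > 0 \<longleftrightarrow> norm (z - x) < r"
  using r by (simp add: abs_square_less_1)
 then show ?thesis by (auto simp: bump_def flat_exp_def dist_norm norm_minus_commute)
qed

lemma bump_eq_0: "r > 0 ==> z \<notin> ball x r ==> bump x r z = 0"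
 using bump_pos_iff[of r x z] bump_nonneg[of x r z] by linarith

lemma support_bump: "r > 0 ==> closure {z. bump x r z ~= 0} = cball x r"
proof -
 assume r: "r > 0"
 have "{z. bump x r z ~= 0} = ball x r"
  using bump_pos_iff[OF r, of x] bump_eq_0[OF r, of _ x] by force
 with r show ?thesis by simp
qed

lemma continuous_on_bump [continuous_intros]: "continuous_on S (bump x r)"
 using C_diff_continuous[OF C_diff_bump] continuous_on_subset by blast

lemma borel_measurable_bump [measurable]: "bump x r \<in> borel_funs"
 by (intro borel_measurable_continuous_onI continuous_on_bump)

lemma integrable_compact_support:
 fixes f :: "'a::euclidean_space => real"
 assumes "f \<in> borel_funs" "!!z. abs (f z) <= B" "!!z. z \<notin> cball x r ==> f z = 0"
 shows "L1 f"
proof (rule integrable_majorant)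
 show "L1 (%z. B * indicator (cball x r) z)"
  by (intro integrable_mult_right integrable_real_indicator)
   (use emeasure_bounded_finite[OF bounded_cball, of x r] in auto)
qed (use assms in \<open>auto simp: indicator_def\<close>)

lemma integrable_indicator_bounded:
 "bounded U ==> U \<in> sets borel ==> L1 (indicat_real (U :: 'a::euclidean_space set))"
 using emeasure_bounded_finite[of U] by (intro integrable_real_indicator) auto

lemma integrable_bump: "r > 0 ==> L1 (bump x r)"
 by (rule integrable_compact_support[of _ 1 x r]) (simp_all add: bump_nonneg bump_le_1 bump_eq_0)

lemma integral_affine_euclidean:
 fixes f :: "'a::euclidean_space => 'b::{banach, second_countable_topology}"
 assumes "c ~= 0"
 shows "(LBINT x. f (t + c *\<^sub>R x)) = (LBINT x. f x) /\<^sub>R abs c ^ DIM('a)"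
  and "L1 f ==> L1 (%x. f (t + c *\<^sub>R x))"
proof -
 have 1: "L1 (%x. f (t + c *\<^sub>R x))" if f: "L1 f" and c: "c ~= 0"
  for f :: "'a => 'b" and t and c :: real
 proof -
  have [measurable]: "f \<in> borel_funs" using f by (simp add: measurable_L1)
  from f have "integrable (density (distr lborel borel (%x. t + c *\<^sub>R x)) (%_. ennreal (abs c ^ DIM('a)))) f"
   using lborel_affine[OF c, of t] by simp
  then show ?thesis
  proof -
   assume "integrable (density (distr lborel borel (%x. t + c *\<^sub>R x)) (%_. ennreal (abs c ^ DIM('a)))) f"
   then have "L1 (%x. abs c ^ DIM('a) *\<^sub>R f (t + c *\<^sub>R x))"
    using c by (subst (asm) integrable_density) (auto simp: integrable_distr_eq)
   then have "L1 (%x. inverse (abs c ^ DIM('a)) *\<^sub>R (abs c ^ DIM('a) *\<^sub>R f (t + c *\<^sub>R x)))"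
    by (rule integrable_scaleR_right)
   then show ?thesis using c by simp
  qed
 qed
 show "L1 f ==> L1 (%x. f (t + c *\<^sub>R x))"
  using 1[OF _ assms] .
 show "(LBINT x. f (t + c *\<^sub>R x)) = (LBINT x. f x) /\<^sub>R abs c ^ DIM('a)"
 proof (cases "L1 f")
  case True
  then have [measurable]: "f \<in> borel_funs" by (simp add: measurable_L1)
  have "(LBINT x. f x) = (\<integral>x. f x \<partial>density (distr lborel borel (%x. t + c *\<^sub>R x)) (%_. ennreal (abs c ^ DIM('a))))"
   using lborel_affine[OF assms, of t] by simp
  also have "... = abs c ^ DIM('a) *\<^sub>R (LBINT x. f (t + c *\<^sub>R x))"
   using assms by (subst integral_density) (auto simp: integral_distr)
  finally show ?thesis using assms by simp
 next
  case False
  \<comment> \<open>If \<open>f\<close> is not integrable, neither is its rescaling, by the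
    integrable case for the inverse affine map; both integrals then have the default value
    0.\<close>
  have "\<not> L1 (%x. f (t + c *\<^sub>R x))"
  proof
   assume "L1 (%x. f (t + c *\<^sub>R x))"
   from 1[OF this, of "1/c" "- t /\<^sub>R c"] assms have "L1 f" by (simp add: algebra_simps)
   with False show False by simp
  qed
  with False show ?thesis by (simp add: not_integrable_integral_eq)
 qed
qed

definition bump_mass :: "'a::euclidean_space itself => real" where
 "bump_mass _ = (LBINT z. bump (0::'a) 1 z)"

lemma bump_mass_pos: "bump_mass TYPE('a::euclidean_space) > 0"
proof -
 let ?f = "bump (0::'a) 1"
 have "\<not> (AE z. ?f z = 0)"
 proof
  assume "AE z. ?f z = 0"
  then have "AE z. z \<notin> ball (0::'a) 1"
   by eventually_elim (metis bump_pos_iff less_irrefl zero_less_one)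
  then have "ball (0::'a) 1 \<in> null_sets lborel" by (simp add: AE_iff_null_sets)
  then have "emeasure lborel (ball (0::'a) 1) = 0" by auto
  then show False using unit_ball_vol_pos[of "real DIM('a)"] by (simp add: emeasure_ball del: unit_ball_vol_pos)
 qed
 then have "(LBINT z. ?f z) ~= 0"
  using integral_nonneg_eq_0_iff_AE[OF integrable_bump, of 1 "0::'a"] bump_nonneg by auto
 moreover have "(LBINT z. ?f z) >= 0" by (intro Bochner_Integration.integral_nonneg bump_nonneg)
 ultimately show ?thesis by (simp add: bump_mass_def)
qed

lemma bounded_compact_support:
 fixes f :: "'a::euclidean_space => 'b::real_normed_vector"
 assumes f: "continuous_on UNIV f" and 0: "!!z. z \<notin> cball x r ==> f z = 0"
 obtains B where "B >= 0" "!!z. norm (f z) <= B"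
proof -
 have "compact (f ` cball x r)"
  by (intro compact_continuous_image continuous_on_subset[OF f]) auto
 then obtain B where B: "!!w. w \<in> cball x r ==> norm (f w) <= B"
  using compact_imp_bounded bounded_iff by (metis imageI)
 have "norm (f w) <= max B 0" for w
  using B[of w] 0[of w] by (cases "w \<in> cball x r") auto
 then show ?thesis by (intro that[of "max B 0"]) auto
qed

definition tgrad :: "('a::euclidean_space => real) => 'a => 'a" where
 "tgrad \<phi> x = (\<Sum>b\<in>Basis. frechet_derivative \<phi> (at x) b *\<^sub>R b)"

lemma tgrad_inner_Basis: "b \<in> Basis ==> tgrad \<phi> x \<bullet> b = frechet_derivative \<phi> (at x) b"
 by (simp add: tgrad_def inner_sum_left_Basis)

lemma has_derivative_tgrad:
 assumes "!!k. C_diff k \<phi>"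
 shows "(\<phi> has_derivative (%h. tgrad \<phi> x \<bullet> h)) (at x)"
proof -
 have "\<phi> differentiable (at x)" using assms[of "Suc 0"] by (auto simp: differentiable_on_def)
 then have d: "(\<phi> has_derivative frechet_derivative \<phi> (at x)) (at x)" by (simp add: frechet_derivative_works)
 have "frechet_derivative \<phi> (at x) h = tgrad \<phi> x \<bullet> h" for h
 proof -
  interpret linear "frechet_derivative \<phi> (at x)" using d by (rule has_derivative_linear)
  have "frechet_derivative \<phi> (at x) h = frechet_derivative \<phi> (at x) (\<Sum>b\<in>Basis. (h \<bullet> b) *\<^sub>R b)" by (simp add: euclidean_representation)
  also have "... = tgrad \<phi> x \<bullet> h" by (simp add: sum scale tgrad_def inner_sum_left inner_commute[of h] mult.commute)
  finally show ?thesis .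
 qed
 then have "frechet_derivative \<phi> (at x) = (%h. tgrad \<phi> x \<bullet> h)" by auto
 with d show ?thesis by simp
qed

lemma tgrad_unique: "(!!k. C_diff k \<phi>) ==> (\<phi> has_derivative (%h. v \<bullet> h)) (at x) ==> tgrad \<phi> x = v"
 by (drule has_derivative_unique[OF has_derivative_tgrad]) (auto simp: fun_eq_iff vector_eq_rdot)

lemma continuous_on_tgrad: "(!!k. C_diff k \<phi>) ==> continuous_on S (tgrad \<phi>)"
proof -
 assume a: "!!k. C_diff k \<phi>"
 have "continuous_on UNIV (%x. frechet_derivative \<phi> (at x) b)" if "b \<in> Basis" for b using a[of "Suc 0"] that by auto
 then have "continuous_on UNIV (tgrad \<phi>)" unfolding tgrad_def by (intro continuous_intros)
 then show ?thesis using continuous_on_subset by blast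
qed

lemma tgrad_eq_0:
 assumes "!!k. C_diff k \<phi>" and V: "open V" "x \<in> V" "!!y. y \<in> V ==> \<phi> y = 0"
 shows "tgrad \<phi> x = 0"
proof (rule tgrad_unique[OF assms(1)])
 show "(\<phi> has_derivative (%h. 0 \<bullet> h)) (at x)"
 proof (rule has_derivative_transform_within_open)
  show "((%_. 0) has_derivative (%h. 0 \<bullet> h)) (at x)" by simp
  show "0 = \<phi> y" if "y \<in> V" for y using V(3)[OF that] by simp
 qed (rule V)+
qed

lemma test_functionD: "test_function U \<phi> ==> C_diff k \<phi>"
 by (simp add: test_function_def)

lemma test_function_outside:
 assumes "test_function U \<phi>" "x \<notin> U"
 shows "\<phi> x = 0" "tgrad \<phi> x = 0"
proof -
 let ?C = "closure {x. \<phi> x ~= 0}"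
 have xC: "x \<in> - ?C" using assms by (auto simp: test_function_def)
 have z: "\<phi> y = 0" if "y \<in> - ?C" for y using that closure_subset[of "{x. \<phi> x ~= 0}"] by auto
 show "\<phi> x = 0" by (rule z[OF xC])
 show "tgrad \<phi> x = 0" by (rule tgrad_eq_0[OF test_functionD[OF assms(1)] _ xC z]) auto
qed

lemma test_function_support:
 assumes "test_function U \<phi>"
 obtains r where "r > 0" "!!x. x \<notin> cball 0 r ==> \<phi> x = 0" "!!x. x \<notin> cball 0 r ==> tgrad \<phi> x = 0"
proof -
 let ?C = "closure {x. \<phi> x ~= 0}"
 have "compact ?C" using assms by (simp add: test_function_def)
 then obtain r where r: "?C \<subseteq> ball 0 r" "r > 0" using bounded_subset_ballD[OF compact_imp_bounded, of ?C 0] by blast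
 have "?C \<subseteq> cball 0 r" using r(1) ball_subset_cball by blast
 then have "test_function (cball 0 r) \<phi>" using assms by (auto simp: test_function_def)
 from test_function_outside[OF this] show ?thesis using r(2) that by blast
qed

lemma test_function_bounded:
 assumes "test_function U \<phi>"
 shows "\<exists>B. \<forall>x. abs (\<phi> x) <= B" "\<exists>B. \<forall>x. norm (tgrad \<phi> x) <= B"
proof -
 obtain r where r: "r > 0" "!!x. x \<notin> cball 0 r ==> \<phi> x = 0" "!!x. x \<notin> cball 0 r ==> tgrad \<phi> x = 0"
  using test_function_support[OF assms] by metis
 show "\<exists>B. \<forall>x. norm (tgrad \<phi> x) <= B"
  using bounded_compact_support[OF continuous_on_tgrad[OF test_functionD[OF assms]] r(3)] by metis
 show "\<exists>B. \<forall>x. abs (\<phi> x) <= B"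
  using bounded_compact_support[OF C_diff_continuous[OF test_functionD[OF assms]] r(2)] by (metis real_norm_def)
qed

section \<open>Mollification with a fixed radius\<close>

definition mker :: "real => 'a::euclidean_space => 'a => real" where
 "mker e x z = bump x e z * (1 / (e ^ DIM('a) * bump_mass TYPE('a)))"

lemma mker_nonneg: "e > 0 ==> 0 <= mker e x z"
 unfolding mker_def using bump_mass_pos[where 'a='a]
 by (intro mult_nonneg_nonneg bump_nonneg) auto

lemma mker_le: "e > 0 ==> mker e x (z::'a::euclidean_space) <= 1 / (e ^ DIM('a) * bump_mass TYPE('a))"
 unfolding mker_def using bump_le_1[of x e z] bump_mass_pos[where 'a='a]
 by (intro mult_left_le_one_le[of _ "bump x e z"]) (auto simp: bump_nonneg)

lemma mker_eq_0: "e > 0 ==> z \<notin> ball x e ==> mker e x z = 0"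
 by (simp add: mker_def bump_eq_0)

lemma mker_commute: "mker e x z = mker e z x"
 by (simp add: mker_def bump_def norm_minus_commute)

lemma mker_translate: "mker e x z = mker e 0 (z - x)"
 by (simp add: mker_def bump_def)

lemma C_diff_mker: "C_diff k (mker e x)"
 unfolding mker_def by (intro C_diff_mult C_diff_bump C_diff_const)

lemma continuous_on_mker: "continuous_on S (mker e x)"
 using C_diff_continuous[OF C_diff_mker] continuous_on_subset by blast

lemma borel_measurable_mker [measurable]: "mker e x \<in> borel_funs"
 by (intro borel_measurable_continuous_onI continuous_on_mker)

lemma borel_measurable_mker2 [measurable]:
 assumes [measurable]: "f \<in> borel_measurable M" "g \<in> borel_measurable M"
 shows "(%z. mker e (f z) (g z)) \<in> borel_measurable M"
 by (subst mker_translate) measurable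

lemma test_function_mker:
 assumes "e > 0" "cball x e \<subseteq> U"
 shows "test_function U (mker e (x::'a::euclidean_space))"
proof -
 have "{z. mker e x z ~= 0} = {z. bump x e z ~= 0}"
  using assms bump_mass_pos[where 'a='a] by (auto simp: mker_def)
 with assms show ?thesis
  by (auto simp: test_function_def C_diff_mker support_bump)
qed

lemma integrable_mker: "e > 0 ==> L1 (mker e x)"
 unfolding mker_def by (intro integrable_mult_left integrable_bump)

lemma integral_mker:
 assumes "e > 0"
 shows "(LBINT z. mker e (x::'a::euclidean_space) z) = 1"
proof -
 have "(LBINT z. bump x e (x + e *\<^sub>R z)) = (LBINT z. bump x e z) /\<^sub>R abs e ^ DIM('a)"
  using assms by (intro integral_affine_euclidean) auto
 moreover have "bump x e (x + e *\<^sub>R z) = bump 0 1 z" for z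
  using assms by (simp add: bump_def)
 ultimately have "(LBINT z. bump x e z) = e ^ DIM('a) * bump_mass TYPE('a)"
  using assms by (simp add: bump_mass_def)
 then show ?thesis
  using assms bump_mass_pos[where 'a='a] unfolding mker_def by simp
qed

lemma uniformly_continuous_compact_support:
 fixes f :: "'a::euclidean_space => 'b::real_normed_vector"
 assumes f: "continuous_on UNIV f" and 0: "!!z. z \<notin> cball x r ==> f z = 0"
 shows "uniformly_continuous_on UNIV f"
 unfolding uniformly_continuous_on_def
proof (intro allI impI)
 fix e :: real assume e: "e > 0"
 have "uniformly_continuous_on (cball x (r + 1)) f"
  by (rule compact_uniformly_continuous) (use f continuous_on_subset in auto)
 then obtain d where d: "d > 0" "!!z w. z \<in> cball x (r + 1) ==> w \<in> cball x (r + 1) ==> dist w z < d ==> dist (f w) (f z) < e"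
  using e unfolding uniformly_continuous_on_def by metis
 show "\<exists>d>0. \<forall>z\<in>UNIV. \<forall>w\<in>UNIV. dist w z < d --> dist (f w) (f z) < e"
 proof (intro exI[of _ "min d 1"] conjI ballI impI)
  fix z w :: 'a assume zw: "dist w z < min d 1"
  show "dist (f w) (f z) < e"
  proof (cases "z \<in> cball x r \<or> w \<in> cball x r")
   case True
   have "z \<in> cball x (r + 1)" "w \<in> cball x (r + 1)"
    using True zw dist_triangle[of x z w] dist_triangle[of x w z] by (auto simp: dist_commute)
   with d zw show ?thesis by auto
  qed (use 0 e in auto)
 qed (use d in auto)
qed

text \<open>The mean value theorem along a segment turns uniform continuity of the gradient into a
  first-order remainder that is uniform in the base point. This is what permits differentiation
  under the mollifying integrals.\<close>

lemma uniformly_differentiable: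
 fixes \<phi> :: "'a::euclidean_space => real"
 assumes \<phi>: "!!z. (\<phi> has_derivative (%h. G z \<bullet> h)) (at z)" and G: "uniformly_continuous_on UNIV G" and e: "e > 0"
 obtains d where "d > 0" "!!z h. norm h < d ==> abs (\<phi> (z + h) - \<phi> z - G z \<bullet> h) <= e * norm h"
proof -
 obtain d where d: "d > 0" "!!z w. dist w z < d ==> dist (G w) (G z) < e"
  using G e unfolding uniformly_continuous_on_def by (metis UNIV_I)
 show ?thesis
 proof
  fix z h :: 'a assume h: "norm h < d"
  have "((%s. \<phi> (z + s *\<^sub>R h)) has_real_derivative G (z + s *\<^sub>R h) \<bullet> h) (at s)" for s
  proof -
   have "((%s. z + s *\<^sub>R h) has_derivative (%t. t *\<^sub>R h)) (at s)"
    by (auto intro!: derivative_eq_intros)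
   from has_derivative_compose[OF this \<phi>] show ?thesis
    by (simp add: o_def has_field_derivative_def mult_commute_abs)
  qed
  then obtain s where s: "0 < s" "s < 1" "\<phi> (z + 1 *\<^sub>R h) - \<phi> (z + 0 *\<^sub>R h) = (1 - 0) * (G (z + s *\<^sub>R h) \<bullet> h)"
   using MVT2[of 0 1 "%s. \<phi> (z + s *\<^sub>R h)" "%s. G (z + s *\<^sub>R h) \<bullet> h"] by auto
  have "\<phi> (z + h) - \<phi> z - G z \<bullet> h = (G (z + s *\<^sub>R h) - G z) \<bullet> h"
   using s by (simp add: inner_diff_left)
  also have "abs ... <= norm (G (z + s *\<^sub>R h) - G z) * norm h"
   by (rule Cauchy_Schwarz_ineq2)
  also have "... <= e * norm h"
  proof (rule mult_right_mono)
   have "norm (s *\<^sub>R h) < d"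
    using s h mult_left_le_one_le[of "norm h" s] by simp
   then have "dist (G (z + s *\<^sub>R h)) (G z) < e" by (intro d) (simp add: dist_norm)
   then show "norm (G (z + s *\<^sub>R h) - G z) <= e" by (simp add: dist_norm)
  qed simp
  finally show "abs (\<phi> (z + h) - \<phi> z - G z \<bullet> h) <= e * norm h" .
 qed (fact d)
qed

abbreviation gradk :: "real => 'a::euclidean_space => 'a" where
 "gradk e \<equiv> tgrad (mker e 0)"

lemma has_derivative_mker: "(mker e x has_derivative (%h. gradk e (z - x) \<bullet> h)) (at z)"
proof -
 have "((%z. z - x) has_derivative (%h. h)) (at z)" by (auto intro!: derivative_eq_intros)
 from has_derivative_compose[OF this has_derivative_tgrad[OF C_diff_mker, of e 0 "z - x"]]
 show ?thesis by (simp add: mker_translate[symmetric])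
qed

lemma gradk_eq_0: "e > 0 ==> w \<notin> cball 0 e ==> gradk e w = 0"
 by (rule tgrad_eq_0[OF C_diff_mker, of "- cball 0 e"]) (auto intro: mker_eq_0)

lemma continuous_gradk: "continuous_on S (gradk e)"
 by (rule continuous_on_tgrad[OF C_diff_mker])

lemma borel_measurable_gradk [measurable]: "gradk e \<in> borel_funs"
 by (intro borel_measurable_continuous_onI continuous_gradk)

lemma uniformly_continuous_gradk: "e > 0 ==> uniformly_continuous_on UNIV (gradk e)"
 by (rule uniformly_continuous_compact_support[OF continuous_gradk gradk_eq_0])

lemma gradk_bounded:
 assumes "e > 0"
 obtains B where "!!w. norm (gradk e (w::'a::euclidean_space)) <= B"
 using bounded_compact_support[OF continuous_gradk gradk_eq_0[OF assms]] by metis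

definition mol :: "real => ('a::euclidean_space => real) => 'a => real" where
 "mol e g x = (LBINT z. g z * mker e x z)"

lemma integrable_mult_mker:
 fixes g :: "'a::euclidean_space => real"
 assumes "L1 g" "e > 0"
 shows "L1 (%z. g z * mker e x z)"
proof (rule integrable_dominated)
 have [measurable]: "g \<in> borel_funs" using assms by (simp add: measurable_L1)
 show "L1 (%z. g z * (1 / (e ^ DIM('a) * bump_mass TYPE('a))))"
  using assms by (intro integrable_mult_left)
 show "(%z. g z * mker e x z) \<in> borel_measurable lborel" by measurable
 show "AE z. norm (g z * mker e x z) <= norm (g z * (1 / (e ^ DIM('a) * bump_mass TYPE('a))))"
 proof (intro AE_I2)
  fix z
  have "abs (mker e x z) <= abs (1 / (e ^ DIM('a) * bump_mass TYPE('a)))"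
   using mker_le[OF assms(2), of x z] mker_nonneg[OF assms(2), of x z] by linarith
  then show "norm (g z * mker e x z) <= norm (g z * (1 / (e ^ DIM('a) * bump_mass TYPE('a))))"
   by (simp only: real_norm_def abs_mult mult_left_mono abs_ge_zero)
 qed
qed

lemma integrable_scaleR_gradk:
 fixes g :: "'a::euclidean_space => real"
 assumes g: "L1 g" and e: "e > 0"
 shows "L1 (%z. g z *\<^sub>R gradk e (z - x))"
proof -
 have [measurable]: "g \<in> borel_funs" using g by (simp add: measurable_L1)
 obtain B where B: "!!w::'a. norm (gradk e w) <= B" using gradk_bounded[OF e] by blast
 show ?thesis
 proof (rule integrable_dominated)
  show "L1 (%z. g z * B)" using g by (intro integrable_mult_left)
  show "AE z. norm (g z *\<^sub>R gradk e (z - x)) <= norm (g z * B)"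
   by (intro AE_I2) (auto simp: abs_mult intro!: mult_left_mono order_trans[OF B abs_ge_self])
  show "(%z. g z *\<^sub>R gradk e (z - x)) \<in> borel_measurable lborel" by measurable
 qed
qed

text \<open>The derivative falls on the kernel, so \<open>g\<close> need only be integrable; the
  minus sign appears because \<open>x\<close> enters the kernel as \<open>z - x\<close>.\<close>

lemma mol_has_derivative:
 fixes g :: "'a::euclidean_space => real"
 assumes g: "L1 g" and e: "e > 0"
 shows "(mol e g has_derivative (%h. (- (LBINT z. g z *\<^sub>R gradk e (z - x))) \<bullet> h)) (at x)"
 unfolding has_derivative_at_alt
proof (intro conjI allI impI)
 note gi = integrable_scaleR_gradk[OF g e, of x]
 let ?V = "- (LBINT z. g z *\<^sub>R gradk e (z - x))"
 fix c :: real assume c: "c > 0"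
 \<comment> \<open>The remainder \<open>c' * norm (y - x)\<close> is integrated against
   \<open>|g|\<close>; adding 1 keeps the denominator positive when \<open>g\<close> vanishes almost
   everywhere.\<close>
 define c' where "c' = c / ((LBINT z. abs (g z)) + 1)"
 have I0: "(LBINT z. abs (g z)) >= 0" by (intro Bochner_Integration.integral_nonneg) auto
 then have I1: "0 < (LBINT z. abs (g z)) + 1" by linarith
 have c': "c' > 0" "c' * (LBINT z. abs (g z)) <= c"
  unfolding c'_def using c I1 by (simp, simp add: field_simps)
 obtain d where d: "d > 0" "!!z h::'a. norm h < d ==> abs (mker e 0 (z + h) - mker e 0 z - gradk e z \<bullet> h) <= c' * norm h"
  by (rule uniformly_differentiable[OF has_derivative_tgrad[OF C_diff_mker] uniformly_continuous_gradk[OF e] c'(1)]) blast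
 show "\<exists>d>0. \<forall>y. norm (y - x) < d --> norm (mol e g y - mol e g x - ?V \<bullet> (y - x)) <= c * norm (y - x)"
 proof (intro exI[of _ d] conjI allI impI)
  fix y assume y: "norm (y - x) < d"
  have gi2: "L1 (%z. g z * (gradk e (z - x) \<bullet> (y - x)))"
   using integrable_inner_left[OF gi, of "y - x"] by simp
  have V: "?V \<bullet> (y - x) = - (LBINT z. g z * (gradk e (z - x) \<bullet> (y - x)))"
   using integral_inner_left[OF gi, of "y - x"] by simp
  note gi3 = integrable_mult_mker[OF g e]
  have "mol e g y - mol e g x - ?V \<bullet> (y - x) =
    (LBINT z. g z * mker e y z - g z * mker e x z + g z * (gradk e (z - x) \<bullet> (y - x)))"
   unfolding V mol_def using gi2 gi3 by simp
  also have "abs ... <= (LBINT z. abs (g z) * (c' * norm (y - x)))"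
  proof (rule order_trans[OF integral_abs_bound integral_mono])
   show "L1 (%z. abs (g z * mker e y z - g z * mker e x z + g z * (gradk e (z - x) \<bullet> (y - x))))"
    using gi2 gi3 by (intro integrable_abs) auto
   show "L1 (%z. abs (g z) * (c' * norm (y - x)))" using g by auto
   fix z
   have "abs (mker e 0 ((z - x) + (x - y)) - mker e 0 (z - x) - gradk e (z - x) \<bullet> (x - y)) <= c' * norm (x - y)"
    using y by (intro d) (simp add: norm_minus_commute)
   then have *: "abs (mker e y z - mker e x z + gradk e (z - x) \<bullet> (y - x)) <= c' * norm (y - x)"
    by (simp add: mker_translate[of e y] mker_translate[of e x] norm_minus_commute inner_diff_right algebra_simps)
   have "g z * mker e y z - g z * mker e x z + g z * (gradk e (z - x) \<bullet> (y - x)) = g z * (mker e y z - mker e x z + gradk e (z - x) \<bullet> (y - x))"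
    by (simp add: algebra_simps)
   then show "abs (g z * mker e y z - g z * mker e x z + g z * (gradk e (z - x) \<bullet> (y - x))) <= abs (g z) * (c' * norm (y - x))"
    using * by (simp only: abs_mult mult_left_mono abs_ge_zero)
  qed
  also have "... = (c' * (LBINT z. abs (g z))) * norm (y - x)" by simp
  also have "... <= c * norm (y - x)" using c' by (intro mult_right_mono) auto
  finally show "norm (mol e g y - mol e g x - ?V \<bullet> (y - x)) <= c * norm (y - x)" by simp
 qed (fact d)
qed (rule bounded_linear_inner_right)

lemma continuous_on_mol:
 assumes "L1 g" "e > 0"
 shows "continuous_on S (mol e g)"
proof (rule continuous_at_imp_continuous_on, rule ballI)
 fix x show "isCont (mol e g) x"
  by (rule has_derivative_continuous[OF mol_has_derivative[OF assms]])
qed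

lemma borel_measurable_mol [measurable]: "L1 g ==> e > 0 ==> mol e g \<in> borel_funs"
 by (intro borel_measurable_continuous_onI continuous_on_mol)

section \<open>Weak gradients and their mollification\<close>

text \<open>Both functions are integrable on the whole space and only the integration by parts is
  local to \<open>U\<close>. Mollifications are thus defined everywhere, and the integrals need no
  restriction because test functions vanish outside \<open>U\<close>.\<close>

definition wgrad :: "'a::euclidean_space set => ('a => real) => ('a => 'a) => bool" where
 "wgrad U g G \<longleftrightarrow> L1 g & L1 G &
  (\<forall>\<phi>. test_function U \<phi> --> (\<forall>b\<in>Basis.
    (LBINT x. g x * (tgrad \<phi> x \<bullet> b)) = - (LBINT x. (G x \<bullet> b) * \<phi> x)))"

definition molv :: "real => ('a::euclidean_space => 'a) => 'a => 'a" where
 "molv e G x = (LBINT z. mker e x z *\<^sub>R G z)"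

lemma integrable_scaleR_mker:
 assumes "L1 G" "e > 0"
 shows "L1 (%z. mker e x z *\<^sub>R G z)"
proof (rule integrable_dominated)
 have [measurable]: "G \<in> borel_funs" using assms by (simp add: measurable_L1)
 show "L1 (%z. norm (G z) * mker e x z)"
  using assms by (intro integrable_mult_mker) auto
 show "(%z. mker e x z *\<^sub>R G z) \<in> borel_measurable lborel" by measurable
qed (use mker_nonneg[OF assms(2), of x] in auto)

lemma molv_inner:
 assumes "L1 G" "e > 0"
 shows "molv e G x \<bullet> h = mol e (%z. G z \<bullet> h) x"
 using integral_inner_left[OF integrable_scaleR_mker[OF assms, of x], of h]
 by (simp add: molv_def mol_def mult.commute)

lemma continuous_on_molv:
 fixes G :: "'a::euclidean_space => 'a"
 assumes "L1 G" "e > 0"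
 shows "continuous_on S (molv e G)"
proof (subst continuous_on_componentwise, intro ballI)
 fix b :: 'a
 have "continuous_on S (mol e (%z. G z \<bullet> b))"
  using assms by (intro continuous_on_mol) auto
 then show "continuous_on S (%x. molv e G x \<bullet> b)"
  using assms by (simp add: molv_inner)
qed

text \<open>The kernel centred at \<open>x\<close> is itself a test function as long as its closed
  support ball lies in \<open>U\<close>; integration by parts against it moves the derivative from
  the kernel to \<open>G\<close>.\<close>

lemma mol_has_derivative_wgrad:
 assumes w: "wgrad U g G" and e: "e > 0" and U: "cball x e \<subseteq> U"
 shows "(mol e g has_derivative (%h. molv e G x \<bullet> h)) (at x)"
proof -
 have g: "L1 g" "L1 G" using w by (auto simp: wgrad_def)
 let ?V = "- (LBINT z. g z *\<^sub>R gradk e (z - x))"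
 note gi = integrable_scaleR_gradk[OF g(1) e, of x]
 have "?V = molv e G x"
 proof (rule euclidean_eqI)
  fix b :: 'a assume b: "b \<in> Basis"
  have "tgrad (mker e x) z = gradk e (z - x)" for z by (rule tgrad_unique[OF C_diff_mker has_derivative_mker])
  then have "(LBINT z. g z * (gradk e (z - x) \<bullet> b)) = - (LBINT z. (G z \<bullet> b) * mker e x z)"
   using w b test_function_mker[OF e U] by (auto simp: wgrad_def)
  moreover have "?V \<bullet> b = - (LBINT z. g z * (gradk e (z - x) \<bullet> b))"
   using integral_inner_left[OF gi, of b] by simp
  moreover have "molv e G x \<bullet> b = (LBINT z. (G z \<bullet> b) * mker e x z)"
   by (simp add: molv_inner[OF g(2) e] mol_def)
  ultimately show "?V \<bullet> b = molv e G x \<bullet> b" by simp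
 qed
 with mol_has_derivative[OF g(1) e, of x] show ?thesis by simp
qed

lemma mol_mono:
 assumes "L1 f" "L1 g" "e > 0" "AE z. f z <= g z"
 shows "mol e f x <= mol e g x"
 unfolding mol_def using assms
 by (intro integral_mono_AE integrable_mult_mker) (auto elim!: eventually_mono intro!: mult_right_mono mker_nonneg)

lemma abs_mol_le:
 assumes "L1 g" "e > 0"
 shows "abs (mol e g x) <= mol e (%z. abs (g z)) x"
 unfolding mol_def using assms mker_nonneg[OF assms(2), of x]
 by (intro order_trans[OF integral_abs_bound]) (simp add: abs_mult)

lemma mol_nonneg: "e > 0 ==> (!!z. 0 <= g z) ==> 0 <= mol e g x"
 unfolding mol_def by (intro Bochner_Integration.integral_nonneg mult_nonneg_nonneg mker_nonneg) auto

lemma mol_le_ball: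
 fixes g :: "'a::euclidean_space => real"
 assumes g: "L1 g" "!!z. 0 <= g z" and e: "e > 0"
 shows "mol e g x <= (LBINT z:ball x e. g z) / (e ^ DIM('a) * bump_mass TYPE('a))"
proof -
 have i: "L1 (%z. indicator (ball x e) z *\<^sub>R g z)"
  using set_integrable_lborel[OF g(1), of "ball x e"] by (simp add: set_integrable_def)
 have "mol e g x <= (LBINT z. (indicator (ball x e) z *\<^sub>R g z) * (1 / (e ^ DIM('a) * bump_mass TYPE('a))))"
  unfolding mol_def
 proof (intro integral_mono integrable_mult_mker integrable_mult_left i g e)
  fix z
  show "g z * mker e x z <= indicator (ball x e) z *\<^sub>R g z * (1 / (e ^ DIM('a) * bump_mass TYPE('a)))"
   using mult_left_mono[OF mker_le[OF e, of x z] g(2)[of z]] mker_eq_0[OF e, of z x]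
   by (cases "z \<in> ball x e") auto
 qed
 then show ?thesis by (simp add: set_integral_def)
qed

text \<open>The kernel is at most \<open>1 / (e ^ n * bump_mass)\<close>, so at a Lebesgue point the
  error is at most \<open>C\<close> times the mean deviation on \<open>ball x e\<close>, where
  \<open>C\<close> is the ratio of the volume of the unit ball to the mass of the unit bump.\<close>

lemma mol_tendsto:
 fixes g :: "'a::euclidean_space => real"
 assumes g: "L1 g"
  and x: "((%r. avg_ball (%y. abs (g y - g x)) x r) \<longlongrightarrow> 0) (at_right 0)"
 shows "((%e. mol e g x) \<longlongrightarrow> g x) (at_right 0)"
proof -
 define C where "C = unit_ball_vol DIM('a) / bump_mass TYPE('a)"
 have "((%e. C * avg_ball (%y. abs (g y - g x)) x e) \<longlongrightarrow> C * 0) (at_right 0)"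
  by (intro tendsto_intros x)
 then have "((%e. C * avg_ball (%y. abs (g y - g x)) x e) \<longlongrightarrow> 0) (at_right 0)" by simp
 moreover have "\<forall>\<^sub>F e in at_right 0. norm (mol e g x - g x) <= C * avg_ball (%y. abs (g y - g x)) x e"
  unfolding eventually_at_right_field
 proof (intro exI[of _ 1] conjI allI impI)
  fix e :: real assume e: "0 < e" "e < 1"
  let ?B = "ball x e"
  have i: "set_integrable lborel ?B (%y. abs (g y - g x))"
   by (intro set_integrable_abs set_integral_diff(1)[OF set_integrable_lborel[OF g] set_integrable_const_ball]) auto
  note i' = i[unfolded set_integrable_def]
  have "mol e g x - g x = (LBINT z. g z * mker e x z) - (LBINT z. g x * mker e x z)"
   using integral_mker[OF e(1), of x] by (simp add: mol_def)
  also have "... = (LBINT z. g z * mker e x z - g x * mker e x z)"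
   using integrable_mult_mker[OF g e(1), of x] integrable_mker[OF e(1), of x] by simp
  also have "abs ... <= (LBINT z. (indicator ?B z *\<^sub>R abs (g z - g x)) * (1 / (e ^ DIM('a) * bump_mass TYPE('a))))"
  proof (rule order_trans[OF integral_abs_bound integral_mono])
   show "L1 (%z. abs (g z * mker e x z - g x * mker e x z))"
    using integrable_mult_mker[OF g e(1), of x] integrable_mker[OF e(1), of x] by simp
   show "L1 (%z. (indicator ?B z *\<^sub>R abs (g z - g x)) * (1 / (e ^ DIM('a) * bump_mass TYPE('a))))"
    by (intro integrable_mult_left i')
   fix z
   have "abs (g z * mker e x z - g x * mker e x z) = abs (g z - g x) * mker e x z"
    using mker_nonneg[OF e(1), of x z] by (simp add: left_diff_distrib[symmetric] abs_mult)
   then show "abs (g z * mker e x z - g x * mker e x z) <= indicator ?B z *\<^sub>R abs (g z - g x) * (1 / (e ^ DIM('a) * bump_mass TYPE('a)))"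
    using mult_left_mono[OF mker_le[OF e(1), of x z] abs_ge_zero[of "g z - g x"]] mker_eq_0[OF e(1), of z x]
    by (cases "z \<in> ?B") auto
  qed
  also have "... = (LBINT z:?B. abs (g z - g x)) / (e ^ DIM('a) * bump_mass TYPE('a))"
   by (simp add: set_integral_def)
  also have "... = C * avg_ball (%y. abs (g y - g x)) x e"
   using e bump_mass_pos[where 'a='a] unit_ball_vol_pos[of "real DIM('a)"]
   by (simp add: avg_ball_def C_def content_ball field_simps del: unit_ball_vol_pos)
  finally show "norm (mol e g x - g x) <= C * avg_ball (%y. abs (g y - g x)) x e" by simp
 qed simp
 ultimately have "((%e. mol e g x - g x) \<longlongrightarrow> 0) (at_right 0)"
  by (rule Lim_null_comparison[rotated])
 then show ?thesis by (simp add: LIM_zero_iff)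
qed

text \<open>Tonelli together with the symmetry of the kernel in its two points: integrating in
  \<open>x\<close> first also gives total mass 1.\<close>

lemma mol_nn_integral_le:
 assumes g: "L1 g" and e: "e > 0"
 shows "(\<integral>\<^sup>+x. ennreal \<bar>mol e g x\<bar> \<partial>lborel) <= (\<integral>\<^sup>+x. ennreal \<bar>g x\<bar> \<partial>lborel)"
proof -
 have [measurable]: "g \<in> borel_funs" using g by (simp add: measurable_L1)
 have "(\<integral>\<^sup>+x. ennreal \<bar>mol e g x\<bar> \<partial>lborel) <= (\<integral>\<^sup>+x. (\<integral>\<^sup>+z. ennreal (abs (g z) * mker e x z) \<partial>lborel) \<partial>lborel)"
 proof (rule nn_integral_mono)
  fix x
  have "(\<integral>\<^sup>+z. ennreal (abs (g z) * mker e x z) \<partial>lborel) = ennreal (mol e (%z. abs (g z)) x)"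
   unfolding mol_def using g e mker_nonneg[OF e, of x] by (intro nn_integral_eq_integral integrable_mult_mker) auto
  then show "ennreal \<bar>mol e g x\<bar> <= (\<integral>\<^sup>+z. ennreal (abs (g z) * mker e x z) \<partial>lborel)"
   using abs_mol_le[OF g e, of x] by (simp add: ennreal_leI)
 qed
 also have "... = (\<integral>\<^sup>+z. (\<integral>\<^sup>+x. ennreal (abs (g z) * mker e x z) \<partial>lborel) \<partial>lborel)"
  by (rule lborel_pair.Fubini'[of "%z x. ennreal (abs (g z) * mker e x z)"]) measurable
 also have "... = (\<integral>\<^sup>+z. ennreal \<bar>g z\<bar> \<partial>lborel)"
 proof (rule nn_integral_cong)
  fix z
  have "(\<integral>\<^sup>+x. ennreal (abs (g z) * mker e x z) \<partial>lborel) = (\<integral>\<^sup>+x. ennreal (abs (g z) * mker e z x) \<partial>lborel)"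
   by (simp add: mker_commute[of e _ z])
  also have "... = ennreal (LBINT x. abs (g z) * mker e z x)"
   using mker_nonneg[OF e, of z] by (intro nn_integral_eq_integral integrable_mult_right integrable_mker e) auto
  also have "... = ennreal \<bar>g z\<bar>" using integral_mker[OF e, of z] by simp
  finally show "(\<integral>\<^sup>+x. ennreal (abs (g z) * mker e x z) \<partial>lborel) = ennreal \<bar>g z\<bar>" .
 qed
 finally show ?thesis .
qed

lemma integrable_mol:
 assumes g: "L1 g" and e: "e > 0"
 shows "L1 (mol e g)"
proof (rule integrableI_bounded)
 have "(\<integral>\<^sup>+x. ennreal \<bar>g x\<bar> \<partial>lborel) < \<infinity>" using g by (simp add: integrable_iff_bounded)
 then show "(\<integral>\<^sup>+x. ennreal (norm (mol e g x)) \<partial>lborel) < \<infinity>"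
  using mol_nn_integral_le[OF assms] by (simp add: le_less_trans)
 show "mol e g \<in> borel_measurable lborel" using borel_measurable_mol[OF assms] by simp
qed

lemma LIMSEQ_inverse_Suc_at_right: "filterlim (%k. 1 / real (Suc k)) (at_right 0) sequentially"
 unfolding filterlim_at using LIMSEQ_inverse_real_of_nat by (auto simp: inverse_eq_divide)

lemma eventually_inverse_Suc_less: "d > 0 ==> \<forall>\<^sub>F k in sequentially. 1 / real (Suc k) < d"
 using order_tendstoD(2)[OF LIMSEQ_inverse_real_of_nat] by (simp add: inverse_eq_divide)

lemma AE_mol_tendsto:
 assumes g: "L1 g"
 shows "AE x. (%k. mol (1 / real (Suc k)) g x) \<longlonglongrightarrow> g x"
 using lebesgue_points[OF g]
 by eventually_elim (rule filterlim_compose[OF mol_tendsto[OF g] LIMSEQ_inverse_Suc_at_right])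

text \<open>Almost everywhere convergence and norms that do not increase give convergence in mean by
  Scheffe's lemma.\<close>

lemma mol_L1:
 assumes g: "L1 g"
 shows "(%k. LBINT x. abs (mol (1 / real (Suc k)) g x - g x)) \<longlonglongrightarrow> 0"
proof -
 let ?m = "%k. mol (1 / real (Suc k)) g"
 have m: "L1 (?m k)" for k using g by (intro integrable_mol) auto
 have "(%k. \<integral>\<^sup>+ x. norm (?m k x - g x) \<partial>lborel) \<longlonglongrightarrow> 0"
  by (rule Scheffe_lemma2) (use g m AE_mol_tendsto[OF g] mol_nn_integral_le[OF g] in auto)
 moreover have "(\<integral>\<^sup>+ x. norm (?m k x - g x) \<partial>lborel) = ennreal (LBINT x. abs (?m k x - g x))" for k
  using m g by (subst nn_integral_eq_integral[symmetric]) auto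
 ultimately have "(%k. ennreal (LBINT x. abs (?m k x - g x))) \<longlonglongrightarrow> ennreal 0" by simp
 then show ?thesis by (subst (asm) tendsto_ennreal_iff) auto
qed

lemma mol_set_integral_tendsto:
 fixes g :: "'a::euclidean_space => real"
 assumes g: "L1 g" and A: "A \<in> sets borel"
 shows "(%k. LBINT x:A. mol (1 / real (Suc k)) g x) \<longlonglongrightarrow> (LBINT x:A. g x)"
proof -
 let ?m = "%k. mol (1 / real (Suc k)) g"
 have m: "L1 (?m k)" for k using g by (intro integrable_mol) auto
 have "(%k. (LBINT x:A. ?m k x) - (LBINT x:A. g x)) \<longlonglongrightarrow> 0"
 proof (rule Lim_null_comparison[OF always_eventually mol_L1[OF g]], intro allI)
  fix k
  have "(LBINT x:A. ?m k x) - (LBINT x:A. g x) = (LBINT x:A. ?m k x - g x)"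
   using m g A by (intro set_integral_diff(2)[symmetric] set_integrable_lborel)
  also have "abs ... <= (LBINT x. abs (?m k x - g x))"
   unfolding set_integral_def
  proof (rule order_trans[OF integral_abs_bound integral_mono])
   show "L1 (%x. abs (indicator A x *\<^sub>R (?m k x - g x)))"
    using set_integrable_lborel[OF Bochner_Integration.integrable_diff[OF m g] A, of k]
    by (intro integrable_abs) (simp add: set_integrable_def)
   show "L1 (%x. abs (?m k x - g x))" using m g by auto
  qed (auto simp: indicator_def)
  finally show "norm ((LBINT x:A. ?m k x) - (LBINT x:A. g x)) <= (LBINT x. abs (?m k x - g x))"
   by simp
 qed
 then show ?thesis by (simp add: LIM_zero_iff)
qed

section \<open>Sobolev functions on cubes\<close>

definition avg_box :: "('a::euclidean_space => real) => 'a => 'a => real" where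
 "avg_box f a b = (LBINT y:cbox a b. f y) / vol (cbox a b)"

text \<open>The homothety with centre \<open>x\<close> and ratio \<open>s\<close>. Applied to both
  corners of a box containing \<open>x\<close> it gives a smaller similar box that still contains
  \<open>x\<close>.\<close>

definition shrink :: "'a::euclidean_space => real => 'a => 'a" where
 "shrink x s a = (1 - s) *\<^sub>R x + s *\<^sub>R a"

lemma shrink_shrink: "shrink x s (shrink x t a) = shrink x (s * t) a"
 by (simp add: shrink_def algebra_simps)

lemma shrink_1 [simp]: "shrink x 1 a = a"
 by (simp add: shrink_def)

lemma shrink_mem_iff: "s > 0 ==> shrink x s y \<in> cbox (shrink x s a) (shrink x s b) \<longleftrightarrow> y \<in> cbox a b"
 by (simp add: mem_box shrink_def inner_add_left)

lemma shrink_diff: "shrink x s y - shrink x s z = s *\<^sub>R (y - z)"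
 by (simp add: shrink_def algebra_simps)

lemma shrink_surj: "s > 0 ==> \<exists>y. z = shrink x s y"
 by (rule exI[of _ "(1/s) *\<^sub>R (z - (1 - s) *\<^sub>R x)"]) (simp add: shrink_def)

lemma cbox_shrink_subset:
 assumes "x \<in> cbox a b" "0 < s" "s <= 1"
 shows "cbox (shrink x s a) (shrink x s b) \<subseteq> cbox a b"
proof
 fix z assume z: "z \<in> cbox (shrink x s a) (shrink x s b)"
 obtain y where y: "z = shrink x s y" using shrink_surj assms by blast
 with z assms have "y \<in> cbox a b" by (simp add: shrink_mem_iff)
 then show "z \<in> cbox a b" unfolding y shrink_def
  using assms convex_box(1)[of a b] by (intro convexD) auto
qed

lemma mem_cbox_shrink: "x \<in> cbox a b ==> 0 < s ==> x \<in> cbox (shrink x s a) (shrink x s b)"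
 using shrink_mem_iff[of s x x a b] by (simp add: shrink_def algebra_simps)

lemma set_integral_shrink:
 fixes f :: "'a::euclidean_space => real"
 assumes s: "s > 0"
 shows "(LBINT y:cbox a b. f (shrink x s y)) = (LBINT y:cbox (shrink x s a) (shrink x s b). f y) / s ^ DIM('a)"
proof -
 have "(LBINT y:cbox a b. f (shrink x s y)) =
  (LBINT y. (indicator (cbox (shrink x s a) (shrink x s b)) ((1 - s) *\<^sub>R x + s *\<^sub>R y) *\<^sub>R f ((1 - s) *\<^sub>R x + s *\<^sub>R y)))"
  unfolding set_integral_def
  using shrink_mem_iff[OF s, of x _ a b] by (intro Bochner_Integration.integral_cong) (auto simp: indicator_def shrink_def)
 also have "... = (LBINT y:cbox (shrink x s a) (shrink x s b). f y) / s ^ DIM('a)"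
  using s by (subst integral_affine_euclidean(1)) (auto simp: set_integral_def divide_inverse mult.commute)
 finally show ?thesis .
qed

lemma measure_shrink:
 fixes a b :: "'a::euclidean_space"
 assumes "s > 0"
 shows "vol (cbox (shrink x s a) (shrink x s b)) = s ^ DIM('a) * vol (cbox a b)"
 using set_integral_shrink[OF assms, of a b "%_. 1" x] assms
 by (simp add: set_integral_def field_simps)

lemma avg_box_nonneg: "(!!x. 0 <= f x) ==> 0 <= avg_box f a b"
 by (simp add: avg_box_def set_integral_nonneg')

lemma avg_box_shrink:
 assumes "s > 0"
 shows "avg_box f (shrink x s a) (shrink x s b) = (LBINT y:cbox a b. f (shrink x s y)) / vol (cbox a b)"
 unfolding avg_box_def set_integral_shrink[OF assms] measure_shrink[OF assms] using assms by simp

lemma avg_box_shrink_le: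
 fixes f :: "'a::euclidean_space => real"
 assumes "L1 f" "!!x. 0 <= f x" "x \<in> cbox a b" "0 < s" "s <= 1"
 shows "avg_box f (shrink x s a) (shrink x s b) <= avg_box f a b / s ^ DIM('a)"
proof -
 have "(LBINT y:cbox (shrink x s a) (shrink x s b). f y) <= (LBINT y:cbox a b. f y)"
  using assms by (intro set_integral_mono_set_nonneg cbox_shrink_subset) auto
 then show ?thesis
  unfolding avg_box_def measure_shrink[OF assms(4)] using assms(4)
  by (auto intro!: divide_right_mono simp: mult.commute)
qed

text \<open>The average over the box shrunk by \<open>s\<close> is the integral of
  \<open>g (shrink x s y)\<close> over the fixed box; its derivative in \<open>s\<close> is the
  integral of \<open>G (shrink x s y) \<bullet> (y - x)\<close>. Undoing the substitution costs
  \<open>s ^ -n <= 2 ^ n\<close> for \<open>s\<close> between 1/2 and 1.\<close>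

lemma smooth_avg_half:
 fixes g w :: "'a::euclidean_space => real"
 assumes der: "!!z. z \<in> cbox a b ==> (g has_derivative (%h. G z \<bullet> h)) (at z)"
  and G: "continuous_on (cbox a b) G" and w: "L1 w" "!!z. 0 <= w z"
  and Gw: "!!z. z \<in> cbox a b ==> norm (G z) <= w z"
  and x: "x \<in> cbox a b" and d: "!!y z. y \<in> cbox a b ==> z \<in> cbox a b ==> norm (y - z) <= d"
  and ne: "box a b ~= {}"
 shows "abs (avg_box g (shrink x (1/2) a) (shrink x (1/2) b) - avg_box g a b) <= d * 2 ^ DIM('a) * avg_box w a b"
proof -
 let ?Q = "cbox a b" and ?U = "{1/2..1::real}"
 define f where "f s y = g (shrink x s y)" for s y
 define f' where "f' s y = G (shrink x s y) \<bullet> (y - x)" for s y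
 have in_Q: "shrink x s y \<in> ?Q" if "s \<in> ?U" "y \<in> ?Q" for s y
  using that x convex_box(1)[of a b] unfolding shrink_def by (intro convexD) auto
 have gc: "continuous_on ?Q g"
  using der by (meson continuous_at_imp_continuous_on has_derivative_continuous)
 have contf: "continuous_on ?Q (f s)" if "s \<in> ?U" for s
  unfolding f_def using in_Q that
  by (intro continuous_on_compose2[OF gc]) (auto simp: shrink_def intro!: continuous_intros)
 have contf': "continuous_on (?U \<times> ?Q) (%(s, y). f' s y)"
  unfolding f'_def case_prod_beta using in_Q
  by (intro continuous_intros continuous_on_compose2[OF G]) (auto simp: shrink_def intro!: continuous_intros)
 have contf'1: "continuous_on ?Q (f' s)" if "s \<in> ?U" for s
  using that by (intro continuous_on_compose2[OF contf', of _ "%y. (s, y)", simplified]) (auto intro!: continuous_intros)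
 have fder: "((%s. f s y) has_field_derivative f' s y) (at s within ?U)" if "s \<in> ?U" "y \<in> ?Q" for s y
 proof -
  have "((%s. shrink x s y) has_derivative (%t. t *\<^sub>R (y - x))) (at s within ?U)"
   unfolding shrink_def by (auto intro!: derivative_eq_intros simp: algebra_simps)
  from has_derivative_compose[OF this der[OF in_Q[OF that]]] show ?thesis
   by (simp add: f_def f'_def has_field_derivative_def mult_commute_abs)
 qed
 have A: "((%s. integral ?Q (f s)) has_field_derivative integral ?Q (f' s)) (at s within ?U)" if "s \<in> ?U" for s
  using that by (intro leibniz_rule_field_derivative fder contf' integrable_continuous contf) auto
 have set_int: "set_integrable lborel ?Q F" if "continuous_on ?Q F" for F :: "'a => real"
  using borel_integrable_compact[OF compact_cbox that] by (simp add: set_integrable_def)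
 have eq: "integral ?Q F = (LBINT y:?Q. F y)" if "continuous_on ?Q F" for F :: "'a => real"
  using set_borel_integral_eq_integral(2)[OF set_int[OF that]] by simp
 have d0: "d >= 0" using d[OF x x] by simp
 have bound: "norm (integral ?Q (f' s)) <= d * 2 ^ DIM('a) * (LBINT y:?Q. w y)" if s: "s \<in> ?U" for s
 proof -
  have iw: "set_integrable lborel ?Q (%y. w (shrink x s y))"
  proof -
   have "L1 (%y. w ((1 - s) *\<^sub>R x + s *\<^sub>R y))"
    using s by (intro integral_affine_euclidean(2) w) auto
   then show ?thesis by (intro set_integrable_lborel) (auto simp: shrink_def)
  qed
  have "norm (integral ?Q (f' s)) <= (LBINT y:?Q. abs (f' s y))"
   unfolding eq[OF contf'1[OF s]]
   using set_integral_norm_bound[OF set_int[OF contf'1[OF s]]] by simp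
  also have "... <= (LBINT y:?Q. d * w (shrink x s y))"
  proof (rule set_integral_mono)
   show "set_integrable lborel ?Q (%y. abs (f' s y))" by (intro set_integrable_abs set_int contf'1 s)
   show "set_integrable lborel ?Q (%y. d * w (shrink x s y))" using iw by simp
   fix y assume y: "y \<in> ?Q"
   have "abs (f' s y) <= norm (G (shrink x s y)) * norm (y - x)"
    unfolding f'_def by (rule Cauchy_Schwarz_ineq2)
   also have "... <= w (shrink x s y) * d"
    using Gw[OF in_Q[OF s y]] d[OF y x] w by (intro mult_mono) auto
   finally show "abs (f' s y) <= d * w (shrink x s y)" by (simp add: mult.commute)
  qed
  also have "... = d * ((LBINT y:cbox (shrink x s a) (shrink x s b). w y) / s ^ DIM('a))"
   using s by (simp add: set_integral_shrink)
  also have "... <= d * ((LBINT y:?Q. w y) / (1/2) ^ DIM('a))"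
   using s d0 set_integral_nonneg'[of w, OF w(2)] x
   by (intro mult_left_mono frac_le set_integral_mono_set_nonneg w power_mono cbox_shrink_subset) auto
  finally show ?thesis by (simp add: power_divide mult_ac)
 qed
 have "norm (integral ?Q (f (1/2)) - integral ?Q (f 1)) <= d * 2 ^ DIM('a) * (LBINT y:?Q. w y) * norm (1/2 - 1 :: real)"
  by (rule field_differentiable_bound[of ?U, OF _ A bound]) auto
 also have "... <= d * 2 ^ DIM('a) * (LBINT y:?Q. w y)"
  using d0 set_integral_nonneg'[of w, OF w(2)] by (intro mult_right_le_one_le) auto
 finally have *: "abs (integral ?Q (f (1/2)) - integral ?Q (f 1)) <= d * 2 ^ DIM('a) * (LBINT y:?Q. w y)" by simp
 have mQ: "vol ?Q > 0" using ne by (simp add: content_pos_lt_eq box_ne_empty)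
 have "avg_box g (shrink x (1/2) a) (shrink x (1/2) b) - avg_box g a b = (integral ?Q (f (1/2)) - integral ?Q (f 1)) / vol ?Q"
  using eq[OF contf, of "1/2"] eq[OF contf, of 1]
  by (simp add: avg_box_shrink) (simp add: avg_box_def f_def[abs_def] diff_divide_distrib)
 with * mQ show ?thesis by (simp add: avg_box_def divide_right_mono abs_mult)
qed

text \<open>The smooth estimate is applied to mollifications of small radius. Only averages over
  boxes enter it, and these converge.\<close>

lemma wgrad_avg_half:
 fixes g u :: "'a::euclidean_space => real"
 assumes wg: "wgrad U g G" and U: "open U" "cbox a b \<subseteq> U" and u: "L1 u" "!!z. 0 <= u z"
  and Gu: "AE z. norm (G z) <= u z"
  and x: "x \<in> cbox a b" and d: "!!y z. y \<in> cbox a b ==> z \<in> cbox a b ==> norm (y - z) <= d"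
  and ne: "box a b ~= {}"
 shows "abs (avg_box g (shrink x (1/2) a) (shrink x (1/2) b) - avg_box g a b) <= d * 2 ^ DIM('a) * avg_box u a b"
proof -
 have g: "L1 g" "L1 G" using wg by (auto simp: wgrad_def)
 obtain e0 where e0: "e0 > 0" "(\<Union>x\<in>cbox a b. ball x e0) \<subseteq> U"
  using compact_subset_open_imp_ball_epsilon_subset[OF compact_cbox U] by blast
 let ?e = "%k. 1 / real (Suc k)"
 have "(%k. avg_box (mol (?e k) f) c d) \<longlonglongrightarrow> avg_box f c d" if "L1 f" for f c d
 proof -
  have "(%k. (LBINT y:cbox c d. mol (?e k) f y) * (1 / vol (cbox c d))) \<longlonglongrightarrow>
    (LBINT y:cbox c d. f y) * (1 / vol (cbox c d))"
   by (intro tendsto_mult tendsto_const mol_set_integral_tendsto[OF that]) simp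
  then show ?thesis by (simp add: avg_box_def)
 qed
 note lim = this[OF g(1)] this[OF u(1)]
 from eventually_inverse_Suc_less[OF e0(1)] have "\<forall>\<^sub>F k in sequentially. abs (avg_box (mol (?e k) g) (shrink x (1/2) a) (shrink x (1/2) b) - avg_box (mol (?e k) g) a b)
  <= d * 2 ^ DIM('a) * avg_box (mol (?e k) u) a b"
 proof eventually_elim
  case (elim k)
  show ?case
  proof (rule smooth_avg_half[OF _ _ _ _ _ x d ne])
   fix z assume z: "z \<in> cbox a b"
   have "cball z (?e k) \<subseteq> U" using e0 z elim by (force simp: subset_iff)
   then show "(mol (?e k) g has_derivative (%h. molv (?e k) G z \<bullet> h)) (at z)"
    by (intro mol_has_derivative_wgrad[OF wg]) auto
   show "norm (molv (?e k) G z) <= mol (?e k) u z"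
   proof -
    have "norm (molv (?e k) G z) <= (LBINT y. norm (mker (?e k) z y *\<^sub>R G y))"
     unfolding molv_def by (rule integral_norm_bound)
    also have "... = mol (?e k) (%y. norm (G y)) z"
     unfolding mol_def using mker_nonneg[of "?e k" z] by (simp add: mult.commute)
    also have "... <= mol (?e k) u z"
     using g u Gu by (intro mol_mono) auto
    finally show ?thesis .
   qed
  next
   show "continuous_on (cbox a b) (molv (?e k) G)" by (intro continuous_on_molv g) auto
   show "L1 (mol (?e k) u)" by (intro integrable_mol u) auto
   show "0 <= mol (?e k) u z" for z by (intro mol_nonneg u) auto
  qed
 qed
 then show ?thesis
  by (intro tendsto_le[OF sequentially_bot _ _ _])
   (use lim in \<open>auto intro!: tendsto_intros\<close>)
qed

section \<open>The dyadic chain of box averages\<close>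

definition dyadic_box_avg :: "('a::euclidean_space => real) => 'a => 'a => 'a => nat => real" where
 "dyadic_box_avg f a b x j = avg_box f (shrink x ((1/2)^j) a) (shrink x ((1/2)^j) b)"

text \<open>Shrunk boxes are compared with balls about the same point, which brings in Lebesgue
  points and maximal functions. Using \<open>d + 1\<close> in place of the diameter bound
  \<open>d\<close> makes the inclusion into an open ball strict and the radius positive.\<close>

lemma dyadic_box_avg_ball_le:
 fixes f :: "'a::euclidean_space => real"
 assumes f: "L1 f" "!!z. 0 <= f z" and x: "x \<in> cbox a b"
  and d: "!!y z. y \<in> cbox a b ==> z \<in> cbox a b ==> norm (y - z) <= d"
  and ne: "box a b ~= {}"
 shows "dyadic_box_avg f a b x j <= unit_ball_vol DIM('a) * (d + 1) ^ DIM('a) / vol (cbox a b) * avg_ball f x ((1/2)^j * (d + 1))"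
proof -
 let ?s = "(1/2::real)^j"
 have d0: "d >= 0" using d[OF x x] by simp
 have mQ: "vol (cbox a b) > 0" using ne by (simp add: content_pos_lt_eq box_ne_empty)
 have sub: "cbox (shrink x ?s a) (shrink x ?s b) \<subseteq> ball x (?s * (d + 1))"
 proof
  fix z assume z: "z \<in> cbox (shrink x ?s a) (shrink x ?s b)"
  obtain y where y: "z = shrink x ?s y" using shrink_surj[of ?s z x] by auto
  with z have yQ: "y \<in> cbox a b" by (simp add: shrink_mem_iff)
  have "x - z = ?s *\<^sub>R (x - y)" unfolding y shrink_def by (simp add: algebra_simps)
  then have "dist x z = ?s * norm (x - y)" by (simp add: dist_norm)
  also have "... < ?s * (d + 1)" using d[OF x yQ] by (intro mult_strict_left_mono) auto
  finally show "z \<in> ball x (?s * (d + 1))" by simp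
 qed
 have "dyadic_box_avg f a b x j <= (LBINT y:ball x (?s * (d + 1)). f y) / (?s ^ DIM('a) * vol (cbox a b))"
  unfolding dyadic_box_avg_def avg_box_def using measure_shrink[of ?s x a b]
  by (auto intro!: divide_right_mono set_integral_mono_set_nonneg f sub)
 also have "... = unit_ball_vol DIM('a) * (d + 1) ^ DIM('a) / vol (cbox a b) * avg_ball f x (?s * (d + 1))"
  using d0 mQ unit_ball_vol_pos[of "real DIM('a)"] unfolding avg_ball_def
  by (subst measure_lborel_ball) (simp_all add: power_mult_distrib del: unit_ball_vol_pos)
 finally show ?thesis .
qed

lemma dyadic_box_avg_tendsto:
 fixes g :: "'a::euclidean_space => real"
 assumes g: "L1 g" and x: "x \<in> cbox a b"
  and d: "!!y z. y \<in> cbox a b ==> z \<in> cbox a b ==> norm (y - z) <= d"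
  and ne: "box a b ~= {}"
  and L: "((%r. avg_ball (%y. abs (g y - g x)) x r) \<longlongrightarrow> 0) (at_right 0)"
 shows "dyadic_box_avg g a b x \<longlonglongrightarrow> g x"
proof -
 define C where "C = unit_ball_vol DIM('a) * (d + 1) ^ DIM('a) / vol (cbox a b)"
 have d0: "d >= 0" using d[OF x x] by simp
 have mQ: "vol (cbox a b) > 0" using ne by (simp add: content_pos_lt_eq box_ne_empty)
 let ?s = "%j. (1/2::real)^j"
 have "(%j. ?s j * (d + 1)) \<longlonglongrightarrow> 0 * (d + 1)"
  by (intro tendsto_mult tendsto_const LIMSEQ_power_zero) simp
 then have "filterlim (%j. ?s j * (d + 1)) (at_right 0) sequentially"
  using d0 by (auto simp: filterlim_at intro!: always_eventually)
 from filterlim_compose[OF L this]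
 have "(%j. C * avg_ball (%y. abs (g y - g x)) x (?s j * (d + 1))) \<longlonglongrightarrow> C * 0"
  by (intro tendsto_intros)
 then have lim0: "(%j. C * avg_ball (%y. abs (g y - g x)) x (?s j * (d + 1))) \<longlonglongrightarrow> 0" by simp
 have "(%j. dyadic_box_avg g a b x j - g x) \<longlonglongrightarrow> 0"
 proof (rule Lim_null_comparison[OF always_eventually lim0], intro allI)
  fix j
  let ?B = "cbox (shrink x (?s j) a) (shrink x (?s j) b)" and ?K = "ball x (?s j * (d + 1))"
  have mB: "vol ?B = ?s j ^ DIM('a) * vol (cbox a b)" by (rule measure_shrink) simp
  have ig: "L1 (%y. indicator ?K y * abs (g y - g x))"
  proof -
   have "set_integrable lborel ?K (%y. abs (g y - g x))"
    by (intro set_integrable_abs set_integral_diff(1)[OF set_integrable_lborel[OF g] set_integrable_const_ball]) auto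
   then show ?thesis by (simp add: set_integrable_def)
  qed
  have icB: "set_integrable lborel ?B (%y. g x)"
   unfolding set_integrable_def using emeasure_bounded_finite[OF bounded_cbox, of "shrink x (?s j) a" "shrink x (?s j) b"]
   by (auto intro!: integrable_mult_left integrable_real_indicator)
  have igB: "set_integrable lborel ?B g" using g by (intro set_integrable_lborel) auto
  have "(LBINT y:?B. g y) - g x * vol ?B = (LBINT y:?B. g y - g x)"
   by (simp only: set_integral_diff(2)[OF igB icB]) (simp add: set_integral_def)
  moreover have "vol ?B > 0" unfolding mB using mQ by simp
  ultimately have "dyadic_box_avg g a b x j - g x = (LBINT y:?B. g y - g x) / vol ?B"
   unfolding dyadic_box_avg_def avg_box_def by (simp only: diff_divide_distrib[symmetric] field_simps) simp
  then have "norm (dyadic_box_avg g a b x j - g x) = abs (LBINT y:?B. g y - g x) / vol ?B"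
   by (simp add: abs_divide)
  also have "... <= (LBINT y:?B. abs (g y - g x)) / vol ?B"
   using set_integral_norm_bound[OF set_integral_diff(1)[OF igB icB]] by (intro divide_right_mono) auto
  also have "(LBINT y:?B. abs (g y - g x)) = (LBINT y:?B. indicator ?K y * abs (g y - g x))"
  proof (rule set_lebesgue_integral_cong)
   show "\<forall>y. y \<in> ?B --> abs (g y - g x) = indicator ?K y * abs (g y - g x)"
   proof (intro allI impI)
    fix z assume z: "z \<in> ?B"
    obtain y where y: "z = shrink x (?s j) y" using shrink_surj[of "?s j" z x] by auto
    with z have yQ: "y \<in> cbox a b" by (simp add: shrink_mem_iff)
    have "x - z = ?s j *\<^sub>R (x - y)" unfolding y shrink_def by (simp add: algebra_simps)
    then have "dist x z = ?s j * norm (x - y)" by (simp add: dist_norm)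
    also have "... < ?s j * (d + 1)" using d[OF x yQ] by (intro mult_strict_left_mono) auto
    finally show "abs (g z - g x) = indicator ?K z * abs (g z - g x)" by simp
   qed
  qed auto
  also have "... / vol ?B = dyadic_box_avg (%y. indicator ?K y * abs (g y - g x)) a b x j"
   by (simp add: dyadic_box_avg_def avg_box_def)
  also have "... <= C * avg_ball (%y. indicator ?K y * abs (g y - g x)) x (?s j * (d + 1))"
   unfolding C_def by (rule dyadic_box_avg_ball_le[OF ig _ x d ne]) auto
  also have "avg_ball (%y. indicator ?K y * abs (g y - g x)) x (?s j * (d + 1)) = avg_ball (%y. abs (g y - g x)) x (?s j * (d + 1))"
   unfolding avg_ball_def by (intro arg_cong2[where f="(/)"] set_lebesgue_integral_cong) auto
  finally show "norm (dyadic_box_avg g a b x j - g x) <= C * avg_ball (%y. abs (g y - g x)) x (?s j * (d + 1))" .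
 qed
 then show ?thesis by (simp add: LIM_zero_iff)
qed

text \<open>At a Lebesgue point the averages over boxes shrinking to \<open>x\<close> converge to
  \<open>g x\<close>, and halving the box at stage \<open>j\<close> costs \<open>2 ^ -j * d\<close>
  times the current average of \<open>u\<close>. The bound \<open>S\<close> on partial sums stands
  in for the series, so no summability has to be assumed.\<close>

theorem wgrad_pointwise:
 fixes g u :: "'a::euclidean_space => real"
 assumes wg: "wgrad U g G" and U: "open U" "cbox a b \<subseteq> U" and u: "L1 u" "!!z. 0 <= u z"
  and Gu: "AE z. norm (G z) <= u z"
  and d: "!!y z. y \<in> cbox a b ==> z \<in> cbox a b ==> norm (y - z) <= d"
  and ne: "box a b ~= {}"
 shows "AE x. x \<in> cbox a b --> (\<forall>S. (\<forall>J. (\<Sum>j<J. (1/2)^j * dyadic_box_avg u a b x j) <= S) -->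
      abs (g x - avg_box g a b) <= d * 2 ^ DIM('a) * S)"
proof -
 have g: "L1 g" using wg by (auto simp: wgrad_def)
 show ?thesis using lebesgue_points[OF g]
 proof (eventually_elim, intro impI allI)
  fix x S assume L: "((%r. avg_ball (%y. abs (g y - g x)) x r) \<longlongrightarrow> 0) (at_right 0)"
   and x: "x \<in> cbox a b" and S: "\<forall>J. (\<Sum>j<J. (1/2)^j * dyadic_box_avg u a b x j) <= S"
  have d0: "d >= 0" using d[OF x x] by simp
  have step: "abs (dyadic_box_avg g a b x (Suc j) - dyadic_box_avg g a b x j) <= d * 2 ^ DIM('a) * ((1/2)^j * dyadic_box_avg u a b x j)" for j
  proof -
   let ?s = "(1/2::real)^j" let ?a = "shrink x ?s a" and ?b = "shrink x ?s b"
   have s1: "?s <= 1" by (simp add: power_le_one)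
   have "abs (avg_box g (shrink x (1/2) ?a) (shrink x (1/2) ?b) - avg_box g ?a ?b) <= (?s * d) * 2 ^ DIM('a) * avg_box u ?a ?b"
   proof (rule wgrad_avg_half[OF wg U(1) _ u Gu])
    show "cbox ?a ?b \<subseteq> U" using cbox_shrink_subset[OF x, of ?s] s1 U(2) by auto
    show "x \<in> cbox ?a ?b" using mem_cbox_shrink[OF x] by simp
    show "box ?a ?b ~= {}" using ne by (simp add: box_ne_empty shrink_def inner_add_left)
    fix y z assume "y \<in> cbox ?a ?b" "z \<in> cbox ?a ?b"
    moreover obtain y' z' where yz: "y = shrink x ?s y'" "z = shrink x ?s z'"
     using shrink_surj[of ?s _ x] by (metis zero_less_power half_gt_zero zero_less_one)
    ultimately have "norm (y' - z') <= d" by (intro d) (auto simp: shrink_mem_iff)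
    then show "norm (y - z) <= ?s * d" by (simp add: yz shrink_diff)
   qed
   then show ?thesis by (simp add: dyadic_box_avg_def shrink_shrink mult_ac)
  qed
  have tele: "abs (dyadic_box_avg g a b x J - avg_box g a b) <= d * 2 ^ DIM('a) * S" for J
  proof -
   have "abs (dyadic_box_avg g a b x J - dyadic_box_avg g a b x 0) <= (\<Sum>j<J. d * 2 ^ DIM('a) * ((1/2)^j * dyadic_box_avg u a b x j))"
   proof (induction J)
    case (Suc J)
    with step[of J] show ?case by simp
   qed simp
   also have "... = d * 2 ^ DIM('a) * (\<Sum>j<J. (1/2)^j * dyadic_box_avg u a b x j)"
    by (simp add: sum_distrib_left)
   also have "... <= d * 2 ^ DIM('a) * S" using S d0 by (intro mult_left_mono) auto
   finally show ?thesis by (simp add: dyadic_box_avg_def)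
  qed
  have "(%J. abs (dyadic_box_avg g a b x J - avg_box g a b)) \<longlonglongrightarrow> \<bar>g x - avg_box g a b\<bar>"
   by (intro tendsto_intros dyadic_box_avg_tendsto[OF g x d ne L])
  then show "abs (g x - avg_box g a b) <= d * 2 ^ DIM('a) * S"
   by (rule LIMSEQ_le_const2) (use tele in blast)
 qed
qed

lemma dyadic_box_avg_le:
 fixes f :: "'a::euclidean_space => real"
 assumes "L1 f" "!!x. 0 <= f x" "x \<in> cbox a b"
 shows "dyadic_box_avg f a b x j <= 2 ^ (j * DIM('a)) * avg_box f a b"
 using avg_box_shrink_le[OF assms, of "(1/2)^j"]
 by (simp add: dyadic_box_avg_def power_le_one power_one_over power_mult[symmetric] mult.commute)

lemma set_integrable_const_cbox:
 fixes c :: real and a :: "'a::euclidean_space"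
 shows "set_integrable lborel (cbox a b) (%y. c)"
 unfolding set_integrable_def using emeasure_bounded_finite[OF bounded_cbox, of a b]
 by (auto intro!: integrable_mult_left integrable_real_indicator)

lemma sum_inverse_squares_le: "(\<Sum>j<J. 1 / (real j + 1)\<^sup>2) <= 2"
proof -
 have *: "(\<Sum>j<Suc J. 1 / (real j + 1)\<^sup>2) <= 2 - 1 / (real J + 1)" for J
 proof (induction J)
  case (Suc J)
  have "1 / (real J + 2)\<^sup>2 <= 1 / ((real J + 1) * (real J + 2))"
   by (intro divide_left_mono) (auto simp: power2_eq_square)
  also have "... = 1 / (real J + 1) - 1 / (real J + 2)" by (simp add: field_simps)
  finally have "1 / (real J + 2)\<^sup>2 <= 1 / (real J + 1) - 1 / (real J + 2)" .
  then show ?case using Suc by (simp add: add.commute)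
 qed simp
 have "(\<Sum>j<J. 1 / (real j + 1)\<^sup>2) <= (\<Sum>j<Suc J. 1 / (real j + 1)\<^sup>2)" by simp
 also have "... <= 2 - 1 / (real J + 1)" by (rule *)
 finally show ?thesis by (rule order_trans) simp
qed

text \<open>At scale \<open>j\<close>, \<open>u\<close> is split at the heights
  \<open>M * (3/2)^j\<close> and \<open>\<beta>'\<close>; above both it is at most a multiple of
  \<open>\<Phi>\<close>. After multiplication by \<open>2 ^ -j\<close> the first height gives the
  geometric series of ratio 3/4 and the rest gives twice \<open>\<beta> / (j + 1)^2\<close>, where
  the square comes from the exponent \<open>2 n\<close> in the hypothesis on
  \<open>\<Phi>\<close>.\<close>

theorem wgrad_oscillation:
 fixes g u \<Phi> :: "'a::euclidean_space => real"
 assumes wg: "wgrad U g G" and U: "open U" "cbox a b \<subseteq> U" and u: "L1 u" "!!z. 0 <= u z"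
  and Gu: "AE z. norm (G z) <= u z"
  and d: "!!y z. y \<in> cbox a b ==> z \<in> cbox a b ==> norm (y - z) <= d"
  and ne: "box a b ~= {}"
  and \<Phi>: "L1 \<Phi>" "!!z. 0 <= \<Phi> z"
  and M: "M > 0" and u\<Phi>: "!!z j. u z > M * (3/2)^j ==> u z ^ DIM('a) * (real j + 1) ^ (2 * DIM('a)) <= \<Phi> z"
  and \<beta>: "\<beta> > 0" "avg_box \<Phi> a b <= \<beta> ^ DIM('a)"
 shows "AE x. x \<in> cbox a b --> abs (g x - avg_box g a b) <= d * 2 ^ DIM('a) * (4 * M + 4 * \<beta>)"
proof -
 have pw: "AE x. x \<in> cbox a b --> (\<forall>S. (\<forall>J. (\<Sum>j<J. (1/2)^j * dyadic_box_avg u a b x j) <= S) -->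
      abs (g x - avg_box g a b) <= d * 2 ^ DIM('a) * S)"
  by (rule wgrad_pointwise[OF wg U u Gu d ne])
 show ?thesis using pw
proof eventually_elim
 case (elim x)
 let ?n = "DIM('a)"
 have mQ: "vol (cbox a b) > 0" using ne by (simp add: content_pos_lt_eq box_ne_empty)
 show ?case
 proof
  assume x: "x \<in> cbox a b"
  have one: "dyadic_box_avg u a b x j <= M * (3/2)^j + 2 * (2^j * \<beta> / (real j + 1)\<^sup>2)" for j
  proof -
   \<comment> \<open>Passing to the box of scale \<open>j\<close> can raise the mean of
     \<open>\<Phi>\<close> from \<open>\<beta> ^ n\<close> to \<open>2 ^ (j n) \<beta> ^ n\<close>.
     The height \<open>\<beta>'\<close> balances this: \<open>c\<close> times the raised mean is
     exactly \<open>\<beta>'\<close>.\<close>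
   define \<beta>' where "\<beta>' = 2^j * \<beta> / (real j + 1)\<^sup>2"
   define c where "c = 1 / ((real j + 1) ^ (2 * ?n) * \<beta>' ^ (?n - 1))"
   have \<beta>': "\<beta>' > 0" using \<beta> by (simp add: \<beta>'_def)
   have c: "c > 0" using \<beta>' by (simp add: c_def)
   let ?a = "shrink x ((1/2)^j) a" and ?b = "shrink x ((1/2)^j) b"
   have mB: "vol (cbox ?a ?b) > 0" using measure_shrink[of "(1/2)^j" x a b] mQ by simp
   have pw: "u z <= (M * (3/2)^j + \<beta>') + c * \<Phi> z" for z
   proof (cases "u z > M * (3/2)^j & u z > \<beta>'")
    case True
    have "u z * \<beta>' ^ (?n - 1) <= u z * u z ^ (?n - 1)"
     using True \<beta>' by (intro mult_left_mono power_mono u) auto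
    also have "... = u z ^ ?n" by (simp add: power_Suc[symmetric] del: power_Suc)
    finally have "u z * \<beta>' ^ (?n - 1) * (real j + 1) ^ (2 * ?n) <= u z ^ ?n * (real j + 1) ^ (2 * ?n)"
     by (intro mult_right_mono) auto
    also have "... <= \<Phi> z" using u\<Phi>[of j z] True by simp
    finally have "u z <= c * \<Phi> z" using \<beta>' by (simp add: c_def field_simps)
    moreover have "0 <= M * (3/2)^j + \<beta>'" using M \<beta>' by simp
    ultimately show ?thesis by linarith
   next
    case False
    moreover have "0 <= c * \<Phi> z" "0 <= M * (3/2)^j" using c \<Phi> M by auto
    ultimately show ?thesis using \<beta>' by argo
   qed
   have i\<Phi>: "set_integrable lborel (cbox ?a ?b) (%z. c * \<Phi> z)"
    using \<Phi> by (intro set_integrable_lborel) auto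
   have "(LBINT z:cbox ?a ?b. u z) <= (LBINT z:cbox ?a ?b. (M * (3/2)^j + \<beta>') + c * \<Phi> z)"
    by (rule set_integral_mono[OF _ set_integral_add(1)[OF set_integrable_const_cbox i\<Phi>] pw])
     (use u in \<open>auto intro: set_integrable_lborel\<close>)
   also have "... = (M * (3/2)^j + \<beta>') * vol (cbox ?a ?b) + c * (LBINT z:cbox ?a ?b. \<Phi> z)"
    by (subst set_integral_add(2)[OF set_integrable_const_cbox i\<Phi>]) (simp add: set_integral_def)
   finally have "dyadic_box_avg u a b x j <= ((M * (3/2)^j + \<beta>') * vol (cbox ?a ?b) + c * (LBINT z:cbox ?a ?b. \<Phi> z)) / vol (cbox ?a ?b)"
    unfolding dyadic_box_avg_def avg_box_def using mB by (intro divide_right_mono) auto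
   also have "... = M * (3/2)^j + \<beta>' + c * dyadic_box_avg \<Phi> a b x j"
    unfolding dyadic_box_avg_def avg_box_def using mB by (simp add: add_divide_distrib)
   also have "dyadic_box_avg \<Phi> a b x j <= 2 ^ (j * ?n) * \<beta> ^ ?n"
    using dyadic_box_avg_le[OF \<Phi> x, of j] \<beta>(2) by (rule order_trans[OF _ mult_left_mono]) auto
   also have "c * (2 ^ (j * ?n) * \<beta> ^ ?n) = \<beta>'"
   proof -
    have "2 ^ (j * ?n) * \<beta> ^ ?n = \<beta>' ^ ?n * (real j + 1) ^ (2 * ?n)"
     by (simp add: \<beta>'_def power_divide power_mult_distrib power_mult)
    also have "\<beta>' ^ ?n = \<beta>' * \<beta>' ^ (?n - 1)" by (simp add: power_Suc[symmetric] del: power_Suc)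
    finally show ?thesis using \<beta>' by (simp add: c_def)
   qed
   finally show ?thesis using c by (simp add: \<beta>'_def mult_ac add_ac)
  qed
  have "(\<Sum>j<J. (1/2)^j * dyadic_box_avg u a b x j) <= 4 * M + 4 * \<beta>" for J
  proof -
   have "(\<Sum>j<J. (1/2)^j * dyadic_box_avg u a b x j) <= (\<Sum>j<J. (1/2)^j * (M * (3/2)^j + 2 * (2^j * \<beta> / (real j + 1)\<^sup>2)))"
    by (intro sum_mono mult_left_mono one) auto
   also have "... = M * (\<Sum>j<J. (3/4)^j) + 2 * \<beta> * (\<Sum>j<J. 1 / (real j + 1)\<^sup>2)"
    unfolding sum_distrib_left sum.distrib[symmetric]
    by (intro sum.cong refl) (simp add: power_divide field_simps power_mult_distrib[symmetric])
   also have "... <= M * 4 + 2 * \<beta> * 2"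
   proof (intro add_mono mult_left_mono sum_inverse_squares_le)
    show "(\<Sum>j<J. (3/4::real)^j) <= 4" by (subst geometric_sum) auto
   qed (use M \<beta> in auto)
   finally show ?thesis by simp
  qed
  with elim x show "abs (g x - avg_box g a b) <= d * 2 ^ DIM('a) * (4 * M + 4 * \<beta>)" by blast
 qed
qed
qed

section \<open>Higher integrability of the function from a logarithmic bound on its gradient\<close>

text \<open>By Borel-Cantelli almost every point leaves some \<open>O' k\<close>. For the least such
  \<open>k\<close> the value is at most \<open>c k\<close>, and if \<open>k = Suc l\<close> the
  point still lies in \<open>O' l\<close>; this explains the shifted index in
  \<open>c (Suc k) * vol (O' k)\<close>.\<close>

lemma level_sets_integrable:
 assumes A: "A \<in> sets borel" "emeasure lborel A < \<infinity>" and F: "F \<in> borel_funs" "!!x. 0 <= F x"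
  and O: "!!k. O' k \<in> sets borel" "!!k. emeasure lborel (O' k) < \<infinity>"
  and s: "summable (%k. vol (O' k))" "summable (%k. c (Suc k) * vol (O' k))"
  and c: "!!k. 0 <= (c k :: real)"
  and le: "AE x. x \<in> A --> (\<forall>k. x \<notin> O' k --> F x <= c k)"
 shows "set_integrable lborel A F"
proof -
 have "AE x. \<forall>\<^sub>F k in sequentially. x \<in> space lborel - O' k"
  by (rule borel_cantelli_AE1) (use O s in auto)
 then have pw: "AE x. ennreal (norm (indicator A x *\<^sub>R F x)) <= ennreal (c 0) * indicator A x + (\<Sum>k. ennreal (c (Suc k)) * indicator (O' k) x)"
  using le
 proof eventually_elim
  case (elim x)
  show ?case
  proof (cases "x \<in> A")
   case True
   obtain k0 where "x \<notin> O' k0" using elim(1) by (auto simp: eventually_sequentially)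
   define k where "k = (LEAST k. x \<notin> O' k)"
   have k: "x \<notin> O' k" unfolding k_def by (rule LeastI) fact
   then have Fk: "F x <= c k" using elim True by auto
   show ?thesis
   proof (cases k)
    case 0
    have "ennreal (norm (indicator A x *\<^sub>R F x)) <= ennreal (c 0) * indicator A x"
     using True Fk 0 F(2)[of x] by (auto intro!: ennreal_leI)
    then show ?thesis by (rule order_trans) simp
   next
    case (Suc l)
    then have "x \<in> O' l" using not_less_Least[of l "%k. x \<notin> O' k"] by (auto simp: k_def)
    then have "ennreal (norm (indicator A x *\<^sub>R F x)) <= ennreal (c (Suc l)) * indicator (O' l) x"
     using True Fk Suc F(2)[of x] by (auto intro!: ennreal_leI)
    also have "... <= (\<Sum>k. ennreal (c (Suc k)) * indicator (O' k) x)"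
    proof -
     define f where "f k = ennreal (c (Suc k)) * indicator (O' k) x" for k
     have "sum f {l} <= suminf f" by (rule sum_le_suminf) auto
     then have "f l <= suminf f" by simp
     then show ?thesis by (simp add: f_def[abs_def])
    qed
    finally show ?thesis by (rule order_trans) simp
   qed
  qed simp
 qed
 have "(\<integral>\<^sup>+x. ennreal (norm (indicator A x *\<^sub>R F x)) \<partial>lborel) <=
  (\<integral>\<^sup>+x. ennreal (c 0) * indicator A x + (\<Sum>k. ennreal (c (Suc k)) * indicator (O' k) x) \<partial>lborel)"
  by (rule nn_integral_mono_AE[OF pw])
 also have "... = ennreal (c 0) * emeasure lborel A + (\<Sum>k. ennreal (c (Suc k)) * emeasure lborel (O' k))"
  using A O by (subst nn_integral_add; (subst nn_integral_suminf)?) (auto simp: nn_integral_cmult_indicator)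
 also have "(\<Sum>k. ennreal (c (Suc k)) * emeasure lborel (O' k)) = (\<Sum>k. ennreal (c (Suc k) * vol (O' k)))"
  using O c by (intro suminf_cong) (auto simp: ennreal_mult emeasure_eq_ennreal_measure less_top)
 also have "... = ennreal (\<Sum>k. c (Suc k) * vol (O' k))"
  using s c by (intro suminf_ennreal2) auto
 also have "ennreal (c 0) * emeasure lborel A + ennreal (\<Sum>k. c (Suc k) * vol (O' k)) < \<infinity>"
  using A by (auto simp: ennreal_mult_less_top)
 finally show ?thesis
  unfolding set_integrable_def using A F by (intro integrableI_bounded) auto
qed

text \<open>Monotonicity of \<open>s / (1 + ln (1 + s))\<close> with denominators cleared; both
  estimates come from \<open>ln x <= x - 1\<close>.\<close>

lemma log_ratio_mono:
 fixes s u :: real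
 assumes "0 < s" "s <= u"
 shows "s * (1 + ln (1 + u)) <= u * (1 + ln (1 + s))"
proof -
 have "ln ((1 + u) / (1 + s)) <= (1 + u) / (1 + s) - 1" using assms by (intro ln_le_minus_one) auto
 then have 1: "ln (1 + u) - ln (1 + s) <= (u - s) / (1 + s)"
  using assms by (simp add: ln_div field_simps)
 have "ln (1 / (1 + s)) <= 1 / (1 + s) - 1" using assms by (intro ln_le_minus_one) auto
 then have 2: "s / (1 + s) <= ln (1 + s)" using assms by (simp add: ln_div field_simps)
 have "s * (ln (1 + u) - ln (1 + s)) <= s * ((u - s) / (1 + s))" using 1 assms by (intro mult_left_mono) auto
 also have "... = (u - s) * (s / (1 + s))" by simp
 also have "... <= (u - s) * ln (1 + s)" using 2 assms by (intro mult_left_mono) auto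
 finally show ?thesis using assms by (simp add: algebra_simps)
qed

text \<open>One factor of the power \<open>s ^ (n - 1)\<close> is spent on replacing
  \<open>ln (1 + u)\<close> by \<open>ln (1 + s)\<close>, by monotonicity of the ratio above; the
  remaining \<open>s ^ (n - 2)\<close> is bounded by \<open>u ^ (n - 2)\<close>, which is where
  \<open>n >= 2\<close> enters.\<close>

lemma tail_integral_le:
 fixes u H :: "'a::euclidean_space => real"
 assumes u: "L1 u" "!!z. 0 <= u z" and H: "L1 H" "!!z. 0 <= H z"
  and uH: "AE z. u z ^ n <= (1 + ln (1 + u z)) * H z" and n: "n >= 2" and s: "s > 0"
 shows "(LBINT z:{z. u z > s}. u z) <= (1 + ln (1 + s)) / s ^ (n - 1) * (LBINT z. H z)"
proof -
 have [measurable]: "u \<in> borel_funs" using u by (simp add: measurable_L1)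
 have S: "{z. u z > s} \<in> sets borel" by measurable
 let ?C = "(1 + ln (1 + s)) / s ^ (n - 1)"
 have C: "?C >= 0" using s by simp
 have "(LBINT z:{z. u z > s}. u z) <= (LBINT z. ?C * H z)"
  unfolding set_integral_def
 proof (rule integral_mono_AE)
  show "L1 (%z. indicator {z. u z > s} z *\<^sub>R u z)"
   using set_integrable_lborel[OF u(1) S] by (simp add: set_integrable_def)
  show "AE z. indicator {z. u z > s} z *\<^sub>R u z <= ?C * H z"
   using uH
  proof eventually_elim
   case (elim z)
   show ?case
   proof (cases "u z > s")
    case True
    then have uz: "u z > 0" "u z >= s" using s by auto
    obtain m where m: "n = Suc (Suc m)" using n by (metis add_2_eq_Suc le_Suc_ex)
    have "u z * s ^ (n - 1) * u z ^ (n - 1) = u z ^ n * s * s ^ (n - 2)"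
     by (simp add: m)
    also have "... <= (1 + ln (1 + u z)) * H z * s * u z ^ (n - 2)"
     using elim s uz H by (intro mult_mono power_mono) (auto intro!: mult_nonneg_nonneg)
    also have "... = (s * (1 + ln (1 + u z))) * H z * u z ^ (n - 2)" by simp
    also have "... <= (u z * (1 + ln (1 + s))) * H z * u z ^ (n - 2)"
     using log_ratio_mono[OF s uz(2)] uz H by (intro mult_right_mono) auto
    also have "... = (1 + ln (1 + s)) * H z * u z ^ (n - 1)"
     by (simp add: m)
    finally have "u z * s ^ (n - 1) <= (1 + ln (1 + s)) * H z"
     using uz by simp
    then show ?thesis using True s by (simp add: field_simps)
   next
    case False
    then show ?thesis using mult_nonneg_nonneg[OF C H(2)[of z]] by simp
   qed
  qed
 qed (use H in auto)
 then show ?thesis by simp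
qed

lemma add_power_le:
 fixes x y :: real
 assumes "0 <= x" "0 <= y"
 shows "(x + y) ^ p <= 2 ^ p * (x ^ p + y ^ p)"
proof -
 have "(x + y) ^ p <= (2 * max x y) ^ p" using assms by (intro power_mono) auto
 also have "... = 2 ^ p * max x y ^ p" by (simp add: power_mult_distrib)
 also have "... <= 2 ^ p * (x ^ p + y ^ p)" using assms by (intro mult_left_mono) (auto simp: max_def)
 finally show ?thesis .
qed

text \<open>At the level \<open>t = 2 ^ (n k)\<close> the weak type bound contributes
  \<open>1 / t\<close> and the tail estimate a multiple of \<open>k / t ^ (n - 1)\<close>, hence the
  decay \<open>k * 2 ^ (- n n k)\<close>. The levels are powers of \<open>2 ^ n\<close> so that they
  match the growth of dyadic averages.\<close>

lemma maximal_set_log_bound: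
 fixes u H :: "'a::euclidean_space => real"
 assumes u: "L1 u" "!!z. 0 <= u z" and H: "L1 H" "!!z. 0 <= H z"
  and uH: "AE z. u z ^ n <= (1 + ln (1 + u z)) * H z" and n: "n >= 2"
 obtains D where "!!k. k >= 1 ==> vol (maximal_set u (2 ^ (n * k))) <= D * (real (Suc k) * (1/2) ^ (n * n * k))"
proof
 fix k :: nat assume k: "k >= 1"
 define s where "s = (2::real) ^ (n * k) / 2"
 have "n * k >= 1" using n k by (cases k) auto
 then have "(2::real) ^ 1 <= 2 ^ (n * k)" by (intro power_increasing) auto
 then have s1: "s >= 1" by (simp add: s_def)
 have "ln (1 + s) <= ln (2 ^ (n * k))" using s1 by (subst ln_le_cancel_iff) (auto simp: s_def)
 also have "... = real (n * k) * ln 2" by (simp add: ln_realpow)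
 also have "... <= real (n * k) * 1" using ln_le_minus_one[of 2] by (intro mult_left_mono) auto
 finally have l: "1 + ln (1 + s) <= real n * real (Suc k)" using n by (simp add: algebra_simps)
 have IH: "0 <= (LBINT z. H z)" using H by (intro Bochner_Integration.integral_nonneg)
 obtain m where m: "n = Suc m" using n by (cases n) auto
 have "vol (maximal_set u (2 ^ (n * k))) <= 2 * 5 ^ DIM('a) / 2 ^ (n * k) * (LBINT z:{z. u z > s}. u z)"
  using measure_maximal_set(2)[OF u, of "2 ^ (n * k)"] by (simp add: s_def)
 also have "... <= 2 * 5 ^ DIM('a) / 2 ^ (n * k) * ((1 + ln (1 + s)) / s ^ (n - 1) * (LBINT z. H z))"
  using s1 by (intro mult_left_mono tail_integral_le[OF u H uH n]) auto
 also have "... <= 2 * 5 ^ DIM('a) / 2 ^ (n * k) * ((real n * real (Suc k)) / s ^ (n - 1) * (LBINT z. H z))"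
  using l s1 IH by (intro mult_left_mono mult_right_mono divide_right_mono) auto
 also have "... = (2 * 5 ^ DIM('a) * 2 ^ (n - 1) * n * (LBINT z. H z)) * (real (Suc k) * (1/2) ^ (n * n * k))"
  by (simp add: s_def m power_divide power_one_over power_mult[symmetric] power_add[symmetric] field_simps)
 finally show "vol (maximal_set u (2 ^ (n * k))) <=
  (2 * 5 ^ DIM('a) * 2 ^ (n - 1) * n * (LBINT z. H z)) * (real (Suc k) * (1/2) ^ (n * n * k))" .
qed

lemma summable_Suc_half: "summable (%k. real (Suc k) * (1/2) ^ k)"
 using geometric_deriv_sums[of "1/2::real"] by (simp add: sums_iff)

text \<open>Off \<open>O' k\<close> the weighted sum of dyadic averages is at most a constant times
  \<open>2 ^ ((n - 1) k)\<close>, which bounds \<open>g\<close> there. Against the decay of the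
  measure of \<open>O' k\<close>, the power \<open>n + 1\<close> leaves a series with terms of order
  \<open>k * 2 ^ -k\<close>.\<close>

theorem wgrad_higher_power_integrable:
 fixes g u H :: "'a::euclidean_space => real"
 assumes n: "DIM('a) >= 2"
  and wg: "wgrad U g G" and U: "open U" "cbox a b \<subseteq> U" and u: "L1 u" "!!z. 0 <= u z"
  and Gu: "AE z. norm (G z) <= u z" and ne: "box a b ~= {}"
  and H: "L1 H" "!!z. 0 <= H z"
  and uH: "AE z. u z ^ DIM('a) <= (1 + ln (1 + u z)) * H z"
 shows "set_integrable lborel (cbox a b) (%x. abs (g x) ^ (DIM('a) + 1))"
proof -
 let ?n = "DIM('a)"
 have g: "L1 g" using wg by (auto simp: wgrad_def)
 then have [measurable]: "g \<in> borel_funs" by (simp add: measurable_L1)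
 obtain B0 where B0: "!!y. y \<in> cbox a b ==> norm y <= B0"
  using bounded_cbox[of a b] by (auto simp: bounded_iff)
 define d where "d = 2 * abs B0"
 have d: "norm (y - z) <= d" if "y \<in> cbox a b" "z \<in> cbox a b" for y z
  using norm_triangle_ineq4[of y z] B0[OF that(1)] B0[OF that(2)] by (simp add: d_def)
 have d0: "d >= 0" by (simp add: d_def)
 have mQ: "vol (cbox a b) > 0" using ne by (simp add: content_pos_lt_eq box_ne_empty)
 define A where "A = avg_box u a b"
 define c0 where "c0 = unit_ball_vol ?n * (d + 1) ^ ?n / vol (cbox a b)"
 have A0: "A >= 0" unfolding A_def by (intro avg_box_nonneg u)
 have c00: "c0 >= 0" unfolding c0_def using d0 mQ by auto
 define B where "B = d * 2 ^ ?n * (A + 2 * c0)"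
 have B: "B >= 0" using d0 A0 c00 by (simp add: B_def)
 define O' where "O' k = maximal_set u (2 ^ (?n * k))" for k
 define c where "c k = (B * 2 ^ ((?n - 1) * k)) ^ (?n + 1)" for k
 let ?F = "%x. abs (g x - avg_box g a b) ^ (?n + 1)"
 let ?D = "%x J. \<Sum>j<J. (1/2)^j * dyadic_box_avg u a b x j"
 let ?p = "%x. x \<in> cbox a b --> (\<forall>S. (\<forall>J. (?D x J) <= S) -->
      abs (g x - avg_box g a b) <= d * 2 ^ ?n * S)"
 have pw: "AE x. ?p x"
  by (rule wgrad_pointwise[OF wg U u Gu d ne])
 have le: "AE x. x \<in> cbox a b --> (\<forall>k. x \<notin> O' k --> ?F x <= c k)"
  using pw
 proof (eventually_elim, intro impI allI)
  fix x k assume pw: "?p x" and x: "x \<in> cbox a b" and xk: "x \<notin> O' k"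
  have av1: "dyadic_box_avg u a b x j <= 2 ^ (j * ?n) * A" for j
   unfolding A_def by (rule dyadic_box_avg_le[OF u x])
  have av2: "dyadic_box_avg u a b x j <= c0 * 2 ^ (?n * k)" for j
  proof -
   let ?r = "(1/2)^j * (d + 1)"
   have r: "?r > 0" using d0 by simp
   then have "vol (ball x ?r) > 0" by (simp add: measure_lborel_ball)
   then have "avg_ball u x ?r <= 2 ^ (?n * k)"
    unfolding avg_ball_def using not_maximal_set[OF xk[unfolded O'_def] r] by (simp add: divide_le_eq)
   then have "c0 * avg_ball u x ?r <= c0 * 2 ^ (?n * k)" using c00 by (rule mult_left_mono)
   moreover have "dyadic_box_avg u a b x j <= c0 * avg_ball u x ?r"
    unfolding c0_def by (rule dyadic_box_avg_ball_le[OF u x d ne])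
   ultimately show ?thesis by linarith
  qed
  \<comment> \<open>Two bounds compete: \<open>2 ^ (j n) A\<close> from the whole box and
    \<open>c0 * 2 ^ (n k)\<close> from the maximal function. They cross near \<open>j = k\<close>;
    the first governs \<open>j < k\<close>, the second \<open>j >= k\<close>, and \<open>min\<close>
    and \<open>max\<close> record both phases in a single induction.\<close>
  have *: "(?D x J) <=
    A * 2 ^ ((?n - 1) * min J k) + c0 * 2 ^ (?n * k) * (2 * (1/2)^k - 2 * (1/2)^(max J k))" for J
  proof (induction J)
   case 0
   then show ?case using A0 by simp
  next
   case (Suc J)
   show ?case
   proof (cases "J < k")
    case True
    have "(1/2)^J * dyadic_box_avg u a b x J <= (1/2)^J * (2 ^ (J * ?n) * A)"
     using av1[of J] by (intro mult_left_mono) auto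
    also have "... = A * 2 ^ ((?n - 1) * J)"
    proof -
     obtain m where "?n = Suc m" using n by (cases ?n) auto
     then show ?thesis by (simp add: power_add power_one_over mult.commute)
    qed
    finally have "(\<Sum>j<Suc J. (1/2)^j * dyadic_box_avg u a b x j) <= A * (2 * 2 ^ ((?n - 1) * J))"
     using Suc True by (simp add: max_def)
    also have "... <= A * 2 ^ ((?n - 1) * Suc J)"
    proof (rule mult_left_mono[OF _ A0])
     have "(2::real) * 2 ^ ((?n - 1) * J) = 2 ^ (1 + (?n - 1) * J)" by simp
     also have "... <= 2 ^ ((?n - 1) * Suc J)" using n by (intro power_increasing) auto
     finally show "(2::real) * 2 ^ ((?n - 1) * J) <= 2 ^ ((?n - 1) * Suc J)" .
    qed
    finally have "(\<Sum>j<Suc J. (1/2)^j * dyadic_box_avg u a b x j) <= A * 2 ^ ((?n - 1) * Suc J)" .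
    moreover have "min (Suc J) k = Suc J" "max (Suc J) k = k" using True by auto
    ultimately show ?thesis by (simp only: cancel_comm_monoid_add_class.diff_cancel mult_zero_right add_0_right)
   next
    case False
    have "(1/2)^J * dyadic_box_avg u a b x J <= (1/2)^J * (c0 * 2 ^ (?n * k))"
     using av2[of J] by (intro mult_left_mono) auto
    moreover have "min (Suc J) k = k" "max (Suc J) k = Suc J" "min J k = k" "max J k = J" using False by auto
    moreover have "c0 * 2 ^ (?n * k) * (2 * (1/2)^k - 2 * (1/2)^(Suc J)) = c0 * 2 ^ (?n * k) * (2 * (1/2)^k - 2 * (1/2)^J) + (1/2)^J * (c0 * 2 ^ (?n * k))"
     by (simp add: algebra_simps)
    ultimately show ?thesis using Suc.IH by (simp only: sum.lessThan_Suc)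
   qed
  qed
  have "(?D x J) <= (A + 2 * c0) * 2 ^ ((?n - 1) * k)" for J
  proof -
   have "A * 2 ^ ((?n - 1) * min J k) <= A * 2 ^ ((?n - 1) * k)"
    using A0 by (intro mult_left_mono power_increasing) auto
   moreover have "c0 * 2 ^ (?n * k) * (2 * (1/2)^k - 2 * (1/2)^(max J k)) <= c0 * 2 ^ (?n * k) * (2 * (1/2)^k)"
    using c00 by (intro mult_left_mono) auto
   moreover have "c0 * 2 ^ (?n * k) * (2 * (1/2)^k) = 2 * c0 * 2 ^ ((?n - 1) * k)"
   proof -
    obtain m where "?n = Suc m" using n by (cases ?n) auto
    then show ?thesis by (simp add: power_add power_one_over)
   qed
   ultimately show ?thesis using *[of J] unfolding distrib_right by linarith
  qed
  with pw x have "abs (g x - avg_box g a b) <= d * 2 ^ ?n * ((A + 2 * c0) * 2 ^ ((?n - 1) * k))" by blast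
  also have "... = B * 2 ^ ((?n - 1) * k)" by (simp add: B_def)
  finally show "?F x <= c k" unfolding c_def by (intro power_mono) auto
 qed
 obtain D where D: "!!k. k >= 1 ==> vol (O' k) <= D * (real (Suc k) * (1/2) ^ (?n * ?n * k))"
  unfolding O'_def using maximal_set_log_bound[OF u H uH n] by blast
 \<comment> \<open>The surplus 1 is what remains after the power \<open>n + 1\<close>: it supplies
   the factor \<open>(1/2) ^ k\<close>.\<close>
 have nn: "?n * ?n = (?n - 1) * (?n + 1) + 1" using n by (cases ?n) auto
 have D': "vol (O' k) <= abs D * (real (Suc k) * (1/2) ^ (?n * ?n * k))" if "k >= 1" for k
  using D[OF that] by (rule order_trans) (intro mult_right_mono, auto)
 have "set_integrable lborel (cbox a b) ?F"
 proof (rule level_sets_integrable[OF _ _ _ _ _ _ _ _ _ le])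
  show "O' k \<in> sets borel" "emeasure lborel (O' k) < \<infinity>" for k
   unfolding O'_def using measure_maximal_set(1)[OF u, of "2 ^ (?n * k)"] u by auto
  show "summable (%k. vol (O' k))"
  proof (rule summable_comparison_test_ev[OF _ summable_mult[OF summable_Suc_half, of "abs D"]])
   show "\<forall>\<^sub>F k in sequentially. norm (vol (O' k)) <= abs D * (real (Suc k) * (1/2) ^ k)"
    using eventually_ge_at_top[of 1]
   proof eventually_elim
    case (elim k)
    have "k <= ?n * ?n * k" using n by auto
    then have "(1/2::real) ^ (?n * ?n * k) <= (1/2) ^ k" by (intro power_decreasing) auto
    then have "abs D * (real (Suc k) * (1/2) ^ (?n * ?n * k)) <= abs D * (real (Suc k) * (1/2) ^ k)"
     by (intro mult_left_mono) auto
    then show ?case using D'[OF elim] by (simp add: measure_nonneg)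
   qed
  qed
  show "summable (%k. c (Suc k) * vol (O' k))"
  proof (rule summable_comparison_test_ev[OF _ summable_mult[OF summable_Suc_half, of "B ^ (?n + 1) * 2 ^ ((?n - 1) * (?n + 1)) * abs D"]])
   show "\<forall>\<^sub>F k in sequentially. norm (c (Suc k) * vol (O' k)) <= B ^ (?n + 1) * 2 ^ ((?n - 1) * (?n + 1)) * abs D * (real (Suc k) * (1/2) ^ k)"
    using eventually_ge_at_top[of 1]
   proof eventually_elim
    case (elim k)
    have cS: "c (Suc k) = B ^ (?n + 1) * 2 ^ ((?n - 1) * (?n + 1)) * 2 ^ ((?n - 1) * (?n + 1) * k)"
    proof -
     have "(B * 2 ^ (p * Suc k)) ^ q = B ^ q * 2 ^ (p * q) * 2 ^ (p * q * k)" for p q :: nat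
     proof -
      have "p * Suc k * q = p * q + p * q * k" by (simp add: algebra_simps)
      then show ?thesis by (simp only: power_mult_distrib power_mult[symmetric] power_add mult.assoc)
     qed
     then show ?thesis unfolding c_def .
    qed
    have c0: "c (Suc k) >= 0" using B by (simp add: c_def)
    have "norm (c (Suc k) * vol (O' k)) = c (Suc k) * vol (O' k)"
     using c0 by (simp add: measure_nonneg)
    also have "... <= c (Suc k) * (abs D * (real (Suc k) * (1/2) ^ (?n * ?n * k)))"
     using c0 D'[OF elim] by (rule mult_left_mono[rotated])
    also have "... = B ^ (?n + 1) * 2 ^ ((?n - 1) * (?n + 1)) * abs D * (real (Suc k) * (2 ^ ((?n - 1) * (?n + 1) * k) * (1/2) ^ (((?n - 1) * (?n + 1) + 1) * k)))"
     unfolding cS nn by (simp only: mult_ac)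
    also have "(2::real) ^ ((?n - 1) * (?n + 1) * k) * (1/2) ^ (((?n - 1) * (?n + 1) + 1) * k) = (1/2) ^ k"
     by (simp only: distrib_right power_add power_one_over) simp
    finally show ?case .
   qed
  qed
  show "0 <= c k" for k using B by (simp add: c_def)
 qed (use emeasure_bounded_finite[OF bounded_cbox, of a b] in auto)
 then have Fi: "L1 (%x. indicator (cbox a b) x *\<^sub>R ?F x)" by (simp add: set_integrable_def)
 have ci: "L1 (%x. indicator (cbox a b) x *\<^sub>R (abs (avg_box g a b) ^ (?n + 1)))"
  using set_integrable_const_cbox[of a b] by (simp add: set_integrable_def)
 show ?thesis unfolding set_integrable_def
 proof (rule integrable_majorant)
  let ?g = "%x. 2 ^ (?n + 1) * (indicator (cbox a b) x *\<^sub>R ?F x + indicator (cbox a b) x *\<^sub>R (abs (avg_box g a b) ^ (?n + 1)))"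
  show "L1 ?g" using Fi ci by (intro integrable_mult_right Bochner_Integration.integrable_add)
  fix x
  have "abs (g x) ^ (?n + 1) <= (abs (g x - avg_box g a b) + abs (avg_box g a b)) ^ (?n + 1)"
   by (intro power_mono) auto
  also have "... <= 2 ^ (?n + 1) * (?F x + abs (avg_box g a b) ^ (?n + 1))"
   by (intro add_power_le) auto
  finally show "\<bar>indicator (cbox a b) x *\<^sub>R \<bar>g x\<bar> ^ (?n + 1)\<bar> <= ?g x"
   by (cases "x \<in> cbox a b") (auto simp: abs_of_nonneg simp del: power_Suc)
 qed measurable
qed

section \<open>Null Lagrangians and truncation\<close>

text \<open>Every product in the Leibniz formula is expanded over the set \<open>S\<close> of rows
  that contribute an entry of \<open>A\<close>; grouping by \<open>card S\<close> gives the
  coefficients, with all rows for the top one.\<close>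

lemma det_one_plus_scaled:
 fixes A :: "real^'n::{finite,wellorder}^'n::_"
 obtains E :: "nat => real^'n::_^'n::_ => real"
 where "!!s A. det (mat 1 + s *\<^sub>R A) = (\<Sum>k\<le>CARD('n). E k A * s ^ k)"
  and "!!A. E CARD('n) A = det A" and "!!k. continuous_on UNIV (E k)"
proof
 define \<delta> where "\<delta> i j = (if i = j then 1 else 0 :: real)" for i j :: 'n
 let ?P = "{p. p permutes (UNIV::'n set)}"
 define E where "E k A = (\<Sum>p\<in>?P. \<Sum>S\<in>{S. card S = k}. of_int (sign p) * ((\<Prod>i\<in>S. A $ i $ p i) * (\<Prod>i\<in>UNIV - S. \<delta> i (p i))))"
  for k and A :: "real^'n::_^'n::_"
 show "det (mat 1 + s *\<^sub>R A) = (\<Sum>k\<le>CARD('n). E k A * s ^ k)" for s and A :: "real^'n::_^'n::_"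
 proof -
  let ?T = "%p S. (\<Prod>i\<in>S. A $ i $ p i) * (\<Prod>i\<in>UNIV - S. \<delta> i (p i))"
  have "det (mat 1 + s *\<^sub>R A) = (\<Sum>p\<in>?P. of_int (sign p) * (\<Prod>i\<in>UNIV. s * A $ i $ p i + \<delta> i (p i)))"
   unfolding det_def by (intro sum.cong refl arg_cong2[where f="(*)"] prod.cong) (auto simp: mat_def \<delta>_def)
  also have "... = (\<Sum>p\<in>?P. of_int (sign p) * (\<Sum>S\<in>UNIV. (\<Prod>i\<in>S. s * A $ i $ p i) * (\<Prod>i\<in>UNIV - S. \<delta> i (p i))))"
   by (simp add: prod_add)
  also have "... = (\<Sum>p\<in>?P. \<Sum>S\<in>UNIV. of_int (sign p) * (?T p S) * s ^ card S)"
   by (simp add: prod.distrib sum_distrib_left mult_ac)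
  also have "... = (\<Sum>p\<in>?P. \<Sum>k\<le>CARD('n). \<Sum>S\<in>{S\<in>UNIV. card S = k}. of_int (sign p) * (?T p S) * s ^ card S)"
   by (intro sum.cong refl sum.group[symmetric]) (auto intro: card_mono)
  also have "... = (\<Sum>p\<in>?P. \<Sum>k\<le>CARD('n). (\<Sum>S\<in>{S. card S = k}. of_int (sign p) * (?T p S)) * s ^ k)"
   by (auto intro!: sum.cong simp: sum_distrib_right)
  also have "... = (\<Sum>k\<le>CARD('n). E k A * s ^ k)"
   unfolding E_def by (subst sum.swap) (simp add: sum_distrib_right)
  finally show ?thesis .
 qed
 show "E CARD('n) A = det A" for A :: "real^'n::_^'n::_"
 proof -
  have "{S :: 'n set. card S = CARD('n)} = {UNIV}" using card_eq_UNIV_imp_eq_UNIV[of "_ :: 'n set"] by auto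
  then show ?thesis by (simp add: E_def det_def)
 qed
 show "continuous_on UNIV (E k)" for k
  unfolding E_def by (intro continuous_intros)
qed

text \<open>For small \<open>s\<close> the map \<open>x + s H x\<close> is a bijection of the box
  onto itself, so the integral of \<open>det (1 + s A)\<close> is the volume of the box. It is a
  polynomial in \<open>s\<close>, constant on an interval, hence its coefficient of degree
  \<open>n\<close>, the integral of \<open>det A\<close>, vanishes.\<close>

lemma null_lagrangian:
 fixes H :: "real^'n::{finite,wellorder} => real^'n::_" and A :: "real^'n::_ => real^'n::_^'n::_"
 assumes der: "!!x. (H has_derivative (%h. A x *v h)) (at x)" and A: "continuous_on UNIV A"
  and supp: "!!x. x \<notin> cbox a b ==> H x = 0"
 shows "integral (cbox a b) (%x. det (A x)) = 0"
proof -
 let ?M = "%s x. mat 1 + s *\<^sub>R A x"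
 let ?C = "cbox a b" and ?n = "CARD('n)"
 have onb: "\<exists>L. \<forall>x\<in>?C. onorm ((*v) (A x)) <= L"
 proof -
  have "compact (A ` ?C)" by (intro compact_continuous_image continuous_on_subset[OF A]) auto
  then obtain L where L: "!!x. x \<in> ?C ==> norm (A x) <= L"
   using compact_imp_bounded bounded_iff by (metis imageI)
  have "onorm ((*v) (A x)) <= real ?n * real ?n * L" if "x \<in> ?C" for x
  proof (rule onorm_le_matrix_component)
   fix i j
   have "abs (A x $ i $ j) <= norm (A x $ i)" by (rule component_le_norm_cart)
   also have "... <= norm (A x)" by (rule Finite_Cartesian_Product.norm_nth_le)
   finally show "abs (A x $ i $ j) <= L" using L[OF that] by linarith
  qed
  then show ?thesis by blast
 qed
 then obtain L0 where L0: "!!x. x \<in> ?C ==> onorm ((*v) (A x)) <= L0" by blast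
 define L where "L = max L0 1"
 have L1: "L > 0" by (simp add: L_def)
 have A0: "(%h. A x *v h) = (%h. 0)" if "x \<notin> ?C" for x
 proof -
  have "((%_. 0) has_derivative (%h. 0)) (at x)" by simp
  then have "(H has_derivative (%h. 0)) (at x)"
   by (rule has_derivative_transform_within_open[of _ _ _ _ "- ?C"]) (use that supp in \<open>auto simp: closed_cbox\<close>)
  from has_derivative_unique[OF der this] show ?thesis .
 qed
 have onL: "onorm (%h. A x *v h) <= L" for x
  using L0[of x] A0[of x] L1 by (cases "x \<in> ?C") (auto simp: L_def onorm_zero)
 have Lip: "norm (H x - H y) <= L * norm (x - y)" for x y
  by (rule differentiable_bound[of UNIV H "%x h. A x *v h"]) (use der onL in auto)
 have Anorm: "norm (A x *v h) <= L * norm h" for x h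
  using onorm[of "(*v) (A x)" h] onL[of x] mult_right_mono[OF onL[of x] norm_ge_zero[of h]] by (auto intro: order_trans)
 obtain E :: "nat => real^'n::_^'n::_ => real" where
  E: "!!s A. det (mat 1 + s *\<^sub>R A) = (\<Sum>k\<le>?n. E k A * s ^ k)" "!!A. E ?n A = det A" "!!k. continuous_on UNIV (E k)"
  using det_one_plus_scaled by blast
 have Econt: "continuous_on S (%x. E k (A x))" for k S
  using continuous_on_compose2[OF E(3) A, of k] continuous_on_subset by blast
 have main: "(\<Sum>k\<le>?n. integral ?C (%x. E k (A x)) * s ^ k) = measure lebesgue ?C" if s: "0 < s" "s < 1 / L" for s
 proof -
  have sL: "s * L < 1" using s L1 by (simp add: field_simps)
  define T where "T x = x + s *\<^sub>R H x" for x
  have derT: "(T has_derivative (%h. (?M s x) *v h)) (at x)" for x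
   unfolding T_def using der[of x]
   by (auto intro!: derivative_eq_intros simp: matrix_vector_mult_add_rdistrib scaleR_matrix_vector_assoc[symmetric])
  have inj: "inj T"
  proof (rule injI)
   fix x y assume "T x = T y"
   then have "x - y = s *\<^sub>R (H y - H x)" by (simp add: T_def algebra_simps)
   then have "norm (x - y) = s * norm (H y - H x)" using s by simp
   also have "... <= s * (L * norm (y - x))" using s Lip by (intro mult_left_mono) auto
   finally have "norm (x - y) <= (s * L) * norm (x - y)" by (simp add: norm_minus_commute)
   then have "(1 - s * L) * norm (x - y) <= 0" by (simp add: algebra_simps)
   with sL have "norm (x - y) = 0" by (simp add: mult_le_0_iff)
   then show "x = y" by simp
  qed
  have Tid: "T x = x" if "x \<notin> ?C" for x using supp[OF that] by (simp add: T_def)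
  \<comment> \<open>Solving \<open>T x = y\<close> is a fixed point problem for a contraction with
    constant \<open>s * L\<close>.\<close>
  have surj: "\<exists>x. T x = y" for y
  proof -
   have "\<exists>!x. y - s *\<^sub>R H x = x"
   proof (rule banach_fix_type)
    show "\<forall>x z. dist (y - s *\<^sub>R H x) (y - s *\<^sub>R H z) <= (s * L) * dist x z"
    proof (intro allI)
     fix x z
     have "dist (y - s *\<^sub>R H x) (y - s *\<^sub>R H z) = s * norm (H x - H z)"
      using s by (simp add: dist_norm scaleR_diff_right[symmetric] norm_minus_commute)
     also have "... <= s * (L * norm (x - z))" using s Lip by (intro mult_left_mono) auto
     finally show "dist (y - s *\<^sub>R H x) (y - s *\<^sub>R H z) <= (s * L) * dist x z" by (simp add: dist_norm)
    qed
   qed (use s sL L1 complete_UNIV in auto)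
   then obtain x where "y - s *\<^sub>R H x = x" by blast
   then have "T x = y" by (simp add: T_def algebra_simps)
   then show ?thesis by blast
  qed
  have img: "T ` ?C = ?C"
  proof (intro equalityI subsetI)
   fix y assume "y \<in> T ` ?C"
   then obtain x where x: "x \<in> ?C" "y = T x" by blast
   show "y \<in> ?C"
   proof (rule ccontr)
    assume "y \<notin> ?C"
    then have "T y = T x" using Tid x by simp
    then have "y = x" using inj by (simp add: inj_eq)
    with x \<open>y \<notin> ?C\<close> show False by simp
   qed
  next
   fix y assume y: "y \<in> ?C"
   obtain x where "T x = y" using surj by blast
   with y Tid[of x] show "y \<in> T ` ?C" by (cases "x \<in> ?C") auto
  qed
  \<comment> \<open>The determinant is 1 at \<open>\<sigma> = 0\<close>. If it were not positive at
    \<open>s\<close>, it would vanish for some \<open>\<sigma>\<close> up to \<open>s\<close>, and a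
    kernel vector would satisfy \<open>h = - \<sigma> A h\<close>, contradicting
    \<open>s * L < 1\<close>.\<close>
  have det_pos: "det (?M s x) > 0" for x
  proof (rule ccontr)
   assume neg: "\<not> det (?M s x) > 0"
   have "continuous_on {0..s} (%\<sigma>. det (mat 1 + \<sigma> *\<^sub>R A x))"
    unfolding E(1) by (intro continuous_intros)
   then obtain \<sigma> where \<sigma>: "0 <= \<sigma>" "\<sigma> <= s" "det (mat 1 + \<sigma> *\<^sub>R A x) = 0"
    using IVT2'[of "%\<sigma>. det (mat 1 + \<sigma> *\<^sub>R A x)" s 0 0] neg s by auto
   then obtain h where h: "h ~= 0" "(mat 1 + \<sigma> *\<^sub>R A x) *v h = 0"
    using invertible_det_nz[of "mat 1 + \<sigma> *\<^sub>R A x"] matrix_left_invertible_ker[of "mat 1 + \<sigma> *\<^sub>R A x"] invertible_left_inverse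
    by blast
   then have "h = - (\<sigma> *\<^sub>R (A x *v h))"
    by (simp add: matrix_vector_mult_add_rdistrib scaleR_matrix_vector_assoc[symmetric] eq_neg_iff_add_eq_0)
   then have "norm h = \<sigma> * norm (A x *v h)" using \<sigma> by (metis norm_minus_cancel norm_scaleR abs_of_nonneg)
   also have "... <= s * (L * norm h)" using \<sigma> Anorm s by (intro mult_mono) auto
   also have "... < 1 * norm h" using sL h by (simp only: mult.assoc[symmetric]) (intro mult_strict_right_mono, auto)
   finally show False by simp
  qed
  have detT: "abs (det (matrix (%h. (?M s x) *v h))) = (\<Sum>k\<le>?n. E k (A x) * s ^ k)" for x
   using det_pos[of x] by (simp add: matrix_of_matrix_vector_mul E(1)[symmetric])
  have int: "(%x. abs (det (matrix (%h. (?M s x) *v h)))) integrable_on ?C"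
   unfolding detT by (intro integrable_continuous continuous_intros Econt)
  have "measure lebesgue (T ` ?C) = integral ?C (%x. abs (det (matrix (%h. (?M s x) *v h))))"
   by (rule measure_differentiable_image_eq[OF _ has_derivative_at_withinI[OF derT] _ int])
    (use inj in \<open>auto intro: inj_on_subset\<close>)
  also have "... = (\<Sum>k\<le>?n. integral ?C (%x. E k (A x) * s ^ k))"
   unfolding detT by (intro integral_sum integrable_continuous continuous_intros Econt) auto
  also have "... = (\<Sum>k\<le>?n. integral ?C (%x. E k (A x)) * s ^ k)" by simp
  finally show ?thesis unfolding img by simp
 qed
 \<comment> \<open>The volume is moved into the constant coefficient. As the dimension is positive,
   the coefficient of degree \<open>n\<close> is unaffected.\<close>
 define c where "c k = integral ?C (%x. E k (A x)) - (if k = 0 then measure lebesgue ?C else 0)" for k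
 have "{0<..<1/L} \<subseteq> {s. (\<Sum>k\<le>?n. c k * s ^ k) = 0}"
 proof
  fix s assume "s \<in> {0<..<1/L}"
  then have "(\<Sum>k\<le>?n. integral ?C (%x. E k (A x)) * s ^ k) = measure lebesgue ?C" by (intro main) auto
  moreover have "(\<Sum>k\<le>?n. c k * s ^ k) = (\<Sum>k\<le>?n. integral ?C (%x. E k (A x)) * s ^ k) - (\<Sum>k\<le>?n. if k = 0 then measure lebesgue ?C else 0)"
   unfolding sum_subtractf[symmetric] c_def by (intro sum.cong) (auto simp: algebra_simps)
  moreover have "(\<Sum>k\<le>?n. if k = 0 then measure lebesgue ?C else 0) = measure lebesgue ?C"
   by (simp add: sum.delta)
  ultimately show "s \<in> {s. (\<Sum>k\<le>?n. c k * s ^ k) = 0}" by simp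
 qed
 moreover have "infinite {0<..<1/L}" using L1 by (intro infinite_Ioo) auto
 ultimately have "infinite {s. (\<Sum>k\<le>?n. c k * s ^ k) = 0}" using finite_subset by blast
 then have "c ?n = 0" using polyfun_finite_roots[of c ?n] by blast
 then show ?thesis by (simp add: c_def E(2))
qed

section \<open>Mollification with variable radius\<close>

text \<open>Off the maximal set of \<open>v\<close> every mollification of \<open>v\<close> obeys
  the same growth on balls about \<open>x\<close>, uniformly in \<open>e\<close>. For
  \<open>e <= r\<close> only the mass of \<open>v\<close> in the doubled ball is seen; for
  \<open>e > r\<close> mollification is pointwise bounded through the ball of radius
  \<open>2 * e\<close>.\<close>

lemma mol_maximal_bound:
 fixes v :: "'a::euclidean_space => real"
 assumes v: "L1 v" "!!x. 0 <= v x" and e: "e > 0" and r: "r > 0" and t: "t >= 0"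
  and x: "x \<notin> maximal_set v t"
 shows "(LBINT z:ball x r. mol e v z) <= (unit_ball_vol DIM('a) * 2 ^ DIM('a) * (1 + unit_ball_vol DIM('a) / bump_mass TYPE('a))) * t * r ^ DIM('a)"
proof -
 let ?n = "DIM('a)" let ?V = "unit_ball_vol ?n" let ?I = "bump_mass TYPE('a)"
 have V: "?V > 0" "?I > 0" using bump_mass_pos[where 'a='a] by auto
 have vb: "(LBINT y:ball x \<rho>. v y) <= t * (?V * \<rho> ^ ?n)" if "\<rho> > 0" for \<rho>
  using not_maximal_set[OF x that] that by (simp add: measure_lborel_ball)
 show ?thesis
 proof (cases "e <= r")
  case True
  define w where "w y = indicator (ball x (2 * r)) y * v y" for y
  have w: "L1 w" "!!y. 0 <= w y"
   using set_integrable_lborel[OF v(1), of "ball x (2 * r)"] v(2) by (auto simp: w_def[abs_def] set_integrable_def)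
  have "(LBINT z:ball x r. mol e v z) = (LBINT z:ball x r. mol e w z)"
  proof (rule set_lebesgue_integral_cong, simp, intro allI impI)
   fix z assume z: "z \<in> ball x r"
   show "mol e v z = mol e w z"
    unfolding mol_def
   proof (rule Bochner_Integration.integral_cong[OF refl])
    fix y
    show "v y * mker e z y = w y * mker e z y"
    proof (cases "y \<in> ball z e")
     case True
     then have "y \<in> ball x (2 * r)" using z \<open>e <= r\<close> dist_triangle[of x y z] by auto
     then show ?thesis by (simp add: w_def)
    qed (use mker_eq_0[OF e, of y z] in simp)
   qed
  qed
  also have "... <= (LBINT z. mol e w z)"
   by (intro set_integral_le_integral integrable_mol w e mol_nonneg) auto
  also have "... <= (LBINT z. w z)"
  proof -
   have "ennreal (LBINT z. mol e w z) <= ennreal (LBINT z. w z)"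
   proof -
    have "abs (mol e w z) = mol e w z" for z using mol_nonneg[of e w z] e w(2) by simp
    then show ?thesis
     using mol_nn_integral_le[OF w(1) e] w integrable_mol[OF w(1) e] mol_nonneg[of e w] e
     by (simp add: nn_integral_eq_integral)
   qed
   moreover have "0 <= (LBINT z. w z)" using w by (intro Bochner_Integration.integral_nonneg)
   ultimately show ?thesis by (simp add: ennreal_le_iff)
  qed
  also have "... = (LBINT y:ball x (2 * r). v y)" by (simp add: w_def set_integral_def)
  also have "... <= t * (?V * (2 * r) ^ ?n)" using r by (intro vb) auto
  also have "... = (?V * 2 ^ ?n * 1) * t * r ^ ?n" by (simp add: power_mult_distrib)
  also have "... <= (?V * 2 ^ ?n * (1 + ?V / ?I)) * t * r ^ ?n"
   using V t r by (intro mult_right_mono mult_left_mono) auto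
  finally show ?thesis .
 next
  case False
  have pw: "mol e v z <= ?V * 2 ^ ?n * t / ?I" if z: "z \<in> ball x r" for z
  proof -
   have "mol e v z <= (LBINT y:ball z e. v y) / (e ^ ?n * ?I)" by (rule mol_le_ball[OF v e])
   also have "(LBINT y:ball z e. v y) <= (LBINT y:ball x (2 * e). v y)"
   proof (intro set_integral_mono_set_nonneg v subsetI)
    fix y assume "y \<in> ball z e"
    then show "y \<in> ball x (2 * e)" using z False dist_triangle[of x y z] by auto
   qed auto
   also have "... <= t * (?V * (2 * e) ^ ?n)" using e by (intro vb) auto
   finally show ?thesis using e V by (simp add: divide_right_mono power_mult_distrib field_simps)
  qed
  have "(LBINT z:ball x r. mol e v z) <= (LBINT z:ball x r. ?V * 2 ^ ?n * t / ?I)"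
   by (rule set_integral_mono[OF _ set_integrable_const_ball pw])
    (use integrable_mol[OF v(1) e] in \<open>auto intro: set_integrable_lborel\<close>)
  also have "... = ?V * 2 ^ ?n * t / ?I * (?V * r ^ ?n)"
   using r by (simp add: set_integral_def content_ball)
  also have "... = (?V * 2 ^ ?n * (?V / ?I)) * t * r ^ ?n" by simp
  also have "... <= (?V * 2 ^ ?n * (1 + ?V / ?I)) * t * r ^ ?n"
   using V t r by (intro mult_right_mono mult_left_mono) auto
  finally show ?thesis .
 qed
qed

lemma integrable_mker_scaleR:
 fixes F :: "'a::euclidean_space => 'b::euclidean_space"
 assumes [measurable]: "F \<in> borel_funs" and B: "!!y. norm y <= 1 ==> norm (F y) <= B"
 shows "L1 (%y. mker 1 0 y *\<^sub>R F y)"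
proof (rule integrable_dominated)
 show "L1 (%y::'a. B * mker 1 0 y)" by (intro integrable_mult_right integrable_mker) simp
 show "(%y. mker 1 0 y *\<^sub>R F y) \<in> borel_measurable lborel" by measurable
 show "AE y. norm (mker 1 0 y *\<^sub>R F y) <= norm (B * mker 1 0 y)"
 proof (intro AE_I2)
  fix y :: 'a
  show "norm (mker 1 0 y *\<^sub>R F y) <= norm (B * mker 1 0 y)"
  proof (cases "norm y <= 1")
   case True
   then have "norm (F y) <= abs B" using B[of y] by linarith
   then have "abs (mker 1 0 y) * norm (F y) <= abs (mker 1 0 y) * abs B" by (intro mult_left_mono) auto
   then show ?thesis by (simp add: abs_mult mult.commute)
  next
   case False
   then have "mker 1 0 y = 0" by (intro mker_eq_0) auto
   then show ?thesis by simp
  qed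
 qed
qed

text \<open>Mollification with radius \<open>\<delta> x\<close>, in rescaled form: the kernel stays
  fixed and the radius sits in the argument, so differentiation in \<open>x\<close> reaches
  \<open>\<phi>\<close> instead of the kernel.\<close>

definition vmol :: "('a::euclidean_space => real) => ('a => real) => 'a => real" where
 "vmol \<phi> \<delta> x = (LBINT y. mker 1 0 y *\<^sub>R \<phi> (x + \<delta> x *\<^sub>R y))"

text \<open>The chain rule for \<open>\<phi> (x + \<delta> x *\<^sub>R y)\<close>: moving
  \<open>x\<close> also changes the radius, which contributes the component of \<open>G\<close>
  along \<open>y\<close> times the gradient \<open>d\<close> of \<open>\<delta>\<close>.\<close>

definition vgrad :: "('a::euclidean_space => 'a) => ('a => real) => ('a => 'a) => 'a => 'a" where
 "vgrad G \<delta> d x = (LBINT y. mker 1 0 y *\<^sub>R (G (x + \<delta> x *\<^sub>R y) + (G (x + \<delta> x *\<^sub>R y) \<bullet> y) *\<^sub>R d x))"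

locale variable_mollification =
 fixes \<phi> :: "'a::euclidean_space => real" and G :: "'a => 'a" and \<delta> :: "'a => real" and d :: "'a => 'a" and B :: real
 assumes \<phi>: "!!z. (\<phi> has_derivative (%h. G z \<bullet> h)) (at z)"
  and G: "uniformly_continuous_on UNIV G" and GB: "!!z. norm (G z) <= B" and \<phi>B: "!!z. abs (\<phi> z) <= B"
  and \<delta>: "!!z. (\<delta> has_derivative (%h. d z \<bullet> h)) (at z)"
  and dc: "continuous_on UNIV d" and d1: "!!z. norm (d z) <= 1"
begin

lemma G_cont: "continuous_on UNIV G" using G by (rule uniformly_continuous_imp_continuous)

lemma phi_cont: "continuous_on UNIV \<phi>"
 using \<phi> has_derivative_continuous by (blast intro: continuous_at_imp_continuous_on)

lemma delta_cont: "continuous_on UNIV \<delta>"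
 using \<delta> has_derivative_continuous by (blast intro: continuous_at_imp_continuous_on)

lemma B_nonneg: "B >= 0" using GB[of undefined] norm_ge_zero order_trans by blast

lemma measurable_G [measurable]: "G \<in> borel_funs"
 by (intro borel_measurable_continuous_onI G_cont)

lemma measurable_phi [measurable]: "\<phi> \<in> borel_funs"
 by (intro borel_measurable_continuous_onI phi_cont)

definition integrand :: "'a => 'a => 'a" where
 "integrand x y = G (x + \<delta> x *\<^sub>R y) + (G (x + \<delta> x *\<^sub>R y) \<bullet> y) *\<^sub>R d x"

lemma measurable_integrand [measurable]: "integrand x \<in> borel_funs"
 unfolding integrand_def[abs_def] by measurable

lemma integrand_bound:
 assumes "norm y <= 1" shows "norm (integrand x y) <= 2 * B"
proof -
 have "abs (G (x + \<delta> x *\<^sub>R y) \<bullet> y) <= norm (G (x + \<delta> x *\<^sub>R y)) * norm y" by (rule Cauchy_Schwarz_ineq2)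
 also have "... <= B * 1" using GB assms B_nonneg by (intro mult_mono) auto
 finally have "abs (G (x + \<delta> x *\<^sub>R y) \<bullet> y) * norm (d x) <= B * 1"
  using d1 B_nonneg by (intro mult_mono) auto
 then have "norm ((G (x + \<delta> x *\<^sub>R y) \<bullet> y) *\<^sub>R d x) <= B" by simp
 then have "norm (G (x + \<delta> x *\<^sub>R y)) + norm ((G (x + \<delta> x *\<^sub>R y) \<bullet> y) *\<^sub>R d x) <= 2 * B"
  using GB[of "x + \<delta> x *\<^sub>R y"] by linarith
 then show ?thesis unfolding integrand_def by (rule norm_triangle_le)
qed

lemma integrable_integrand: "L1 (%y. mker 1 0 y *\<^sub>R integrand x y)"
 by (rule integrable_mker_scaleR[OF measurable_integrand integrand_bound])

lemma integrable_vmol: "L1 (%y. mker 1 0 y *\<^sub>R \<phi> (x + c *\<^sub>R y))"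
 by (rule integrable_mker_scaleR[of _ B]) (use \<phi>B in auto)

lemma vgrad_eq: "vgrad G \<delta> d x = (LBINT y. mker 1 0 y *\<^sub>R integrand x y)"
 by (simp add: vgrad_def integrand_def)

lemma integrable_vgrad_inner:
 "L1 (%y. mker 1 0 y * (G (x + \<delta> x *\<^sub>R y) \<bullet> (w + (d x \<bullet> w) *\<^sub>R y)))"
 and vgrad_inner: "vgrad G \<delta> d x \<bullet> w = (LBINT y. mker 1 0 y * (G (x + \<delta> x *\<^sub>R y) \<bullet> (w + (d x \<bullet> w) *\<^sub>R y)))"
proof -
 have eq: "(mker 1 0 y *\<^sub>R integrand x y) \<bullet> w = mker 1 0 y * (G (x + \<delta> x *\<^sub>R y) \<bullet> (w + (d x \<bullet> w) *\<^sub>R y))" for y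
  by (simp add: integrand_def inner_add_left inner_add_right mult.commute)
 show "L1 (%y. mker 1 0 y * (G (x + \<delta> x *\<^sub>R y) \<bullet> (w + (d x \<bullet> w) *\<^sub>R y)))"
  using integrable_inner_left[OF integrable_integrand[of x], of w] by (simp only: eq)
 show "vgrad G \<delta> d x \<bullet> w = (LBINT y. mker 1 0 y * (G (x + \<delta> x *\<^sub>R y) \<bullet> (w + (d x \<bullet> w) *\<^sub>R y)))"
  unfolding vgrad_eq using integral_inner_left[OF integrable_integrand[of x], of w] by (simp only: eq)
qed

lemma vmol_has_derivative: "(vmol \<phi> \<delta> has_derivative (%h. vgrad G \<delta> d x \<bullet> h)) (at x)"
 unfolding has_derivative_at_alt
proof (intro conjI allI impI)
 fix c :: real assume c: "c > 0"
 \<comment> \<open>A displacement \<open>k\<close> of \<open>x\<close> moves the argument by at most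
   \<open>3 * norm k\<close>, which gives the 3; the remainder in expanding \<open>\<delta>\<close>
   is multiplied by \<open>G\<close>, which gives the \<open>B\<close>.\<close>
 define \<eta> where "\<eta> = min 1 (c / (3 + B))"
 have \<eta>: "\<eta> > 0" "\<eta> <= 1" "\<eta> * (3 + B) <= c"
 proof -
  have "3 + B > 0" using B_nonneg by simp
  then show "\<eta> > 0" "\<eta> <= 1" using c by (auto simp: \<eta>_def)
  have "\<eta> * (3 + B) <= c / (3 + B) * (3 + B)" using \<open>3 + B > 0\<close> by (intro mult_right_mono) (auto simp: \<eta>_def)
  then show "\<eta> * (3 + B) <= c" using \<open>3 + B > 0\<close> by simp
 qed
 obtain r1 where r1: "r1 > 0" "!!z h. norm h < r1 ==> abs (\<phi> (z + h) - \<phi> z - G z \<bullet> h) <= \<eta> * norm h"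
  by (rule uniformly_differentiable[OF \<phi> G \<eta>(1)]) blast
 obtain r2 where r2: "r2 > 0" "!!y. norm (y - x) < r2 ==> norm (\<delta> y - \<delta> x - d x \<bullet> (y - x)) <= \<eta> * norm (y - x)"
  using \<delta>[of x] \<eta>(1) unfolding has_derivative_at_alt by blast
 show "\<exists>r>0. \<forall>x'. norm (x' - x) < r --> norm (vmol \<phi> \<delta> x' - vmol \<phi> \<delta> x - vgrad G \<delta> d x \<bullet> (x' - x)) <= c * norm (x' - x)"
 proof (intro exI[of _ "min r2 (r1 / 3)"] conjI allI impI)
  fix x' assume x': "norm (x' - x) < min r2 (r1 / 3)"
  define k where "k = x' - x"
  define q where "q = \<delta> x' - \<delta> x - d x \<bullet> k"
  have q: "abs q <= \<eta> * norm k" using r2(2)[of x'] x' by (simp add: q_def k_def)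
  have dk: "abs (d x \<bullet> k) <= norm k"
   using Cauchy_Schwarz_ineq2[of "d x" k] d1[of x] mult_right_mono[OF d1[of x] norm_ge_zero[of k]] by simp
  have pw: "abs (\<phi> (x' + \<delta> x' *\<^sub>R y) - \<phi> (x + \<delta> x *\<^sub>R y) - integrand x y \<bullet> k) <= c * norm k" if y: "norm y <= 1" for y
  proof -
   define z where "z = x + \<delta> x *\<^sub>R y"
   define h where "h = k + (\<delta> x' - \<delta> x) *\<^sub>R y"
   have "abs (\<delta> x' - \<delta> x) <= abs (d x \<bullet> k) + abs q" by (simp add: q_def)
   also have "... <= 2 * norm k" using dk q mult_right_mono[OF \<eta>(2) norm_ge_zero[of k]] by simp
   finally have dd: "abs (\<delta> x' - \<delta> x) <= 2 * norm k" .
   have "norm h <= norm k + abs (\<delta> x' - \<delta> x) * norm y" unfolding h_def by (rule norm_triangle_le) simp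
   also have "... <= norm k + 2 * norm k * 1" using dd y by (intro add_left_mono mult_mono) auto
   finally have hk: "norm h <= 3 * norm k" by simp
   then have "norm h < r1" using x' by (simp add: k_def)
   then have 1: "abs (\<phi> (z + h) - \<phi> z - G z \<bullet> h) <= \<eta> * norm h" by (rule r1)
   have zh: "z + h = x' + \<delta> x' *\<^sub>R y" by (simp add: z_def h_def k_def algebra_simps)
   have Gh: "G z \<bullet> h = integrand x y \<bullet> k + (G z \<bullet> y) * q"
    by (simp add: h_def integrand_def z_def[symmetric] inner_add_left inner_add_right q_def algebra_simps)
   have "abs (G z \<bullet> y) <= B" using Cauchy_Schwarz_ineq2[of "G z" y] mult_mono[OF GB[of z] y] B_nonneg by simp
   then have "abs ((G z \<bullet> y) * q) <= B * (\<eta> * norm k)" unfolding abs_mult using q B_nonneg by (intro mult_mono) auto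
   moreover have "\<eta> * norm h <= \<eta> * (3 * norm k)" using hk \<eta> by (intro mult_left_mono) auto
   ultimately have "abs (\<phi> (z + h) - \<phi> z - integrand x y \<bullet> k) <= \<eta> * (3 * norm k) + B * (\<eta> * norm k)"
    using 1 unfolding Gh by linarith
   also have "... = (\<eta> * (3 + B)) * norm k" by (simp add: algebra_simps)
   also have "... <= c * norm k" using \<eta> by (intro mult_right_mono) auto
   finally have "abs (\<phi> (z + h) - \<phi> z - integrand x y \<bullet> k) <= c * norm k" .
   from this[unfolded zh, unfolded z_def] show ?thesis .
  qed
  have ik: "L1 (%y. mker 1 0 y *\<^sub>R (integrand x y \<bullet> k))"
   using integrable_inner_left[OF integrable_integrand[of x], of k] by simp
  have ck: "L1 (%y::'a. mker 1 0 y * (c * norm k))"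
   by (intro integrable_mult_left integrable_mker) auto
  have "vmol \<phi> \<delta> x' - vmol \<phi> \<delta> x - vgrad G \<delta> d x \<bullet> k =
   (LBINT y. mker 1 0 y * (\<phi> (x' + \<delta> x' *\<^sub>R y) - \<phi> (x + \<delta> x *\<^sub>R y) - integrand x y \<bullet> k))"
   unfolding vmol_def vgrad_eq using integral_inner_left[OF integrable_integrand[of x], of k] integrable_vmol ik
   by (simp add: right_diff_distrib)
  also have "abs ... <= (LBINT y. mker 1 (0::'a) y * (c * norm k))"
  proof (rule order_trans[OF integral_abs_bound integral_mono[OF _ ck]])
   show "L1 (%y. abs (mker 1 0 y * (\<phi> (x' + \<delta> x' *\<^sub>R y) - \<phi> (x + \<delta> x *\<^sub>R y) - integrand x y \<bullet> k)))"
    using integrable_vmol[of x' "\<delta> x'"] integrable_vmol[of x "\<delta> x"] ik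
    by (intro integrable_abs) (simp add: right_diff_distrib)
   fix y :: 'a
   show "abs (mker 1 0 y * (\<phi> (x' + \<delta> x' *\<^sub>R y) - \<phi> (x + \<delta> x *\<^sub>R y) - integrand x y \<bullet> k)) <= mker 1 0 y * (c * norm k)"
   proof (cases "norm y <= 1")
    case True
    then show ?thesis unfolding abs_mult using mker_nonneg[of 1 0 y] pw[OF True]
     by (simp add: mult_left_mono)
   next
    case False
    then have "mker 1 0 y = 0" by (intro mker_eq_0) auto
    then show ?thesis by simp
   qed
  qed
  also have "... = c * norm k" by (simp add: integral_mker)
  finally show "norm (vmol \<phi> \<delta> x' - vmol \<phi> \<delta> x - vgrad G \<delta> d x \<bullet> (x' - x)) <= c * norm (x' - x)"
   by (simp add: k_def)
 qed (use r1 r2 in auto)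
qed (rule bounded_linear_inner_right)

lemma vgrad_cont: "continuous_on UNIV (vgrad G \<delta> d)"
 unfolding continuous_on_sequentially
proof (intro allI ballI impI, elim conjE)
 fix X :: "nat => 'a" and x assume X: "X \<longlonglongrightarrow> x"
 have c: "(%n. F (X n)) \<longlonglongrightarrow> F x" if "continuous_on UNIV F" for F :: "'a => 'c::real_normed_vector"
  using that X by (auto simp: continuous_on_sequentially o_def)
 have "(%n. LBINT y. mker 1 0 y *\<^sub>R integrand (X n) y) \<longlonglongrightarrow> (LBINT y. mker 1 0 y *\<^sub>R integrand x y)"
 proof (rule integral_dominated_convergence[where w="%y. mker 1 0 y * (2 * B)"])
  show "L1 (%y::'a. mker 1 0 y * (2 * B))" by (intro integrable_mult_left integrable_mker) auto
  show "AE y. (%n. mker 1 0 y *\<^sub>R integrand (X n) y) \<longlonglongrightarrow> mker 1 0 y *\<^sub>R integrand x y"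
  proof (intro AE_I2 tendsto_scaleR tendsto_const)
   fix y
   have "continuous_on UNIV (%x. integrand x y)"
    unfolding integrand_def
    by (intro continuous_intros dc delta_cont continuous_on_compose2[OF G_cont]) auto
   from c[OF this] show "(%n. integrand (X n) y) \<longlonglongrightarrow> integrand x y" .
  qed
  show "AE y. norm (mker 1 0 y *\<^sub>R integrand (X n) y) <= mker 1 0 y * (2 * B)" for n
  proof (intro AE_I2)
   fix y :: 'a
   show "norm (mker 1 0 y *\<^sub>R integrand (X n) y) <= mker 1 0 y * (2 * B)"
   proof (cases "norm y <= 1")
    case True
    then show ?thesis using mker_nonneg[of 1 0 y] integrand_bound[OF True, of "X n"] by (simp add: mult_left_mono)
   next
    case False
    then have "mker 1 0 y = 0" by (intro mker_eq_0) auto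
    then show ?thesis by simp
   qed
  qed
 qed measurable
 then show "(vgrad G \<delta> d \<circ> X) \<longlonglongrightarrow> vgrad G \<delta> d x" by (simp add: vgrad_eq o_def)
qed

end

text \<open>The kernel is even. A constant gradient therefore does not feel the variation of the
  radius.\<close>

lemma integral_mker_odd: "(LBINT y. mker 1 0 y *\<^sub>R (v \<bullet> y)) = 0"
proof -
 let ?f = "%y. mker 1 0 y *\<^sub>R (v \<bullet> y)"
 have "(LBINT y. ?f y) = (LBINT y. ?f (0 + (-1) *\<^sub>R y))"
  by (subst integral_affine_euclidean(1)) auto
 also have "... = - (LBINT y. ?f y)" by (simp add: mker_def bump_def)
 finally show ?thesis by simp
qed

text \<open>The difference quotient in the direction of \<open>V\<close> itself tends to
  \<open>V \<bullet> V\<close>, while its absolute value is at most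
  \<open>L * norm V\<close>.\<close>

lemma inner_le_of_lipschitz:
 fixes f :: "'a::euclidean_space => real"
 assumes f: "(f has_derivative (%h. V \<bullet> h)) (at x)" and L: "!!y. abs (f y - f x) <= L * norm (y - x)"
 shows "norm V <= L"
proof -
 have "((%s. f (x + s *\<^sub>R V)) has_real_derivative V \<bullet> V) (at 0)"
 proof -
  have "((%s. x + s *\<^sub>R V) has_derivative (%t. t *\<^sub>R V)) (at 0)" by (auto intro!: derivative_eq_intros)
  from has_derivative_compose[OF this, of f "%h. V \<bullet> h"] f show ?thesis
   by (simp add: has_field_derivative_def mult_commute_abs)
 qed
 then have "((%s. (f (x + s *\<^sub>R V) - f x) / s) \<longlongrightarrow> V \<bullet> V) (at 0)" by (simp add: DERIV_def)
 then have "V \<bullet> V <= L * norm V"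
 proof (rule tendsto_upperbound)
  show "\<forall>\<^sub>F s in at 0. (f (x + s *\<^sub>R V) - f x) / s <= L * norm V"
   unfolding eventually_at
  proof (intro exI[of _ 1] conjI ballI impI)
   fix s :: real assume s: "s ~= 0 & dist s 0 < 1"
   have "abs ((f (x + s *\<^sub>R V) - f x) / s) <= (L * norm (s *\<^sub>R V)) / abs s"
    unfolding abs_divide using L[of "x + s *\<^sub>R V"] by (intro divide_right_mono) auto
   also have "... = L * norm V" using s by simp
   finally show "(f (x + s *\<^sub>R V) - f x) / s <= L * norm V" by linarith
  qed simp
 qed simp
 then have "norm V * norm V <= L * norm V" by (simp add: dot_square_norm power2_eq_square)
 moreover have "L >= 0"
 proof -
  obtain b :: 'a where "b \<in> Basis" using nonempty_Basis by blast
  then show ?thesis using order_trans[OF abs_ge_zero L[of "x + b"]] by (simp add: norm_Basis)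
 qed
 ultimately show ?thesis by (cases "norm V = 0") (auto simp: mult_le_cancel_right)
qed

lemma mol_lipschitz:
 fixes \<psi> :: "'a::euclidean_space => real"
 assumes i: "L1 \<psi>" and L: "!!x y. abs (\<psi> x - \<psi> y) <= L * norm (x - y)" and e: "e > 0"
 shows "abs (mol e \<psi> x - mol e \<psi> y) <= L * norm (x - y)" and "abs (mol e \<psi> x - \<psi> x) <= L * e"
proof -
 have L0: "L >= 0"
 proof -
  obtain b :: 'a where "b \<in> Basis" using nonempty_Basis by blast
  then show ?thesis using order_trans[OF abs_ge_zero L[of b 0]] by (simp add: norm_Basis)
 qed
 have tr: "mol e \<psi> x = (LBINT w. \<psi> (x + w) * mker e 0 w)" for x
  unfolding mol_def using integral_affine_euclidean(1)[of 1 "%z. \<psi> z * mker e x z" x]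
  by (simp add: mker_translate[of e x])
 have ti: "L1 (%w. \<psi> (x + w) * mker e 0 w)" for x
  using integral_affine_euclidean(2)[of 1 "%z. \<psi> z * mker e x z" x] integrable_mult_mker[OF i e, of x]
  by (simp add: mker_translate[of e x])
 have "abs (mol e \<psi> x - mol e \<psi> y) = abs (LBINT w. (\<psi> (x + w) - \<psi> (y + w)) * mker e 0 w)"
  unfolding tr using ti by (simp add: left_diff_distrib)
 also have "... <= (LBINT w. (L * norm (x - y)) * mker e (0::'a) w)"
 proof (rule order_trans[OF integral_abs_bound integral_mono])
  show "L1 (%w. abs ((\<psi> (x + w) - \<psi> (y + w)) * mker e 0 w))"
   using ti[of x] ti[of y] by (intro integrable_abs) (simp add: left_diff_distrib)
  show "L1 (%w::'a. (L * norm (x - y)) * mker e 0 w)"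
   using e by (intro integrable_mult_right integrable_mker)
  show "abs ((\<psi> (x + w) - \<psi> (y + w)) * mker e 0 w) <= (L * norm (x - y)) * mker e 0 w" for w
   using L[of "x + w" "y + w"] mker_nonneg[OF e, of 0 w] by (simp add: abs_mult mult_right_mono)
 qed
 finally show "abs (mol e \<psi> x - mol e \<psi> y) <= L * norm (x - y)" using e by (simp add: integral_mker)
 have "abs (mol e \<psi> x - \<psi> x) = abs (LBINT w. (\<psi> (x + w) - \<psi> x) * mker e 0 w)"
  unfolding tr using ti integrable_mker[OF e, of "0::'a"] integral_mker[OF e, of "0::'a"]
  by (simp add: left_diff_distrib)
 also have "... <= (LBINT w. (L * e) * mker e (0::'a) w)"
 proof (rule order_trans[OF integral_abs_bound integral_mono])
  show "L1 (%w. abs ((\<psi> (x + w) - \<psi> x) * mker e 0 w))"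
   using ti[of x] integrable_mker[OF e, of "0::'a"] by (intro integrable_abs) (simp add: left_diff_distrib)
  show "L1 (%w::'a. (L * e) * mker e 0 w)"
   using e by (intro integrable_mult_right integrable_mker)
  fix w :: 'a
  show "abs ((\<psi> (x + w) - \<psi> x) * mker e 0 w) <= (L * e) * mker e 0 w"
  proof (cases "w \<in> ball 0 e")
   case True
   have "abs (\<psi> (x + w) - \<psi> x) <= L * norm w" using L[of "x + w" x] by simp
   also have "... <= L * e" using True L0 by (intro mult_left_mono) auto
   finally show ?thesis using mker_nonneg[OF e, of 0 w] by (simp add: abs_mult mult_right_mono)
  qed (simp add: mker_eq_0[OF e])
 qed
 finally show "abs (mol e \<psi> x - \<psi> x) <= L * e" using e by (simp add: integral_mker)
qed

lemma continuous_integral_gradk: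
 fixes \<psi> :: "'a::euclidean_space => real"
 assumes i: "L1 \<psi>" and e: "e > 0"
 shows "continuous_on UNIV (%x. LBINT z. \<psi> z *\<^sub>R gradk e (z - x))"
 unfolding continuous_on_sequentially
proof (intro allI ballI impI, elim conjE)
 fix X :: "nat => 'a" and x assume X: "X \<longlonglongrightarrow> x"
 have [measurable]: "\<psi> \<in> borel_funs" using i by (simp add: measurable_L1)
 obtain B where B: "!!w::'a. norm (gradk e w) <= B" using gradk_bounded[OF e] by blast
 have "(%n. LBINT z. \<psi> z *\<^sub>R gradk e (z - X n)) \<longlonglongrightarrow> (LBINT z. \<psi> z *\<^sub>R gradk e (z - x))"
 proof (rule integral_dominated_convergence[where w="%z. abs (\<psi> z) * B"])
  show "L1 (%z. abs (\<psi> z) * B)" using i by auto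
  show "AE z. (%n. \<psi> z *\<^sub>R gradk e (z - X n)) \<longlonglongrightarrow> \<psi> z *\<^sub>R gradk e (z - x)"
  proof (intro AE_I2 tendsto_scaleR tendsto_const)
   fix z
   have "(%n. z - X n) \<longlonglongrightarrow> z - x" using X by (intro tendsto_intros)
   then show "(%n. gradk e (z - X n)) \<longlonglongrightarrow> gradk e (z - x)"
    using continuous_gradk[of UNIV e] by (auto simp: continuous_on_sequentially o_def)
  qed
  show "AE z. norm (\<psi> z *\<^sub>R gradk e (z - X n)) <= abs (\<psi> z) * B" for n
   using B by (intro AE_I2) (simp add: mult_left_mono)
 qed measurable
 then show "((%x. LBINT z. \<psi> z *\<^sub>R gradk e (z - x)) \<circ> X) \<longlonglongrightarrow> (LBINT z. \<psi> z *\<^sub>R gradk e (z - x))"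
  by (simp add: o_def)
qed

text \<open>Minkowski's integral inequality, obtained by pairing the vector of integrals with itself
  and applying Cauchy-Schwarz under the integral. The constant is 1 for every index set, which keeps
  later constants free of \<open>m\<close>.\<close>

lemma L2_set_integral_le:
 assumes f: "!!i. i \<in> A ==> integrable M (f i)" and g: "integrable M g"
  and le: "AE y in M. L2_set (%i. f i y) A <= g y"
 shows "L2_set (%i. \<integral>y. f i y \<partial>M) A <= (\<integral>y. g y \<partial>M)"
proof -
 define a where "a i = (\<integral>y. f i y \<partial>M)" for i
 define N where "N = L2_set a A"
 have g0: "0 <= (\<integral>y. g y \<partial>M)"
  using le by (intro integral_nonneg_AE) (auto elim!: eventually_mono intro: order_trans[OF L2_set_nonneg])
 have N0: "N >= 0" by (simp add: N_def L2_set_nonneg)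
 have "N * N = (\<Sum>i\<in>A. (a i)\<^sup>2)"
  unfolding N_def L2_set_def by (simp add: sum_nonneg)
 also have "... = (\<Sum>i\<in>A. \<integral>y. a i * f i y \<partial>M)" by (simp add: a_def power2_eq_square)
 also have "... = (\<integral>y. (\<Sum>i\<in>A. a i * f i y) \<partial>M)"
  using f by (intro Bochner_Integration.integral_sum[symmetric] integrable_mult_right)
 also have "... <= (\<integral>y. N * g y \<partial>M)"
 proof (intro integral_mono_AE Bochner_Integration.integrable_sum integrable_mult_right f g)
  show "AE y in M. (\<Sum>i\<in>A. a i * f i y) <= N * g y"
   using le
  proof eventually_elim
   case (elim y)
   have "(\<Sum>i\<in>A. a i * f i y) <= (\<Sum>i\<in>A. abs (a i) * abs (f i y))"
    by (intro sum_mono) (metis abs_ge_self abs_mult)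
   also have "... <= N * L2_set (%i. f i y) A" unfolding N_def by (rule L2_set_mult_ineq)
   also have "... <= N * g y" using N0 elim by (intro mult_left_mono)
   finally show ?case .
  qed
 qed
 also have "... = N * (\<integral>y. g y \<partial>M)" by simp
 finally have "N * N <= N * (\<integral>y. g y \<partial>M)" .
 then have "N <= (\<integral>y. g y \<partial>M)" using N0 g0 by (cases "N = 0") (auto simp: mult_le_cancel_left)
 then show ?thesis by (simp add: N_def a_def[abs_def])
qed

section \<open>Constant coefficient forms and truncation of the gradient\<close>

text \<open>The value of the form with constant coefficients \<open>c\<close> on the columns of the
  matrix with rows \<open>A i\<close>, for \<open>i < m\<close>. For a derivative this is the
  pullback evaluated on the standard basis.\<close>

definition form_at :: "nat => (('n::{finite,wellorder} => nat) => real) => (nat => real^'n::_) => real" where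
 "form_at m c A = (\<Sum>I\<in>multi_indices m. c I * det (\<chi> k j. A (I k) $ j))"

lemma multi_indices_less: "I \<in> multi_indices m ==> I k < m"
 by (auto simp: multi_indices_def)

lemma form_at_zero:
 assumes "!!i. i < m ==> A i = 0"
 shows "form_at m c A = 0"
proof -
 have "det (\<chi> k' j. A (I k') $ j) = 0" if "I \<in> multi_indices m" for I
  using assms multi_indices_less[OF that] by (simp add: det_def power_0_left)
 then show ?thesis by (simp add: form_at_def)
qed

lemma tendsto_form_at:
 assumes "!!i j. i < m ==> ((%x. A x i $ j) \<longlongrightarrow> B i $ j) F"
 shows "((%x. form_at m c (A x)) \<longlongrightarrow> form_at m c B) F"
 unfolding form_at_def det_def vec_lambda_beta
 by (intro tendsto_sum tendsto_mult tendsto_const tendsto_prod assms multi_indices_less)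

lemma measurable_form_at:
 assumes "!!i j. i < m ==> (%x. A x i $ j) \<in> borel_measurable M"
 shows "(%x. form_at m c (A x)) \<in> borel_measurable M"
 unfolding form_at_def det_def
 by (intro borel_measurable_sum borel_measurable_times borel_measurable_const borel_measurable_prod)
  (auto intro!: assms multi_indices_less)

lemma set_integral_ball_affine:
 fixes f :: "'a::euclidean_space => real"
 assumes "s > 0"
 shows "(LBINT y:ball 0 1. f (x + s *\<^sub>R y)) = (LBINT y:ball x s. f y) / s ^ DIM('a)"
proof -
 have mem: "x + s *\<^sub>R y \<in> ball x s \<longleftrightarrow> y \<in> ball 0 1" for y
  using assms by (simp add: dist_norm)
 have "(LBINT y:ball 0 1. f (x + s *\<^sub>R y)) =
  (LBINT y. (indicator (ball x s) (x + s *\<^sub>R y) *\<^sub>R f (x + s *\<^sub>R y)))"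
  unfolding set_integral_def
  using mem by (intro Bochner_Integration.integral_cong) (auto simp: indicator_def)
 also have "... = (LBINT y:ball x s. f y) / s ^ DIM('a)"
  using assms by (subst integral_affine_euclidean(1)) (auto simp: set_integral_def divide_inverse mult.commute)
 finally show ?thesis .
qed

text \<open>Mollification with a radius comparable to the distance to \<open>F\<close> makes all
  partial derivatives at most \<open>T\<close>, including those off \<open>F\<close>, where nothing
  is known about \<open>G\<close>. The form of the new gradient has integral zero, so its integral
  over \<open>F\<close> is minus that over the complement, at most \<open>\<kappa> T ^ n\<close>
  times its volume. As the radius tends to 0 on \<open>F\<close>, the original gradient
  returns.\<close>

lemma smooth_truncation:
 fixes \<phi> :: "nat => real^'n::{finite,wellorder} => real" and G :: "nat => real^'n::_ => real^'n::_"
 assumes \<phi>: "!!i z. i < m ==> (\<phi> i has_derivative (%h. G i z \<bullet> h)) (at z)"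
  and G: "!!i. i < m ==> uniformly_continuous_on UNIV (G i)"
  and supp: "!!i z. i < m ==> z \<notin> cball x0 R ==> \<phi> i z = 0" "!!i z. i < m ==> z \<notin> cball x0 R ==> G i z = 0"
  and W: "L1 W" "!!z. 0 <= W z" and WG: "!!z w. L2_set (%i. G i z \<bullet> w) {..<m} <= W z * norm w"
  and F: "closed F" "F ~= {}" "- F \<subseteq> ball x0 R'"
  and WF: "!!x r. x \<in> F ==> r > 0 ==> (LBINT z:ball x r. W z) <= K * r ^ CARD('n)" and K: "K >= 0"
  and fb: "!!A. abs (form_at m c A) <= \<kappa> * (\<Prod>j\<in>UNIV. L2_set (%i. A i $ j) {..<m})" and \<kappa>: "\<kappa> >= 0"
 shows "abs (LBINT x:F. form_at m c (%i. G i x)) <=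
   \<kappa> * (3/2 * 3 ^ CARD('n) / bump_mass TYPE(real^'n::_) * K) ^ CARD('n) * vol (- F)"
proof -
 let ?n = "CARD('n)" and ?I = "bump_mass TYPE(real^'n::_)"
 have I: "?I > 0" by (rule bump_mass_pos)
 define T where "T = 3/2 * 3 ^ ?n / ?I * K"
 have T: "T >= 0" using I K by (simp add: T_def)
 \<comment> \<open>Half the distance has Lipschitz constant 1/2, so varying the radius enlarges a
   direction of length 1 to length 3/2 at most.\<close>
 define \<psi> where "\<psi> x = infdist x F / 2" for x
 have \<psi>0: "\<psi> x = 0" if "x \<in> F" for x using that by (simp add: \<psi>_def)
 have \<psi>nn: "\<psi> x >= 0" for x by (simp add: \<psi>_def infdist_nonneg)
 have \<psi>c: "continuous_on UNIV \<psi>" unfolding \<psi>_def by (intro continuous_intros) auto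
 have \<psi>s: "\<psi> z = 0" if "z \<notin> cball x0 R'" for z using that F(3) by (intro \<psi>0) auto
 obtain B\<psi> where B\<psi>: "!!z. norm (\<psi> z) <= B\<psi>" using bounded_compact_support[OF \<psi>c \<psi>s] by blast
 have \<psi>i: "L1 \<psi>"
  by (rule integrable_compact_support[of _ B\<psi> x0 R']) (use B\<psi> \<psi>s \<psi>c in \<open>auto intro: borel_measurable_continuous_onI\<close>)
 have \<psi>L: "abs (\<psi> x - \<psi> y) <= 1/2 * norm (x - y)" for x y
  using infdist_triangle_abs[of x F y] unfolding \<psi>_def diff_divide_distrib[symmetric] abs_divide by (simp add: dist_norm)
 define e where "e k = 1 / real (Suc k)" for k
 have e: "e k > 0" "e k <= 1" for k by (auto simp: e_def)
 \<comment> \<open>The distance is neither differentiable nor positive on \<open>F\<close>.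
   Mollifying it repairs the first defect with error at most \<open>e k / 2\<close>, adding
   \<open>e k\<close> the second.\<close>
 define \<delta> where "\<delta> k x = mol (e k) \<psi> x + e k" for k x
 let ?p = "%k x y. x + \<delta> k x *\<^sub>R y"
 define d where "d k x = - (LBINT z. \<psi> z *\<^sub>R gradk (e k) (z - x))" for k x
 have mder: "(mol (e k) \<psi> has_derivative (%h. d k x \<bullet> h)) (at x)" for k x
  unfolding d_def by (rule mol_has_derivative[OF \<psi>i e(1)])
 have \<delta>der: "(\<delta> k has_derivative (%h. d k x \<bullet> h)) (at x)" for k x
  unfolding \<delta>_def[abs_def] using mder[of k x] by (auto intro!: derivative_eq_intros)
 have dn: "norm (d k x) <= 1/2" for k x
  by (rule inner_le_of_lipschitz[OF mder mol_lipschitz(1)[OF \<psi>i \<psi>L e(1)]])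
 have dc: "continuous_on UNIV (d k)" for k
  unfolding d_def[abs_def] by (intro continuous_intros continuous_integral_gradk \<psi>i e)
 have \<delta>b: "\<psi> x + e k / 2 <= \<delta> k x" "\<delta> k x <= \<psi> x + 3/2 * e k" for k x
  using mol_lipschitz(2)[OF \<psi>i \<psi>L e(1)[of k], of x] unfolding \<delta>_def by linarith+
 have \<delta>pos: "\<delta> k x > 0" for k x using \<delta>b(1)[of x k] \<psi>nn[of x] e(1)[of k] by linarith
 have Gc: "continuous_on UNIV (G i)" if "i < m" for i using G[OF that] by (rule uniformly_continuous_imp_continuous)
 have \<phi>c: "continuous_on UNIV (\<phi> i)" if "i < m" for i
  using \<phi>[OF that] has_derivative_continuous by (blast intro: continuous_at_imp_continuous_on)
 have vm: "\<exists>B. \<forall>k. variable_mollification (\<phi> i) (G i) (\<delta> k) (d k) B" if i: "i < m" for i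
 proof -
  obtain B1 where B1: "!!z. norm (G i z) <= B1" using bounded_compact_support[OF Gc[OF i] supp(2)[OF i]] by blast
  obtain B2 where B2: "!!z. norm (\<phi> i z) <= B2" using bounded_compact_support[OF \<phi>c[OF i] supp(1)[OF i]] by blast
  have "variable_mollification (\<phi> i) (G i) (\<delta> k) (d k) (max B1 B2)" for k
  proof
   show "norm (d k z) <= 1" for z using dn[of k z] by linarith
   show "norm (G i z) <= max B1 B2" for z using B1[of z] by simp
   show "abs (\<phi> i z) <= max B1 B2" for z using B2[of z] by simp
  qed (use \<phi> G i \<delta>der dc in auto)
  then show ?thesis by blast
 qed
 define X where "X k i = vmol (\<phi> i) (\<delta> k)" for k i
 define P where "P k i = vgrad (G i) (\<delta> k) (d k)" for k i
 have Xder: "(X k i has_derivative (%h. P k i x \<bullet> h)) (at x)" if "i < m" for i k x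
  using vm[OF that] variable_mollification.vmol_has_derivative unfolding X_def P_def by blast
 have Pc: "continuous_on UNIV (P k i)" if "i < m" for i k
  using vm[OF that] variable_mollification.vgrad_cont unfolding P_def by blast
 \<comment> \<open>Beyond \<open>R'\<close> only points of \<open>F\<close> occur, where the radius
   is at most 3/2; the margin 2 keeps every averaging ball there away from the support of
   \<open>\<phi>\<close>.\<close>
 obtain a where a: "cball x0 (max R R' + 2) \<subseteq> cbox (-a) a"
  using bounded_subset_cbox_symmetric[OF bounded_cball] by blast
 let ?C = "cbox (-a) a"
 have out: "\<phi> i (?p k x y) = 0 & G i (?p k x y) = 0" if x: "x \<notin> ?C" and i: "i < m" and y: "norm y <= 1" for x i k y
 proof -
  have "\<not> dist x0 x <= max R R' + 2" using x a by (auto simp: subset_iff)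
  then have far: "dist x0 x > max R R' + 2" by simp
  then have "x \<in> F" using F(3) by (auto simp: subset_iff)
  then have "\<delta> k x <= 3/2" using \<delta>b(2)[of k x] \<psi>0 e(2)[of k] by simp
  then have "norm (\<delta> k x *\<^sub>R y) <= 3/2 * 1" using y \<delta>pos[of k x] unfolding norm_scaleR by (intro mult_mono) auto
  then have "dist x (?p k x y) <= 3/2" by (simp add: dist_norm)
  then have "?p k x y \<notin> cball x0 R"
   using far dist_triangle[of x0 x "?p k x y"] by (auto simp: dist_commute)
  then show ?thesis using supp i by blast
 qed
 have mk0: "mker 1 0 y = 0" if "\<not> norm y <= 1" for y :: "real^'n::_" using that by (intro mker_eq_0) auto
 have X0: "X k i x = 0" if "x \<notin> ?C" "i < m" for k i x
 proof -
  have "mker 1 0 y *\<^sub>R \<phi> i (?p k x y) = 0" for y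
   using out[OF that, of y k] mk0[of y] by (cases "norm y <= 1") auto
  then show ?thesis unfolding X_def vmol_def by (simp only: Bochner_Integration.integral_zero)
 qed
 have P0: "P k i x = 0" if "x \<notin> ?C" "i < m" for k i x
 proof -
  have "mker 1 0 y *\<^sub>R (G i (?p k x y) + (G i (?p k x y) \<bullet> y) *\<^sub>R d k x) = 0" for y
   using out[OF that, of y k] mk0[of y] by (cases "norm y <= 1") auto
  then show ?thesis unfolding P_def vgrad_def by (simp only: Bochner_Integration.integral_zero)
 qed
 define f where "f k x = form_at m c (%i. P k i x)" for k x
 let ?D = "%k I x. \<chi> k' j. P k (I k') x $ j"
 have detc: "continuous_on S (%x. det (?D k I x))" if "I \<in> multi_indices m" for k I S
  unfolding det_def using multi_indices_less[OF that]
  by (auto intro!: continuous_intros continuous_on_subset[OF Pc])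
 have null: "(LBINT x:?C. det (?D k I x)) = 0" if I: "I \<in> multi_indices m" for k I
 proof -
  have "integral ?C (%x. det (\<chi> k'. P k (I k') x)) = 0"
  proof (rule null_lagrangian[of "%x. \<chi> k'. X k (I k') x"])
   fix x
   show "((%x. \<chi> k'. X k (I k') x) has_derivative (%h. (\<chi> k'. P k (I k') x) *v h)) (at x)"
   proof (subst has_derivative_componentwise_within, intro ballI)
    fix b :: "real^'n::_" assume "b \<in> Basis"
    then obtain l where b: "b = axis l 1" by (auto simp: Basis_vec_def)
    have "((\<chi> k'. P k (I k') x) *v h) \<bullet> b = P k (I l) x \<bullet> h" for h
     unfolding b inner_axis by (simp add: matrix_vector_mult_def inner_vec_def)
    then show "((%x. (\<chi> k'. X k (I k') x) \<bullet> b) has_derivative (%h. ((\<chi> k'. P k (I k') x) *v h) \<bullet> b)) (at x)"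
     using Xder[OF multi_indices_less[OF I], of k] by (simp add: b inner_axis)
   qed
   show "(\<chi> k'. X k (I k') x) = 0" if "x \<notin> ?C"
    using X0[OF that multi_indices_less[OF I]] by (simp add: vec_eq_iff)
  next
   show "continuous_on UNIV (%x. \<chi> k'. P k (I k') x)"
    by (intro continuous_on_vec_lambda Pc multi_indices_less[OF I])
  qed
  moreover have "(?D k I x) = (\<chi> k'. P k (I k') x)" for x by (simp add: vec_eq_iff)
  moreover have "set_integrable lborel ?C (%x. det (?D k I x))"
   unfolding set_integrable_def by (rule borel_integrable_compact[OF compact_cbox detc[OF I]])
  ultimately show ?thesis by (simp add: set_borel_integral_eq_integral(2))
 qed
 have f0: "f k x = 0" if "x \<notin> ?C" for k x
  unfolding f_def by (intro form_at_zero P0 that)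
 have fm [measurable]: "f k \<in> borel_funs" for k
  unfolding f_def using Pc
  by (intro measurable_form_at) (auto intro!: borel_measurable_continuous_onI continuous_intros)
 \<comment> \<open>Each determinant is the Jacobian of a compactly supported map into
   \<open>n\<close>-space formed by the components that \<open>I\<close> selects, hence a null
   Lagrangian.\<close>
 have fint0: "(LBINT x. f k x) = 0" for k
 proof -
  have ii: "L1 (%x. indicator ?C x *\<^sub>R det (?D k I x))" if I: "I \<in> multi_indices m" for I
   by (rule borel_integrable_compact[OF compact_cbox detc[OF I]])
  have "(LBINT x. f k x) = (LBINT x. (\<Sum>I\<in>multi_indices m. c I * (indicator ?C x *\<^sub>R det (?D k I x))))"
  proof (rule Bochner_Integration.integral_cong[OF refl])
   fix x
   show "f k x = (\<Sum>I\<in>multi_indices m. c I * (indicator ?C x *\<^sub>R det (?D k I x)))"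
    using f0[of x k] by (cases "x \<in> ?C") (auto simp: f_def form_at_def)
  qed
  also have "... = (\<Sum>I\<in>multi_indices m. c I * (LBINT x:?C. det (?D k I x)))"
   unfolding set_integral_def using ii
   by (subst Bochner_Integration.integral_sum) auto
  also have "... = 0" using null by simp
  finally show ?thesis .
 qed
 \<comment> \<open>The direction in which \<open>G\<close> is evaluated when the j-th partial
   derivative of the variable mollification is taken.\<close>
 define w where "w k x j y = axis j 1 + (d k x \<bullet> axis j 1) *\<^sub>R y" for k x j and y :: "real^'n::_"
 have wn: "norm (w k x j y) <= 3/2" if "norm y <= 1" for k x j y
 proof -
  have "abs (d k x \<bullet> axis j 1) <= 1/2"
   using Cauchy_Schwarz_ineq2[of "d k x" "axis j 1"] dn[of k x] by (simp add: norm_axis_1)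
  then have "abs (d k x \<bullet> axis j 1) * norm y <= 1/2 * 1" using that by (intro mult_mono) auto
  then have "norm (axis j 1 :: real^'n::_) + norm ((d k x \<bullet> axis j 1) *\<^sub>R y) <= 3/2" by (simp add: norm_axis_1)
  then show ?thesis unfolding w_def by (rule norm_triangle_le)
 qed
 have Pw: "P k i x $ j = (LBINT y. mker 1 0 y * (G i (?p k x y) \<bullet> w k x j y))"
  "L1 (%y. mker 1 0 y * (G i (?p k x y) \<bullet> w k x j y))" if i: "i < m" for i k x j
 proof -
  obtain B where B: "variable_mollification (\<phi> i) (G i) (\<delta> k) (d k) B" using vm[OF i] by blast
  show "P k i x $ j = (LBINT y. mker 1 0 y * (G i (?p k x y) \<bullet> w k x j y))"
   unfolding w_def P_def using variable_mollification.vgrad_inner[OF B, of x "axis j 1"] by (simp add: inner_axis)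
  show "L1 (%y. mker 1 0 y * (G i (?p k x y) \<bullet> w k x j y))"
   unfolding w_def by (rule variable_mollification.integrable_vgrad_inner[OF B])
 qed
 have m0: "mker 1 0 y >= 0" for y :: "real^'n::_" by (intro mker_nonneg) auto
 have L2P: "L2_set (%i. P k i x $ j) {..<m} <= T" for k x j
 proof -
  let ?w = "w k x j"
  let ?g = "%y. (W (?p k x y)) * mker 1 0 y * (3/2)"
  have iW: "L1 (%y. W (?p k x y))"
   by (rule integral_affine_euclidean(2)[OF _ W(1)]) (use \<delta>pos[of k x] in auto)
  have "L2_set (%i. P k i x $ j) {..<m} = L2_set (%i. LBINT y. mker 1 0 y * (G i (?p k x y) \<bullet> ?w y)) {..<m}"
   using Pw(1) by (intro L2_set_cong) auto
  also have "... <= (LBINT y. ?g y)"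
  proof (rule L2_set_integral_le)
   show "L1 (%y. mker 1 0 y * (G i (?p k x y) \<bullet> ?w y))" if "i \<in> {..<m}" for i
    using Pw(2) that by simp
  next
   show "L1 ?g" by (intro integrable_mult_left integrable_mult_mker iW) auto
   show "AE y. L2_set (%i. mker 1 0 y * (G i (?p k x y) \<bullet> ?w y)) {..<m} <= ?g y"
   proof (intro AE_I2)
    fix y :: "real^'n::_"
    show "L2_set (%i. mker 1 0 y * (G i (?p k x y) \<bullet> ?w y)) {..<m} <= ?g y"
    proof (cases "norm y <= 1")
     case True
     have "L2_set (%i. mker 1 0 y * (G i (?p k x y) \<bullet> ?w y)) {..<m} = mker 1 0 y * L2_set (%i. G i (?p k x y) \<bullet> ?w y) {..<m}"
      using m0 by (rule L2_set_right_distrib[symmetric])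
     also have "... <= mker 1 0 y * (W (?p k x y) * norm (?w y))"
      using m0 WG by (intro mult_left_mono)
     also have "... <= mker 1 0 y * (W (?p k x y) * (3/2))"
      using m0 W(2) wn[OF True] by (intro mult_left_mono)
     finally show ?thesis by (simp add: mult_ac)
    qed (use mk0 in \<open>simp add: L2_set_def\<close>)
   qed
  qed
  also have "... = 3/2 * mol 1 (%y. W (?p k x y)) 0" by (simp add: mol_def)
  also have "... <= 3/2 * ((LBINT y:ball 0 1. W (?p k x y)) / ?I)"
   using mol_le_ball[OF iW, of 1 0] W(2) by (intro mult_left_mono) auto
  also have "(LBINT y:ball 0 1. W (?p k x y)) = (LBINT y:ball x (\<delta> k x). W y) / \<delta> k x ^ ?n"
   using set_integral_ball_affine[OF \<delta>pos, of W x k x] by simp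
  also have "3/2 * ((LBINT y:ball x (\<delta> k x). W y) / \<delta> k x ^ ?n / ?I) <= 3/2 * (K * (3 * \<delta> k x) ^ ?n / \<delta> k x ^ ?n / ?I)"
  proof -
   \<comment> \<open>Growth of \<open>W\<close> is known only at points of \<open>F\<close>. The
     nearest one is closer than twice the radius, so tripling the radius gives a ball about it that
     contains the original one; this is the origin of \<open>3 ^ n\<close> in
     \<open>T\<close>.\<close>
   obtain x' where x': "x' \<in> F" "infdist x F = dist x x'" using infdist_attains_inf[OF F(1,2)] by metis
   have dx: "dist x x' < 2 * \<delta> k x" using x'(2) \<delta>b(1)[of x k] e(1)[of k] by (simp add: \<psi>_def)
   have "(LBINT y:ball x (\<delta> k x). W y) <= (LBINT y:ball x' (3 * \<delta> k x). W y)"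
   proof (intro set_integral_mono_set_nonneg W subsetI)
    fix y assume "y \<in> ball x (\<delta> k x)"
    then show "y \<in> ball x' (3 * \<delta> k x)" using dx dist_triangle[of x' y x] by (simp add: dist_commute)
   qed auto
   also have "... <= K * (3 * \<delta> k x) ^ ?n" using x'(1) \<delta>pos by (intro WF) auto
   finally show ?thesis using \<delta>pos[of k x] I by (intro mult_left_mono divide_right_mono) auto
  qed
  also have "... = T" using \<delta>pos[of k x] by (simp add: T_def power_mult_distrib)
  finally show ?thesis .
 qed
 have fbd: "abs (f k x) <= \<kappa> * T ^ ?n" for k x
 proof -
  have "(\<Prod>j\<in>UNIV. L2_set (%i. P k i x $ j) {..<m}) <= (\<Prod>j\<in>(UNIV::'n set). T)"
   using L2P by (intro prod_mono) (auto simp: L2_set_nonneg)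
  then have "\<kappa> * (\<Prod>j\<in>UNIV. L2_set (%i. P k i x $ j) {..<m}) <= \<kappa> * T ^ ?n"
   using \<kappa> by (intro mult_left_mono) auto
  then show ?thesis unfolding f_def using fb[of "%i. P k i x"] by linarith
 qed
 have Cfin: "emeasure lborel ?C < \<infinity>" using emeasure_bounded_finite[OF bounded_cbox] .
 have iC: "L1 (%x. \<kappa> * T ^ ?n * indicator ?C x)"
  using Cfin by (intro integrable_mult_right integrable_real_indicator) auto
 have fi: "L1 (f k)" for k
  by (rule integrable_dominated[OF iC])
   (use fbd[of k] f0[of _ k] in \<open>auto simp: indicator_def intro!: AE_I2 order_trans[OF _ abs_ge_self]\<close>)
 have Fs: "F \<in> sets borel" "- F \<in> sets borel" using F(1) by auto
 have Ofin: "emeasure lborel (- F) < \<infinity>" using F(3) bounded_ball bounded_subset emeasure_bounded_finite by blast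
 have bd: "abs (LBINT x:F. f k x) <= \<kappa> * T ^ ?n * vol (- F)" for k
 proof -
  have "(LBINT x:F. f k x) + (LBINT x:-F. f k x) = (LBINT x:F \<union> - F. f k x)"
   using Fs by (intro set_integral_Un[symmetric] set_integrable_lborel fi) auto
  also have "... = 0" using fint0[of k] by (simp add: set_integral_def Compl_partition)
  finally have "abs (LBINT x:F. f k x) = abs (LBINT x:-F. f k x)" by linarith
  also have "... <= (LBINT x. \<kappa> * T ^ ?n * indicator (- F) x)"
   unfolding set_integral_def
  proof (rule order_trans[OF integral_abs_bound integral_mono])
   show "L1 (%x. abs (indicator (- F) x *\<^sub>R f k x))"
    using set_integrable_lborel[OF fi[of k] Fs(2)] by (intro integrable_abs) (simp add: set_integrable_def)
   show "L1 (%x. \<kappa> * T ^ ?n * indicator (- F) x)"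
    using Ofin Fs by (intro integrable_mult_right integrable_real_indicator) auto
   show "abs (indicator (- F) x *\<^sub>R f k x) <= \<kappa> * T ^ ?n * indicator (- F) x" for x
    using fbd[of k x] by (auto simp: indicator_def)
  qed
  also have "... = \<kappa> * T ^ ?n * vol (- F)" using Fs Ofin by simp
  finally show ?thesis .
 qed
 \<comment> \<open>On \<open>F\<close> the radius is at most \<open>3/2 * e k\<close>, so
   \<open>G\<close> at the averaged points approaches \<open>G x\<close>. The gradient of the radius
   need not tend to 0, but against the constant \<open>G x\<close> its term integrates to zero
   because the kernel is even.\<close>
 have Plim: "(%k. P k i x $ j) \<longlonglongrightarrow> G i x $ j" if x: "x \<in> F" and i: "i < m" for x i j
 proof (rule LIMSEQ_I)
  fix \<eta> :: real assume \<eta>: "\<eta> > 0"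
  obtain r where r: "r > 0" "!!z w. dist w z < r ==> dist (G i w) (G i z) < \<eta> / 2"
   using G[OF i] \<eta> unfolding uniformly_continuous_on_def by (metis UNIV_I half_gt_zero)
  obtain N where N: "!!k. k >= N ==> e k < r / 2"
   using order_tendstoD(2)[OF LIMSEQ_inverse_real_of_nat, of "r/2"] r(1)
   unfolding e_def by (auto simp: eventually_sequentially inverse_eq_divide)
  show "\<exists>N. \<forall>k\<ge>N. norm (P k i x $ j - G i x $ j) < \<eta>"
  proof (intro exI[of _ N] allI impI)
   fix k assume k: "k >= N"
   let ?w = "w k x j"
   have i2: "L1 (%y. mker 1 0 y *\<^sub>R (G i x \<bullet> y))"
   proof (rule integrable_mker_scaleR[of _ "norm (G i x)"])
    fix y :: "real^'n::_" assume "norm y <= 1"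
    then have "norm (G i x) * norm y <= norm (G i x) * 1" by (intro mult_left_mono) auto
    then show "norm (G i x \<bullet> y) <= norm (G i x)" using Cauchy_Schwarz_ineq2[of "G i x" y] by simp
   qed auto
   have i3: "L1 (%y::real^'n::_. mker 1 0 y)" by (intro integrable_mker) auto
   have eqw: "mker 1 0 y * (G i x \<bullet> ?w y) = (G i x $ j) * mker 1 0 y + (d k x \<bullet> axis j 1) * (mker 1 0 y *\<^sub>R (G i x \<bullet> y))" for y
    by (simp add: w_def inner_add_right inner_axis algebra_simps)
   have i4: "L1 (%y. mker 1 0 y * (G i x \<bullet> ?w y))"
    unfolding eqw by (intro Bochner_Integration.integrable_add integrable_mult_right i2 i3)
   have Gx: "G i x $ j = (LBINT y. mker 1 0 y * (G i x \<bullet> ?w y))"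
    unfolding eqw using i2 i3 integral_mker_odd[of "G i x"]
    by (subst Bochner_Integration.integral_add) (auto simp: integral_mker)
   have "P k i x $ j - G i x $ j = (LBINT y. mker 1 0 y * ((G i (?p k x y) - G i x) \<bullet> ?w y))"
    unfolding Pw(1)[OF i] unfolding Gx using Pw(2)[OF i] i4 by (simp add: inner_diff_left right_diff_distrib)
   also have "norm ... <= (LBINT y. mker 1 (0::real^'n::_) y * (\<eta> / 2 * (3/2)))"
   proof (rule order_trans[OF integral_norm_bound integral_mono])
    show "L1 (%y. norm (mker 1 0 y * ((G i (?p k x y) - G i x) \<bullet> ?w y)))"
     using Pw(2)[OF i] i4 by (intro integrable_norm) (simp add: inner_diff_left right_diff_distrib)
    show "L1 (%y. mker 1 (0::real^'n::_) y * (\<eta> / 2 * (3/2)))" using i3 by simp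
    fix y :: "real^'n::_"
    show "norm (mker 1 0 y * ((G i (?p k x y) - G i x) \<bullet> ?w y)) <= mker 1 (0::real^'n::_) y * (\<eta> / 2 * (3/2))"
    proof (cases "norm y <= 1")
     case True
     have "\<delta> k x < r" using \<delta>b(2)[of k x] \<psi>0[OF x] N[OF k] r(1) by linarith
     moreover have "\<delta> k x * norm y <= \<delta> k x * 1" using True \<delta>pos[of k x] by (intro mult_left_mono) auto
     ultimately have "\<delta> k x * norm y < r" by linarith
     then have "dist (?p k x y) x < r" using \<delta>pos[of k x] by (simp add: dist_norm)
     then have "norm (G i (?p k x y) - G i x) < \<eta> / 2" using r(2) by (simp add: dist_norm)
     then have "norm (G i (?p k x y) - G i x) * norm (?w y) <= \<eta> / 2 * (3/2)"
      using wn[OF True] \<eta> by (intro mult_mono) auto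
     then have "abs ((G i (?p k x y) - G i x) \<bullet> ?w y) <= \<eta> / 2 * (3/2)"
      using Cauchy_Schwarz_ineq2 order_trans by blast
     then have "abs (mker 1 0 y) * abs ((G i (?p k x y) - G i x) \<bullet> ?w y) <= mker 1 0 y * (\<eta> / 2 * (3/2))"
      unfolding abs_of_nonneg[OF m0] using m0 by (rule mult_left_mono)
     then show ?thesis by (simp only: real_norm_def abs_mult)
    qed (use mk0 in simp)
   qed
   also have "... < \<eta>" using \<eta> by (simp add: integral_mker)
   finally show "norm (P k i x $ j - G i x $ j) < \<eta>" .
  qed
 qed
 have "(%k. LBINT x:F. f k x) \<longlonglongrightarrow> (LBINT x:F. form_at m c (%i. G i x))"
  unfolding set_integral_def
 proof (rule integral_dominated_convergence[OF _ _ iC])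
  have "(%x. form_at m c (%i. G i x)) \<in> borel_funs"
   using Gc by (intro measurable_form_at) (auto intro!: borel_measurable_continuous_onI continuous_intros)
  then show "(%x. indicator F x *\<^sub>R form_at m c (%i. G i x)) \<in> borel_measurable lborel"
   using Fs by measurable
  show "(%x. indicator F x *\<^sub>R f k x) \<in> borel_measurable lborel" for k using Fs by measurable
  show "AE x. (%k. indicator F x *\<^sub>R f k x) \<longlonglongrightarrow> indicator F x *\<^sub>R form_at m c (%i. G i x)"
  proof (intro AE_I2)
   fix x
   show "(%k. indicator F x *\<^sub>R f k x) \<longlonglongrightarrow> indicator F x *\<^sub>R form_at m c (%i. G i x)"
   proof (cases "x \<in> F")
    case True
    have "(%k. form_at m c (%i. P k i x)) \<longlonglongrightarrow> form_at m c (%i. G i x)"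
     by (intro tendsto_form_at Plim True)
    then show ?thesis using True by (simp add: f_def)
   qed simp
  qed
  show "AE x. norm (indicator F x *\<^sub>R f k x) <= \<kappa> * T ^ ?n * indicator ?C x" for k
   using fbd[of k] f0[of _ k] order_trans[OF abs_ge_zero fbd[of k x0]] by (intro AE_I2) (auto simp: indicator_def)
 qed
 then have "(%k. abs (LBINT x:F. f k x)) \<longlonglongrightarrow> \<bar>LBINT x:F. form_at m c (%i. G i x)\<bar>"
  by (rule tendsto_rabs)
 then have "abs (LBINT x:F. form_at m c (%i. G i x)) <= \<kappa> * T ^ ?n * vol (- F)"
  by (rule LIMSEQ_le_const2) (use bd in blast)
 then show ?thesis by (simp add: T_def)
qed

text \<open>A ball on which the mean is large must meet the support of \<open>v\<close>, and its
  radius is bounded through the total mass.\<close>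

lemma maximal_set_bounded:
 fixes v :: "'a::euclidean_space => real"
 assumes v: "L1 v" "!!x. 0 <= v x" and vs: "!!x. x \<notin> cball x0 R ==> v x = 0" and t: "t > 0"
 obtains R' where "maximal_set v t \<subseteq> ball x0 R'"
proof
 define I where "I = (LBINT x. v x)"
 define V where "V = unit_ball_vol DIM('a)"
 have V: "V > 0" by (simp add: V_def)
 show "maximal_set v t \<subseteq> ball x0 (R + max 1 (I / (t * V)) + 1)"
 proof
  fix x assume "x \<in> maximal_set v t"
  then obtain r where r: "r > 0" "t * vol (ball x r) < (LBINT y:ball x r. v y)"
   by (auto simp: maximal_set_def)
  have m: "vol (ball x r) = V * r ^ DIM('a)" using r by (simp add: measure_lborel_ball V_def)
  have far: "dist x0 x - R < r"
  proof (rule ccontr)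
   assume "\<not> dist x0 x - R < r"
   then have "v y = 0" if "y \<in> ball x r" for y
    using that dist_triangle[of x0 x y] by (intro vs) (auto simp: dist_commute)
   then have "(LBINT y:ball x r. v y) = (LBINT y:ball x r. 0)"
    by (intro set_lebesgue_integral_cong) auto
   moreover have "t * vol (ball x r) > 0" unfolding m using t V r by simp
   ultimately show False using r by (simp add: set_integral_def)
  qed
  have "t * (V * r ^ DIM('a)) < I"
   using r(2) set_integral_le_integral[OF v, of "ball x r"] unfolding m I_def by simp
  then have "r ^ DIM('a) < I / (t * V)" using t V by (simp add: field_simps)
  moreover have "r <= r ^ DIM('a)" if "r >= 1" using that by (intro self_le_power) auto
  ultimately have "r <= max 1 (I / (t * V))" by linarith
  with far show "x \<in> ball x0 (R + max 1 (I / (t * V)) + 1)" by simp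
 qed
qed

text \<open>The gradient bound of the truncated map per unit of the level \<open>t\<close>: the
  constant of the variable mollification times the growth constant of mollified functions. It
  involves the domain dimension only.\<close>

definition trunc_const :: "'a::euclidean_space itself => real" where
 "trunc_const T = 3/2 * 3 ^ DIM('a) / bump_mass T *
  (unit_ball_vol DIM('a) * 2 ^ DIM('a) * (1 + unit_ball_vol DIM('a) / bump_mass T))"

lemma mol_support:
 assumes e: "0 < e" "e <= 1" and g: "!!z. z \<notin> cball x0 R ==> g z = 0" and x: "x \<notin> cball x0 (R + 1)"
 shows "mol e g x = 0"
proof -
 have "g z * mker e x z = 0" for z
 proof (cases "z \<in> ball x e")
  case True
  then have "z \<notin> cball x0 R" using x e dist_triangle[of x0 x z] by (auto simp: dist_commute)
  then show ?thesis using g by simp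
 qed (use mker_eq_0[OF e(1), of z x] in simp)
 then show ?thesis unfolding mol_def by (simp only: Bochner_Integration.integral_zero)
qed

lemma molv_nth:
 assumes "L1 G" "e > 0"
 shows "molv e G x $ j = mol e (%z. G z $ j) x"
 using molv_inner[OF assms, of x "axis j 1"] by (simp add: inner_axis)

text \<open>The smooth case is applied to mollifications of the map while the maximal set of the
  original \<open>v\<close> is kept fixed; the growth bound there is uniform in the mollification
  radius. Off that set the mollified gradients are bounded, so dominated convergence
  applies.\<close>

theorem truncated_pullback:
 fixes h :: "nat => real^'n::{finite,wellorder} => real" and D :: "nat => real^'n::_ => real^'n::_"
 assumes wg: "!!i. i < m ==> wgrad UNIV (h i) (D i)"
  and hs: "!!i x. i < m ==> x \<notin> cball x0 R ==> h i x = 0" and Ds: "!!i x. i < m ==> x \<notin> cball x0 R ==> D i x = 0"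
  and v: "L1 v" "!!x. 0 <= v x" and vs: "!!x. x \<notin> cball x0 R ==> v x = 0"
  and vD: "AE x. \<forall>w. L2_set (%i. D i x \<bullet> w) {..<m} <= v x * norm w"
  and fb: "!!A. abs (form_at m c A) <= \<kappa> * (\<Prod>j\<in>UNIV. L2_set (%i. A i $ j) {..<m})" and \<kappa>: "\<kappa> >= 0" and t: "t > 0"
 shows "abs (LBINT x:- maximal_set v t. form_at m c (%i. D i x)) <=
  \<kappa> * (trunc_const TYPE(real^'n::_) * t) ^ CARD('n) * vol (maximal_set v t)"
proof -
 let ?n = "CARD('n)" and ?I = "bump_mass TYPE(real^'n::_)" and ?O = "maximal_set v t" and ?V = "unit_ball_vol (real CARD('n))"
 have I: "?I > 0" by (rule bump_mass_pos)
 have hi: "L1 (h i)" "L1 (D i)" if "i < m" for i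
  using wg[OF that] by (auto simp: wgrad_def)
 have Dm [measurable]: "D i \<in> borel_funs" if "i < m" for i
  using hi(2)[OF that] by (simp add: measurable_L1)
 have Os: "?O \<in> sets borel" "- ?O \<in> sets borel" using sets_maximal_set[OF v] by auto
 define e where "e k = 1 / real (Suc k)" for k
 have e: "e k > 0" "e k <= 1" for k by (auto simp: e_def)
 obtain R' where R': "?O \<subseteq> ball x0 R'" using maximal_set_bounded[OF v vs t] by blast
 define K where "K = (?V * 2 ^ ?n * (1 + ?V / ?I)) * t"
 have K: "K >= 0" using I t by (simp add: K_def)
 let ?\<phi> = "%k i. mol (e k) (h i)" and ?G = "%k i. molv (e k) (D i)" and ?W = "%k. mol (e k) v"
 have Gs: "?G k i z = 0" if "i < m" "z \<notin> cball x0 (R + 1)" for k i z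
 proof (rule euclidean_eqI)
  fix b :: "real^'n::_"
  show "?G k i z \<bullet> b = 0 \<bullet> b"
   using mol_support[OF e, of x0 R "%z. D i z \<bullet> b" z k] Ds[OF that(1)] that(2) molv_inner[OF hi(2)[OF that(1)] e(1)[of k], of z b]
   by auto
 qed
 have bd: "abs (LBINT x:- ?O. form_at m c (%i. ?G k i x)) <= \<kappa> * (3/2 * 3 ^ ?n / ?I * K) ^ ?n * vol ?O" for k
 proof -
  have "abs (LBINT x:- ?O. form_at m c (%i. ?G k i x)) <= \<kappa> * (3/2 * 3 ^ ?n / ?I * K) ^ ?n * vol (- (- ?O))"
  proof (rule smooth_truncation[where \<phi>="?\<phi> k" and W="?W k" and R="R + 1" and ?x0.0=x0 and R'=R'])
   show "(?\<phi> k i has_derivative (%h. ?G k i z \<bullet> h)) (at z)" if "i < m" for i z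
    by (rule mol_has_derivative_wgrad[OF wg[OF that] e(1)]) auto
   show "uniformly_continuous_on UNIV (?G k i)" if i: "i < m" for i
    by (rule uniformly_continuous_compact_support[OF continuous_on_molv[OF hi(2)[OF i] e(1)] Gs[OF i]])
   show "?\<phi> k i z = 0" if "i < m" "z \<notin> cball x0 (R + 1)" for i z
    using hs[OF that(1)] that(2) by (intro mol_support[OF e]) auto
   show "?G k i z = 0" if "i < m" "z \<notin> cball x0 (R + 1)" for i z by (rule Gs[OF that])
   show "L1 (?W k)" by (intro integrable_mol v e)
   show "0 <= ?W k z" for z by (intro mol_nonneg v e)
   show "L2_set (%i. ?G k i z \<bullet> w) {..<m} <= ?W k z * norm w" for z w
   proof -
    have "L2_set (%i. ?G k i z \<bullet> w) {..<m} = L2_set (%i. LBINT y. (D i y \<bullet> w) * mker (e k) z y) {..<m}"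
     by (rule L2_set_cong[OF refl]) (simp add: molv_inner[OF hi(2) e(1)] mol_def)
    also have "... <= (LBINT y. (v y * mker (e k) z y) * norm w)"
    proof (rule L2_set_integral_le)
     show "L1 (%y. (D i y \<bullet> w) * mker (e k) z y)" if "i \<in> {..<m}" for i
      using hi(2)[of i] that e by (intro integrable_mult_mker integrable_inner_left) auto
     show "L1 (%y. (v y * mker (e k) z y) * norm w)"
      using e by (intro integrable_mult_left integrable_mult_mker v)
     show "AE y. L2_set (%i. (D i y \<bullet> w) * mker (e k) z y) {..<m} <= (v y * mker (e k) z y) * norm w"
      using vD
     proof eventually_elim
      case (elim y)
      have m0: "mker (e k) z y >= 0" by (intro mker_nonneg e)
      have "L2_set (%i. (D i y \<bullet> w) * mker (e k) z y) {..<m} = L2_set (%i. D i y \<bullet> w) {..<m} * mker (e k) z y"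
       using m0 by (rule L2_set_left_distrib[symmetric])
      also have "... <= (v y * norm w) * mker (e k) z y" using elim m0 by (intro mult_right_mono) auto
      finally show ?case by (simp add: mult_ac)
     qed
    qed
    also have "... = ?W k z * norm w" by (simp add: mol_def)
    finally show ?thesis .
   qed
   show "closed (- ?O)" using open_maximal_set[OF v] by (simp add: closed_Compl)
   show "- ?O ~= {}"
   proof
    assume "- ?O = {}"
    then have "UNIV \<subseteq> ball x0 R'" using R' by auto
    then show False using bounded_subset[OF bounded_ball] not_bounded_UNIV by blast
   qed
   show "- (- ?O) \<subseteq> ball x0 R'" using R' by simp
   show "(LBINT z:ball x r. ?W k z) <= K * r ^ ?n" if "x \<in> - ?O" "r > 0" for x r
    using mol_maximal_bound[OF v e(1) that(2), of t x k] t that by (simp add: K_def)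
  qed (use K fb \<kappa> in auto)
  then show ?thesis by simp
 qed
 have ptw: "abs (form_at m c (%i. ?G k i x)) <= \<kappa> * (t * ?V / ?I) ^ ?n" if x: "x \<in> - ?O" for k x
 proof -
  have W: "?W k x <= t * ?V / ?I"
  proof -
   have "?W k x <= (LBINT z:ball x (e k). v z) / (e k ^ ?n * ?I)" using mol_le_ball[OF v e(1), of k x] by simp
   also have "... <= (t * (?V * e k ^ ?n)) / (e k ^ ?n * ?I)"
    using not_maximal_set[of x v t "e k"] x e[of k] I by (intro divide_right_mono) (auto simp: content_ball)
   also have "... = t * ?V / ?I" using e(1)[of k] by simp
   finally show ?thesis .
  qed
  have L: "L2_set (%i. ?G k i x $ j) {..<m} <= t * ?V / ?I" for j
  proof -
   have "L2_set (%i. ?G k i x $ j) {..<m} = L2_set (%i. LBINT y. D i y $ j * mker (e k) x y) {..<m}"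
    by (rule L2_set_cong[OF refl]) (simp add: molv_nth[OF hi(2) e(1)] mol_def)
   also have "... <= (LBINT y. v y * mker (e k) x y)"
   proof (rule L2_set_integral_le)
    show "L1 (%y. D i y $ j * mker (e k) x y)" if "i \<in> {..<m}" for i
     using integrable_inner_left[OF hi(2)[of i], of "axis j 1"] that e by (intro integrable_mult_mker) (auto simp: inner_axis)
    show "L1 (%y. v y * mker (e k) x y)" using e by (intro integrable_mult_mker v)
    show "AE y. L2_set (%i. D i y $ j * mker (e k) x y) {..<m} <= v y * mker (e k) x y"
     using vD
    proof eventually_elim
     case (elim y)
     have m0: "mker (e k) x y >= 0" by (intro mker_nonneg e)
     have "L2_set (%i. D i y $ j * mker (e k) x y) {..<m} = L2_set (%i. D i y $ j) {..<m} * mker (e k) x y"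
      using m0 by (rule L2_set_left_distrib[symmetric])
     also have "... <= v y * mker (e k) x y"
      using elim[rule_format, of "axis j 1"] m0 by (intro mult_right_mono) (auto simp: inner_axis norm_axis_1)
     finally show ?case .
    qed
   qed
   also have "... = ?W k x" by (simp add: mol_def)
   finally show ?thesis using W by linarith
  qed
  have "(\<Prod>j\<in>UNIV. L2_set (%i. ?G k i x $ j) {..<m}) <= (\<Prod>j\<in>(UNIV::'n set). t * ?V / ?I)"
   using L by (intro prod_mono) (auto simp: L2_set_nonneg)
  then have "\<kappa> * (\<Prod>j\<in>UNIV. L2_set (%i. ?G k i x $ j) {..<m}) <= \<kappa> * (t * ?V / ?I) ^ ?n"
   using \<kappa> by (intro mult_left_mono) auto
  then show ?thesis using fb[of "%i. ?G k i x"] by linarith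
 qed

 have outs: "form_at m c (%i. ?G k i x) = 0" if "x \<notin> cball x0 (R + 1)" for k x
  using Gs that by (blast intro: form_at_zero)
 have AEl: "AE x. \<forall>i\<in>{..<m}. \<forall>j\<in>UNIV. (%k. ?G k i x $ j) \<longlonglongrightarrow> D i x $ j"
 proof (intro AE_ball_countable[THEN iffD2] ballI countable_finite)
  fix i and j :: 'n assume "i \<in> {..<m}"
  then have i: "i < m" by simp
  have Dj: "L1 (%z. D i z $ j)" using integrable_inner_left[OF hi(2)[OF i], of "axis j 1"] by (simp add: inner_axis)
  show "AE x. (%k. ?G k i x $ j) \<longlonglongrightarrow> D i x $ j"
   unfolding molv_nth[OF hi(2)[OF i] e(1)] unfolding e_def by (rule AE_mol_tendsto[OF Dj])
 qed auto
 have lim: "(%k. LBINT x:- ?O. form_at m c (%i. ?G k i x)) \<longlonglongrightarrow> (LBINT x:- ?O. form_at m c (%i. D i x))"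
  unfolding set_integral_def
 proof (rule integral_dominated_convergence[where w="%x. \<kappa> * (t * ?V / ?I) ^ ?n * indicator (cball x0 (R + 1)) x"])
  have "(%x. D i x $ j) \<in> borel_funs" if "i < m" for i j
   using measurable_L1[OF integrable_inner_left[OF hi(2)[OF that], of "axis j 1"]] by (simp add: inner_axis)
  then have "(%x. form_at m c (%i. D i x)) \<in> borel_funs" by (intro measurable_form_at)
  then show "(%x. indicator (- ?O) x *\<^sub>R form_at m c (%i. D i x)) \<in> borel_measurable lborel"
   using Os by measurable
  have "(%x. form_at m c (%i. ?G k i x)) \<in> borel_funs" for k
   using hi by (intro measurable_form_at borel_measurable_continuous_onI continuous_intros continuous_on_molv e)
  then show "(%x. indicator (- ?O) x *\<^sub>R form_at m c (%i. ?G k i x)) \<in> borel_measurable lborel" for k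
   using Os by measurable
  show "L1 (%x. \<kappa> * (t * ?V / ?I) ^ ?n * indicator (cball x0 (R + 1)) x)"
   by (intro integrable_mult_right integrable_indicator_bounded) auto
  show "AE x. (%k. indicator (- ?O) x *\<^sub>R form_at m c (%i. ?G k i x)) \<longlonglongrightarrow> indicator (- ?O) x *\<^sub>R form_at m c (%i. D i x)"
   using AEl by eventually_elim (intro tendsto_scaleR tendsto_const tendsto_form_at, simp)
  show "AE x. norm (indicator (- ?O) x *\<^sub>R form_at m c (%i. ?G k i x)) <= \<kappa> * (t * ?V / ?I) ^ ?n * indicator (cball x0 (R + 1)) x" for k
  proof (intro AE_I2)
   fix x
   have "0 <= \<kappa> * (t * ?V / ?I) ^ ?n" using \<kappa> t I by simp
   then show "norm (indicator (- ?O) x *\<^sub>R form_at m c (%i. ?G k i x)) <= \<kappa> * (t * ?V / ?I) ^ ?n * indicator (cball x0 (R + 1)) x"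
    using ptw[of x k] outs[of x k] by (cases "x \<in> - ?O"; cases "x \<in> cball x0 (R + 1)") auto
  qed
 qed
 have "abs (LBINT x:- ?O. form_at m c (%i. D i x)) <= \<kappa> * (3/2 * 3 ^ ?n / ?I * K) ^ ?n * vol ?O"
  by (rule LIMSEQ_le_const2[OF tendsto_rabs[OF lim]]) (use bd in blast)
 also have "3/2 * 3 ^ ?n / ?I * K = trunc_const TYPE(real^'n::_) * t" by (simp add: K_def trunc_const_def)
 finally show ?thesis .
qed

section \<open>Logarithmic integrability of the gradient\<close>

text \<open>The dyadic level of \<open>v\<close>: it counts the naturals \<open>k\<close> with
  \<open>2 ^ k < v\<close>, and is 0 for \<open>v <= 1\<close>. Sums over dyadic levels turn into
  sums up to \<open>lev v\<close>.\<close>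

definition lev :: "real => nat" where
 "lev v = (LEAST K. v <= 2 ^ K)"

lemma le_lev: "v <= 2 ^ lev v"
proof -
 obtain K where "v < 2 ^ K" using real_arch_pow[of 2 v] by auto
 then have "v <= 2 ^ K" by simp
 then show ?thesis unfolding lev_def by (rule LeastI)
qed

lemma less_lev_iff: "k < lev v \<longleftrightarrow> 2 ^ k < v"
proof
 assume "k < lev v"
 then have "\<not> v <= 2 ^ k" unfolding lev_def by (rule not_less_Least)
 then show "2 ^ k < v" by simp
next
 assume k: "2 ^ k < v"
 show "k < lev v"
 proof (rule ccontr)
  assume "\<not> k < lev v"
  then have "(2::real) ^ lev v <= 2 ^ k" by (intro power_increasing) auto
  with le_lev[of v] k show False by linarith
 qed
qed

lemma Suc_le_lev_iff: "k >= 1 ==> k <= lev v \<longleftrightarrow> 2 ^ k / 2 < v"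
 using less_lev_iff[of "k - 1" v] by (cases k) auto

lemma measurable_lev [measurable]: "(%x. lev (v x)) \<in> measurable M (count_space UNIV)"
 if [measurable]: "v \<in> borel_measurable M"
proof (subst measurable_count_space_eq2_countable, intro conjI ballI)
 fix K
 have "(%x. lev (v x)) -` {K} \<inter> space M = {x \<in> space M. v x <= 2 ^ K & (\<forall>k\<in>{..<K}. 2 ^ k < v x)}"
 proof -
  have "lev r = K \<longleftrightarrow> r <= 2 ^ K & (\<forall>k\<in>{..<K}. 2 ^ k < r)" for r
   using less_lev_iff[of K r] less_lev_iff[of _ r] le_lev[of r] by (metis antisym_conv3 lessThan_iff not_less)
  then show ?thesis by auto
 qed
 also have "... \<in> sets M" by measurable
 finally show "(%x. lev (v x)) -` {K} \<inter> space M \<in> sets M" .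
qed auto

lemma ln_le_lev: "0 <= v ==> ln (1 + v) <= real (lev v) + 1"
proof -
 assume v: "0 <= v"
 have "(1::real) <= 2 ^ lev v" by simp
 then have "1 + v <= 2 * 2 ^ lev v" using le_lev[of v] by linarith
 then have "1 + v <= 2 ^ (lev v + 1)" by simp
 then have "ln (1 + v) <= ln (2 ^ (lev v + 1))" using v by (subst ln_le_cancel_iff) auto
 also have "... = real (lev v + 1) * ln 2" by (rule ln_realpow)
 also have "... <= real (lev v + 1) * 1" using ln_le_minus_one[of 2] by (intro mult_left_mono) auto
 finally show ?thesis by simp
qed

text \<open>Dividing by the index does not spoil the domination of a geometric sum by its last term;
  this is how a logarithm in the denominator arises in the next estimate.\<close>

lemma sum_geom_over_index_le:
 assumes "m >= 1" "K >= 1"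
 shows "(\<Sum>k=1..K. 2 ^ (m * k) / real k) <= 4 * 2 ^ (m * K) / real K"
 using assms(2)
proof (induction K rule: dec_induct)
 case base
 then show ?case by simp
next
 case (step K)
 have m2: "(2::real) ^ m >= 2" using power_increasing[of 1 m "2::real"] assms by simp
 \<comment> \<open>The inductive inequality reduces to \<open>4 (K + 1) <= 6 K\<close>, which needs
   \<open>K >= 2\<close>; the step from 1 to 2 is done by hand.\<close>
 show ?case
 proof (cases "K = 1")
  case True
  have "(2::real) ^ m * 2 <= 2 ^ m * 2 ^ m" using m2 by (intro mult_left_mono) auto
  then have "(2::real) ^ m * 2 <= 2 ^ (m * 2)" by (simp add: power_add[symmetric] mult_2_right)
  moreover have "(0::real) <= 2 ^ (m * 2)" by simp
  ultimately have "2 ^ m + 2 ^ (m * 2) / 2 <= 2 * (2::real) ^ (m * 2)" by linarith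
  moreover have "{Suc 0..2} = {1, 2::nat}" by auto
  ultimately show ?thesis using True by (simp add: numeral_2_eq_2[symmetric])
 next
  case False
  then have K2: "real K >= 2" using step by simp
  define P where "P = (2::real) ^ (m * K)"
  have P: "P > 0" by (simp add: P_def)
  have PS: "2 ^ (m * Suc K) = P * 2 ^ m" by (simp add: P_def power_add mult.commute)
  have "4 * P * (real K + 1) <= 3 * real K * (P * 2)" using K2 P by (simp add: algebra_simps)
  also have "... <= 3 * real K * (P * 2 ^ m)" using m2 K2 P by (intro mult_left_mono) auto
  finally have "4 * P / real K <= 3 * (P * 2 ^ m) / (real K + 1)" using K2 by (simp add: field_simps)
  moreover have "(\<Sum>k=1..Suc K. 2 ^ (m * k) / real k) = P * 2 ^ m / (real K + 1) + (\<Sum>k=1..K. 2 ^ (m * k) / real k)"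
   by (subst sum.nat_ivl_Suc') (auto simp: PS[simplified] add.commute)
  ultimately have "(\<Sum>k=1..Suc K. 2 ^ (m * k) / real k) <= P * 2 ^ m / (real K + 1) + 3 * (P * 2 ^ m) / (real K + 1)"
   using step.IH unfolding P_def by linarith
  also have "... = 4 * 2 ^ (m * Suc K) / real (Suc K)"
   unfolding PS by (simp add: add_divide_distrib[symmetric] add.commute)
  finally show ?thesis .
 qed
qed

text \<open>With \<open>a k = 2 ^ (k n) * vol (maximal_set v (2 ^ k))\<close>, the series of
  \<open>a k / k\<close> is controlled by the integral of \<open>v ^ n\<close> divided by the level
  of \<open>v\<close>, hence by that of \<open>H\<close>. If \<open>a k >= c\<close> for all large
  \<open>k\<close>, the harmonic series would converge.\<close>

lemma maximal_set_small_along: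
 fixes v H :: "'a::euclidean_space => real"
 assumes v: "L1 v" "!!x. 0 <= v x" and H: "L1 H" "!!z. 0 <= H z"
  and vH: "AE z. v z ^ n <= (1 + ln (1 + v z)) * H z" and n: "n >= 2" and c: "c > 0"
 shows "\<exists>k\<ge>k0. (2 ^ k) ^ n * vol (maximal_set v (2 ^ k)) < c"
proof (rule ccontr)
 assume neg: "\<not> ?thesis"
 define a where "a k = (2 ^ k) ^ n * vol (maximal_set v (2 ^ k))" for k
 have a0: "a k >= 0" for k by (simp add: a_def measure_nonneg)
 have ac: "a k >= c" if "k >= k0" for k using neg that by (auto simp: a_def)
 have [measurable]: "v \<in> borel_funs" using v by (simp add: measurable_L1)
 obtain m where m: "n = Suc m" "m >= 1" using n by (cases n) auto
 let ?S = "%N x. \<Sum>k=1..N. 2 ^ (m * k) / real k * (indicator {x. v x > 2 ^ k / 2} x * v x)"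
 have iv: "L1 (%x. indicator {x. v x > 2 ^ k / 2} x * v x)" for k :: nat
  using set_integrable_lborel[OF v(1), of "{x. v x > 2 ^ k / 2}"] by (simp add: set_integrable_def)
 \<comment> \<open>Pointwise, the geometric sum contributes 4, the power \<open>(2 * v) ^ m\<close>
   contributes \<open>2 ^ m\<close>, and \<open>1 + ln (1 + v) <= 3 * K\<close> contributes 3, which
   makes up \<open>12 * 2 ^ m\<close>.\<close>
 have bd: "(\<Sum>k=1..N. a k / real k) <= 2 * 5 ^ DIM('a) * (12 * 2 ^ m * (LBINT x. H x))" for N
 proof -
  have "(\<Sum>k=1..N. a k / real k) <= (\<Sum>k=1..N. 2 * 5 ^ DIM('a) * (2 ^ (m * k) / real k * (LBINT x. indicator {x. v x > 2 ^ k / 2} x * v x)))"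
  proof (rule sum_mono)
   fix k assume k: "k \<in> {1..N}"
   have "a k <= (2 ^ k) ^ n * (2 * 5 ^ DIM('a) / 2 ^ k * (LBINT x:{x. v x > 2 ^ k / 2}. v x))"
    unfolding a_def by (intro mult_left_mono measure_maximal_set(2)[OF v]) auto
   also have "... = 2 * 5 ^ DIM('a) * (2 ^ (m * k) * (LBINT x. indicator {x. v x > 2 ^ k / 2} x * v x))"
    by (simp add: m set_integral_def power_mult[symmetric] mult.commute)
   finally have "a k / real k <= 2 * 5 ^ DIM('a) * (2 ^ (m * k) * (LBINT x. indicator {x. v x > 2 ^ k / 2} x * v x)) / real k"
    by (intro divide_right_mono) auto
   then show "a k / real k <= 2 * 5 ^ DIM('a) * (2 ^ (m * k) / real k * (LBINT x. indicator {x. v x > 2 ^ k / 2} x * v x))"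
    by simp
  qed
  also have "... = 2 * 5 ^ DIM('a) * (LBINT x. (?S N x))"
   using iv by (subst Bochner_Integration.integral_sum) (auto simp: sum_distrib_left)
  also have "(LBINT x. (?S N x)) <= (LBINT x. 12 * 2 ^ m * H x)"
  proof (rule integral_mono_AE)
   show "L1 (%x. \<Sum>k=1..N. 2 ^ (m * k) / real k * (indicator {x. v x > 2 ^ k / 2} x * v x))"
    using iv by (intro Bochner_Integration.integrable_sum integrable_mult_right)
   show "AE x. (?S N x) <= 12 * 2 ^ m * H x"
    using vH
   proof eventually_elim
    case (elim x)
    define K where "K = lev (v x)"
    have "(?S N x) = (\<Sum>k\<in>{1..N}. if k <= K then 2 ^ (m * k) / real k * v x else 0)"
     using Suc_le_lev_iff[of _ "v x"] by (intro sum.cong) (auto simp: K_def)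
    also have "... = (\<Sum>k\<in>{1..N} \<inter> {..K}. 2 ^ (m * k) / real k * v x)"
     by (subst sum.inter_restrict) auto
    also have "... <= (\<Sum>k\<in>{1..K}. 2 ^ (m * k) / real k * v x)"
     using v(2) by (intro sum_mono2) auto
    also have "... <= 12 * 2 ^ m * H x"
    proof (cases "K = 0")
     case True
     then show ?thesis using H by simp
    next
     case False
     then have K: "K >= 1" by simp
     have vK: "2 ^ K < 2 * v x" using Suc_le_lev_iff[OF K, of "v x"] by (simp add: K_def)
     have "(\<Sum>k\<in>{1..K}. 2 ^ (m * k) / real k * v x) = (\<Sum>k\<in>{1..K}. 2 ^ (m * k) / real k) * v x"
      by (simp add: sum_distrib_right)
     also have "... <= (4 * 2 ^ (m * K) / real K) * v x"
      using v(2) by (intro mult_right_mono sum_geom_over_index_le m K)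
     also have "... = (2 ^ K) ^ m * v x * (4 / real K)" by (simp add: power_mult[symmetric] mult.commute)
     also have "... <= (2 * v x) ^ m * v x * (4 / real K)"
      using vK v(2) by (intro mult_right_mono power_mono) auto
     also have "... = v x ^ n * (2 ^ m * (4 / real K))" by (simp add: m power_mult_distrib)
     also have "... <= ((1 + ln (1 + v x)) * H x) * (2 ^ m * (4 / real K))"
      using elim by (intro mult_right_mono) auto
     also have "... <= ((3 * real K) * H x) * (2 ^ m * (4 / real K))"
      using ln_le_lev[OF v(2), of x] K H(2)[of x] by (intro mult_right_mono) (auto simp: K_def)
     also have "... = 12 * 2 ^ m * H x" using K by simp
     finally show ?thesis .
    qed
    finally show ?case .
   qed
  qed (use H in auto)
  finally show ?thesis by (simp add: mult_left_mono)
 qed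
 have "summable (%k. a k / real k)"
 proof (rule summableI_nonneg_bounded)
  fix N
  have "(\<Sum>k<N. a k / real k) <= (\<Sum>k\<in>insert 0 {1..N}. a k / real k)"
   using a0 by (intro sum_mono2) auto
  also have "... = (\<Sum>k=1..N. a k / real k)" by simp
  finally show "(\<Sum>k<N. a k / real k) <= 2 * 5 ^ DIM('a) * (12 * 2 ^ m * (LBINT x. H x))" using bd[of N] by linarith
 qed (use a0 in auto)
 then have "summable (%k. c * (1 / real k))"
 proof (rule summable_comparison_test_ev[rotated])
  show "\<forall>\<^sub>F k in sequentially. norm (c * (1 / real k)) <= a k / real k"
   using eventually_ge_at_top[of k0] by eventually_elim (use ac c in \<open>auto intro!: divide_right_mono\<close>)
 qed
 then have "summable (%k. inverse c * (c * (1 / real k)))" by (rule summable_mult)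
 then have "summable (%k. 1 / real k)" using c by simp
 then show False using not_summable_harmonic[where 'a=real] by (simp add: inverse_eq_divide)
qed

text \<open>The truncation bound concerns the complement of the maximal set. It passes to the set
  itself once the total integral of the pullback is known to vanish.\<close>

theorem pullback_on_maximal_set:
 fixes h :: "nat => real^'n::{finite,wellorder} => real" and D :: "nat => real^'n::_ => real^'n::_"
 assumes wg: "!!i. i < m ==> wgrad UNIV (h i) (D i)"
  and hs: "!!i x. i < m ==> x \<notin> cball x0 R ==> h i x = 0" and Ds: "!!i x. i < m ==> x \<notin> cball x0 R ==> D i x = 0"
  and v: "L1 v" "!!x. 0 <= v x" and vs: "!!x. x \<notin> cball x0 R ==> v x = 0"
  and vD: "AE x. \<forall>w. L2_set (%i. D i x \<bullet> w) {..<m} <= v x * norm w"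
  and fb: "!!A. abs (form_at m c A) <= \<kappa> * (\<Prod>j\<in>UNIV. L2_set (%i. A i $ j) {..<m})" and \<kappa>: "\<kappa> >= 0" and t: "t > 0"
  and n: "CARD('n) >= 2" and H: "L1 H" "!!z. 0 <= H z"
  and vH: "AE z. v z ^ CARD('n) <= (1 + ln (1 + v z)) * H z"
  and J: "L1 (%x. form_at m c (%i. D i x))"
 shows "abs (LBINT x:maximal_set v t. form_at m c (%i. D i x)) <=
  \<kappa> * (trunc_const TYPE(real^'n::_) * t) ^ CARD('n) * vol (maximal_set v t)"
proof -
 let ?J = "%x. form_at m c (%i. D i x)" and ?C = "trunc_const TYPE(real^'n::_)" and ?n = "CARD('n)"
 have Os: "maximal_set v t \<in> sets borel" "- maximal_set v t \<in> sets borel" for t using sets_maximal_set[OF v] by auto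
 have C: "?C >= 0" unfolding trunc_const_def using bump_mass_pos[where 'a="real^'n::_"] by simp
 have T: "abs (LBINT x:- maximal_set v t. ?J x) <= \<kappa> * (?C * t) ^ ?n * vol (maximal_set v t)" if "t > 0" for t
  by (rule truncated_pullback[OF wg hs Ds v vs vD fb \<kappa> that])
 \<comment> \<open>The integrals over the complements of \<open>maximal_set v (2 ^ k)\<close> tend
   to the total integral, while the truncation bound for them falls below any prescribed positive
   number for arbitrarily large \<open>k\<close>. A nonzero limit is impossible.\<close>
 have zero: "(LBINT x. ?J x) = 0"
 proof (rule ccontr)
  assume nz: "(LBINT x. ?J x) ~= 0"
  define L where "L = abs (LBINT x. ?J x)"
  have L: "L > 0" using nz by (simp add: L_def)
  have ms: "vol (maximal_set v (2 ^ k)) <= 5 ^ ?n * (LBINT x. v x) * (1/2) ^ k" for k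
   using measure_maximal_set(3)[OF v, of "2 ^ k"] by (simp add: power_one_over field_simps)
  have "summable (%k. vol (maximal_set v (2 ^ k)))"
   by (rule summable_comparison_test'[of "%k. 5 ^ ?n * (LBINT x. v x) * (1/2) ^ k" 0])
    (use ms in \<open>auto simp: measure_nonneg intro!: summable_mult summable_geometric\<close>)
  then have ev: "AE x. \<forall>\<^sub>F k in sequentially. x \<in> space lborel - maximal_set v (2 ^ k)"
   using Os measure_maximal_set(1)[OF v] by (intro borel_cantelli_AE1) auto
  have "(%k. LBINT x:- maximal_set v (2 ^ k). ?J x) \<longlonglongrightarrow> (LBINT x. ?J x)"
   unfolding set_integral_def
  proof (rule integral_dominated_convergence[where w="%x. abs (?J x)"])
   show "AE x. (%k. indicator (- maximal_set v (2 ^ k)) x *\<^sub>R ?J x) \<longlonglongrightarrow> ?J x"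
    using ev
   proof eventually_elim
    case (elim x)
    show ?case
     by (rule tendsto_eventually, rule eventually_mono[OF elim]) simp
   qed
   show "AE x. norm (indicator (- maximal_set v (2 ^ k)) x *\<^sub>R ?J x) <= abs (?J x)" for k
    by (auto simp: indicator_def)
   have [measurable]: "?J \<in> borel_funs" using J by (simp add: measurable_L1)
   show "(%x. indicator (- maximal_set v (2 ^ k)) x *\<^sub>R ?J x) \<in> borel_measurable lborel" for k
    using Os[of "2 ^ k"] by measurable
  qed (use J in auto)
  then have "(%k. abs (LBINT x:- maximal_set v (2 ^ k). ?J x)) \<longlonglongrightarrow> L" unfolding L_def by (rule tendsto_rabs)
  then have "\<forall>\<^sub>F k in sequentially. L / 2 < abs (LBINT x:- maximal_set v (2 ^ k). ?J x)"
   using L by (intro order_tendstoD) auto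
  then obtain k0 where k0: "!!k. k >= k0 ==> L / 2 < abs (LBINT x:- maximal_set v (2 ^ k). ?J x)"
   by (auto simp: eventually_sequentially)
  define q where "q = L / 2 / (\<kappa> * ?C ^ ?n + 1)"
  have q0: "\<kappa> * ?C ^ ?n >= 0" using \<kappa> C by simp
  have q: "q > 0" using L q0 by (simp add: q_def)
  obtain k where k: "k >= k0" "(2 ^ k) ^ ?n * vol (maximal_set v (2 ^ k)) < q"
   using maximal_set_small_along[OF v H vH n q] by blast
  have "abs (LBINT x:- maximal_set v (2 ^ k). ?J x) <= \<kappa> * (?C * 2 ^ k) ^ ?n * vol (maximal_set v (2 ^ k))"
   by (rule T) auto
  also have "... = (\<kappa> * ?C ^ ?n) * ((2 ^ k) ^ ?n * vol (maximal_set v (2 ^ k)))"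
   by (simp add: power_mult_distrib)
  also have "... <= (\<kappa> * ?C ^ ?n) * q" using q0 k(2) by (intro mult_left_mono) auto
  also have "... <= (\<kappa> * ?C ^ ?n + 1) * q" using q by (intro mult_right_mono) auto
  also have "... = L / 2"
  proof -
   have "\<kappa> * ?C ^ ?n + 1 ~= 0" using q0 by linarith
   moreover have "y * (L / 2 / y) = L / 2" if "y ~= 0" for y using that by simp
   ultimately show ?thesis unfolding q_def by blast
  qed
  finally show False using k0[OF k(1)] by linarith
 qed
 have "(LBINT x:maximal_set v t. ?J x) + (LBINT x:- maximal_set v t. ?J x) = (LBINT x:maximal_set v t \<union> - maximal_set v t. ?J x)"
  using Os by (intro set_integral_Un[symmetric] set_integrable_lborel J) auto
 also have "... = 0" using zero by (simp add: set_integral_def Compl_partition)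
 finally have "abs (LBINT x:maximal_set v t. ?J x) = abs (LBINT x:- maximal_set v t. ?J x)" by linarith
 also have "... <= \<kappa> * (?C * t) ^ ?n * vol (maximal_set v t)" by (rule T[OF t])
 finally show ?thesis .
qed

section \<open>Weighted summation over dyadic levels and absorption\<close>

text \<open>At a Lebesgue point the means tend to \<open>v x\<close>, so some ball has mean above
  any \<open>t < v x\<close>. One null set serves all \<open>t\<close>.\<close>

lemma AE_mem_maximal_set:
 assumes v: "L1 v"
 shows "AE x. \<forall>t. t < v x --> x \<in> maximal_set v t"
 using lebesgue_points[OF v]
proof (eventually_elim, intro allI impI)
 fix x t assume L: "((%r. avg_ball (%y. abs (v y - v x)) x r) \<longlongrightarrow> 0) (at_right 0)" and t: "t < v x"
 have "\<forall>\<^sub>F r in at_right 0. avg_ball (%y. abs (v y - v x)) x r < v x - t"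
  using L t by (intro order_tendstoD) auto
 then obtain d where d: "d > 0" "!!r. 0 < r ==> r < d ==> avg_ball (%y. abs (v y - v x)) x r < v x - t"
  unfolding eventually_at_right_field by blast
 define r where "r = d / 2"
 have r: "r > 0" "r < d" using d(1) by (auto simp: r_def)
 let ?B = "ball x r"
 have m: "vol ?B > 0" using r by (simp add: measure_lborel_ball)
 have i: "set_integrable lborel ?B v" using v by (intro set_integrable_lborel) auto
 note c = set_integrable_const_ball[of x r "v x"]
 have ia: "set_integrable lborel ?B (%y. abs (v y - v x))" by (intro set_integrable_abs set_integral_diff(1)[OF i c])
 have "v x * vol ?B = (LBINT y:?B. v x)" using r by (simp add: set_integral_def)
 also have "... <= (LBINT y:?B. v y + abs (v y - v x))"
  by (rule set_integral_mono[OF c set_integral_add(1)[OF i ia]]) auto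
 also have "... = (LBINT y:?B. v y) + (LBINT y:?B. abs (v y - v x))" by (rule set_integral_add(2)[OF i ia])
 also have "(LBINT y:?B. abs (v y - v x)) < (v x - t) * vol ?B"
  using d(2)[OF r] m by (simp add: avg_ball_def pos_divide_less_eq)
 finally have "t * vol ?B < (LBINT y:?B. v y)" by (simp add: algebra_simps)
 then show "x \<in> maximal_set v t" using r by (auto simp: maximal_set_def)
qed

lemma summable_power_half: "summable (%k. real k ^ P * (1/2) ^ k)"
proof -
 have "((%k. (1 + 1 / real k) ^ P) \<longlonglongrightarrow> (1 + 0) ^ P)"
  by (intro tendsto_intros lim_1_over_n)
 then have "\<forall>\<^sub>F k in sequentially. (1 + 1 / real k) ^ P < 3/2"
  by (intro order_tendstoD) auto
 then obtain N where N: "!!k. k >= N ==> (1 + 1 / real k) ^ P < 3/2" by (auto simp: eventually_sequentially)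
 show ?thesis
 proof (rule summable_ratio_test[of "3/4" "max N 1"])
  fix k assume k: "max N 1 <= k"
  have "real (Suc k) ^ P = (1 + 1 / real k) ^ P * real k ^ P"
   using k by (simp add: power_mult_distrib[symmetric] field_simps)
  also have "... <= 3/2 * real k ^ P" using N[of k] k by (intro mult_right_mono) auto
  finally have "real (Suc k) ^ P * (1/2) ^ Suc k <= 3/2 * real k ^ P * (1/2) ^ Suc k" by (intro mult_right_mono) auto
  then show "norm (real (Suc k) ^ P * (1/2) ^ Suc k) <= 3/4 * norm (real k ^ P * (1/2) ^ k)" by simp
 qed simp
qed

lemma power_le_two_power: obtains C where "C > 0" "!!k. real k ^ P <= C * 2 ^ k"
proof -
 have "(%k. real k ^ P * (1/2) ^ k) \<longlonglongrightarrow> 0" by (rule summable_LIMSEQ_zero[OF summable_power_half])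
 then have "Bseq (%k. real k ^ P * (1/2) ^ k)" by (intro convergent_imp_Bseq) (auto simp: convergent_def)
 then obtain C where C: "C > 0" "!!k. norm (real k ^ P * (1/2) ^ k) <= C" by (auto simp: Bseq_def)
 have "real k ^ P <= C * 2 ^ k" for k
  using C(2)[of k] by (simp add: power_one_over field_simps)
 with C(1) show ?thesis by (rule that)
qed

text \<open>The step \<open>M ^ Suc A - (M - 1) ^ Suc A <= (A + 1) * M ^ A\<close> is Bernoulli's
  inequality. The sum of the weights thus recovers one more power of the level than each single
  weight has.\<close>

lemma sum_powers_ge: "real M ^ Suc A <= real (Suc A) * (\<Sum>k=1..M. real k ^ A)"
proof (induction M)
 case (Suc M)
 define y where "y = real (Suc M)"
 have y: "y > 0" "y >= 1" by (auto simp: y_def)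
 have "1 + real (Suc A) * (- 1 / y) <= (1 + - 1 / y) ^ Suc A"
  by (rule Bernoulli_inequality) (use y in simp)
 then have "y ^ Suc A * (1 + real (Suc A) * (- 1 / y)) <= y ^ Suc A * (1 + - 1 / y) ^ Suc A"
  using y by (intro mult_left_mono) auto
 also have "... = (y * (1 + - 1 / y)) ^ Suc A" by (rule power_mult_distrib[symmetric])
 also have "y * (1 + - 1 / y) = real M" using y by (simp add: y_def field_simps)
 also have "y ^ Suc A * (1 + real (Suc A) * (- 1 / y)) = y ^ Suc A - real (Suc A) * y ^ A"
  using y by (simp add: field_simps)
 finally show ?case using Suc by (simp add: y_def algebra_simps)
qed simp

lemma sum_geom_weighted_le:
 assumes "m >= 1"
 shows "(\<Sum>k=1..K. real k ^ A * 2 ^ (k * m)) <= 2 * real K ^ A * 2 ^ (K * m)"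
proof -
 have q: "(2::real) ^ m >= 2" using power_increasing[of 1 m "2::real"] assms by simp
 have g: "(\<Sum>k=1..K. (2 ^ m) ^ k) <= 2 * ((2::real) ^ m) ^ K" for K
 proof (induction K)
  case (Suc K)
  have "2 * ((2::real) ^ m) ^ K <= 2 ^ m * (2 ^ m) ^ K" using q by (intro mult_right_mono) auto
  then have "2 * ((2::real) ^ m) ^ K <= (2 ^ m) ^ Suc K" by simp
  moreover have "(\<Sum>k=1..Suc K. ((2::real) ^ m) ^ k) = (\<Sum>k=1..K. (2 ^ m) ^ k) + (2 ^ m) ^ Suc K" by simp
  ultimately show ?case using Suc by linarith
 qed simp
 have "(\<Sum>k=1..K. real k ^ A * 2 ^ (k * m)) <= (\<Sum>k=1..K. real K ^ A * 2 ^ (k * m))"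
  by (intro sum_mono mult_right_mono power_mono) auto
 also have "... = real K ^ A * (\<Sum>k=1..K. (2 ^ m) ^ k)"
  by (simp add: sum_distrib_left power_mult[symmetric] mult.commute)
 also have "... <= real K ^ A * (2 * (2 ^ m) ^ K)" using g by (intro mult_left_mono) auto
 finally show ?thesis by (simp add: power_mult[symmetric] mult_ac)
qed

lemma power_mult_le_sum:
 fixes x y :: real
 assumes "0 <= x" "0 <= y"
 shows "x ^ n * y <= x ^ (n + 1) + y ^ (n + 1)"
proof (cases "x <= y")
 case True
 have "x ^ n * y <= y ^ n * y" using True assms by (intro mult_right_mono power_mono) auto
 moreover have "x ^ (n + 1) >= 0" "y ^ (n + 1) = y ^ n * y" using assms by auto
 ultimately show ?thesis by linarith
next
 case False
 have "x ^ n * y <= x ^ n * x" using False assms by (intro mult_left_mono) auto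
 then show ?thesis using assms by (simp add: mult.commute add_increasing2)
qed

text \<open>If \<open>a\<close> exceeds \<open>n * 2 ^ (n + 1) * K * b\<close>, the distortion
  inequality bounds the term by \<open>w * W / 4\<close>. Otherwise \<open>a\<close> is at most a
  multiple of \<open>K * b\<close>, or of \<open>b\<close>, and only powers of \<open>b\<close>,
  \<open>K\<close> and \<open>W\<close> remain, each controlled separately: \<open>b\<close> by its
  \<open>L^{n+1}\<close> bound, \<open>K\<close> by the exponential, \<open>W\<close> by the weak
  type estimate.\<close>

lemma absorb_term1:
 assumes n: "n >= 1" and a: "0 <= a" and b: "0 <= b" and aw: "a ^ n <= K * w" and K: "K >= 1" and W: "W >= 0" and w: "w >= 0"
 shows "real n * b * (a + b) ^ (n - 1) * W <= w * W / 4 +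
  (real n * 2 ^ (n - 1) * (real n * 2 ^ (n + 1)) ^ (n - 1)) * (b ^ (n + 1) + K ^ (2 * ((n - 1) * (n + 1))) + W ^ (2 * (n + 1)))"
proof -
 define B where "B = (real n * 2 ^ (n + 1)) ^ (n - 1)"
 have "real n * 2 ^ (n + 1) >= 1 * 1" using n by (intro mult_mono one_le_power) auto
 then have B: "B >= 1" unfolding B_def by (intro one_le_power) simp
 obtain m where m: "n = Suc m" using n by (cases n) auto
 define KW where "KW = K ^ (n - 1) * W"
 have KW: "KW >= 0" "W <= KW" unfolding KW_def using K W mult_right_mono[OF one_le_power[OF K, of "n - 1"] W] by auto
 \<comment> \<open>The mixed power of \<open>K\<close> and \<open>W\<close> is separated by
   \<open>p * q <= p^2 + q^2\<close>; this doubles the exponents of both.\<close>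
 have sq: "KW ^ (n + 1) <= K ^ (2 * ((n - 1) * (n + 1))) + W ^ (2 * (n + 1))"
 proof -
  define p where "p = K ^ ((n - 1) * (n + 1))"
  define q where "q = W ^ (n + 1)"
  have "0 <= (p - q)\<^sup>2 + p\<^sup>2 + q\<^sup>2" by simp
  then have "p * q <= p\<^sup>2 + q\<^sup>2" by (simp add: power2_eq_square algebra_simps)
  moreover have "KW ^ (n + 1) = p * q" unfolding KW_def p_def q_def by (simp only: power_mult_distrib power_mult)
  moreover have "p\<^sup>2 = K ^ (2 * ((n - 1) * (n + 1)))" "q\<^sup>2 = W ^ (2 * (n + 1))"
   unfolding p_def q_def by (simp_all only: power_mult[symmetric] mult.commute[of _ 2])
  ultimately show ?thesis by simp
 qed
 have rest: "real n * 2 ^ (n - 1) * B * (b ^ n * KW) <= real n * 2 ^ (n - 1) * B * (b ^ (n + 1) + K ^ (2 * ((n - 1) * (n + 1))) + W ^ (2 * (n + 1)))"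
  using power_mult_le_sum[OF b KW(1), of n] sq B by (intro mult_left_mono) auto
 have wW: "0 <= w * W / 4" using w W by simp
 have rhs0: "0 <= real n * 2 ^ (n - 1) * B * (b ^ (n + 1) + K ^ (2 * ((n - 1) * (n + 1))) + W ^ (2 * (n + 1)))"
  using B b K W by simp
 have "real n * b * (a + b) ^ (n - 1) * W <= w * W / 4 + real n * 2 ^ (n - 1) * B * (b ^ (n + 1) + K ^ (2 * ((n - 1) * (n + 1))) + W ^ (2 * (n + 1)))"
 proof (cases "a <= b")
  case True
  have "real n * b * (a + b) ^ (n - 1) * W <= real n * b * (2 * b) ^ (n - 1) * KW"
   using True a b W KW by (intro mult_mono power_mono) auto
  also have "... = real n * 2 ^ (n - 1) * 1 * (b ^ n * KW)" by (simp add: m power_mult_distrib)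
  also have "... <= real n * 2 ^ (n - 1) * B * (b ^ n * KW)"
   using B b KW by (intro mult_right_mono mult_left_mono) auto
  finally show ?thesis using rest wW by linarith
 next
  case ab: False
  have 1: "real n * b * (a + b) ^ (n - 1) * W <= real n * b * (2 * a) ^ (n - 1) * W"
   using ab a b W by (intro mult_mono power_mono) auto
  show ?thesis
  proof (cases "real n * 2 ^ (n + 1) * K * b <= a")
   case True
   \<comment> \<open>The exponent \<open>n + 1\<close> in the threshold is
     \<open>2 + (n - 1)\<close>: four for the quarter of \<open>w * W\<close>, and
     \<open>2 ^ (n - 1)\<close> from replacing \<open>a + b\<close> by \<open>2 * a\<close>.\<close>
   have "4 * K * (real n * b * (2 * a) ^ (n - 1)) = (real n * 2 ^ (n + 1) * K * b) * a ^ (n - 1)"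
    by (simp add: m power_mult_distrib)
   also have "... <= a * a ^ (n - 1)" using True a by (intro mult_right_mono) auto
   also have "... = a ^ n" by (simp add: m)
   also have "... <= K * w" by (rule aw)
   finally have "K * (4 * (real n * b * (2 * a) ^ (n - 1))) <= K * w" by (simp only: mult_ac)
   then have "4 * (real n * b * (2 * a) ^ (n - 1)) <= w" using K by simp
   then have "real n * b * (2 * a) ^ (n - 1) * W <= w / 4 * W" using W by (intro mult_right_mono) auto
   then show ?thesis using 1 rhs0 by simp
  next
   case False
   then have "2 * a <= 2 * (real n * 2 ^ (n + 1) * K * b)" by linarith
   then have "(2 * a) ^ (n - 1) <= (2 * (real n * 2 ^ (n + 1) * K * b)) ^ (n - 1)" using a by (intro power_mono) auto
   then have "real n * b * (2 * a) ^ (n - 1) * W <= real n * b * (2 * (real n * 2 ^ (n + 1) * K * b)) ^ (n - 1) * W"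
    using b W by (intro mult_right_mono mult_left_mono) auto
   also have "... = real n * 2 ^ (n - 1) * B * (b ^ n * KW)"
    unfolding B_def KW_def by (simp only: m diff_Suc_1 power_mult_distrib power_Suc mult_ac)
   finally show ?thesis using 1 rest wW by linarith
  qed
 qed
 then show ?thesis by (simp only: B_def)
qed

text \<open>The reciprocal of the total constant collected in the absorbed case of the second term,
  so that this case yields precisely \<open>w * W / 4\<close>.\<close>

definition absorb_eps :: "nat => nat => real => real" where
 "absorb_eps n A C1 = 1 / (4 * C1 * 4 ^ n * 2 ^ Suc A * real (Suc A))"

lemma absorb_eps: "C1 >= 1 ==> 0 < absorb_eps n A C1 & absorb_eps n A C1 <= 1"
proof -
 assume C1: "C1 >= 1"
 have "1 * 1 * 1 * 1 * 1 <= 4 * C1 * 4 ^ n * 2 ^ Suc A * real (Suc A)"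
  using C1 by (intro mult_mono) (auto simp: one_le_power simp del: power_Suc)
 then show ?thesis unfolding absorb_eps_def using C1 by (auto simp: divide_le_eq_1)
qed

text \<open>Let \<open>\<kappa>\<close> be the truncated level of \<open>v\<close>. When
  \<open>b\<close> dominates, \<open>b ^ (n + 1)\<close> suffices. When \<open>a\<close> dominates
  and \<open>K <= \<epsilon> * \<kappa>\<close>, the distortion inequality trades \<open>K\<close>
  for a further power of \<open>\<kappa>\<close>, which the weight sum \<open>W\<close> supplies, so
  the term is absorbed. When \<open>K > \<epsilon> * \<kappa>\<close>,
  \<open>2 ^ (\<kappa> n)\<close> is at most an exponential of \<open>K\<close>.\<close>

lemma absorb_term2:
 fixes C1 :: real and n A :: nat
 assumes n: "n >= 2" and C1: "C1 >= 1"
 defines "\<epsilon> \<equiv> absorb_eps n A C1"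
 obtains D where "D > 0"
  "!!a b w K W v N. [|0 <= a; 0 <= b; a ^ n <= K * w; K >= 1; W >= 0; w >= 0; v = a + b;
   2 <= min N (lev v) ==> (\<Sum>k=1..min N (lev v) - 1. real k ^ A) <= W|] ==>
  C1 * v * (\<Sum>k=1..min N (lev v). real k ^ A * 2 ^ (k * (n - 1))) <= w * W / 4 + D * (b ^ (n + 1) + v + w + exp (3 * real n / \<epsilon> * K))"
proof -
 obtain CA where CA: "CA > 0" "!!k. real k ^ A <= CA * 2 ^ k" using power_le_two_power[of A] by blast
 define D where "D = C1 * 2 ^ (n - 1) + 2 * C1 * CA * 2 ^ n * 2 ^ (n + 1) + 4 * C1 * CA"
 have D1: "C1 * 2 ^ (n - 1) <= D" "2 * C1 * CA * 2 ^ n * 2 ^ (n + 1) <= D" "4 * C1 * CA <= D" "D > 0"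
  unfolding D_def using C1 CA(1) by (auto intro!: add_nonneg_nonneg add_pos_pos mult_pos_pos mult_nonneg_nonneg)
 have \<epsilon>: "\<epsilon> > 0" and \<epsilon>1: "\<epsilon> <= 1" using absorb_eps[OF C1] by (auto simp: \<epsilon>_def)
 obtain m where m: "n = Suc (Suc m)" using n by (metis add_2_eq_Suc le_Suc_ex)
 show ?thesis
 proof (rule that[OF D1(4)])
  fix a b w K W v :: real and N :: nat
  assume a: "0 <= a" and b: "0 <= b" and aw: "a ^ n <= K * w" and K: "K >= 1" and W: "W >= 0" and w: "w >= 0" and v: "v = a + b"
   and Wl: "2 <= min N (lev v) ==> (\<Sum>k=1..min N (lev v) - 1. real k ^ A) <= W"
  define \<kappa> where "\<kappa> = min N (lev v)"
  define E where "E = exp (3 * real n / \<epsilon> * K)"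
  have E: "E >= 0" by (simp add: E_def)
  have v0: "v >= 0" using a b v by simp
  have wW: "0 <= w * W / 4" using w W by simp
  have pow0: "b ^ (n + 1) >= 0" using b by simp
  let ?S = "\<Sum>k=1..\<kappa>. real k ^ A * 2 ^ (k * (n - 1))"
  have "C1 * v * ?S <= w * W / 4 + D * (b ^ (n + 1) + v + w + E)"
  proof -
   consider "\<kappa> = 0" | "\<kappa> = 1" | "\<kappa> >= 2" by linarith
   then show ?thesis
   proof cases
    case 1
    then show ?thesis using wW D1(4) pow0 v0 w E by simp
   next
    case 2
    then have "C1 * v * ?S = (C1 * 2 ^ (n - 1)) * v" by simp
    also have "... <= D * v" using D1(1) v0 by (rule mult_right_mono)
    also have "... <= D * (b ^ (n + 1) + v + w + E)" using D1(4) pow0 w E by (intro mult_left_mono) auto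
    finally show ?thesis using wW by linarith
   next
    case 3
    have S: "?S <= 2 * real \<kappa> ^ A * 2 ^ (\<kappa> * (n - 1))" using n by (intro sum_geom_weighted_le) simp
    have "\<kappa> <= lev v" by (simp add: \<kappa>_def)
    then have \<kappa>v: "2 ^ \<kappa> < 2 * v" using Suc_le_lev_iff[of \<kappa> v] 3 by simp
    have pn: "(2::real) ^ \<kappa> * 2 ^ (\<kappa> * (n - 1)) = (2 ^ \<kappa>) ^ n" by (simp add: m power_mult power_add)
    show ?thesis
    proof (cases "a <= b")
     case True
     have "C1 * v * ?S <= C1 * v * (2 * (CA * 2 ^ \<kappa>) * 2 ^ (\<kappa> * (n - 1)))"
      using S CA(2)[of \<kappa>] C1 v0 by (intro mult_left_mono order_trans[OF S] mult_right_mono) auto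
     also have "... = 2 * C1 * CA * v * (2 ^ \<kappa> * 2 ^ (\<kappa> * (n - 1)))" by simp
     also have "... = 2 * C1 * CA * v * (2 ^ \<kappa>) ^ n" by (simp only: pn)
     also have "... <= 2 * C1 * CA * v * (2 * v) ^ n"
      using \<kappa>v C1 CA v0 by (intro mult_left_mono power_mono) auto
     also have "... = 2 * C1 * CA * 2 ^ n * v ^ (n + 1)" by (simp add: power_mult_distrib)
     also have "... <= 2 * C1 * CA * 2 ^ n * (2 * b) ^ (n + 1)"
      using True v C1 CA v0 by (intro mult_left_mono power_mono) auto
     also have "... = 2 * C1 * CA * 2 ^ n * 2 ^ (n + 1) * b ^ (n + 1)" by (simp add: power_mult_distrib)
     also have "... <= D * b ^ (n + 1)" using D1(2) pow0 by (rule mult_right_mono)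
     also have "... <= D * (b ^ (n + 1) + v + w + E)" using D1(4) v0 w E by (intro mult_left_mono) auto
     finally show ?thesis using wW by linarith
    next
     case ab: False
     then have v2a: "v <= 2 * a" using v by simp
     have a0: "a > 0" using ab b by linarith
     show ?thesis
     proof (cases "K <= \<epsilon> * real \<kappa>")
      case True
      have "C1 * v * ?S <= C1 * (2 * a) * (2 * real \<kappa> ^ A * 2 ^ (\<kappa> * (n - 1)))"
       using S C1 v0 v2a a by (intro mult_mono) (auto intro!: sum_nonneg)
      also have "(2::real) ^ (\<kappa> * (n - 1)) = (2 ^ \<kappa>) ^ (n - 1)" by (simp add: power_mult)
      also have "C1 * (2 * a) * (2 * real \<kappa> ^ A * (2 ^ \<kappa>) ^ (n - 1)) <= C1 * (2 * a) * (2 * real \<kappa> ^ A * (4 * a) ^ (n - 1))"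
       using \<kappa>v v2a C1 a by (intro mult_left_mono power_mono) auto
      also have "... = C1 * 4 ^ n * a ^ n * real \<kappa> ^ A" by (simp add: m power_mult_distrib)
      also have "... <= C1 * 4 ^ n * (K * w) * real \<kappa> ^ A"
       using aw C1 by (intro mult_right_mono mult_left_mono) auto
      also have "... <= C1 * 4 ^ n * ((\<epsilon> * real \<kappa>) * w) * real \<kappa> ^ A"
       using True C1 w by (intro mult_right_mono mult_left_mono) auto
      also have "... = C1 * 4 ^ n * \<epsilon> * w * real \<kappa> ^ Suc A" by simp
      also have "... <= C1 * 4 ^ n * \<epsilon> * w * (2 ^ Suc A * (real (Suc A) * W))"
      proof (rule mult_left_mono)
       \<comment> \<open>The weight sum reaches only \<open>\<kappa> - 1\<close>, so
         \<open>\<kappa> <= 2 * (\<kappa> - 1)\<close> is used; it holds from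
         \<open>\<kappa> = 2\<close> on, and levels 0 and 1 are treated separately above.\<close>
       have "real \<kappa> ^ Suc A <= (2 * real (\<kappa> - 1)) ^ Suc A" using 3 by (intro power_mono) auto
       also have "... = 2 ^ Suc A * real (\<kappa> - 1) ^ Suc A" by (rule power_mult_distrib)
       also have "real (\<kappa> - 1) ^ Suc A <= real (Suc A) * W"
        using sum_powers_ge[of "\<kappa> - 1" A] Wl[folded \<kappa>_def, OF 3] mult_left_mono[of _ W "real (Suc A)"]
        by (meson of_nat_0_le_iff order_trans)
       finally show "real \<kappa> ^ Suc A <= 2 ^ Suc A * (real (Suc A) * W)" by simp
       show "0 <= C1 * 4 ^ n * \<epsilon> * w" using C1 \<epsilon> w by simp
      qed
      also have "... = (4 * C1 * 4 ^ n * 2 ^ Suc A * real (Suc A)) * \<epsilon> * (w * W / 4)" by simp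
      also have "(4 * C1 * 4 ^ n * 2 ^ Suc A * real (Suc A)) * \<epsilon> = 1" unfolding \<epsilon>_def absorb_eps_def using C1 by simp
      finally have "C1 * v * ?S <= w * W / 4" by simp
      moreover have "0 <= D * (b ^ (n + 1) + v + w + E)" using D1(4) pow0 v0 w E by simp
      ultimately show ?thesis by linarith
     next
      case False
      define X where "X = real n / \<epsilon> * K"
      have \<kappa>K: "real \<kappa> <= K / \<epsilon>" using False \<epsilon> by (simp add: field_simps)
      have XK: "K <= X"
      proof -
       have "1 * 1 <= real n * (1 / \<epsilon>)" using n \<epsilon> \<epsilon>1 by (intro mult_mono) auto
       then have "1 * K <= real n / \<epsilon> * K" using K by (intro mult_right_mono) auto
       then show ?thesis by (simp add: X_def)
      qed
      have X0: "X >= 0" using XK K by linarith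
      have EX: "E = exp X ^ 3" by (simp add: E_def X_def exp_of_nat_mult[symmetric])
      have "(2::real) ^ \<kappa> <= exp (real \<kappa>)"
       using power_mono[of "2::real" "exp 1" \<kappa>] exp_ge_add_one_self[of 1] by (simp add: exp_of_nat_mult[symmetric])
      then have "(2 ^ \<kappa>) ^ n <= exp (real \<kappa>) ^ n" by (intro power_mono) auto
      also have "... = exp (real n * real \<kappa>)" by (simp add: exp_of_nat_mult)
      also have "... <= exp X" using \<kappa>K n mult_left_mono[OF \<kappa>K, of "real n"] by (simp add: X_def)
      finally have 2: "(2 ^ \<kappa>) ^ n <= exp X" .
      \<comment> \<open>Up to \<open>exp X ^ 2\<close> the size of \<open>a\<close> is paid for by
        \<open>exp (3 * X)\<close>, the origin of the 3 in the exponential constant. Beyond it,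
        \<open>K * exp X <= a\<close>, and \<open>a * a <= a ^ n <= K * w\<close> gives the bound by
        \<open>w\<close>.\<close>
      have 3: "a * exp X <= E + w"
      proof (cases "a <= exp X ^ 2")
       case True
       have "a * exp X <= exp X ^ 2 * exp X" using True by (intro mult_right_mono) auto
       then have "a * exp X <= E" unfolding EX power2_eq_square power3_eq_cube .
       then show ?thesis using w by linarith
      next
       case False
       have eX: "exp X >= 1" using X0 by simp
       have a1: "a >= 1" using False one_le_power[OF eX, of 2] by linarith
       have "K <= exp X" using XK exp_ge_add_one_self[of X] by linarith
       then have "K * exp X <= exp X * exp X" by (intro mult_right_mono) auto
       also have "... <= a" using False by (simp add: power2_eq_square)
       finally have "K * exp X * a <= a * a" using a by (intro mult_right_mono)
       also have "... <= a ^ n" using power_increasing[OF n a1] by (simp add: power2_eq_square)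
       also have "... <= K * w" by (rule aw)
       finally have "K * (a * exp X) <= K * w" by (simp only: mult_ac)
       then have "a * exp X <= w" using K by simp
       then show ?thesis using E by linarith
      qed
      have "C1 * v * ?S <= C1 * (2 * a) * (2 * (CA * 2 ^ \<kappa>) * 2 ^ (\<kappa> * (n - 1)))"
       using order_trans[OF S mult_right_mono[OF mult_left_mono[OF CA(2)[of \<kappa>]], of 2 "2 ^ (\<kappa> * (n - 1))"]] C1 v0 v2a a
       by (intro mult_mono) (auto intro!: sum_nonneg)
      also have "... = 4 * C1 * CA * (a * (2 ^ \<kappa> * 2 ^ (\<kappa> * (n - 1))))" by simp
      also have "... <= 4 * C1 * CA * (a * exp X)"
       unfolding pn using 2 C1 CA a by (intro mult_left_mono) auto
      also have "... <= 4 * C1 * CA * (E + w)" using 3 C1 CA by (intro mult_left_mono) auto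
      also have "... <= D * (E + w)" using D1(3) E w by (intro mult_right_mono) auto
      also have "... <= D * (b ^ (n + 1) + v + w + E)" using D1(4) pow0 v0 by (intro mult_left_mono) auto
      finally show ?thesis using wW by linarith
     qed
    qed
   qed
  qed
  then show "C1 * v * (\<Sum>k=1..min N (lev v). real k ^ A * 2 ^ (k * (n - 1))) <= w * W / 4 + D * (b ^ (n + 1) + v + w + exp (3 * real n / \<epsilon> * K))"
   by (simp only: \<kappa>_def E_def)
 qed
qed

lemma power_le_fact_exp:
 fixes x :: real
 assumes "x >= 0"
 shows "x ^ j <= fact j * exp x"
proof -
 have s: "summable (%i. inverse (fact i) *\<^sub>R x ^ i)" by (rule summable_exp_generic)
 have "(\<Sum>i\<in>{j}. inverse (fact i) *\<^sub>R x ^ i) <= exp x"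
  unfolding exp_def by (rule sum_le_suminf[OF s]) (use assms in auto)
 then show ?thesis by (simp add: field_simps)
qed

text \<open>For nested sets only the last index \<open>\<kappa>\<close> with \<open>x\<close> in
  \<open>V \<kappa>\<close> counts: the sum is at most \<open>\<kappa> ^ Suc A\<close>, and its
  power is one of the terms on the right. High powers of the weight sum are thus integrable through
  the measures of the sets.\<close>

lemma power_nested_sum_le:
 assumes anti: "!!j k. 1 <= j ==> j <= k ==> x \<in> V k ==> x \<in> V j"
 shows "(\<Sum>k=1..N. real k ^ A * indicator (V k) x) ^ Suc P <= (\<Sum>k=1..N. real k ^ (Suc A * Suc P) * indicator (V k) x)"
proof (cases "\<exists>k\<in>{1..N}. x \<in> V k")
 case False
 then have "(\<Sum>k=1..N. real k ^ A * indicator (V k) x) = 0" by (intro sum.neutral) auto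
 moreover have "0 <= (\<Sum>k=1..N. real k ^ (Suc A * Suc P) * indicat_real (V k) x)" by (intro sum_nonneg) auto
 ultimately show ?thesis by simp
next
 case True
 define \<kappa> where "\<kappa> = Max {k\<in>{1..N}. x \<in> V k}"
 have "\<kappa> \<in> {k\<in>{1..N}. x \<in> V k}" unfolding \<kappa>_def using True by (intro Max_in) auto
 then have \<kappa>: "\<kappa> \<in> {1..N}" "x \<in> V \<kappa>" by auto
 have le: "k <= \<kappa>" if "k \<in> {1..N}" "x \<in> V k" for k unfolding \<kappa>_def using that by (intro Max_ge) auto
 have "(\<Sum>k=1..N. real k ^ A * indicator (V k) x) = (\<Sum>k=1..\<kappa>. real k ^ A)"
  using le \<kappa> anti by (intro sum.mono_neutral_cong_right) (auto simp: indicator_def)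
 also have "... <= (\<Sum>k=1..\<kappa>. real \<kappa> ^ A)" by (intro sum_mono power_mono) auto
 also have "... = real \<kappa> ^ Suc A" by simp
 finally have "(\<Sum>k=1..N. real k ^ A * indicator (V k) x) ^ Suc P <= (real \<kappa> ^ Suc A) ^ Suc P"
  by (intro power_mono sum_nonneg) auto
 also have "... = real \<kappa> ^ (Suc A * Suc P) * indicator (V \<kappa>) x" using \<kappa> by (simp only: power_mult indicator_simps mult_1_right)
 also have "... <= (\<Sum>k=1..N. real k ^ (Suc A * Suc P) * indicator (V k) x)"
  using \<kappa> by (intro member_le_sum) auto
 finally show ?thesis .
qed

lemma maximal_set_antimono:
 assumes "s <= t"
 shows "maximal_set v t \<subseteq> maximal_set v s"
proof
 fix x assume "x \<in> maximal_set v t"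
 then obtain r where r: "r > 0" "t * vol (ball x r) < (LBINT y:ball x r. v y)"
  unfolding maximal_set_def by blast
 have "s * vol (ball x r) <= t * vol (ball x r)" using assms by (intro mult_right_mono) auto
 then have "s * vol (ball x r) < (LBINT y:ball x r. v y)" using r(2) by linarith
 with r(1) show "x \<in> maximal_set v s" unfolding maximal_set_def by blast
qed

text \<open>Fatou's lemma: the integrands are eventually constant in \<open>N\<close> at each point,
  and their integrals have a common bound.\<close>

lemma integrable_bounded_partial_sums:
 assumes [measurable]: "w \<in> borel_measurable lborel" "v \<in> borel_measurable lborel" and w: "!!x. 0 <= w x"
  and i: "!!N. L1 (%x. w x * (\<Sum>k=1..min N (lev (v x) - 1). real k ^ A))"
  and le: "!!N. (LBINT x. w x * (\<Sum>k=1..min N (lev (v x) - 1). real k ^ A)) <= Q"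
 shows "L1 (%x. w x * (\<Sum>k=1..lev (v x) - 1. real k ^ A))"
proof (rule integrableI_bounded)
 let ?g = "%x. w x * (\<Sum>k=1..lev (v x) - 1. real k ^ A)"
 let ?u = "%N x. ennreal (w x * (\<Sum>k=1..min N (lev (v x) - 1). real k ^ A))"
 have [measurable]: "(%x. ?g x) \<in> borel_measurable lborel"
 proof -
  have "(%x. (%L. \<Sum>k=1..L - 1. real k ^ A) (lev (v x))) \<in> borel_measurable lborel"
   by (rule measurable_compose[OF measurable_lev]) auto
  then show ?thesis by (intro borel_measurable_times) auto
 qed
 then show "(%x. ?g x) \<in> borel_measurable lborel" .
 have eq: "ennreal (norm (?g x)) = liminf (%N. ?u N x)" for x
 proof -
  have "\<forall>\<^sub>F N in sequentially. ?u N x = ennreal (?g x)"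
   using eventually_ge_at_top[of "lev (v x)"] by eventually_elim (simp add: min_absorb2)
  then have "(%N. ?u N x) \<longlonglongrightarrow> ennreal (?g x)" by (rule tendsto_eventually)
  moreover have "0 <= ?g x" using w by (intro mult_nonneg_nonneg sum_nonneg) auto
  ultimately show ?thesis by (simp add: lim_imp_Liminf)
 qed
 have "(\<integral>\<^sup>+x. ennreal (norm (?g x)) \<partial>lborel) = (\<integral>\<^sup>+x. liminf (%N. ?u N x) \<partial>lborel)"
  by (simp only: eq)
 also have "... <= liminf (%N. \<integral>\<^sup>+x. ?u N x \<partial>lborel)"
  using i by (intro nn_integral_liminf) (auto intro: measurable_L1)
 also have "... <= ennreal Q"
 proof -
  have "(\<integral>\<^sup>+x. ?u N x \<partial>lborel) <= ennreal Q" for N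
   using le[of N] w by (subst nn_integral_eq_integral[OF i]) (auto intro!: AE_I2 mult_nonneg_nonneg sum_nonneg ennreal_leI)
  then show ?thesis by (intro Liminf_le) (auto intro!: always_eventually)
 qed
 finally show "(\<integral>\<^sup>+x. ennreal (norm (?g x)) \<partial>lborel) < \<infinity>"
  by (rule le_less_trans) simp
qed

lemma bounded_maximal_power_sums:
 fixes v :: "'a::euclidean_space => real"
 assumes v: "L1 v" "!!x. 0 <= v x"
 obtains Q where "!!N. (\<Sum>k=1..N. real k ^ P * vol (maximal_set v (2 ^ k))) <= Q"
proof -
 have "(\<Sum>k=1..N. real k ^ P * vol (maximal_set v (2 ^ k)))
   <= 5 ^ DIM('a) * (LBINT x. v x) * (\<Sum>k. real k ^ P * (1/2) ^ k)" for N
 proof -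
  have I: "0 <= 5 ^ DIM('a) * (LBINT x. v x)" using v by (intro mult_nonneg_nonneg integral_nonneg_AE) auto
  have "(\<Sum>k=1..N. real k ^ P * vol (maximal_set v (2 ^ k)))
    <= (\<Sum>k=1..N. real k ^ P * (5 ^ DIM('a) / 2 ^ k * (LBINT x. v x)))"
   using measure_maximal_set(3)[OF v] by (intro sum_mono mult_left_mono) auto
  also have "... = 5 ^ DIM('a) * (LBINT x. v x) * (\<Sum>k=1..N. real k ^ P * (1/2) ^ k)"
   by (simp add: sum_distrib_left power_one_over field_simps)
  also have "... <= 5 ^ DIM('a) * (LBINT x. v x) * (\<Sum>k. real k ^ P * (1/2) ^ k)"
   using I by (intro mult_left_mono sum_le_suminf summable_power_half) auto
  finally show ?thesis .
 qed
 then show ?thesis by (rule that)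
qed

text \<open>The estimate \<open>star\<close> on each super-level set is summed with weights \<open>k\<^sup>A\<close>; the weighted sum on the
  right is then absorbed into half of the left-hand side, by the exponential integrability of the
  distortion.\<close>

theorem log_integrability_by_absorption:
 fixes v a b w K :: "'a::euclidean_space => real" and A :: nat and C1 :: real
 defines "\<epsilon> \<equiv> absorb_eps DIM('a) A C1"
 assumes n: "DIM('a) >= 2" and C1: "C1 >= 1"
  and v: "L1 v" "!!x. v x = a x + b x"
  and am [measurable]: "a \<in> borel_measurable lborel" and bm [measurable]: "b \<in> borel_measurable lborel"
  and a: "!!x. 0 <= a x" and b: "!!x. 0 <= b x" and w: "L1 w" "!!x. 0 <= w x"
  and Km [measurable]: "K \<in> borel_measurable lborel" and K: "!!x. 1 <= K x"
  and aw: "AE x. a x ^ DIM('a) <= K x * w x"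
  and S [measurable]: "S \<in> sets borel" and off: "!!x. x \<notin> S ==> a x = 0 & b x = 0"
  and eK: "L1 (%x. indicator S x * exp (3 * real DIM('a) / \<epsilon> * K x))"
  and bn: "L1 (%x. b x ^ (DIM('a) + 1))" and bv: "L1 (%x. b x * v x ^ (DIM('a) - 1))"
  and star: "!!k. k >= 1 ==> (LBINT x:maximal_set v (2 ^ k). w x) <=
    real DIM('a) * (LBINT x:maximal_set v (2 ^ k). b x * v x ^ (DIM('a) - 1)) +
    C1 * 2 ^ (k * (DIM('a) - 1)) * (LBINT x:{x. v x > 2 ^ k / 2}. v x)"
 shows "L1 (%x. a x ^ DIM('a) * ln (1 + a x) ^ A)"
proof -
 let ?n = "DIM('a)"
 let ?S = "%N x. \<Sum>k=1..min N (lev (v x)). real k ^ A * 2 ^ (k * (?n - 1))" and ?R = "%N x. \<Sum>k=1..min N (lev (v x) - 1). real k ^ A"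
 define V where "V k = maximal_set v (2 ^ k)" for k :: nat
 define c where "c = 3 * real ?n / \<epsilon>"
 have v0: "0 <= v x" for x using v(2)[of x] a[of x] b[of x] by simp
 note [measurable] = measurable_L1[OF v(1)] measurable_L1[OF w(1)]
 have Os [measurable]: "V k \<in> sets borel" for k unfolding V_def by (rule sets_maximal_set[OF v(1) v0])
 have Ofin: "emeasure lborel (V k) < \<infinity>" for k unfolding V_def by (rule measure_maximal_set(1)[OF v(1) v0]) simp
 have Oanti: "V k \<subseteq> V j" if "j <= k" for j k unfolding V_def using that by (intro maximal_set_antimono power_increasing) auto
 have \<epsilon>: "\<epsilon> > 0" "\<epsilon> <= 1" using absorb_eps[OF C1] by (auto simp: \<epsilon>_def)
 have c: "c >= real ?n + 1"
 proof -
  have "real ?n + 1 <= 3 * real ?n" using n by simp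
  also have "... <= c" unfolding c_def using \<epsilon> n by (simp add: field_simps)
  finally show ?thesis .
 qed
 \<comment> \<open>The sum of the weights of the super-level sets containing \<open>x\<close>, cut
   at \<open>N\<close>. The cut makes \<open>W N\<close> bounded, so \<open>w * W N\<close> has a
   finite integral before anything is absorbed.\<close>
 define W where "W N x = (\<Sum>k=1..N. real k ^ A * indicator (V k) x)" for N x
 have W0: "0 <= W N x" for N x unfolding W_def by (intro sum_nonneg) auto
 have Wm [measurable]: "W N \<in> borel_measurable lborel" for N unfolding W_def by measurable
 have Wb: "abs (W N x) <= (\<Sum>k=1..N. real k ^ A)" for N x
  unfolding abs_of_nonneg[OF W0] unfolding W_def by (intro sum_mono) (auto simp: indicator_def)
 have intW: "L1 (%x. f x * W N x)" if "L1 f" for f N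
 proof (rule integrable_dominated[OF integrable_mult_left[OF that, of "\<Sum>k=1..N. real k ^ A"]])
  show "(%x. f x * W N x) \<in> borel_measurable lborel"
   by (rule borel_measurable_times[OF measurable_L1[OF that] Wm])
  have "abs (W N x) <= abs (\<Sum>k=1..N. real k ^ A)" for x using Wb[of N x] by linarith
  then show "AE x. norm (f x * W N x) <= norm (f x * (\<Sum>k=1..N. real k ^ A))"
   by (intro AE_I2) (simp only: real_norm_def abs_mult, intro mult_left_mono abs_ge_zero)
 qed
 define P where "P = 2 * (?n + 1) - 1"
 have P: "Suc P = 2 * (?n + 1)" by (simp add: P_def)
 define Z where "Z N x = (\<Sum>k=1..N. real k ^ (Suc A * Suc P) * indicator (V k) x)" for N and x :: 'a
 have Z: "W N x ^ (2 * (?n + 1)) <= Z N x" for N x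
  unfolding W_def Z_def P[symmetric] by (rule power_nested_sum_le) (use Oanti in blast)
 have Zi: "L1 (Z N)" for N
  unfolding Z_def by (intro Bochner_Integration.integrable_sum integrable_mult_right) (use Ofin in \<open>auto intro!: integrable_real_indicator\<close>)
 obtain QZ where QZ: "!!N. (\<Sum>k=1..N. real k ^ (Suc A * Suc P) * vol (V k)) <= QZ"
  unfolding V_def using bounded_maximal_power_sums[OF v(1) v0] by blast
 have ZQ: "(LBINT x. Z N x) <= QZ" for N
 proof -
  have "(LBINT x. Z N x) = (\<Sum>k=1..N. real k ^ (Suc A * Suc P) * vol (V k))"
   unfolding Z_def using Ofin by (subst Bochner_Integration.integral_sum) (auto intro!: integrable_real_indicator integrable_mult_right)
  with QZ[of N] show ?thesis by simp
 qed
 obtain D where D: "D > 0"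
  "!!a b w K W v N. [|0 <= a; 0 <= b; a ^ ?n <= K * w; K >= 1; W >= 0; w >= 0; v = a + b;
   2 <= min N (lev v) ==> (\<Sum>k=1..min N (lev v) - 1. real k ^ A) <= W|] ==>
  C1 * v * (\<Sum>k=1..min N (lev v). real k ^ A * 2 ^ (k * (?n - 1))) <= w * W / 4 + D * (b ^ (?n + 1) + v + w + exp (c * K))"
  using absorb_term2[OF n C1, of A, folded \<epsilon>_def, folded c_def] by blast
 define B where "B = real ?n * 2 ^ (?n - 1) * (real ?n * 2 ^ (?n + 1)) ^ (?n - 1)"
 have B: "B >= 0" by (simp add: B_def)
 define J where "J = 2 * ((?n - 1) * (?n + 1))"
 define F where "F x = (B + D) * (b x ^ (?n + 1)) + (B * fact J + D) * (indicator S x * exp (c * K x)) + D * v x + D * w x" for x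
 have eK': "L1 (%x. indicator S x * exp (c * K x))" using eK by (simp only: c_def)
 have Fi: "L1 F" unfolding F_def by (intro Bochner_Integration.integrable_add integrable_mult_right bn eK' v(1) w(1))
 have KJ: "K x ^ J <= fact J * exp (c * K x)" for x
 proof -
  have "K x ^ J <= fact J * exp (K x)" using K[of x] by (intro power_le_fact_exp) auto
  also have "... <= fact J * exp (c * K x)" using c K[of x] mult_right_mono[of 1 c "K x"] by (intro mult_left_mono) auto
  finally show ?thesis .
 qed
 \<comment> \<open>Where \<open>v\<close> exceeds \<open>2 ^ k\<close>, so does its maximal
   function, almost everywhere; \<open>W N\<close> is therefore at least the weight sum that the
   second absorption estimate requires.\<close>
 have Wl: "AE x. \<forall>N. (?R N x) <= W N x"
  using AE_mem_maximal_set[OF v(1)]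
 proof (eventually_elim, intro allI)
  fix x N assume M: "\<forall>t. t < v x --> x \<in> maximal_set v t"
  have "(?R N x) = (\<Sum>k=1..min N (lev (v x) - 1). real k ^ A * indicator (V k) x)"
  proof (intro sum.cong refl)
   fix k assume "k \<in> {1..min N (lev (v x) - 1)}"
   then have "k < lev (v x)" by auto
   then have "x \<in> V k" using M less_lev_iff[of k "v x"] by (auto simp: V_def)
   then show "real k ^ A = real k ^ A * indicator (V k) x" by simp
  qed
  also have "... <= W N x" unfolding W_def by (intro sum_mono2) auto
  finally show "(?R N x) <= W N x" .
 qed
 have pw: "AE x. \<forall>N. real ?n * (b x * v x ^ (?n - 1)) * W N x
   + C1 * v x * (?S N x) <= w x * W N x / 2 + (F x + B * Z N x)"
  using Wl aw
 proof (eventually_elim, intro allI)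
  fix x N assume Wl: "\<forall>N. (?R N x) <= W N x" and aw: "a x ^ ?n <= K x * w x"
  have e0: "0 <= exp (c * K x)" by simp
  have Z0: "0 <= Z N x" unfolding Z_def by (intro sum_nonneg) auto
  show "real ?n * (b x * v x ^ (?n - 1)) * W N x
   + C1 * v x * (?S N x) <= w x * W N x / 2 + (F x + B * Z N x)"
  proof (cases "x \<in> S")
   case False
   then have "v x = 0" "b x = 0" using off v(2) by auto
   moreover have "0 <= F x" unfolding F_def using B D(1) b v0 w(2) by (intro add_nonneg_nonneg mult_nonneg_nonneg) auto
   moreover have "0 <= w x * W N x / 2" using w(2) W0 by simp
   moreover have "0 <= B * Z N x" using B Z0 by simp
   ultimately show ?thesis by simp
  next
   case True
   have 1: "real ?n * b x * (a x + b x) ^ (?n - 1) * W N x <= w x * W N x / 4 +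
    B * (b x ^ (?n + 1) + K x ^ J + W N x ^ (2 * (?n + 1)))"
    unfolding B_def J_def using absorb_term1[OF _ a b aw K W0 w(2)] n by simp
   have 2: "C1 * v x * (?S N x) <= w x * W N x / 4 + D * (b x ^ (?n + 1) + v x + w x + exp (c * K x))"
   proof (rule D(2)[OF a b aw K W0 w(2) v(2)])
    have "(\<Sum>k=1..min N (lev (v x)) - 1. real k ^ A) <= (?R N x)"
     by (intro sum_mono2) auto
    also have "... <= W N x" using Wl by blast
    finally show "(\<Sum>k=1..min N (lev (v x)) - 1. real k ^ A) <= W N x" .
   qed
   have 3: "B * (b x ^ (?n + 1) + K x ^ J + W N x ^ (2 * (?n + 1))) <= B * (b x ^ (?n + 1) + fact J * exp (c * K x) + Z N x)"
    using B KJ[of x] Z[of N x] by (intro mult_left_mono add_mono) auto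
   show ?thesis using 1 2 3 True by (simp add: F_def v(2)[symmetric] algebra_simps)
  qed
 qed
 \<comment> \<open>The factor 2 arises when half of the integral of \<open>w * W N\<close> is moved
   to the left; the bound does not involve \<open>N\<close>.\<close>
 define Q where "Q = 2 * ((LBINT x. F x) + B * QZ)"
 have WQ: "(LBINT x. w x * W N x) <= Q" for N
 proof -
  let ?T = "%x. C1 * v x * (?S N x)"
  let ?T' = "%x. \<Sum>k=1..N. real k ^ A * (C1 * 2 ^ (k * (?n - 1)) * (indicator {x. v x > 2 ^ k / 2} x * v x))"
  have VV: "?T x = ?T' x" for x
  proof -
   have "(\<Sum>k=1..N. real k ^ A * (C1 * 2 ^ (k * (?n - 1)) * (indicator {x. v x > 2 ^ k / 2} x * v x)))
    = (\<Sum>k\<in>{1..N} \<inter> {k. 2 ^ k / 2 < v x}. real k ^ A * (C1 * 2 ^ (k * (?n - 1)) * v x))"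
    by (intro sum.mono_neutral_cong_right) (auto simp: indicator_def)
   also have "{1..N} \<inter> {k. 2 ^ k / 2 < v x} = {1..min N (lev (v x))}" using Suc_le_lev_iff[of _ "v x"] by auto
   finally show ?thesis by (simp add: sum_distrib_left mult_ac)
  qed
  have iV: "L1 (%x. indicator {x. v x > s} x * v x)" for s
   by (rule integrable_dominated[OF v(1)]) (auto intro!: AE_I2 simp: indicator_def)
  have iV': "L1 ?T'" by (intro Bochner_Integration.integrable_sum integrable_mult_right iV)
  have sw: "(LBINT x. f x * W N x) = (\<Sum>k=1..N. real k ^ A * (LBINT x:V k. f x))" if f: "L1 f" for f
  proof -
   have "(LBINT x. f x * W N x) = (LBINT x. (\<Sum>k=1..N. real k ^ A * (indicator (V k) x *\<^sub>R f x)))"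
    unfolding W_def sum_distrib_left real_scaleR_def by (intro Bochner_Integration.integral_cong refl sum.cong) (simp only: mult_ac)
   also have "... = (\<Sum>k=1..N. real k ^ A * (LBINT x:V k. f x))"
    unfolding set_integral_def using f set_integrable_lborel[OF f Os, unfolded set_integrable_def]
    by (subst Bochner_Integration.integral_sum) auto
   finally show ?thesis .
  qed
  have "(LBINT x. w x * W N x) = (\<Sum>k=1..N. real k ^ A * (LBINT x:V k. w x))" by (rule sw[OF w(1)])
  also have "... <= (\<Sum>k=1..N. real k ^ A * (real ?n * (LBINT x:V k. b x * v x ^ (?n - 1)) +
    C1 * 2 ^ (k * (?n - 1)) * (LBINT x:{x. v x > 2 ^ k / 2}. v x)))"
   using star by (intro sum_mono mult_left_mono) (auto simp: V_def)
  also have "... = real ?n * (\<Sum>k=1..N. real k ^ A * (LBINT x:V k. b x * v x ^ (?n - 1)))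
    + (\<Sum>k=1..N. real k ^ A * (C1 * 2 ^ (k * (?n - 1)) * (LBINT x:{x. v x > 2 ^ k / 2}. v x)))"
   by (simp add: ring_distribs sum.distrib sum_distrib_left mult_ac)
  also have "... = real ?n * (LBINT x. b x * v x ^ (?n - 1) * W N x) + (LBINT x. ?T' x)"
  proof -
   have "(LBINT x. ?T' x) = (\<Sum>k=1..N. (LBINT x. real k ^ A * (C1 * 2 ^ (k * (?n - 1)) * (indicator {x. v x > 2 ^ k / 2} x * v x))))"
    by (intro Bochner_Integration.integral_sum integrable_mult_right iV)
   then show ?thesis unfolding sw[OF bv] set_integral_def by simp
  qed
  also have "... = (LBINT x. real ?n * (b x * v x ^ (?n - 1)) * W N x + ?T' x)"
   using intW[OF bv] iV' by (subst Bochner_Integration.integral_add) (auto simp: mult.assoc)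
  also have "... <= (LBINT x. w x * W N x / 2 + (F x + B * Z N x))"
  proof (rule integral_mono_AE)
   show "L1 (%x. real ?n * (b x * v x ^ (?n - 1)) * W N x + ?T' x)"
    using intW[OF bv] iV' by (intro Bochner_Integration.integrable_add) (auto simp: mult.assoc)
   show "L1 (%x. w x * W N x / 2 + (F x + B * Z N x))" using intW[OF w(1)] Fi Zi by auto
   show "AE x. real ?n * (b x * v x ^ (?n - 1)) * W N x + ?T' x <= w x * W N x / 2 + (F x + B * Z N x)"
    using pw unfolding VV[symmetric] by eventually_elim blast
  qed
  also have "... = (LBINT x. w x * W N x) / 2 + ((LBINT x. F x) + B * (LBINT x. Z N x))"
   using intW[OF w(1)] Fi Zi by simp
  also have "... <= (LBINT x. w x * W N x) / 2 + ((LBINT x. F x) + B * QZ)"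
   using mult_left_mono[OF ZQ B] by simp
  finally show ?thesis by (simp add: Q_def)
 qed
 have Li: "L1 (%x. w x * (\<Sum>k=1..lev (v x) - 1. real k ^ A))"
 proof (rule integrable_bounded_partial_sums)
  let ?f = "%N x. w x * (?R N x)"
  have fm: "?f N \<in> borel_measurable lborel" for N
  proof -
   have "(%x. (%L. \<Sum>k=1..min N (L - 1). real k ^ A) (lev (v x))) \<in> borel_measurable lborel"
    by (rule measurable_compose[OF measurable_lev]) auto
   then show ?thesis by (intro borel_measurable_times) auto
  qed
  have le: "AE x. ?f N x <= w x * W N x" for N
   using Wl by eventually_elim (auto intro!: mult_left_mono w(2))
  have f0: "0 <= ?f N x" for N x using w(2) by (intro mult_nonneg_nonneg sum_nonneg) auto
  show fi: "L1 (?f N)" for N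
   by (rule integrable_dominated[OF intW[OF w(1), of N] fm])
    (use le[of N] in \<open>eventually_elim, use f0 in \<open>simp add: abs_of_nonneg\<close>\<close>)
  show "(LBINT x. ?f N x) <= Q" for N
   using integral_mono_AE[OF fi intW[OF w(1)] le] WQ by (rule order_trans)
 qed (use w in auto)
 define G where "G x = 2 ^ Suc A * (real (Suc A) * (w x * (\<Sum>k=1..lev (v x) - 1. real k ^ A)) + 2 ^ Suc A * w x)
   + fact A * (indicator S x * exp (c * K x))" for x
 have Gi: "L1 G"
  unfolding G_def by (intro Bochner_Integration.integrable_add integrable_mult_right Li w(1) eK')
 show ?thesis
 proof (rule integrable_dominated[OF Gi])
  show "(%x. a x ^ ?n * ln (1 + a x) ^ A) \<in> borel_measurable lborel" by measurable
  show "AE x. norm (a x ^ ?n * ln (1 + a x) ^ A) <= norm (G x)"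
   using aw
  proof eventually_elim
   case (elim x)
   note aw = elim
   let ?l = "ln (1 + a x)" and ?L = "lev (v x)"
   have l0: "0 <= ?l" using a[of x] by simp
   have s0: "0 <= w x * (\<Sum>k=1..?L - 1. real k ^ A)" using w(2) by (intro mult_nonneg_nonneg sum_nonneg) auto
   have e0: "0 <= fact A * (indicator S x * exp (c * K x))" by simp
   have t0: "0 <= 2 ^ Suc A * (real (Suc A) * (w x * (\<Sum>k=1..?L - 1. real k ^ A)) + 2 ^ Suc A * w x)"
    using s0 w(2)[of x] by simp
   \<comment> \<open>If the distortion is at most \<open>ln (1 + a)\<close>, then
     \<open>a ^ n <= ln (1 + a) * w\<close>, and one further logarithm is paid for by the weight sum
     up to the level of \<open>v\<close>. Otherwise \<open>a <= exp K\<close> and everything is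
     exponential in \<open>K\<close>.\<close>
   have "a x ^ ?n * ?l ^ A <= G x"
   proof (cases "K x <= ?l")
    case True
    have "?l <= ln (1 + v x)" using a[of x] b[of x] v(2)[of x] by simp
    also have "... <= real ?L + 1" by (rule ln_le_lev[OF v0])
    also have "... <= real (?L - 1) + 2" by simp
    finally have l: "?l <= real (?L - 1) + 2" .
    have "a x ^ ?n * ?l ^ A <= (?l * w x) * ?l ^ A"
     using aw True w(2)[of x] l0 by (intro mult_right_mono order_trans[OF aw]) auto
    also have "... = w x * ?l ^ Suc A" by simp
    also have "... <= w x * (2 ^ Suc A * (real (Suc A) * (\<Sum>k=1..?L - 1. real k ^ A) + 2 ^ Suc A))"
    proof (intro mult_left_mono w(2))
     have "?l ^ Suc A <= (real (?L - 1) + 2) ^ Suc A" using l l0 by (intro power_mono) auto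
     also have "... <= 2 ^ Suc A * (real (?L - 1) ^ Suc A + 2 ^ Suc A)" by (rule add_power_le) auto
     also have "... <= 2 ^ Suc A * (real (Suc A) * (\<Sum>k=1..?L - 1. real k ^ A) + 2 ^ Suc A)"
      using sum_powers_ge[of "?L - 1" A] by (intro mult_left_mono add_right_mono) auto
     finally show "?l ^ Suc A <= 2 ^ Suc A * (real (Suc A) * (\<Sum>k=1..?L - 1. real k ^ A) + 2 ^ Suc A)" .
    qed
    also have "... = 2 ^ Suc A * (real (Suc A) * (w x * (\<Sum>k=1..?L - 1. real k ^ A)) + 2 ^ Suc A * w x)"
     by (simp only: ring_distribs mult_ac)
    finally show ?thesis unfolding G_def using e0 by linarith
   next
    case False
    show ?thesis
    proof (cases "x \<in> S")
     case xS: False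
     then have "a x = 0" using off by auto
     then show ?thesis using n t0 e0 unfolding G_def by (simp add: power_0_left)
    next
     case True
     have "1 + a x = exp ?l" using a[of x] by simp
     also have "... <= exp (K x)" using False by simp
     finally have ae: "a x <= exp (K x)" by simp
     have "a x ^ ?n * ?l ^ A <= exp (K x) ^ ?n * K x ^ A"
      using ae a[of x] l0 False by (intro mult_mono power_mono) auto
     also have "... <= exp (K x) ^ ?n * (fact A * exp (K x))"
      using K[of x] by (intro mult_left_mono power_le_fact_exp) auto
     also have "... = fact A * exp ((real ?n + 1) * K x)"
      by (simp add: exp_of_nat_mult[symmetric] ring_distribs exp_add)
     also have "... <= fact A * exp (c * K x)" using c K[of x] by (intro mult_left_mono) (auto intro!: mult_right_mono)
     also have "... = fact A * (indicator S x * exp (c * K x))" using True by simp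
     finally show ?thesis unfolding G_def using t0 by linarith
    qed
   qed
   moreover have "0 <= a x ^ ?n * ?l ^ A" using a[of x] l0 by simp
   ultimately show "norm (a x ^ ?n * ?l ^ A) <= norm (G x)" by simp
  qed
 qed
qed

section \<open>Localisation by a cut-off function\<close>

lemma integrable_bounded_scaleR:
 assumes G: "L1 G" and f: "f \<in> borel_funs" "!!x. abs (f x) <= B"
 shows "L1 (%x. f x *\<^sub>R G x)"
proof (rule integrable_dominated[OF integrable_scaleR_right[OF G, of B]])
 have "abs (f x) <= abs B" for x using f(2)[of x] by linarith
 then show "AE x. norm (f x *\<^sub>R G x) <= norm (B *\<^sub>R G x)" by (intro AE_I2) (simp add: mult_right_mono)
qed (use G f in auto)

lemma integrable_scaleR_bounded:
 assumes g: "L1 g" and F: "F \<in> borel_funs" "!!x. norm (F x) <= B"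
 shows "L1 (%x. g x *\<^sub>R F x)"
proof (rule integrable_dominated[OF integrable_mult_left[OF g, of B]])
 have "norm (F x) <= abs B" for x using F(2)[of x] by linarith
 then show "AE x. norm (g x *\<^sub>R F x) <= norm (g x * B)" by (intro AE_I2) (simp add: abs_mult mult_left_mono)
qed (use g F in auto)

lemma test_function_integrable:
 assumes \<phi>: "test_function U \<phi>"
 shows "L1 G ==> L1 (%x. \<phi> x *\<^sub>R G x)" "L1 g ==> L1 (%x. g x *\<^sub>R tgrad \<phi> x)"
 using test_function_bounded[OF \<phi>] C_diff_continuous[OF test_functionD[OF \<phi>]] continuous_on_tgrad[OF test_functionD[OF \<phi>]]
 by (blast intro: integrable_bounded_scaleR integrable_scaleR_bounded borel_measurable_continuous_onI)+

lemma test_function_mult: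
 assumes \<eta>: "test_function U \<eta>" and \<phi>: "!!k. C_diff k \<phi>"
 shows "test_function U (%x. \<eta> x * \<phi> x)"
proof -
 have "closure {x. \<eta> x * \<phi> x ~= 0} \<subseteq> closure {x. \<eta> x ~= 0}" by (intro closure_mono) auto
 moreover from this have "compact (closure {x. \<eta> x * \<phi> x ~= 0})"
  using \<eta> compact_Int_closed[of "closure {x. \<eta> x ~= 0}" "closure {x. \<eta> x * \<phi> x ~= 0}"]
  by (auto simp: test_function_def Int_absorb1)
 ultimately show ?thesis using \<eta> \<phi> by (auto simp: test_function_def C_diff_mult)
qed

text \<open>The product \<open>\<eta> \<phi>\<close> is a test function on \<open>U\<close> for
  every \<open>\<phi>\<close> on the whole space, so a local weak gradient becomes a global one, as
  the truncation requires.\<close>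

lemma wgrad_mult_test_function:
 assumes wg: "wgrad U g G" and \<eta>: "test_function U \<eta>"
 shows "wgrad UNIV (%x. \<eta> x * g x) (%x. \<eta> x *\<^sub>R G x + g x *\<^sub>R tgrad \<eta> x)"
proof -
 have g: "L1 g" "L1 G" using wg by (auto simp: wgrad_def)
 have 1: "L1 (%x. \<eta> x * g x)" using test_function_integrable(1)[OF \<eta> g(1)] by simp
 note 2 = test_function_integrable(1)[OF \<eta> g(2)] and 3 = test_function_integrable(2)[OF \<eta> g(1)]
 have "(LBINT x. (\<eta> x * g x) * (tgrad \<phi> x \<bullet> b)) = - (LBINT x. ((\<eta> x *\<^sub>R G x + g x *\<^sub>R tgrad \<eta> x) \<bullet> b) * \<phi> x)"
  if \<phi>: "test_function UNIV \<phi>" and b: "b \<in> Basis" for \<phi> b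
 proof -
  let ?\<psi> = "%x. \<eta> x * \<phi> x"
  have \<eta>\<phi>: "test_function U ?\<psi>" using \<phi> by (intro test_function_mult[OF \<eta>]) (simp add: test_function_def)
  have t: "tgrad ?\<psi> x = \<eta> x *\<^sub>R tgrad \<phi> x + \<phi> x *\<^sub>R tgrad \<eta> x" for x
   by (rule tgrad_unique[OF test_functionD[OF \<eta>\<phi>]])
    (use has_derivative_mult[OF has_derivative_tgrad[OF test_functionD[OF \<eta>]] has_derivative_tgrad[OF test_functionD[OF \<phi>]]]
     in \<open>simp add: inner_add_left mult.commute\<close>)
  have w: "(LBINT x. g x * (tgrad ?\<psi> x \<bullet> b)) = - (LBINT x. (G x \<bullet> b) * ?\<psi> x)"
   using wg \<eta>\<phi> b by (auto simp: wgrad_def)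
  have i1: "L1 (%x. g x * (tgrad ?\<psi> x \<bullet> b))"
   using integrable_inner_left[OF test_function_integrable(2)[OF \<eta>\<phi> g(1)], of b] by simp
  have i2: "L1 (%x. g x * (tgrad \<eta> x \<bullet> b) * \<phi> x)"
   using integrable_inner_left[OF test_function_integrable(1)[OF \<phi> 3], of b] by (simp add: mult_ac)
  have i3: "L1 (%x. (G x \<bullet> b) * ?\<psi> x)"
   using integrable_inner_left[OF test_function_integrable(1)[OF \<eta>\<phi> g(2)], of b] by (simp add: mult_ac)
  have "(LBINT x. (\<eta> x * g x) * (tgrad \<phi> x \<bullet> b)) = (LBINT x. g x * (tgrad ?\<psi> x \<bullet> b) - g x * (tgrad \<eta> x \<bullet> b) * \<phi> x)"
   by (simp add: t inner_add_left algebra_simps)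
  also have "... = - (LBINT x. (G x \<bullet> b) * ?\<psi> x + g x * (tgrad \<eta> x \<bullet> b) * \<phi> x)"
   using i1 i2 i3 w by simp
  also have "(LBINT x. (G x \<bullet> b) * ?\<psi> x + g x * (tgrad \<eta> x \<bullet> b) * \<phi> x) = (LBINT x. ((\<eta> x *\<^sub>R G x + g x *\<^sub>R tgrad \<eta> x) \<bullet> b) * \<phi> x)"
   by (simp add: inner_add_left algebra_simps)
  finally show ?thesis .
 qed
 with 1 2 3 show ?thesis by (auto simp: wgrad_def)
qed

lemma form_at_add_column:
 fixes A :: "nat => real^'n::{finite,wellorder}"
 shows "form_at m c (%i. \<chi> j. if j = k then p i + q i else A i $ j) =
  form_at m c (%i. \<chi> j. if j = k then p i else A i $ j) + form_at m c (%i. \<chi> j. if j = k then q i else A i $ j)"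
proof -
 have T: "det (\<chi> k' j. (\<chi> j. if j = k then r (I k') else A (I k') $ j) $ j) =
   det (\<chi> j. if j = k then (\<chi> k'. r (I k')) else (\<chi> k'. A (I k') $ j))" for r and I :: "'n => nat"
  by (subst det_transpose[symmetric], rule arg_cong[of _ _ det]) (simp add: transpose_def vec_eq_iff)
 have "det (\<chi> k' j. (\<chi> j. if j = k then p (I k') + q (I k') else A (I k') $ j) $ j) =
  det (\<chi> k' j. (\<chi> j. if j = k then p (I k') else A (I k') $ j) $ j) +
  det (\<chi> k' j. (\<chi> j. if j = k then q (I k') else A (I k') $ j) $ j)" for I :: "'n => nat"
  unfolding T T[of "%i. p i + q i"] det_row_add[symmetric]
  by (rule arg_cong[of _ _ det]) (simp add: vec_eq_iff)
 then show ?thesis by (simp add: form_at_def sum.distrib ring_distribs)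
qed

lemma form_at_scaleR:
 fixes A :: "nat => real^'n::{finite,wellorder}"
 shows "form_at m c (%i. s *\<^sub>R A i) = s ^ CARD('n) * form_at m c A"
proof -
 have "det (\<chi> k j. (s *\<^sub>R A (I k)) $ j) = s ^ CARD('n) * det (\<chi> k j. A (I k) $ j)" for I :: "'n => nat"
 proof -
  have "det ((\<chi> k. s *s A (I k)) :: ((real, 'n::_) vec, 'n::_) vec) = s ^ CARD('n) * det ((\<chi> k. A (I k)) :: ((real, 'n::_) vec, 'n::_) vec)" using det_rows_mul[of "%_. s" "%k. A (I k)"] by simp
  moreover have "(\<chi> k j. (s *\<^sub>R A (I k)) $ j) = (\<chi> k. s *s A (I k))" "(\<chi> k j. A (I k) $ j) = (\<chi> k. A (I k))"
   by (simp_all add: vec_eq_iff)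
  ultimately show ?thesis by simp
 qed
 then show ?thesis by (simp add: form_at_def sum_distrib_left mult_ac)
qed

text \<open>Columns are changed one at a time. By multilinearity each change adds the form with one
  column of size \<open>b\<close> and the others of size at most \<open>a + b\<close>.\<close>

lemma form_at_perturb:
 fixes X Y :: "nat => real^'n::{finite,wellorder}"
 assumes fb: "!!A. abs (form_at m c A) <= \<kappa> * (\<Prod>j\<in>UNIV. L2_set (%i. A i $ j) {..<m})" and \<kappa>: "\<kappa> >= 0"
  and X: "!!j. L2_set (%i. X i $ j) {..<m} <= a" and Y: "!!j. L2_set (%i. Y i $ j) {..<m} <= b"
 shows "abs (form_at m c (%i. X i + Y i) - form_at m c X) <= \<kappa> * (real CARD('n) * b * (a + b) ^ (CARD('n) - 1))"
proof -
 have a: "a >= 0" using X L2_set_nonneg order_trans by blast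
 have b: "b >= 0" using Y L2_set_nonneg order_trans by blast
 define Z where "Z S i = (\<chi> j. if j \<in> S then X i $ j + Y i $ j else X i $ j)" for S :: "'n set" and i
 have "abs (form_at m c (Z S) - form_at m c X) <= \<kappa> * (real (card S) * b * (a + b) ^ (CARD('n) - 1))" for S
 proof (induction S rule: finite_induct[OF finite])
  case 1
  then show ?case by (simp add: Z_def)
 next
  case (2 k S)
  let ?Y = "%i. \<chi> j. if j = k then Y i $ k else Z S i $ j"
  have "Z (insert k S) = (%i. \<chi> j. if j = k then X i $ k + Y i $ k else Z S i $ j)"
   by (auto simp: Z_def vec_eq_iff fun_eq_iff)
  moreover have "Z S = (%i. \<chi> j. if j = k then X i $ k else Z S i $ j)"
   using 2(2) by (auto simp: Z_def vec_eq_iff fun_eq_iff)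
  ultimately have eq: "form_at m c (Z (insert k S)) = form_at m c (Z S) + form_at m c ?Y"
   using form_at_add_column[of m c k "%i. X i $ k" "%i. Y i $ k" "Z S"] by simp
  have Zb: "L2_set (%i. Z S i $ j) {..<m} <= a + b" for j
  proof -
   have "L2_set (%i. X i $ j + Y i $ j) {..<m} <= a + b"
    using L2_set_triangle_ineq[of "%i. X i $ j" "%i. Y i $ j" "{..<m}"] X[of j] Y[of j] by linarith
   moreover have "L2_set (%i. X i $ j) {..<m} <= a + b" using X[of j] b by linarith
   ultimately show ?thesis by (cases "j \<in> S") (simp_all add: Z_def)
  qed
  have "abs (form_at m c ?Y) <= \<kappa> * (\<Prod>j\<in>UNIV. L2_set (%i. ?Y i $ j) {..<m})" by (rule fb)
  also have "(\<Prod>j\<in>UNIV. L2_set (%i. ?Y i $ j) {..<m}) = L2_set (%i. ?Y i $ k) {..<m} * (\<Prod>j\<in>UNIV - {k}. L2_set (%i. ?Y i $ j) {..<m})"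
   by (rule prod.remove) auto
  also have "... <= b * (\<Prod>j\<in>UNIV - {k}. a + b)"
   using Y[of k] Zb b by (intro mult_mono prod_mono conjI prod_nonneg) (auto simp: L2_set_nonneg)
  also have "(\<Prod>j\<in>UNIV - {k}. a + b) = (a + b) ^ (CARD('n) - 1)" by simp
  finally have "abs (form_at m c ?Y) <= \<kappa> * (b * (a + b) ^ (CARD('n) - 1))" using \<kappa> by (simp add: mult_left_mono)
  with 2 eq show ?case by (simp add: algebra_simps)
 qed
 note this[of UNIV]
 moreover have "Z UNIV = (%i. X i + Y i)" by (auto simp: Z_def vec_eq_iff fun_eq_iff)
 ultimately show ?thesis by simp
qed

text \<open>The factor \<open>2 * 5 ^ n\<close> is the weak type constant with restriction to
  \<open>{v > t/2}\<close>; the power of \<open>trunc_const\<close> is the gradient bound entering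
  an \<open>n\<close>-form.\<close>

definition level_const :: "'a::euclidean_space itself => real" where
 "level_const T = max 1 (2 * 5 ^ DIM('a) * trunc_const T ^ DIM('a))"

text \<open>The exponential rate demanded by the second absorption estimate for the weights
  \<open>k ^ (2 n)\<close>. It depends on the domain dimension alone and serves as the constant of
  the theorem.\<close>

definition exp_const :: "'a::euclidean_space itself => real" where
 "exp_const T = 3 * real DIM('a) / absorb_eps DIM('a) (2 * DIM('a)) (level_const T)"

lemma exp_const_ge: "exp_const TYPE('a::euclidean_space) >= 3 * real DIM('a)"
proof -
 have "level_const TYPE('a) >= 1" by (simp add: level_const_def)
 from absorb_eps[OF this, of "DIM('a)" "2 * DIM('a)"] show ?thesis
  by (simp add: exp_const_def pos_le_divide_eq mult_left_le)
qed

lemma norm_le_of_L2_le: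
 assumes "\<forall>w. L2_set (%i. A i \<bullet> w) {..<m::nat} <= u * norm w" "i < m" "0 <= u"
 shows "norm (A i) <= u"
proof -
 have "norm (A i) * norm (A i) = A i \<bullet> A i" by (simp add: dot_square_norm power2_eq_square)
 also have "... <= L2_set (%j. A j \<bullet> A i) {..<m}"
  using assms(2) by (intro member_le_L2_set[of "{..<m}" i "%j. A j \<bullet> A i"]) auto
 also have "... <= u * norm (A i)" using assms(1) by blast
 finally show ?thesis using assms(3) by (cases "A i = 0") auto
qed

text \<open>Either \<open>K <= 1 + ln (1 + a)\<close>, and the logarithm replaces the distortion, or
  \<open>a <= exp K\<close>. This is the loss of a logarithm against \<open>L^n\<close>
  integrability.\<close>

lemma distortion_log_bound:
 assumes "0 <= a" "0 <= w" "1 <= K" "a ^ n <= K * w"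
 shows "a ^ n <= (1 + ln (1 + a)) * (w + exp (real n * K))"
proof -
 have l: "0 <= ln (1 + a)" using assms(1) by simp
 show ?thesis
 proof (cases "K <= 1 + ln (1 + a)")
  case True
  have "a ^ n <= K * w" by (rule assms(4))
  also have "... <= (1 + ln (1 + a)) * (w + exp (real n * K))"
   using True l assms by (intro mult_mono) auto
  finally show ?thesis .
 next
  case False
  have "1 + a = exp (ln (1 + a))" using assms(1) by simp
  also have "... <= exp K" using False l by simp
  finally have "a <= exp K" by simp
  then have "a ^ n <= exp K ^ n" using assms(1) by (intro power_mono)
  also have "... = 1 * exp (real n * K)" by (simp add: exp_of_nat_mult)
  also have "... <= (1 + ln (1 + a)) * (w + exp (real n * K))"
   using l assms by (intro mult_mono) auto
  finally show ?thesis .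
 qed
qed

lemma le_of_log_bound:
 fixes a H :: real
 assumes "0 <= a" "0 <= H" "n >= 2" "a ^ n <= (1 + ln (1 + a)) * H"
 shows "a <= 1 + 2 * H"
proof (cases "a <= 1")
 case True
 then show ?thesis using assms by linarith
next
 case False
 have "ln (1 + a) <= a" using assms(1) by (intro ln_add_one_self_le_self)
 have "a * a <= a ^ n" using power_increasing[of 2 n a] False assms(3) by (simp add: power2_eq_square)
 also have "... <= (1 + ln (1 + a)) * H" by (rule assms(4))
 also have "... <= (2 * a) * H" using \<open>ln (1 + a) <= a\<close> False assms(2) by (intro mult_right_mono) auto
 finally have "a * a <= a * (2 * H)" by simp
 then show ?thesis using False by simp
qed

text \<open>The gradient of the cut-off map is dominated by \<open>v = a + b\<close>, with
  \<open>a\<close> from the gradient of \<open>f\<close> and \<open>b\<close> from that of the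
  cut-off. Its pullback is \<open>\<kappa> w\<close> up to \<open>\<kappa> n b v ^ (n - 1)\<close>,
  which feeds the super-level estimate \<open>star\<close> into the absorption argument.\<close>

theorem local_log_integrability:
 fixes f :: "nat => real^'n::{finite,wellorder} => real" and D :: "nat => real^'n::_ => real^'n::_"
  and u K :: "real^'n::_ => real"
 assumes n: "CARD('n) >= 2" and fb: "!!A. abs (form_at m c A) <= \<kappa> * (\<Prod>j\<in>UNIV. L2_set (%i. A i $ j) {..<m})" and \<kappa>: "\<kappa> > 0"
  and box: "r > 0" "cball x0 r \<subseteq> cbox p q" "cbox p q \<subseteq> ball x0 R"
  and wg: "!!i. i < m ==> wgrad (ball x0 R) (f i) (D i)"
  and off: "!!i x. i < m ==> x \<notin> cball x0 R ==> D i x = 0" "!!x. x \<notin> cball x0 R ==> u x = 0"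
  and um: "u \<in> borel_funs" and u0: "!!x. 0 <= u x"
  and Du: "AE x. \<forall>w. L2_set (%i. D i x \<bullet> w) {..<m} <= u x * norm w"
  and Km: "K \<in> borel_funs" and K: "!!x. 1 <= K x"
  and J: "L1 (%x. form_at m c (%i. D i x))"
  and uK: "AE x. u x ^ CARD('n) <= K x * (form_at m c (%i. D i x) / \<kappa>)"
  and eK: "L1 (%x. indicator (cball x0 R) x * exp (exp_const TYPE(real^'n::_) * K x))"
 shows "L1 (%x. (bump x0 r x * u x) ^ CARD('n) * ln (1 + bump x0 r x * u x) ^ (2 * CARD('n)))"
proof -
 let ?n = "CARD('n)" and ?T = "TYPE(real^'n::_)"
 let ?J = "%x. form_at m c (%i. D i x)"
 define S where "S = cball x0 R"
 define C1 where "C1 = level_const ?T"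
 have C1: "C1 >= 1" by (simp add: C1_def level_const_def)
 have Sm [measurable]: "S \<in> sets borel" by (simp add: S_def)
 have iS: "L1 (indicat_real S)" unfolding S_def by (rule integrable_indicator_bounded) auto
 note [measurable] = um Km
 have Jm [measurable]: "?J \<in> borel_funs" using J by (simp add: measurable_L1)
 define \<eta> where "\<eta> = bump x0 r"
 have tr: "cball x0 r \<subseteq> ball x0 R" using box by blast
 have \<eta>t: "test_function (ball x0 R) \<eta>"
  using tr box(1) by (auto simp: \<eta>_def test_function_def C_diff_bump support_bump)
 have \<eta>: "0 <= \<eta> x" "\<eta> x <= 1" for x by (simp_all add: \<eta>_def bump_nonneg bump_le_1)
 have \<eta>0: "\<eta> x = 0" if "x \<notin> ball x0 r" for x using bump_eq_0[OF box(1) that] by (simp add: \<eta>_def)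
 have \<eta>m [measurable]: "\<eta> \<in> borel_funs"
  unfolding \<eta>_def by (intro borel_measurable_continuous_onI continuous_on_bump)
 have \<eta>C: "C_diff k \<eta>" for k by (rule test_functionD[OF \<eta>t])
 have tgm [measurable]: "tgrad \<eta> \<in> borel_funs"
  by (intro borel_measurable_continuous_onI continuous_on_tgrad \<eta>C)
 have tg0: "tgrad \<eta> x = 0" if "x \<notin> cball x0 r" for x
  by (rule tgrad_eq_0[OF \<eta>C, of "- cball x0 r"]) (use that \<eta>0 in auto)
 obtain B' where "!!x. norm (tgrad \<eta> x) <= B'" using test_function_bounded(2)[OF \<eta>t] by blast
 then obtain B where B: "!!x. norm (tgrad \<eta> x) <= B" "B >= 0" by (metis norm_ge_zero order_trans)
 note B0 = B(2)
 have fi: "L1 (f i)" if "i < m" for i using wg[OF that] by (auto simp: wgrad_def)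
 have Di: "L1 (D i)" if "i < m" for i using wg[OF that] by (auto simp: wgrad_def)
 define \<phi> where "\<phi> x = L2_set (%i. f i x) {..<m}" for x
 have \<phi>m [measurable]: "\<phi> \<in> borel_funs"
 proof -
  have "(%x. (f i x)\<^sup>2) \<in> borel_funs" if "i < m" for i
   using fi[OF that] by (simp add: measurable_L1)
  then show ?thesis unfolding \<phi>_def L2_set_def by measurable
 qed
 have \<phi>0: "0 <= \<phi> x" for x by (simp add: \<phi>_def L2_set_nonneg)
 define a where "a x = \<eta> x * u x" for x
 define b where "b x = norm (tgrad \<eta> x) * \<phi> x" for x
 define v where "v x = a x + b x" for x
 \<comment> \<open>The pullback is nonnegative almost everywhere only; the maximum with 0 makes
   \<open>w\<close> nonnegative at every point.\<close>
 define w where "w x = \<eta> x ^ ?n * (max 0 (?J x) / \<kappa>)" for x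
 have am [measurable]: "a \<in> borel_funs" and bm [measurable]: "b \<in> borel_funs"
  and vm [measurable]: "v \<in> borel_funs" and wm [measurable]: "w \<in> borel_funs"
  unfolding a_def b_def v_def w_def by measurable
 have a: "0 <= a x" and b: "0 <= b x" and w: "0 <= w x" and v: "0 <= v x" for x
  using \<eta>[of x] u0[of x] \<phi>0[of x] \<kappa> by (simp_all add: a_def b_def w_def v_def)
 have offr: "a x = 0" "b x = 0" "v x = 0" if "x \<notin> cball x0 r" for x
  using \<eta>0[of x] tg0[OF that] that by (auto simp: a_def b_def v_def)
 have offS: "a x = 0 & b x = 0" if "x \<notin> S" for x using offr that tr by (force simp: S_def)
 have pos: "AE x. 0 <= ?J x"
  using uK
 proof eventually_elim
  case (elim x)
  then have "0 <= K x * (?J x / \<kappa>)" using u0[of x] by (meson order_trans zero_le_power)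
  then show ?case using K[of x] \<kappa> by (simp add: zero_le_mult_iff zero_le_divide_iff)
 qed
 have weq: "AE x. w x = \<eta> x ^ ?n * (?J x / \<kappa>)"
  using pos by eventually_elim (simp add: w_def)
 have wi: "L1 w"
 proof (rule integrable_majorant)
  show "L1 (%x. 1 * (abs (?J x) / \<kappa>))" using J by auto
  have "\<eta> x ^ ?n * (max 0 (?J x) / \<kappa>) <= 1 * (abs (?J x) / \<kappa>)" for x
   using \<eta>[of x] \<kappa> by (intro mult_mono divide_right_mono power_le_one) auto
  then show "abs (w x) <= 1 * (abs (?J x) / \<kappa>)" for x using w[of x] by (simp only: w_def abs_of_nonneg)
 qed simp
 have aw: "AE x. a x ^ ?n <= K x * w x"
  using uK weq
 proof eventually_elim
  case (elim x)
  then show ?case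
   using mult_left_mono[of "u x ^ ?n" "K x * (?J x / \<kappa>)" "\<eta> x ^ ?n"] \<eta>[of x]
   by (simp add: a_def power_mult_distrib mult_ac)
 qed
 have ec: "exp_const ?T >= 3 * real ?n" using exp_const_ge[where 'a="real^'n::_"] by simp
 have eK': "L1 (%x. indicator S x * exp (t * K x))" if t: "t <= exp_const ?T" for t
 proof (rule integrable_majorant[OF eK])
  show "abs (indicat_real S x * exp (t * K x)) <= indicator (cball x0 R) x * exp (exp_const ?T * K x)" for x
   using K[of x] t by (simp add: S_def indicator_def mult_right_mono)
 qed measurable
 define E where "E x = indicator S x * exp (real ?n * K x)" for x
 have Ei: "L1 E" unfolding E_def using ec by (intro eK') simp
 have E: "0 <= E x" for x by (simp add: E_def)
 define Gu where "Gu x = max 0 (?J x) / \<kappa> + E x" for x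
 have Gui: "L1 Gu"
  unfolding Gu_def by (intro Bochner_Integration.integrable_add Ei integrable_divide integrable_max J) simp
 have Gu0: "0 <= Gu x" for x using \<kappa> E[of x] by (simp add: Gu_def)
 have uG: "AE x. u x ^ ?n <= (1 + ln (1 + u x)) * Gu x"
  using uK pos
 proof eventually_elim
  case (elim x)
  note 1 = elim(1) elim(2)
  show ?case
  proof (cases "x \<in> S")
   case True
   then show ?thesis using distortion_log_bound[OF u0 _ K 1(1)] 1(2) \<kappa> by (simp add: Gu_def E_def)
  next
   case False
   then show ?thesis using off(2)[of x] Gu0[of x] by (simp add: S_def power_0_left)
  qed
 qed
 have ui: "L1 u"
 proof (rule integrable_dominated)
  show "L1 (%x. indicat_real S x + 2 * Gu x)" using iS Gui by auto
  show "AE x. norm (u x) <= norm (indicat_real S x + 2 * Gu x)"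
   using uG
  proof eventually_elim
   case (elim x)
   note 1 = elim
   show ?case
    using le_of_log_bound[OF u0 Gu0 n 1] off(2)[of x] u0[of x] Gu0[of x] by (cases "x \<in> S") (auto simp: S_def)
  qed
 qed simp
 have bne: "box p q ~= {}"
 proof -
  have "ball x0 r \<subseteq> interior (cbox p q)" using box(2) by (meson ball_subset_cball interior_maximal open_ball order_trans)
  then have "ball x0 r \<subseteq> box p q" by (simp add: interior_cbox)
  moreover have "x0 \<in> ball x0 r" using box(1) by simp
  ultimately show ?thesis by blast
 qed
 have DimN: "DIM(real^'n::_) = ?n" by simp
 have fhigh: "set_integrable lborel (cbox p q) (%x. abs (f i x) ^ (?n + 1))" if i: "i < m" for i
 proof -
  have "AE z. norm (D i z) <= u z"
   using Du
   by eventually_elim (rule norm_le_of_L2_le[OF _ i u0])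
  from wgrad_higher_power_integrable[OF _ wg[OF i] _ box(3) ui u0 this bne Gui Gu0, unfolded DimN]
  show ?thesis using n uG by auto
 qed
 \<comment> \<open>Here the \<open>L^{n+1}\<close> bound on the components is used. The factor
   \<open>m\<close> affects only the size of this integral, not the exponential threshold.\<close>
 have bhigh: "L1 (%x. b x ^ (?n + 1))"
 proof (rule integrable_majorant)
  let ?g = "%x. (B * real m) ^ (?n + 1) * (\<Sum>i<m. indicator (cbox p q) x *\<^sub>R abs (f i x) ^ (?n + 1))"
  show "L1 ?g"
   using fhigh unfolding set_integrable_def by (intro integrable_mult_right Bochner_Integration.integrable_sum) auto
  show "abs (b x ^ (?n + 1)) <= ?g x" for x
  proof (cases "x \<in> cball x0 r")
   case False
   then show ?thesis using offr B0 by (auto intro!: mult_nonneg_nonneg sum_nonneg)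
  next
   case True
   then have xb: "x \<in> cbox p q" using box(2) by blast
   show ?thesis
   proof (cases "m = 0")
    case True
    then show ?thesis by (simp add: b_def \<phi>_def)
   next
    case False
    define M where "M = Max ((%i. abs (f i x)) ` {..<m})"
    have "M \<in> (%i. abs (f i x)) ` {..<m}" unfolding M_def using False by (intro Max_in) auto
    then obtain i0 where i0: "i0 < m" "M = abs (f i0 x)" by auto
    have M: "abs (f i x) <= M" if "i < m" for i unfolding M_def using that by (intro Max_ge) auto
    have "\<phi> x <= (\<Sum>i<m. abs (f i x))" unfolding \<phi>_def by (rule L2_set_le_sum_abs)
    also have "... <= (\<Sum>i<m. M)" using M by (intro sum_mono) auto
    finally have "\<phi> x <= real m * M" by simp
    then have "b x <= B * (real m * M)" unfolding b_def using B B0 \<phi>0 by (intro mult_mono) auto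
    then have "b x ^ (?n + 1) <= (B * real m * M) ^ (?n + 1)" using b[of x] by (intro power_mono) (auto simp: mult.assoc)
    also have "... = (B * real m) ^ (?n + 1) * M ^ (?n + 1)" by (rule power_mult_distrib)
    also have "M ^ (?n + 1) <= (\<Sum>i<m. indicator (cbox p q) x *\<^sub>R abs (f i x) ^ (?n + 1))"
     using i0 xb member_le_sum[of i0 "{..<m}" "%i. indicator (cbox p q) x *\<^sub>R abs (f i x) ^ (?n + 1)"] by auto
    finally have "b x ^ (?n + 1) <= ?g x" using B0 by (simp add: mult_left_mono)
    then show ?thesis using b[of x] by simp
   qed
  qed
 qed measurable
 have bn: "L1 (%x. b x ^ ?n)"
 proof (rule integrable_majorant)
  show "L1 (%x. indicat_real S x + b x ^ (?n + 1))" using iS bhigh by auto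
  show "abs (b x ^ ?n) <= indicat_real S x + b x ^ (?n + 1)" for x
  proof (cases "x \<in> S")
   case True
   have "b x ^ ?n * 1 <= b x ^ (?n + 1) + 1 ^ (?n + 1)" using b by (intro power_mult_le_sum) auto
   then show ?thesis using True b[of x] by simp
  next
   case False
   then show ?thesis using offS by (simp add: power_0_left)
  qed
 qed measurable
 define H where "H x = 2 ^ ?n * (w x + E x + b x ^ ?n)" for x
 have Hi: "L1 H" unfolding H_def using wi Ei bn by auto
 have H0: "0 <= H x" for x using w[of x] E[of x] b[of x] by (simp add: H_def)
 have aH: "AE x. a x ^ ?n <= (1 + ln (1 + a x)) * (w x + E x)"
  using aw
 proof eventually_elim
  case (elim x)
  note 1 = elim
  show ?case
  proof (cases "x \<in> S")
   case True
   then show ?thesis using distortion_log_bound[OF a w K 1] by (simp add: E_def)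
  next
   case False
   then show ?thesis using offS[of x] w[of x] by (simp add: E_def power_0_left)
  qed
 qed
 have vH: "AE x. v x ^ ?n <= (1 + ln (1 + v x)) * H x"
  using aH
 proof eventually_elim
  case (elim x)
  note 1 = elim
  have l: "ln (1 + a x) <= ln (1 + v x)" "0 <= ln (1 + v x)" using a[of x] b[of x] by (auto simp: v_def)
  have "a x ^ ?n <= (1 + ln (1 + v x)) * (w x + E x)"
   using 1 l w[of x] E[of x] by (elim order_trans) (intro mult_right_mono, auto)
  moreover have "b x ^ ?n <= (1 + ln (1 + v x)) * b x ^ ?n"
   using mult_right_mono[of 1 "1 + ln (1 + v x)" "b x ^ ?n"] l b[of x] by simp
  ultimately have "a x ^ ?n + b x ^ ?n <= (1 + ln (1 + v x)) * (w x + E x + b x ^ ?n)" by (simp add: ring_distribs)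
  moreover have "v x ^ ?n <= 2 ^ ?n * (a x ^ ?n + b x ^ ?n)" unfolding v_def using a b by (rule add_power_le)
  ultimately have "v x ^ ?n <= 2 ^ ?n * ((1 + ln (1 + v x)) * (w x + E x + b x ^ ?n))"
   by (meson mult_left_mono order_trans zero_le_numeral zero_le_power)
  then show ?case by (simp add: H_def mult_ac)
 qed
 have vi: "L1 v"
 proof (rule integrable_dominated)
  show "L1 (%x. indicat_real S x + 2 * H x)" using iS Hi by auto
  show "AE x. norm (v x) <= norm (indicat_real S x + 2 * H x)"
   using vH
  proof eventually_elim
   case (elim x)
   note 1 = elim
   show ?case
    using le_of_log_bound[OF v H0 n 1] offS[of x] v[of x] H0[of x] by (cases "x \<in> S") (auto simp: v_def)
  qed
 qed simp
 \<comment> \<open>If \<open>K * b <= a\<close>, then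
   \<open>K * (a ^ (n - 1) * b) <= a ^ n <= K * w\<close>. Otherwise \<open>a\<close> is at most
   \<open>K * b\<close>, and the powers of \<open>K\<close> are dominated by an exponential.\<close>
 have bv: "L1 (%x. b x * v x ^ (?n - 1))"
 proof (rule integrable_dominated)
  let ?P = "(?n - 1) * (?n + 1)"
  let ?g = "%x. 2 ^ (?n - 1) * (w x + b x ^ ?n + (b x ^ (?n + 1) + fact ?P * (indicator S x * exp (1 * K x))))"
  have ec1: "1 <= exp_const ?T" using ec n by linarith
  show "L1 ?g" using wi bn bhigh eK'[OF ec1] by auto
  show "AE x. norm (b x * v x ^ (?n - 1)) <= norm (?g x)"
   using aw
  proof eventually_elim
   case (elim x)
   note aw = elim
   obtain k where k: "?n = Suc k" using n by (cases ?n) auto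
   have g0: "0 <= fact ?P * (indicat_real S x * exp (1 * K x))" "0 <= b x ^ (?n + 1)" "0 <= b x ^ ?n" using b[of x] by auto
   have ab: "a x ^ (?n - 1) * b x <= w x + (b x ^ (?n + 1) + fact ?P * (indicator S x * exp (1 * K x)))"
   proof (cases "x \<in> S")
    case False
    then show ?thesis using offS[of x] w[of x] g0 by simp
   next
    case xS: True
    show ?thesis
    proof (cases "K x * b x <= a x")
     case True
     have "K x * (a x ^ (?n - 1) * b x) = a x ^ (?n - 1) * (K x * b x)" by simp
     also have "... <= a x ^ (?n - 1) * a x" using True a[of x] by (intro mult_left_mono) auto
     also have "... = a x ^ ?n" by (simp add: k)
     also have "... <= K x * w x" by (rule aw)
     finally have "a x ^ (?n - 1) * b x <= w x" using K[of x] by simp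
     then show ?thesis using g0 by linarith
    next
     case False
     have "a x ^ (?n - 1) * b x <= (K x * b x) ^ (?n - 1) * b x"
      using False a[of x] b[of x] by (intro mult_right_mono power_mono) auto
     also have "... = b x ^ ?n * K x ^ (?n - 1)" by (simp add: k power_mult_distrib)
     also have "... <= b x ^ (?n + 1) + (K x ^ (?n - 1)) ^ (?n + 1)"
      using b[of x] K[of x] by (intro power_mult_le_sum) auto
     also have "(K x ^ (?n - 1)) ^ (?n + 1) = K x ^ ?P" by (rule power_mult[symmetric])
     also have "... <= fact ?P * exp (K x)" using K[of x] by (intro power_le_fact_exp) auto
     finally show ?thesis using xS w[of x] by simp
    qed
   qed
   have "b x * v x ^ (?n - 1) <= b x * (2 ^ (?n - 1) * (a x ^ (?n - 1) + b x ^ (?n - 1)))"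
    unfolding v_def using a b by (intro mult_left_mono add_power_le) auto
   also have "... = 2 ^ (?n - 1) * (a x ^ (?n - 1) * b x + b x ^ ?n)" by (simp add: k algebra_simps)
   also have "... <= ?g x" using ab by (intro mult_left_mono) auto
   finally show "norm (b x * v x ^ (?n - 1)) <= norm (?g x)" using b[of x] v[of x] by simp
  qed
 qed measurable
 define h where "h i x = \<eta> x * f i x" for i x
 define Dh where "Dh i x = \<eta> x *\<^sub>R D i x + f i x *\<^sub>R tgrad \<eta> x" for i x
 have hw: "wgrad UNIV (h i) (Dh i)" if "i < m" for i
  using wgrad_mult_test_function[OF wg[OF that] \<eta>t] by (simp add: h_def[abs_def] Dh_def[abs_def])
 have h0: "h i x = 0" "Dh i x = 0" if "x \<notin> cball x0 r" for i x
  using \<eta>0[of x] tg0[OF that] that by (auto simp: h_def Dh_def)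
 have vDh: "AE x. \<forall>w. L2_set (%i. Dh i x \<bullet> w) {..<m} <= v x * norm w"
  using Du
 proof (eventually_elim, intro allI)
  fix x w assume L: "\<forall>w. L2_set (%i. D i x \<bullet> w) {..<m} <= u x * norm w"
  have "L2_set (%i. Dh i x \<bullet> w) {..<m} = L2_set (%i. \<eta> x * (D i x \<bullet> w) + (tgrad \<eta> x \<bullet> w) * f i x) {..<m}"
   by (simp add: Dh_def inner_add_left mult.commute)
  also have "... <= L2_set (%i. \<eta> x * (D i x \<bullet> w)) {..<m} + L2_set (%i. (tgrad \<eta> x \<bullet> w) * f i x) {..<m}"
   by (rule L2_set_triangle_ineq)
  also have "L2_set (%i. \<eta> x * (D i x \<bullet> w)) {..<m} = \<eta> x * L2_set (%i. D i x \<bullet> w) {..<m}"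
   using \<eta>[of x] by (simp add: L2_set_right_distrib)
  also have "L2_set (%i. (tgrad \<eta> x \<bullet> w) * f i x) {..<m} = abs (tgrad \<eta> x \<bullet> w) * \<phi> x"
   unfolding \<phi>_def L2_set_right_distrib[OF abs_ge_zero] by (simp add: L2_set_def power_mult_distrib)
  also have "\<eta> x * L2_set (%i. D i x \<bullet> w) {..<m} + abs (tgrad \<eta> x \<bullet> w) * \<phi> x <= \<eta> x * (u x * norm w) + (norm (tgrad \<eta> x) * norm w) * \<phi> x"
   using L \<eta>[of x] \<phi>0[of x] by (intro add_mono mult_left_mono mult_right_mono Cauchy_Schwarz_ineq2) auto
  also have "... = v x * norm w" by (simp add: v_def a_def b_def algebra_simps)
  finally show "L2_set (%i. Dh i x \<bullet> w) {..<m} <= v x * norm w" .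
 qed
 let ?F = "%x. form_at m c (%i. Dh i x)"
 \<comment> \<open>Along the scaled gradient the form is homogeneous of degree \<open>n\<close>,
   which produces \<open>\<eta> ^ n\<close>; the rank-one terms from the gradient of
   \<open>\<eta>\<close> are the perturbation.\<close>
 have Fw: "AE x. abs (?F x / \<kappa> - w x) <= real ?n * (b x * v x ^ (?n - 1))"
  using Du weq
 proof eventually_elim
  case (elim x)
  note L = elim(1) and we = elim(2)
  have X: "L2_set (%i. (\<eta> x *\<^sub>R D i x) $ j) {..<m} <= a x" for j
  proof -
   have "L2_set (%i. D i x \<bullet> axis j 1) {..<m} <= u x * norm (axis j (1::real))" using L by blast
   then have "L2_set (%i. D i x $ j) {..<m} <= u x" by (simp add: inner_axis)
   then have "\<eta> x * L2_set (%i. D i x $ j) {..<m} <= a x" unfolding a_def using \<eta>[of x] by (intro mult_left_mono) auto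
   then show ?thesis using \<eta>[of x] by (simp add: L2_set_right_distrib)
  qed
  have Y: "L2_set (%i. (f i x *\<^sub>R tgrad \<eta> x) $ j) {..<m} <= b x" for j
  proof -
   have "L2_set (%i. (f i x *\<^sub>R tgrad \<eta> x) $ j) {..<m} = abs (tgrad \<eta> x $ j) * \<phi> x"
    unfolding \<phi>_def L2_set_right_distrib[OF abs_ge_zero] by (simp add: L2_set_def power_mult_distrib mult.commute)
   also have "... <= b x" unfolding b_def using component_le_norm_cart[of "tgrad \<eta> x" j] \<phi>0[of x] by (intro mult_right_mono) auto
   finally show ?thesis .
  qed
  have "abs (?F x - form_at m c (%i. \<eta> x *\<^sub>R D i x)) <= \<kappa> * (real ?n * b x * (a x + b x) ^ (?n - 1))"
   unfolding Dh_def by (rule form_at_perturb[OF fb _ X Y]) (use \<kappa> in auto)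
  then have "abs (?F x - \<kappa> * w x) <= \<kappa> * (real ?n * (b x * v x ^ (?n - 1)))"
   using \<kappa> by (simp add: form_at_scaleR we v_def mult_ac)
  moreover have "abs (?F x / \<kappa> - w x) = abs (?F x - \<kappa> * w x) / \<kappa>" using \<kappa> by (simp add: field_simps abs_divide)
  ultimately show "abs (?F x / \<kappa> - w x) <= real ?n * (b x * v x ^ (?n - 1))"
   using \<kappa> by (simp add: field_simps)
 qed
 have Fm [measurable]: "?F \<in> borel_funs"
 proof (rule measurable_form_at)
  show "(%x. Dh i x $ j) \<in> borel_funs" if "i < m" for i j
  proof -
   have "Dh i \<in> borel_funs" using hw[OF that] unfolding wgrad_def by (auto dest: measurable_L1)
   then have "(%x. Dh i x \<bullet> axis j 1) \<in> borel_funs" by (intro borel_measurable_inner) auto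
   then show ?thesis by (simp add: inner_axis)
  qed
 qed
 have Fi: "L1 ?F"
 proof (rule integrable_dominated)
  show "L1 (%x. \<kappa> * (w x + real ?n * (b x * v x ^ (?n - 1))))" using wi bv by auto
  show "AE x. norm (?F x) <= norm (\<kappa> * (w x + real ?n * (b x * v x ^ (?n - 1))))"
   using Fw
  proof eventually_elim
   case (elim x)
   note 1 = elim
   have 0: "0 <= b x * v x ^ (?n - 1)" using b[of x] v[of x] by simp
   have "abs (?F x / \<kappa>) <= w x + real ?n * (b x * v x ^ (?n - 1))" using 1 w[of x] by linarith
   then have "abs (?F x) <= \<kappa> * (w x + real ?n * (b x * v x ^ (?n - 1)))" using \<kappa> by (simp add: abs_divide field_simps)
   then show ?case by (simp only: real_norm_def)
  qed
 qed simp
 have star: "(LBINT x:maximal_set v (2 ^ k). w x) <=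
    real ?n * (LBINT x:maximal_set v (2 ^ k). b x * v x ^ (?n - 1)) +
    C1 * 2 ^ (k * (?n - 1)) * (LBINT x:{x. v x > 2 ^ k / 2}. v x)" for k
 proof -
  define t where "t = (2::real) ^ k"
  have t: "t > 0" by (simp add: t_def)
  let ?O = "maximal_set v t"
  have Os: "?O \<in> sets borel" by (rule sets_maximal_set[OF vi v])
  have si: "set_integrable lborel ?O g" if "L1 g" for g :: "real^'n::_ => real"
   by (rule set_integrable_lborel[OF that Os])
  have "abs (LBINT x:?O. ?F x) <= \<kappa> * (trunc_const ?T * t) ^ ?n * vol ?O"
   by (rule pullback_on_maximal_set[OF hw h0(1) h0(2) vi v offr(3) vDh fb _ t n Hi H0 vH Fi]) (use \<kappa> in auto)
  then have 1: "(LBINT x:?O. ?F x) / \<kappa> <= (trunc_const ?T * t) ^ ?n * vol ?O"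
   using \<kappa> by (simp add: field_simps)
  have tc: "trunc_const ?T >= 0" unfolding trunc_const_def using bump_mass_pos[where 'a="real^'n::_"] by simp
  have "(LBINT x:?O. w x) <= (LBINT x:?O. ?F x / \<kappa> + real ?n * (b x * v x ^ (?n - 1)))"
  proof (rule set_integral_mono_AE)
   show "AE x \<in> ?O in lborel. w x <= ?F x / \<kappa> + real ?n * (b x * v x ^ (?n - 1))"
    using Fw by eventually_elim auto
  qed (use wi Fi bv in \<open>auto intro!: si\<close>)
  also have "... = (LBINT x:?O. ?F x) / \<kappa> + real ?n * (LBINT x:?O. b x * v x ^ (?n - 1))"
   using si[OF Fi] si[OF bv] by (subst set_integral_add(2)) auto
  also have "(LBINT x:?O. ?F x) / \<kappa> <= (trunc_const ?T * t) ^ ?n * (2 * 5 ^ ?n / t * (LBINT x:{x. v x > t/2}. v x))"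
   using measure_maximal_set(2)[OF vi v t] tc t by (intro order_trans[OF 1] mult_left_mono) auto
  also have "... = (2 * 5 ^ ?n * trunc_const ?T ^ ?n) * (t ^ ?n / t) * (LBINT x:{x. v x > t/2}. v x)"
   by (simp add: power_mult_distrib)
  also have "... <= C1 * (t ^ ?n / t) * (LBINT x:{x. v x > t/2}. v x)"
   using t v by (intro mult_right_mono set_integral_nonneg') (auto simp: C1_def level_const_def)
  also have "t ^ ?n / t = 2 ^ (k * (?n - 1))"
  proof -
   obtain j where j: "?n = Suc j" using n by (cases ?n) auto
   show ?thesis by (simp add: j t_def power_mult)
  qed
  finally show ?thesis by (simp add: t_def)
 qed
 have "L1 (%x. a x ^ DIM(real^'n::_) * ln (1 + a x) ^ (2 * ?n))"
 proof (rule log_integrability_by_absorption[where v=v and b=b and w=w and K=K and S=S and ?C1.0=C1])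
  show "L1 (%x. indicat_real S x * exp (3 * real DIM(real^'n::_) / absorb_eps DIM(real^'n::_) (2 * ?n) C1 * K x))"
   using eK unfolding S_def C1_def exp_const_def by simp
 qed (use n C1 vi v_def am bm a b wi w Km K aw Sm offS bhigh bv star in \<open>simp_all\<close>)
 then show ?thesis by (simp add: a_def \<eta>_def)
qed

section \<open>Oscillation and differentiability\<close>

lemma distr_lborel_line:
 assumes b: "(Basis :: 'a::euclidean_space set) = {b}"
 shows "distr lborel borel (%t::real. t *\<^sub>R b) = (lborel :: 'a measure)"
proof (rule lborel_eqI[symmetric])
 have nb: "b \<bullet> b = 1" using b by (metis inner_same_Basis insertI1)
 fix l u :: 'a assume "!!c. c \<in> Basis ==> l \<bullet> c <= u \<bullet> c"
 then have lu: "l \<bullet> b <= u \<bullet> b" using b by auto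
 have "(%t::real. t *\<^sub>R b) -` box l u = {l \<bullet> b <..< u \<bullet> b}" unfolding box_def b using nb by auto
 then have "emeasure (distr lborel borel (%t::real. t *\<^sub>R b)) (box l u) = emeasure lborel {l \<bullet> b <..< u \<bullet> b}"
  by (subst emeasure_distr) auto
 also have "... = ennreal (u \<bullet> b - l \<bullet> b)" using lu by simp
 finally show "emeasure (distr lborel borel (%t::real. t *\<^sub>R b)) (box l u) = ennreal (prod ((\<bullet>) (u - l)) Basis)"
  unfolding b by (simp add: inner_diff_left)
qed simp

text \<open>In dimension one a box is a segment, and the fundamental theorem of calculus bounds the
  increment of the mollified function by the integral of its derivative. Transport along
  \<open>t *\<^sub>R b\<close> identifies the line with the space.\<close>

lemma mol_oscillation_line:
 fixes g u :: "'a::euclidean_space => real"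
 assumes b: "(Basis :: 'a set) = {b}"
  and wg: "wgrad U g G" and u: "L1 u" "!!z. 0 <= u z" and Gu: "AE z. norm (G z) <= u z"
  and e: "e > 0" and U: "!!x. x \<in> cbox p q ==> cball x e \<subseteq> U" and xy: "x \<in> cbox p q" "y \<in> cbox p q"
 shows "abs (mol e g x - mol e g y) <= (LBINT z:cbox p q. mol e u z)"
proof -
 have nb: "b \<bullet> b = 1" using b by (metis inner_same_Basis insertI1)
 have rep: "z = (z \<bullet> b) *\<^sub>R b" for z using euclidean_representation[of z] unfolding b by simp
 have G: "L1 G" using wg by (auto simp: wgrad_def)
 have Gb: "abs (molv e G z \<bullet> b) <= mol e u z" for z
 proof -
  have "abs (molv e G z \<bullet> b) <= mol e (%z. abs (G z \<bullet> b)) z"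
   unfolding molv_inner[OF G e] by (rule abs_mol_le[OF integrable_inner_left[OF G] e])
  also have "... <= mol e u z"
  proof (rule mol_mono[OF _ u(1) e])
   have "norm b = 1" using nb by (simp add: norm_eq_sqrt_inner)
   then have "abs (G z \<bullet> b) <= norm (G z)" for z using Cauchy_Schwarz_ineq2[of "G z" b] by simp
   note leG = order_trans[OF this]
   show "AE z. abs (G z \<bullet> b) <= u z"
    using Gu by eventually_elim (rule leG)
  qed (use G in auto)
  finally show ?thesis .
 qed
 have main: "abs (mol e g y - mol e g x) <= (LBINT z:cbox p q. mol e u z)"
  if xy: "x \<in> cbox p q" "y \<in> cbox p q" "x \<bullet> b <= y \<bullet> b" for x y
 proof -
  define s where "s = x \<bullet> b"
  define t where "t = y \<bullet> b"
  have st: "s <= t" "x = s *\<^sub>R b" "y = t *\<^sub>R b" using xy(3) rep[of x] rep[of y] by (simp_all add: s_def t_def)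
  have inb: "\<tau> *\<^sub>R b \<in> cbox x y \<longleftrightarrow> \<tau> \<in> {s..t}" for \<tau> unfolding mem_box b using nb by (simp add: s_def t_def)
  have sub: "cbox x y \<subseteq> cbox p q"
  proof
   fix z assume "z \<in> cbox x y"
   then show "z \<in> cbox p q" using xy unfolding mem_box b by auto
  qed
  have d: "((%\<tau>. mol e g (\<tau> *\<^sub>R b)) has_vector_derivative molv e G (\<tau> *\<^sub>R b) \<bullet> b) (at \<tau> within {s..t})" if \<tau>: "\<tau> \<in> {s..t}" for \<tau>
  proof -
   have "cball (\<tau> *\<^sub>R b) e \<subseteq> U" using U inb \<tau> sub by blast
   from mol_has_derivative_wgrad[OF wg e this]
   have "((%\<tau>. mol e g (\<tau> *\<^sub>R b)) has_derivative (%h. molv e G (\<tau> *\<^sub>R b) \<bullet> (h *\<^sub>R b))) (at \<tau> within {s..t})"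
    by (rule has_derivative_compose[rotated]) (auto intro!: derivative_eq_intros)
   then show ?thesis by (simp add: has_vector_derivative_def)
  qed
  have ftc: "((%\<tau>. molv e G (\<tau> *\<^sub>R b) \<bullet> b) has_integral (mol e g y - mol e g x)) {s..t}"
   using fundamental_theorem_of_calculus[OF st(1) d] st by simp
  have cu: "continuous_on UNIV (%\<tau>. mol e u (\<tau> *\<^sub>R b))"
   by (intro continuous_on_compose2[OF continuous_on_mol[OF u(1) e, of UNIV]] continuous_intros) auto
  have si: "set_integrable lborel {s..t} (%\<tau>. mol e u (\<tau> *\<^sub>R b))"
   by (rule borel_integrable_atLeastAtMost') (rule continuous_on_subset[OF cu], simp)
  have "abs (mol e g y - mol e g x) = norm (integral {s..t} (%\<tau>. molv e G (\<tau> *\<^sub>R b) \<bullet> b))"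
   using integral_unique[OF ftc] by simp
  also have "... <= integral {s..t} (%\<tau>. mol e u (\<tau> *\<^sub>R b))"
   using ftc Gb set_borel_integral_eq_integral(1)[OF si] by (intro integral_norm_bound_integral) (auto simp: integrable_on_def)
  also have "... = (LBINT \<tau>:{s..t}. mol e u (\<tau> *\<^sub>R b))"
   using set_borel_integral_eq_integral(2)[OF si] by simp
  also have "... = (LBINT \<tau>. indicator (cbox x y) (\<tau> *\<^sub>R b) *\<^sub>R mol e u (\<tau> *\<^sub>R b))"
   unfolding set_integral_def using inb by (intro Bochner_Integration.integral_cong) (auto simp: indicator_def)
  also have "... = (LINT z|distr lborel borel (%\<tau>. \<tau> *\<^sub>R b). indicator (cbox x y) z *\<^sub>R mol e u z)"
   using u e by (subst integral_distr) auto
  also have "... = (LBINT z:cbox x y. mol e u z)" unfolding distr_lborel_line[OF b] by (simp add: set_integral_def)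
  also have "... <= (LBINT z:cbox p q. mol e u z)"
   using sub integrable_mol[OF u(1) e] mol_nonneg[OF e u(2)] by (intro set_integral_mono_set_nonneg) auto
  finally show ?thesis .
 qed
 show ?thesis using main[OF xy] main[OF xy(2,1)] by (cases "x \<bullet> b <= y \<bullet> b") (auto simp: abs_minus_commute)
qed

lemma avg_box_diff_le:
 assumes g: "L1 g" and ne: "box p q ~= {}"
  and le: "AE y. y \<in> cbox p q --> abs (t - g y) <= I"
 shows "abs (t - avg_box g p q) <= I"
proof -
 let ?Q = "cbox p q"
 have m: "vol ?Q > 0" using ne by (simp add: content_pos_lt_eq box_ne_empty)
 have c: "set_integrable lborel ?Q (%_. r)" for r :: real by (rule set_integrable_const_cbox)
 have gQ: "set_integrable lborel ?Q g" by (rule set_integrable_lborel[OF g]) simp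
 have "t * vol ?Q - (LBINT y:?Q. g y) = (LBINT y:?Q. t - g y)"
  using set_integral_diff(2)[OF c gQ] by (simp add: set_integral_def)
 also have "abs ... <= (LBINT y:?Q. abs (t - g y))"
  unfolding set_integral_def by (rule order_trans[OF integral_abs_bound]) (simp add: abs_mult)
 also have "... <= (LBINT y:?Q. I)"
  by (rule set_integral_mono_AE[OF set_integrable_abs[OF set_integral_diff(1)[OF c gQ]] c]) (use le in auto)
 also have "... = I * vol ?Q" by (simp add: set_integral_def)
 finally have "abs (t * vol ?Q - (LBINT y:?Q. g y)) <= I * vol ?Q" .
 moreover have "t * vol ?Q - (LBINT y:?Q. g y) = (t - avg_box g p q) * vol ?Q"
  using m by (simp add: avg_box_def field_simps)
 ultimately show ?thesis using m by (simp add: abs_mult)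
qed

lemma wgrad_oscillation_line:
 fixes g u :: "'a::euclidean_space => real"
 assumes n: "DIM('a) = 1" and wg: "wgrad U g G" and U: "open U" "cbox p q \<subseteq> U" and u: "L1 u" "!!z. 0 <= u z"
  and Gu: "AE z. norm (G z) <= u z" and ne: "box p q ~= {}"
 shows "AE x. x \<in> cbox p q --> abs (g x - avg_box g p q) <= (LBINT z:cbox p q. u z)"
proof -
 obtain b :: 'a where b: "Basis = {b}" using n by (auto simp: card_1_singleton_iff)
 have g: "L1 g" using wg by (auto simp: wgrad_def)
 obtain e0 where e0: "e0 > 0" "(\<Union>x\<in>cbox p q. cball x e0) \<subseteq> U"
  by (rule compact_subset_open_imp_cball_epsilon_subset[OF compact_cbox U])
 let ?I = "LBINT z:cbox p q. u z"
 have osc: "abs (g x - g y) <= ?I"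
  if xy: "x \<in> cbox p q" "y \<in> cbox p q" and lim: "(%k. mol (1 / real (Suc k)) g x) \<longlonglongrightarrow> g x" "(%k. mol (1 / real (Suc k)) g y) \<longlonglongrightarrow> g y" for x y
 proof (rule tendsto_le[OF _ mol_set_integral_tendsto[OF u(1), of "cbox p q"] tendsto_rabs[OF tendsto_diff[OF lim]]])
  from eventually_inverse_Suc_less[OF e0(1)] show "\<forall>\<^sub>F k in sequentially. abs (mol (1 / real (Suc k)) g x - mol (1 / real (Suc k)) g y) <= (LBINT z:cbox p q. mol (1 / real (Suc k)) u z)"
  proof eventually_elim
   case (elim k)
   note k = elim
   have "cball x (1 / real (Suc k)) \<subseteq> U" if "x \<in> cbox p q" for x
   proof -
    have "cball x (1 / real (Suc k)) \<subseteq> cball x e0" using k by (intro subset_cball) simp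
    then show ?thesis using e0(2) that by blast
   qed
   then show ?case
    by (intro mol_oscillation_line[OF b wg u Gu] xy) auto
  qed
 qed auto
 show ?thesis
  using AE_mol_tendsto[OF g]
 proof (eventually_elim, intro impI)
  fix x assume lim: "(%k. mol (1 / real (Suc k)) g x) \<longlonglongrightarrow> g x" and x: "x \<in> cbox p q"
  show "abs (g x - avg_box g p q) <= ?I"
  proof (rule avg_box_diff_le[OF g ne])
   show "AE y. y \<in> cbox p q --> abs (g x - g y) <= ?I"
    using AE_mol_tendsto[OF g] by eventually_elim (use osc[OF x _ lim] in blast)
  qed
 qed
qed

text \<open>The exponent \<open>2n\<close> makes the dyadic series in the oscillation estimate converge; in dimension one
  the derivative itself controls the oscillation.\<close>

definition osc_weight :: "nat => real => real => real" where
 "osc_weight n M s = (if n = 1 then s else s ^ n * (1 + 3 * ln (1 + s / M)) ^ (2 * n))"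

lemma osc_weight_0: "n > 0 ==> osc_weight n M 0 = 0"
 by (simp add: osc_weight_def power_0_left)

lemma osc_weight_nonneg: "M > 0 ==> s >= 0 ==> 0 <= osc_weight n M s"
 by (auto simp: osc_weight_def intro!: mult_nonneg_nonneg zero_le_power add_nonneg_nonneg)

lemma osc_weight_mono:
 assumes "M > 0" "0 <= s" "s <= t"
 shows "osc_weight n M s <= osc_weight n M t"
proof -
 have "ln (1 + s / M) <= ln (1 + t / M)" "0 <= ln (1 + s / M)"
  using assms by (auto simp: divide_right_mono add_pos_nonneg)
 then show ?thesis unfolding osc_weight_def using assms
  by (auto intro!: mult_mono power_mono)
qed

lemma measurable_osc_weight [measurable]: "osc_weight n M \<in> borel_funs"
 unfolding osc_weight_def by (cases "n = 1") auto

lemma osc_weight_small: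
 assumes "M > 0" "0 <= s" "s <= M" "n >= 1"
 shows "osc_weight n M s <= 4 ^ (2 * n) * M ^ n"
proof (cases "n = 1")
 case True
 then show ?thesis using assms by (simp add: osc_weight_def)
next
 case False
 have "s / M <= 1" "0 <= s / M" using assms by auto
 then have "ln (1 + s / M) <= 1" using ln_add_one_self_le_self[of "s / M"] by linarith
 moreover have "0 <= ln (1 + s / M)" using assms by auto
 ultimately have "s ^ n * (1 + 3 * ln (1 + s / M)) ^ (2 * n) <= M ^ n * 4 ^ (2 * n)"
  using assms by (intro mult_mono power_mono) auto
 then show ?thesis using False by (simp add: osc_weight_def mult.commute)
qed

text \<open>From \<open>s / M > (3/2) ^ j\<close> and \<open>ln (3/2) >= 1/3\<close> follows
  \<open>3 * ln (1 + s / M) >= j\<close>; this is the origin of the 3 in the weight.\<close>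

lemma osc_weight_level:
 assumes M: "M > 0" and s: "s > M * (3/2) ^ j" and n: "n >= 2"
 shows "s ^ n * (real j + 1) ^ (2 * n) <= osc_weight n M s"
proof -
 have s0: "s > 0" using s M by (meson less_trans mult_pos_pos zero_less_divide_iff zero_less_numeral zero_less_power)
 have "ln (1 / (3/2)) <= 1 / (3/2) - (1::real)" by (rule ln_le_minus_one) simp
 then have l: "ln (3/2) >= (1/3 :: real)" by (simp add: ln_div)
 have "(3/2) ^ j <= s / M" using s M by (simp add: field_simps)
 then have "(3/2) ^ j <= 1 + s / M" by linarith
 then have "ln ((3/2) ^ j) <= ln (1 + s / M)" using s0 M by (subst ln_le_cancel_iff) (auto simp: add_pos_pos)
 then have "real j * ln (3/2) <= ln (1 + s / M)" by (simp add: ln_realpow)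
 moreover have "real j * (1/3) <= real j * ln (3/2)" using l by (intro mult_left_mono) auto
 ultimately have "real j + 1 <= 1 + 3 * ln (1 + s / M)" by linarith
 then have "(real j + 1) ^ (2 * n) <= (1 + 3 * ln (1 + s / M)) ^ (2 * n)" by (intro power_mono) auto
 then show ?thesis unfolding osc_weight_def using n s0 by (auto intro!: mult_left_mono)
qed

section \<open>Oscillation on cubes and the continuous representative\<close>

lemma cube_ne:
 assumes "s > 0" "!!i. i \<in> Basis ==> (q - p) \<bullet> i = s"
 shows "box p q ~= {}"
proof -
 have "p \<bullet> i < q \<bullet> i" if "i \<in> Basis" for i using assms(2)[OF that] assms(1) by (simp add: inner_diff_left)
 then show ?thesis by (simp add: box_ne_empty)
qed

lemma cube_volume:
 fixes p q :: "'a::euclidean_space"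
 assumes s: "s > 0" "!!i. i \<in> Basis ==> (q - p) \<bullet> i = s"
 shows "vol (cbox p q) = s ^ DIM('a)"
proof -
 have "cbox p q ~= {}" using cube_ne[OF s] box_subset_cbox by blast
 then show ?thesis using s(2) by (subst content_cbox_if) (auto simp: inner_diff_left)
qed

text \<open>On a cube of side \<open>s\<close> the mean of the weight is at most
  \<open>(\<beta> / s) ^ n\<close>, and the diameter bound \<open>n * s\<close> restores the missing
  \<open>s\<close>. The resulting bound \<open>s * M + \<beta>\<close> also covers dimension
  one.\<close>

lemma wgrad_cube_oscillation:
 fixes g u :: "'a::euclidean_space => real"
 assumes wg: "wgrad U g G" and U: "open U" "cbox p q \<subseteq> U" and u: "L1 u" "!!z. 0 <= u z"
  and Gu: "AE z. norm (G z) <= u z" and M: "M > 0"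
  and \<Phi>: "L1 (%z. osc_weight DIM('a) M (u z))"
  and s: "s > 0" "!!i. i \<in> Basis ==> (q - p) \<bullet> i = s" and \<beta>: "\<beta> > 0"
  and le: "(LBINT z:cbox p q. osc_weight DIM('a) M (u z)) <= \<beta> ^ DIM('a)"
 shows "AE x. x \<in> cbox p q --> abs (g x - avg_box g p q) <= real DIM('a) * 2 ^ (DIM('a) + 2) * (s * M + \<beta>)"
proof -
 let ?n = "DIM('a)"
 have ne: "box p q ~= {}" by (rule cube_ne[OF s])
 show ?thesis
 proof (cases "?n = 1")
  case True
  have "(LBINT z:cbox p q. u z) <= \<beta>" using le by (simp add: True osc_weight_def)
  also have "... <= real ?n * 2 ^ (?n + 2) * (s * M + \<beta>)" using s(1) M \<beta> by (simp add: True)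
  finally have I: "(LBINT z:cbox p q. u z) <= real ?n * 2 ^ (?n + 2) * (s * M + \<beta>)" .
  show ?thesis using wgrad_oscillation_line[OF True wg U u Gu ne] by eventually_elim (use I in auto)
 next
  case False
  then have n: "?n >= 2" using DIM_positive[where 'a='a] by linarith
  have vol: "vol (cbox p q) = s ^ ?n" using s by (intro cube_volume) auto
  have d: "norm (y - z) <= real ?n * s" if "y \<in> cbox p q" "z \<in> cbox p q" for y z
  proof -
   have "norm (y - z) <= (\<Sum>i\<in>Basis. abs ((y - z) \<bullet> i))" by (rule norm_le_l1)
   also have "... <= (\<Sum>i\<in>(Basis::'a set). s)"
    using that s(2) by (intro sum_mono) (fastforce simp: mem_box inner_diff_left abs_le_iff)
   finally show ?thesis by simp
  qed
  have "avg_box (%z. osc_weight ?n M (u z)) p q <= (\<beta> / s) ^ ?n"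
   using le s(1) by (simp add: avg_box_def vol power_divide divide_right_mono)
  from wgrad_oscillation[OF wg U u Gu d ne \<Phi> osc_weight_nonneg[OF M u(2)] M _ _ this]
  have "AE x. x \<in> cbox p q --> abs (g x - avg_box g p q) <= real ?n * s * 2 ^ ?n * (4 * M + 4 * (\<beta> / s))"
   using osc_weight_level[OF M _ n] s(1) \<beta> by simp
  moreover have "real ?n * s * 2 ^ ?n * (4 * M + 4 * (\<beta> / s)) = real ?n * 2 ^ (?n + 2) * (s * M + \<beta>)"
  proof -
   have "real ?n * s * 2 ^ ?n * (4 * M + 4 * (\<beta> / s)) = real ?n * (2 ^ ?n * 4) * (s * M + s * (\<beta> / s))"
    by (simp only: ring_distribs mult_ac)
   also have "s * (\<beta> / s) = \<beta>" using s(1) by simp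
   finally show ?thesis by (simp add: power_add)
  qed
  ultimately show ?thesis by (simp only:)
 qed
qed

lemma continuous_AE_le_imp_le:
 fixes h :: "'a::euclidean_space => real"
 assumes h: "continuous_on (cbox p q) h" and ne: "box p q ~= {}"
  and ae: "AE x. x \<in> cbox p q --> abs (h x - t) <= I" and x: "x \<in> cbox p q"
 shows "abs (h x - t) <= I"
proof -
 let ?C = "{z \<in> cbox p q. abs (h z - t) <= I}"
 have "closed (cbox p q \<inter> (%z. abs (h z - t)) -` {..I})"
  by (intro continuous_closed_preimage continuous_intros h) auto
 moreover have "cbox p q \<inter> (%z. abs (h z - t)) -` {..I} = ?C" by auto
 ultimately have cl: "closed ?C" by simp
 have "z \<in> ?C" if z: "z \<in> box p q" for z
 proof (rule mem_closed_if_AE_lebesgue_open[OF open_box cl _ z])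
  have "AE x. x \<in> box p q --> x \<in> ?C"
   using ae by eventually_elim (use box_subset_cbox in blast)
  then show "AE x\<in>box p q in lebesgue. x \<in> ?C" by (rule AE_completion)
 qed
 then have "box p q \<subseteq> ?C" by blast
 then have "closure (box p q) \<subseteq> ?C" using cl by (rule closure_minimal)
 then show ?thesis using x closure_box[OF ne] by auto
qed

text \<open>Outer regularity of the finite measure with density \<open>f\<close>, which vanishes on
  null sets.\<close>

lemma small_open_nbhd:
 fixes f :: "'a::euclidean_space => real"
 assumes f: "L1 f" "!!z. 0 <= f z" and N: "N \<in> null_sets lborel" and e: "e > 0"
 obtains V where "open V" "N \<subseteq> V" "(LBINT z:V. f z) < e"
proof -
 let ?\<nu> = "density lborel f"
 have [measurable]: "f \<in> borel_funs" using f(1) by (simp add: measurable_L1)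
 have Nb: "N \<in> sets borel" using N by auto
 have "N \<in> null_sets ?\<nu>"
  using N AE_not_in[OF N] by (subst null_sets_density_iff) (auto elim: eventually_mono)
 then have N0: "emeasure ?\<nu> N = 0" by auto
 have fin: "emeasure ?\<nu> (space ?\<nu>) ~= \<infinity>"
  using nn_set_integral_eq[OF f, of UNIV] by simp
 have "(INF V \<in> {V. N \<subseteq> V & open V}. emeasure ?\<nu> V) = 0"
  using outer_regular[of ?\<nu> N] fin Nb N0 by simp
 also have "... < ennreal e" using e by simp
 finally obtain V where V: "N \<subseteq> V" "open V" "emeasure ?\<nu> V < ennreal e" by (auto simp: INF_less_iff)
 have "ennreal (LBINT z:V. f z) < ennreal e"
  using V nn_set_integral_eq[OF f, of V] by simp
 then have "(LBINT z:V. f z) < e" using e by (simp add: ennreal_less_iff set_integral_nonneg' f)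
 with V show ?thesis by (intro that) auto
qed

lemma mem_cube_subset_ball:
 fixes x :: "'a::euclidean_space"
 assumes "t >= 0"
 shows "cbox (x - t *\<^sub>R One) (x + t *\<^sub>R One) \<subseteq> cball x (real DIM('a) * t)"
proof
 fix z assume z: "z \<in> cbox (x - t *\<^sub>R One) (x + t *\<^sub>R One)"
 have "norm (z - x) <= (\<Sum>i\<in>Basis. abs ((z - x) \<bullet> i))" by (rule norm_le_l1)
 also have "... <= (\<Sum>i\<in>(Basis::'a set). t)"
 proof (rule sum_mono)
  fix i :: 'a assume i: "i \<in> Basis"
  then have "x \<bullet> i - t <= z \<bullet> i" "z \<bullet> i <= x \<bullet> i + t"
   using z by (auto simp: mem_box inner_diff_left inner_add_left)
  then show "abs ((z - x) \<bullet> i) <= t" by (simp add: inner_diff_left abs_le_iff)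
 qed
 finally show "z \<in> cball x (real DIM('a) * t)" by (simp add: dist_norm norm_minus_commute)
qed

abbreviation osc_const :: "'a::euclidean_space itself => real" where
 "osc_const T \<equiv> real DIM('a) * 2 ^ (DIM('a) + 2)"

lemma representative_oscillation:
 fixes g u h :: "'a::euclidean_space => real"
 assumes wg: "wgrad U g G" and U: "open U" and u: "L1 u" "!!z. 0 <= u z"
  and Gu: "AE z. norm (G z) <= u z" and M: "M > 0"
  and \<Phi>: "L1 (%z. osc_weight DIM('a) M (u z))"
  and hg: "AE x. x \<in> U --> h x = g x" and h: "continuous_on U h"
  and Q: "cbox p q \<subseteq> U" and s: "s > 0" "!!i. i \<in> Basis ==> (q - p) \<bullet> i = s" and \<beta>: "\<beta> > 0"
  and le: "(LBINT z:cbox p q. osc_weight DIM('a) M (u z)) <= \<beta> ^ DIM('a)"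
  and xy: "x \<in> cbox p q" "y \<in> cbox p q"
 shows "abs (h x - h y) <= 2 * (osc_const TYPE('a) * (s * M + \<beta>))"
proof -
 let ?I = "osc_const TYPE('a) * (s * M + \<beta>)"
 have ne: "box p q ~= {}" by (rule cube_ne[OF s])
 have "AE x. x \<in> cbox p q --> abs (g x - avg_box g p q) <= ?I"
  by (rule wgrad_cube_oscillation[OF wg U Q u Gu M \<Phi> s \<beta> le])
 with hg have "AE x. x \<in> cbox p q --> abs (h x - avg_box g p q) <= ?I"
 proof eventually_elim
  case (elim x)
  then show ?case using Q by auto
 qed
 then have *: "abs (h x - avg_box g p q) <= ?I" if "x \<in> cbox p q" for x
  by (rule continuous_AE_le_imp_le[OF continuous_on_subset[OF h Q] ne _ that])
 show ?thesis using *[OF xy(1)] *[OF xy(2)] by linarith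
qed

text \<open>The precise representative as a limit of mollifications. It is determined by
  \<open>g\<close> near \<open>x\<close> and does not depend on the cube used to control it.\<close>

definition prec :: "('a::euclidean_space => real) => 'a => real" where
 "prec g x = lim (%k. mol (1 / real (Suc k)) g x)"

text \<open>A point is a null set, so it has an open neighbourhood of small weighted mass. On a
  small cube inside it the oscillation of \<open>g\<close> about its mean is small, and
  mollifications of small radius inherit this; they are Cauchy and their limit is
  continuous.\<close>

lemma prec_oscillation:
 fixes g u :: "'a::euclidean_space => real"
 assumes wg: "wgrad U g G" and U: "open U" and u: "L1 u" "!!z. 0 <= u z"
  and Gu: "AE z. norm (G z) <= u z"
  and \<Phi>: "L1 (%z. osc_weight DIM('a) 1 (u z))"
 shows "x \<in> U ==> (%k. mol (1 / real (Suc k)) g x) \<longlonglongrightarrow> prec g x" "continuous_on U (prec g)"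
  "AE x. x \<in> U --> prec g x = g x"
proof -
 let ?n = "DIM('a)" and ?C = "osc_const TYPE('a)"
 have C: "?C > 0" by simp
 have g: "L1 g" using wg by (auto simp: wgrad_def)
 have small: "\<exists>V I. open V & x \<in> V & V \<subseteq> U & (\<forall>z\<in>V. \<forall>\<^sub>F k in sequentially. abs (mol (1 / real (Suc k)) g z - I) <= e)"
  if x: "x \<in> U" and e: "e > 0" for x e
 proof -
  \<comment> \<open>The side \<open>2 * t\<close> will be at most \<open>\<beta>\<close>, so that
    the oscillation bound is at most \<open>osc_const * (2 * \<beta>) = e\<close>.\<close>
  define \<beta> where "\<beta> = e / (2 * ?C)"
  have \<beta>: "\<beta> > 0" using e C by (simp add: \<beta>_def)
  have "{x} \<in> null_sets lborel" by (intro null_setsI) auto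
  then obtain V where V: "open V" "{x} \<subseteq> V" "(LBINT z:V. osc_weight ?n 1 (u z)) < \<beta> ^ ?n"
   using small_open_nbhd[OF \<Phi> osc_weight_nonneg[OF _ u(2)], of "{x}" "\<beta> ^ ?n"] \<beta> by auto
  have "open (U \<inter> V)" "x \<in> U \<inter> V" using U V x by auto
  then obtain \<rho> where \<rho>: "\<rho> > 0" "cball x \<rho> \<subseteq> U \<inter> V" by (meson open_contains_cball)
  define t where "t = min (\<rho> / real ?n) (\<beta> / 2)"
  have t: "t > 0" "real ?n * t <= \<rho>" "2 * t <= \<beta>" using \<rho> \<beta> by (auto simp: t_def min_def field_simps)
  let ?p = "x - t *\<^sub>R One" and ?q = "x + t *\<^sub>R One"
  have Q: "cbox ?p ?q \<subseteq> U \<inter> V"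
   using mem_cube_subset_ball[of t x] t \<rho>(2) subset_cball[OF t(2), of x] by auto
  have "(LBINT z:cbox ?p ?q. osc_weight ?n 1 (u z)) <= (LBINT z:V. osc_weight ?n 1 (u z))"
   using Q V(1) osc_weight_nonneg[OF _ u(2)] \<Phi> by (intro set_integral_mono_set_nonneg) auto
  then have le: "(LBINT z:cbox ?p ?q. osc_weight ?n 1 (u z)) <= \<beta> ^ ?n" using V(3) by linarith
  have ae: "AE z. z \<in> cbox ?p ?q --> abs (g z - avg_box g ?p ?q) <= e"
  proof -
   have 1: "AE z. z \<in> cbox ?p ?q --> abs (g z - avg_box g ?p ?q) <= ?C * (2 * t * 1 + \<beta>)"
   proof (rule wgrad_cube_oscillation[OF wg U _ u Gu _ \<Phi> _ _ \<beta> le])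
    show "(?q - ?p) \<bullet> i = 2 * t" if "i \<in> Basis" for i using that by (simp add: inner_diff_left inner_add_left)
   qed (use Q t in auto)
   have "?C * (2 * t * 1 + \<beta>) <= ?C * (2 * \<beta>)" using t C by (intro mult_left_mono) auto
   also have "?C * (2 * \<beta>) = e" using C by (simp add: \<beta>_def)
   finally have 2: "?C * (2 * t * 1 + \<beta>) <= e" .
   show ?thesis using 1 by eventually_elim (blast intro: order_trans[OF _ 2])
  qed
  have "\<forall>\<^sub>F k in sequentially. abs (mol (1 / real (Suc k)) g z - avg_box g ?p ?q) <= e" if z: "z \<in> box ?p ?q" for z
  proof -
   obtain d where d: "d > 0" "ball z d \<subseteq> box ?p ?q" using z open_box by (meson open_contains_ball)
   from eventually_inverse_Suc_less[OF d(1)] show ?thesis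
   proof eventually_elim
    case (elim k)
    note k = elim
    define \<epsilon> where "\<epsilon> = 1 / real (Suc k)"
    have \<epsilon>: "\<epsilon> > 0" by (simp add: \<epsilon>_def)
    have "ball z \<epsilon> \<subseteq> ball z d" using k by (intro subset_ball) (simp add: \<epsilon>_def)
    then have \<epsilon>Q: "ball z \<epsilon> \<subseteq> cbox ?p ?q" using d(2) box_subset_cbox by blast
    let ?A = "avg_box g ?p ?q"
    have i: "L1 (%y. g y * mker \<epsilon> z y)" "L1 (mker \<epsilon> z)"
     using integrable_mult_mker[OF g \<epsilon>(1)] integrable_mker[OF \<epsilon>] by auto
    have "mol \<epsilon> g z - ?A = (LBINT y. (g y - ?A) * mker \<epsilon> z y)"
     using i integral_mker[OF \<epsilon>, of z] by (simp add: mol_def left_diff_distrib)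
    also have "abs ... <= (LBINT y. abs ((g y - ?A) * mker \<epsilon> z y))" by (rule integral_abs_bound)
    also have "... <= (LBINT y. e * mker \<epsilon> z y)"
    proof (rule integral_mono_AE)
     show "L1 (%y. abs ((g y - ?A) * mker \<epsilon> z y))" using i by (simp add: left_diff_distrib)
     show "AE y. abs ((g y - ?A) * mker \<epsilon> z y) <= e * mker \<epsilon> z y"
      using ae
     proof eventually_elim
      fix y assume y: "y \<in> cbox ?p ?q --> abs (g y - ?A) <= e"
      show "abs ((g y - ?A) * mker \<epsilon> z y) <= e * mker \<epsilon> z y"
      proof (cases "y \<in> ball z \<epsilon>")
       case True
       then have "abs (g y - ?A) <= e" using y \<epsilon>Q by blast
       then show ?thesis using mker_nonneg[OF \<epsilon>, of z y] by (simp add: abs_mult mult_right_mono)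
      qed (simp add: mker_eq_0[OF \<epsilon>])
     qed
    qed (use i in auto)
    also have "... = e" using integral_mker[OF \<epsilon>, of z] by simp
    finally show "abs (mol (1 / real (Suc k)) g z - ?A) <= e" by (simp add: \<epsilon>_def)
   qed
  qed
  moreover have "x \<in> box ?p ?q" using t by (auto simp: mem_box inner_diff_left inner_add_left)
  moreover have "box ?p ?q \<subseteq> U" using Q box_subset_cbox by blast
  ultimately show ?thesis using open_box by blast
 qed
 show lim: "(%k. mol (1 / real (Suc k)) g x) \<longlonglongrightarrow> prec g x" if x: "x \<in> U" for x
 proof -
  have "Cauchy (%k. mol (1 / real (Suc k)) g x)"
  proof (rule CauchyI)
   fix e :: real assume e: "e > 0"
   obtain V I where "x \<in> V" "\<forall>z\<in>V. \<forall>\<^sub>F k in sequentially. abs (mol (1 / real (Suc k)) g z - I) <= e / 3"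
    using small[OF x, of "e/3"] e by auto
   then obtain K where K: "!!k. k >= K ==> abs (mol (1 / real (Suc k)) g x - I) <= e / 3"
    by (auto simp: eventually_sequentially)
   have "norm (mol (1 / real (Suc k)) g x - mol (1 / real (Suc l)) g x) < e" if "k >= K" "l >= K" for k l
    using K[OF that(1)] K[OF that(2)] e by (simp only: real_norm_def)
   then show "\<exists>K. \<forall>k\<ge>K. \<forall>l\<ge>K. norm (mol (1 / real (Suc k)) g x - mol (1 / real (Suc l)) g x) < e" by blast
  qed
  then show ?thesis unfolding prec_def by (simp add: Cauchy_convergent_iff convergent_LIMSEQ_iff)
 qed
 show "continuous_on U (prec g)"
  unfolding continuous_on_iff
 proof (intro ballI allI impI)
  fix x e assume x: "x \<in> U" and e: "(0::real) < e"
  obtain V I where V: "open V" "x \<in> V" "V \<subseteq> U" "\<forall>z\<in>V. \<forall>\<^sub>F k in sequentially. abs (mol (1 / real (Suc k)) g z - I) <= e / 3"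
   using small[OF x, of "e/3"] e by auto
  have I: "abs (prec g z - I) <= e / 3" if z: "z \<in> V" for z
  proof -
   have "z \<in> U" using z V(3) by blast
   then have "(%k. abs (mol (1 / real (Suc k)) g z - I)) \<longlonglongrightarrow> \<bar>prec g z - I\<bar>" using lim by (intro tendsto_intros) auto
   then show ?thesis using V(4) z by (intro tendsto_upperbound) auto
  qed
  obtain d where d: "d > 0" "ball x d \<subseteq> V" using V by (meson open_contains_ball)
  have "dist (prec g z) (prec g x) < e" if "dist z x < d" for z
  proof -
   have "z \<in> V" using that d(2) by (auto simp: dist_commute)
   then show ?thesis using I[of z] I[OF V(2)] e unfolding dist_real_def by linarith
  qed
  then show "\<exists>d>0. \<forall>z\<in>U. dist z x < d --> dist (prec g z) (prec g x) < e" using d(1) by blast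
 qed
 show "AE x. x \<in> U --> prec g x = g x"
  using AE_mol_tendsto[OF g] by eventually_elim (use lim LIMSEQ_unique in blast)
qed

section \<open>Differentiability almost everywhere\<close>

text \<open>Translation does not change the integral of \<open>\<phi>\<close>, and the difference
  quotient differs from the derivative by at most \<open>e\<close> on a fixed ball and not at all
  outside it.\<close>

lemma integral_tgrad_test_function:
 fixes \<phi> :: "'a::euclidean_space => real"
 assumes \<phi>: "test_function U \<phi>" and b: "b \<in> Basis"
 shows "(LBINT x. tgrad \<phi> x \<bullet> b) = 0"
proof -
 obtain r where r: "r > 0" "!!x. x \<notin> cball 0 r ==> \<phi> x = 0" "!!x. x \<notin> cball 0 r ==> tgrad \<phi> x = 0"
  using test_function_support[OF \<phi>] by metis
 note \<phi>0 = r(2) and t0 = r(3)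
 have C: "C_diff k \<phi>" for k by (rule test_functionD[OF \<phi>])
 note d = has_derivative_tgrad[OF C] and tc = continuous_on_tgrad[OF C]
 have uc: "uniformly_continuous_on UNIV (tgrad \<phi>)"
  by (rule uniformly_continuous_compact_support[OF tc]) (erule t0)
 have iI: "L1 (indicat_real (cball (0::'a) r))"
  by (rule integrable_indicator_bounded) auto
 have "(%x. \<phi> x *\<^sub>R indicat_real (cball 0 r) x) = \<phi>" using \<phi>0 by (auto simp: indicator_def fun_eq_iff)
 then have \<phi>i: "L1 \<phi>" using test_function_integrable(1)[OF \<phi> iI] by simp
 have "(%x. indicat_real (cball 0 r) x *\<^sub>R tgrad \<phi> x) = tgrad \<phi>" using t0 by (auto simp: indicator_def fun_eq_iff)
 then have "L1 (tgrad \<phi>)" using test_function_integrable(2)[OF \<phi> iI] by simp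
 then have di: "L1 (%x. tgrad \<phi> x \<bullet> b)" by simp
 let ?D = "abs (LBINT x. tgrad \<phi> x \<bullet> b)" and ?m = "vol (cball (0::'a) (r + 1))"
 have le: "?D <= e * ?m" if e: "e > 0" for e
 proof -
  obtain d where d: "d > 0" "!!z h. norm h < d ==> abs (\<phi> (z + h) - \<phi> z - tgrad \<phi> z \<bullet> h) <= e * norm h"
   by (rule uniformly_differentiable[OF d uc e]) blast
  define t where "t = min (d / 2) 1"
  have t: "0 < t" "t < d" "t <= 1" using d(1) by (auto simp: t_def)
  let ?R = "%z. \<phi> (z + t *\<^sub>R b) - \<phi> z - t * (tgrad \<phi> z \<bullet> b)"
  have si: "L1 (%z. \<phi> (z + t *\<^sub>R b))" "(LBINT z. \<phi> (z + t *\<^sub>R b)) = (LBINT z. \<phi> z)"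
   using integral_affine_euclidean[of 1 \<phi> "t *\<^sub>R b"] \<phi>i by (simp_all add: add.commute)
  have Ri: "L1 ?R" using si(1) \<phi>i di by simp
  have "t * (LBINT z. tgrad \<phi> z \<bullet> b) = - (LBINT z. ?R z)" using si \<phi>i di by simp
  then have "abs (t * (LBINT z. tgrad \<phi> z \<bullet> b)) = abs (- (LBINT z. ?R z))" by (rule arg_cong)
  then have "t * ?D = abs (LBINT z. ?R z)" using t(1) by (simp only: abs_mult abs_minus_cancel abs_of_pos)
  also have "... <= (LBINT z. abs (?R z))" by (rule integral_abs_bound)
  also have "... <= (LBINT z. (e * t) * indicator (cball (0::'a) (r + 1)) z)"
  proof (rule Bochner_Integration.integral_mono)
   show "L1 (%z. (e * t) * indicator (cball (0::'a) (r + 1)) z)"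
    by (intro integrable_mult_right integrable_indicator_bounded) auto
   fix z :: 'a
   show "abs (?R z) <= (e * t) * indicator (cball 0 (r + 1)) z"
   proof (cases "z \<in> cball 0 (r + 1)")
    case True
    then show ?thesis using d(2)[of "t *\<^sub>R b" z] t b by simp
   next
    case False
    then have z: "norm z > r + 1" by simp
    have "norm z <= norm (z + t *\<^sub>R b) + norm (t *\<^sub>R b)" using norm_triangle_ineq4[of "z + t *\<^sub>R b" "t *\<^sub>R b"] by simp
    then have "norm (z + t *\<^sub>R b) > r" using z t b by simp
    then show ?thesis using z t0[of z] \<phi>0[of z] \<phi>0[of "z + t *\<^sub>R b"] False by simp
   qed
  qed (use Ri in auto)
  also have "... = t * (e * ?m)" by simp
  finally show ?thesis using t by simp
 qed
 have "?D <= 0"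
 proof (rule field_le_epsilon)
  fix e :: real assume e: "e > 0"
  have "?D <= (e / (?m + 1)) * ?m" using e by (intro le) (auto intro!: divide_pos_pos add_nonneg_pos)
  also have "... = e * (?m / (?m + 1))" by simp
  also have "... <= e * 1"
  proof (rule mult_left_mono)
   have "0 < ?m + 1" by (intro add_nonneg_pos) auto
   then show "?m / (?m + 1) <= 1" by (subst pos_divide_le_eq) auto
  qed (use e in auto)
  also have "... = 0 + e" by simp
  finally show "?D <= 0 + e" .
 qed
 then show ?thesis by simp
qed

text \<open>Linear functions are not integrable on the whole space, hence the indicator of
  \<open>U\<close>. Differentiability subtracts a candidate linear part in this way; with slope 0
  the lemma restricts the data to a smaller set.\<close>

lemma wgrad_minus_linear:
 assumes wg: "wgrad U g G" and U: "open U" "bounded U"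
 shows "wgrad U (%z. indicator U z * (g z - c \<bullet> z)) (%z. indicator U z *\<^sub>R (G z - c))"
proof -
 let ?I = "indicat_real U"
 have g: "L1 g" "L1 G" using wg by (auto simp: wgrad_def)
 have [measurable]: "U \<in> sets borel" using U(1) by simp
 obtain r where r: "U \<subseteq> ball 0 r" using bounded_subset_ballD[OF U(2), of 0] by blast
 have iU: "L1 ?I" by (rule integrable_indicator_bounded[OF U(2)]) simp
 have l: "L1 (%z. ?I z * (c \<bullet> z))"
 proof (rule integrable_majorant[OF integrable_mult_right[OF iU, of "norm c * r"]])
  show "abs (?I z * (c \<bullet> z)) <= norm c * r * ?I z" for z
  proof (cases "z \<in> U")
   case True
   then have "norm z <= r" using r by auto
   then have "abs (c \<bullet> z) <= norm c * r" by (intro order_trans[OF Cauchy_Schwarz_ineq2] mult_left_mono) auto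
   then show ?thesis using True by simp
  qed simp
 qed measurable
 have gU: "L1 (%z. ?I z * g z)" "L1 (%z. ?I z *\<^sub>R G z)"
  using integrable_mult_indicator[of U lborel g] integrable_mult_indicator[of U lborel G] g by auto
 have 1: "L1 (%z. ?I z * (g z - c \<bullet> z))"
  using gU(1) l by (simp add: right_diff_distrib)
 have 2: "L1 (%z. ?I z *\<^sub>R (G z - c))"
  using gU(2) integrable_scaleR_left[OF iU, of c] by (simp add: scaleR_diff_right)
 have "(LBINT x. ?I x * (g x - c \<bullet> x) * (tgrad \<phi> x \<bullet> b)) = - (LBINT x. ((?I x *\<^sub>R (G x - c)) \<bullet> b) * \<phi> x)"
  if \<phi>: "test_function U \<phi>" and b: "b \<in> Basis" for \<phi> b
 proof -
  note out = test_function_outside[OF \<phi>]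
  have i1: "L1 (%x. h x * (tgrad \<phi> x \<bullet> b))" if "L1 h" for h
   using integrable_inner_left[OF test_function_integrable(2)[OF \<phi> that], of b] by simp
  have i2: "L1 (%x. (G x \<bullet> b) * \<phi> x)"
   using integrable_inner_left[OF test_function_integrable(1)[OF \<phi> g(2)], of b] by (simp add: mult.commute)
  have i3: "L1 (%x. ?I x * (c \<bullet> b) * \<phi> x)"
   using test_function_integrable(1)[OF \<phi> integrable_mult_left[OF iU, of "c \<bullet> b"]] by (simp add: mult_ac)
  have lin: "(LBINT x. ?I x * (c \<bullet> x) * (tgrad \<phi> x \<bullet> b) + ?I x * (c \<bullet> b) * \<phi> x) = 0"
  proof -
   have cx: "C_diff k (%x. c \<bullet> x)" for k using C_diff_inner[of k c] by (simp add: inner_commute)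
   have t: "test_function U (%x. \<phi> x * (c \<bullet> x))" by (rule test_function_mult[OF \<phi> cx])
   have "tgrad (%x. \<phi> x * (c \<bullet> x)) x = (c \<bullet> x) *\<^sub>R tgrad \<phi> x + \<phi> x *\<^sub>R c" for x
    by (rule tgrad_unique[OF test_functionD[OF t]])
     (use has_derivative_mult[OF has_derivative_tgrad[OF test_functionD[OF \<phi>]] has_derivative_inner_right[OF has_derivative_ident, of c]]
      in \<open>simp add: inner_add_left algebra_simps\<close>)
   then have "tgrad (%x. \<phi> x * (c \<bullet> x)) x \<bullet> b = ?I x * (c \<bullet> x) * (tgrad \<phi> x \<bullet> b) + ?I x * (c \<bullet> b) * \<phi> x" for x
    using out[of x] by (cases "x \<in> U") (simp_all add: inner_add_left)
   then show ?thesis using integral_tgrad_test_function[OF t b] by simp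
  qed
  have "(LBINT x. ?I x * (g x - c \<bullet> x) * (tgrad \<phi> x \<bullet> b)) = (LBINT x. g x * (tgrad \<phi> x \<bullet> b) - ?I x * (c \<bullet> x) * (tgrad \<phi> x \<bullet> b))"
   using out(2) by (intro Bochner_Integration.integral_cong refl) (auto simp: indicator_def left_diff_distrib)
  also have "... = - (LBINT x. (G x \<bullet> b) * \<phi> x) + (LBINT x. ?I x * (c \<bullet> b) * \<phi> x)"
   using i1[OF g(1)] i1[OF l] i3 lin wg \<phi> b by (simp add: wgrad_def)
  also have "... = - (LBINT x. (G x \<bullet> b) * \<phi> x - ?I x * (c \<bullet> b) * \<phi> x)" using i2 i3 by simp
  also have "(LBINT x. (G x \<bullet> b) * \<phi> x - ?I x * (c \<bullet> b) * \<phi> x) = (LBINT x. ((?I x *\<^sub>R (G x - c)) \<bullet> b) * \<phi> x)"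
   using out(1) by (intro Bochner_Integration.integral_cong refl) (auto simp: indicator_def inner_diff_left left_diff_distrib)
  finally show ?thesis .
 qed
 with 1 2 show ?thesis by (auto simp: wgrad_def)
qed

text \<open>The oscillation estimate is applied to \<open>h\<close> minus a linear map of slope
  \<open>q\<close> close to \<open>G x\<close>. At a Lebesgue point of the weight of
  \<open>|G - q|\<close>, its mass on a cube of side \<open>2 * t\<close> is of order
  \<open>(M t) ^ n\<close>, so the oscillation is of order \<open>M t\<close>.\<close>

theorem representative_differentiable:
 fixes g u h :: "'a::euclidean_space => real"
 assumes wg: "wgrad U g G" and U: "open U" "bounded U" and um: "u \<in> borel_funs" and u0: "!!z. 0 <= u z"
  and Gu: "AE z. norm (G z) <= u z"
  and \<Phi>: "!!M d. M > 0 ==> d >= 0 ==> L1 (%z. indicator U z * osc_weight DIM('a) M (u z + d))"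
  and hg: "AE x. x \<in> U --> h x = g x" and h: "continuous_on U h"
 shows "AE x. x \<in> U --> (h has_derivative (%w. G x \<bullet> w)) (at x)"
proof -
 let ?n = "DIM('a)" and ?C = "osc_const TYPE('a)"
 have C: "?C > 0" by simp
 have G: "L1 G" using wg by (auto simp: wgrad_def)
 have [measurable]: "G \<in> borel_funs" "U \<in> sets borel" using G U(1) by (simp_all add: measurable_L1)
 note [measurable] = um
 have iU: "L1 (indicat_real U)" by (rule integrable_indicator_bounded[OF U(2)]) simp
 define V where "V q z = indicator U z * norm (G z - q)" for q z
 have Vm [measurable]: "V q \<in> borel_funs" for q unfolding V_def by measurable
 have V0: "0 <= V q z" for q z by (simp add: V_def)
 have Vi: "L1 (V q)" for q
 proof (rule integrable_majorant)
  show "L1 (%z. norm (G z) + norm q * indicator U z)" using G iU by auto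
  show "abs (V q z) <= norm (G z) + norm q * indicator U z" for z
   using norm_triangle_ineq4[of "G z" q] by (simp add: V_def indicator_def)
 qed simp
 have n0: "?n >= 1" using DIM_positive[where 'a='a] by linarith

 have V\<Phi>: "L1 (%z. osc_weight ?n M (V q z))" if M: "M > 0" for M q
 proof (rule integrable_dominated[OF \<Phi>[OF M norm_ge_zero[of q]]])
  show "AE z. norm (osc_weight ?n M (V q z)) <= norm (indicat_real U z * osc_weight ?n M (u z + norm q))"
   using Gu
  proof eventually_elim
   case (elim z)
   note z = elim
   have "osc_weight ?n M (V q z) <= indicat_real U z * osc_weight ?n M (u z + norm q)"
   proof (cases "z \<in> U")
    case True
    have "V q z <= u z + norm q" using norm_triangle_ineq4[of "G z" q] z True by (simp add: V_def)
    then show ?thesis using osc_weight_mono[OF M V0] True by simp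
   qed (simp add: V_def osc_weight_0)
   then show ?case
    using osc_weight_nonneg[OF M V0, of ?n q z] by simp
  qed
 qed measurable
 \<comment> \<open>The slope \<open>G x\<close> varies with the point, while a null set may be
   discarded only countably often. A countable dense set of slopes and the thresholds
   \<open>1 / Suc k\<close> suffice.\<close>
 obtain D :: "'a set" where D: "countable D" "!!X. open X ==> X ~= {} ==> \<exists>d \<in> D. d \<in> X"
  by (rule countable_dense_setE) blast
 let ?M = "%k. 1 / real (Suc k)"
 let ?Q = "%x. \<forall>q\<in>D. \<forall>k. ((%r. avg_ball (%y. abs (osc_weight ?n (?M k) (V q y) - osc_weight ?n (?M k) (V q x))) x r) \<longlongrightarrow> 0) (at_right 0)"
 have M0: "?M k > 0" for k by simp
 have leb: "AE x. ?Q x"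
  unfolding AE_ball_countable[OF D(1)] AE_all_countable using lebesgue_points[OF V\<Phi>[OF M0]] by blast
 \<comment> \<open>This bounds the weighted mass on the cube in units of \<open>(M * t) ^ n\<close>:
   the value at \<open>x\<close> gives \<open>4 ^ (2 n)\<close>, the mean deviation gives 1, and the
   ball of radius \<open>2 n t\<close> gives the rest. Since \<open>L >= 1\<close>, also
   \<open>L <= L ^ n\<close>, so \<open>L * M * t\<close> can play the part of
   \<open>\<beta>\<close>.\<close>
 define L where "L = max 1 ((4 ^ (2 * ?n) + 1) * unit_ball_vol ?n * (2 * real ?n) ^ ?n)"
 have L: "L >= 1" "(4 ^ (2 * ?n) + 1) * unit_ball_vol ?n * (2 * real ?n) ^ ?n <= L" by (auto simp: L_def)
 have LL: "L <= L ^ ?n" using power_increasing[OF n0 L(1)] by simp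
 \<comment> \<open>The oscillation of the corrected function contributes
   \<open>2 * (osc_const * (2 + L))\<close>; the final 1 pays for replacing the slope
   \<open>q\<close> by \<open>G x\<close>.\<close>
 define E where "E = 2 * (?C * (2 + L)) + 1"
 have E: "E > 0" using C L by (simp add: E_def add_nonneg_pos)
 show ?thesis
  using leb
 proof (eventually_elim, intro impI)
  fix x assume leb: "?Q x"
   and x: "x \<in> U"
  show "(h has_derivative (%w. G x \<bullet> w)) (at x)"
   unfolding has_derivative_at_alt
  proof (intro conjI allI impI bounded_linear_inner_right)
   fix e :: real assume e: "e > 0"
   obtain k where k: "?M k < e / E" using reals_Archimedean[of "e / E"] e E by (auto simp: inverse_eq_divide)
   define M where "M = ?M k"
   have M: "M > 0" "E * M <= e" using k E by (auto simp: M_def field_simps)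
   obtain q where q: "q \<in> D" "norm (G x - q) < M" using D(2)[of "ball (G x) M"] M by (auto simp: dist_norm)
   define \<psi> where "\<psi> z = osc_weight ?n M (V q z)" for z
   have \<psi>i: "L1 \<psi>" unfolding \<psi>_def by (rule V\<Phi>[OF M(1)])
   have \<psi>0: "0 <= \<psi> z" for z unfolding \<psi>_def by (rule osc_weight_nonneg[OF M(1) V0])
   have \<psi>x: "\<psi> x <= 4 ^ (2 * ?n) * M ^ ?n"
    unfolding \<psi>_def by (rule osc_weight_small[OF M(1) V0 _ n0]) (use x q in \<open>simp add: V_def\<close>)
   have "((%r. avg_ball (%y. abs (\<psi> y - \<psi> x)) x r) \<longlongrightarrow> 0) (at_right 0)"
    using leb q(1) unfolding \<psi>_def M_def by blast
   then have "\<forall>\<^sub>F r in at_right 0. avg_ball (%y. abs (\<psi> y - \<psi> x)) x r < M ^ ?n"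
    using M by (intro order_tendstoD(2)) auto
   then obtain d1 where d1: "d1 > 0" "!!r. 0 < r ==> r < d1 ==> avg_ball (%y. abs (\<psi> y - \<psi> x)) x r < M ^ ?n"
    unfolding eventually_at_right_field by blast
   obtain d2 where d2: "d2 > 0" "ball x d2 \<subseteq> U" using x U(1) by (meson open_contains_ball)
   define d where "d = min d1 d2 / (2 * real ?n)"
   have d: "d > 0" using d1(1) d2(1) n0 by (simp add: d_def)
   have main: "abs (h y - h x - G x \<bullet> (y - x)) <= e * norm (y - x)" if y: "norm (y - x) < d" "y ~= x" for y
   proof -
    define t where "t = norm (y - x)"
    have t: "t > 0" using y by (simp add: t_def)
    define r where "r = 2 * real ?n * t"
    have r: "r > 0" "r < d1" "r < d2"
     using y(1) t n0 by (auto simp: r_def d_def t_def[symmetric] field_simps)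
    let ?p = "x - t *\<^sub>R One" and ?q = "x + t *\<^sub>R One" and ?B = "ball x r"
    have "cball x (real ?n * t) \<subseteq> ?B" using t n0 by (intro cball_subset_ball_iff[THEN iffD2]) (simp add: r_def)
    then have QB: "cbox ?p ?q \<subseteq> ?B" using mem_cube_subset_ball[of t x] t by auto
    have QU: "cbox ?p ?q \<subseteq> U" using QB r(3) d2(2) subset_ball[of r d2 x] by fastforce
    have mB: "vol ?B = unit_ball_vol ?n * r ^ ?n" using r by (intro measure_lborel_ball) simp
    have mB0: "vol ?B > 0" using r unfolding mB by simp
    have cB: "set_integrable lborel ?B (%_. c)" for c :: real by (rule set_integrable_const_ball)
    have \<psi>B: "set_integrable lborel ?B \<psi>" by (rule set_integrable_lborel[OF \<psi>i]) simp
    have aB: "set_integrable lborel ?B (%y. abs (\<psi> y - \<psi> x))" by (intro set_integrable_abs set_integral_diff(1)[OF \<psi>B cB])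
    have "(LBINT z:cbox ?p ?q. \<psi> z) <= (LBINT z:?B. \<psi> z)"
     using QB \<psi>0 \<psi>i by (intro set_integral_mono_set_nonneg) auto
    also have "... <= (LBINT z:?B. \<psi> x + abs (\<psi> z - \<psi> x))"
     by (rule set_integral_mono[OF \<psi>B set_integral_add(1)[OF cB aB]]) auto
    also have "... = \<psi> x * vol ?B + (LBINT z:?B. abs (\<psi> z - \<psi> x))"
     by (subst set_integral_add(2)[OF cB aB]) (use r in \<open>simp add: set_integral_def\<close>)
    also have "(LBINT z:?B. abs (\<psi> z - \<psi> x)) <= M ^ ?n * vol ?B"
     using d1(2)[OF r(1,2)] mB0 by (simp add: avg_ball_def pos_divide_less_eq)
    also have "\<psi> x * vol ?B <= (4 ^ (2 * ?n) * M ^ ?n) * vol ?B"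
     using \<psi>x by (intro mult_right_mono) auto
    also have "(4 ^ (2 * ?n) * M ^ ?n) * vol ?B + M ^ ?n * vol ?B
     = ((4 ^ (2 * ?n) + 1) * unit_ball_vol ?n * (2 * real ?n) ^ ?n) * (M * t) ^ ?n"
     unfolding mB unfolding r_def by (simp add: power_mult_distrib algebra_simps)
    also have "... <= L ^ ?n * (M * t) ^ ?n"
     using L(2) LL M t by (intro mult_right_mono) auto
    also have "... = (L * (M * t)) ^ ?n" by (rule power_mult_distrib[symmetric])
    finally have le: "(LBINT z:cbox ?p ?q. \<psi> z) <= (L * (M * t)) ^ ?n" by simp
    let ?h = "%z. h z - q \<bullet> z"
    have tn: "abs ((y - x) \<bullet> i) <= t" if "i \<in> Basis" for i unfolding t_def using that by (rule Basis_le_norm)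
    have "abs (?h y - ?h x) <= 2 * (?C * ((2 * t) * M + L * (M * t)))"
    proof (rule representative_oscillation[OF wgrad_minus_linear[OF wg U, of q] U(1) Vi V0 _ M(1) V\<Phi>[OF M(1)]])
     show "AE z. norm (indicator U z *\<^sub>R (G z - q)) <= V q z" by (simp add: V_def)
     show "AE z. z \<in> U --> ?h z = indicator U z * (g z - q \<bullet> z)" using hg by eventually_elim auto
     show "continuous_on U ?h" by (intro continuous_intros h)
     show "cbox ?p ?q \<subseteq> U" by (rule QU)
     show "2 * t > 0" "L * (M * t) > 0" using t L M by auto
     show "(?q - ?p) \<bullet> i = 2 * t" if "i \<in> Basis" for i using that by (simp add: inner_diff_left inner_add_left)
     show "(LBINT z:cbox ?p ?q. osc_weight ?n M (V q z)) <= (L * (M * t)) ^ ?n" using le by (simp only: \<psi>_def)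
     show "x \<in> cbox ?p ?q" using t by (simp add: mem_box inner_diff_left inner_add_left)
     show "y \<in> cbox ?p ?q" using tn by (fastforce simp: mem_box inner_diff_left inner_add_left abs_le_iff)
    qed
    also have "... = 2 * (?C * (2 + L)) * M * t" by (simp add: algebra_simps)
    finally have 1: "abs (?h y - ?h x) <= 2 * (?C * (2 + L)) * M * t" .
    have "abs ((q - G x) \<bullet> (y - x)) <= norm (q - G x) * t" unfolding t_def by (rule Cauchy_Schwarz_ineq2)
    also have "... <= M * t" using q(2) t by (intro mult_right_mono) (auto simp: norm_minus_commute)
    finally have 2: "abs ((q - G x) \<bullet> (y - x)) <= M * t" .
    have "h y - h x - G x \<bullet> (y - x) = (?h y - ?h x) + (q - G x) \<bullet> (y - x)"
     by (simp add: inner_diff_left inner_diff_right)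
    then have "abs (h y - h x - G x \<bullet> (y - x)) <= 2 * (?C * (2 + L)) * M * t + M * t" using 1 2 by linarith
    also have "... = E * M * t" by (simp add: E_def algebra_simps)
    also have "... <= e * t" using M(2) t by (intro mult_right_mono) auto
    finally show ?thesis by (simp add: t_def)
   qed
   show "\<exists>d>0. \<forall>y. norm (y - x) < d --> norm (h y - h x - G x \<bullet> (y - x)) <= e * norm (y - x)"
   proof (intro exI[of _ d] conjI allI impI d)
    fix y assume "norm (y - x) < d"
    then show "norm (h y - h x - G x \<bullet> (y - x)) <= e * norm (y - x)" using main[of y] by (cases "y = x") auto
   qed
  qed
 qed
qed

section \<open>Hausdorff measure of images of null sets\<close>

text \<open>A witness that the Hausdorff premeasure at scale \<open>\<delta>\<close> is small, with
  the normalising constant left out.\<close>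

definition fine_cover :: "nat => nat => real => real => (nat => real) set => (nat => (nat => real) set) => bool" where
 "fine_cover m s \<delta> e A W \<longleftrightarrow> A \<subseteq> (\<Union>i. W i) &
  (\<forall>i. W i \<subseteq> topspace (Euclidean_space m) & ediam m (W i) <= ennreal \<delta>) &
  (\<Sum>i. ediam m (W i) ^ s) <= ennreal e"

text \<open>The j-th set is given the share \<open>e / 2 ^ (j + 1)\<close>, and the double sequence
  of covers is enumerated by the pairing function.\<close>

lemma fine_cover_UN:
 assumes e: "e > 0" and c: "!!j e. e > 0 ==> \<exists>W. fine_cover m s \<delta> e (A j) W"
 shows "\<exists>W. fine_cover m s \<delta> e (\<Union>j::nat. A j) W"
proof -
 have "\<forall>j. \<exists>W. fine_cover m s \<delta> (e * (1/2) ^ Suc j) (A j) W" using c e by simp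
 then obtain W where W: "!!j. fine_cover m s \<delta> (e * (1/2) ^ Suc j) (A j) (W j)" by metis
 define Z where "Z i = W (fst (prod_decode i)) (snd (prod_decode i))" for i
 have "(\<Sum>i. ediam m (Z i) ^ s) = (\<Sum>i. (%p. ediam m (W (fst p) (snd p)) ^ s) (prod_decode i))" by (simp add: Z_def)
 also have "... = (\<Sum>j. \<Sum>i. ediam m (W j i) ^ s)" by (rule suminf_ennreal_2dimen) simp
 also have "... <= (\<Sum>j. ennreal (e * (1/2) ^ Suc j))"
  using W by (intro suminf_le) (auto simp: fine_cover_def)
 also have "... = ennreal e"
 proof (rule suminf_ennreal_eq)
  show "(%j. e * (1/2) ^ Suc j) sums e" using sums_mult[OF power_half_series, of e] by simp
 qed (use e in simp)
 finally have 1: "(\<Sum>i. ediam m (Z i) ^ s) <= ennreal e" .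
 have "(\<Union>j. A j) \<subseteq> (\<Union>i. Z i)"
 proof
  fix x assume "x \<in> (\<Union>j. A j)"
  then obtain j where "x \<in> A j" by blast
  moreover have "A j \<subseteq> (\<Union>i. W j i)" using W[of j] by (simp add: fine_cover_def)
  ultimately obtain i where "x \<in> W j i" by blast
  then have "x \<in> Z (prod_encode (j, i))" by (simp add: Z_def)
  then show "x \<in> (\<Union>i. Z i)" by blast
 qed
 moreover have "Z i \<subseteq> topspace (Euclidean_space m) & ediam m (Z i) <= ennreal \<delta>" for i
  using W[of "fst (prod_decode i)"] by (simp add: fine_cover_def Z_def)
 ultimately have "fine_cover m s \<delta> e (\<Union>j. A j) Z" using 1 by (simp add: fine_cover_def)
 then show ?thesis by blast
qed

lemma hausdorff_measure_eq_0:
 assumes "!!\<delta> e. \<delta> > 0 ==> e > 0 ==> \<exists>W. fine_cover m s \<delta> e A W"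
 shows "hausdorff_measure m s A = 0"
proof -
 have "hausdorff_premeasure m s \<delta> A <= 0" if \<delta>: "\<delta> > 0" for \<delta>
 proof (rule ennreal_le_epsilon)
  fix e :: real assume e: "e > 0"
  define c where "c = unit_ball_vol (real s) / 2 ^ s"
  have c: "c > 0" by (simp add: c_def)
  \<comment> \<open>The scale may be infinite; any positive real below it serves, since covers finer
    than required are admissible.\<close>
  obtain d where d: "d > 0" "ennreal d <= \<delta>"
  proof (cases \<delta>)
   case (real r)
   then show thesis using \<delta> that[of r] by simp
  next
   case top
   then show thesis using that[of 1] by simp
  qed
  obtain W where W: "fine_cover m s d (e / c) A W" using assms[OF d(1), of "e / c"] e c by auto
  have "hausdorff_premeasure m s \<delta> A <= (\<Sum>i. ennreal c * ediam m (W i) ^ s)"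
   unfolding hausdorff_premeasure_def c_def
   by (rule INF_lower) (use W d(2) in \<open>auto simp: fine_cover_def intro: order_trans\<close>)
  also have "... = ennreal c * (\<Sum>i. ediam m (W i) ^ s)" by simp
  also have "... <= ennreal c * ennreal (e / c)" using W by (intro mult_left_mono) (auto simp: fine_cover_def)
  also have "... = 0 + ennreal e" using c e by (simp add: ennreal_mult[symmetric])
  finally show "hausdorff_premeasure m s \<delta> A <= 0 + ennreal e" .
 qed
 then have "hausdorff_measure m s A <= 0" unfolding hausdorff_measure_def by (intro SUP_least) auto
 then show ?thesis by simp
qed

lemma ediam_le:
 assumes "!!x y. x \<in> A ==> y \<in> A ==> L2_set (%i. x i - y i) {..<m} <= d"
 shows "ediam m A <= ennreal d"
 unfolding ediam_def by (intro SUP_least ennreal_leI assms)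

lemma set_integral_interior_cbox:
 assumes f: "L1 f"
 shows "(LBINT z:cbox a b. f z) = (LBINT z:box a b. f z)"
proof (rule set_integral_cong_set)
 have [measurable]: "f \<in> borel_funs" using f by (simp add: measurable_L1)
 show "set_borel_measurable lborel (box a b) f" "set_borel_measurable lborel (cbox a b) f"
  unfolding set_borel_measurable_def by measurable
 have "emeasure lborel (cbox a b - box a b) = 0"
  by (subst emeasure_Diff) (use box_subset_cbox emeasure_lborel_box_finite[of a b] in \<open>auto simp: emeasure_lborel_box_eq emeasure_lborel_cbox_eq\<close>)
 then have "cbox a b - box a b \<in> null_sets lborel" by (auto intro: null_setsI)
 then show "AE x. x \<in> box a b \<longleftrightarrow> x \<in> cbox a b"
  by (rule AE_I') (use box_subset_cbox in auto)
qed

text \<open>The null set is covered by non-overlapping cubes inside an open set of small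
  \<open>f\<close>-mass. The oscillation estimate bounds the diameter of each image, raised to the
  power \<open>n\<close>, by a constant times the \<open>f\<close>-mass of the cube, and these
  masses add up.\<close>

theorem fine_cover_image_null_set:
 fixes g :: "'a::euclidean_space => nat => real" and \<phi> :: "'a => real"
 assumes U: "open U" "bounded U" and \<phi>: "L1 \<phi>" "!!z. 0 <= \<phi> z" and C: "C >= 0"
  and osc: "!!p q s \<beta> i x y. [|i < m; cbox p q \<subseteq> U; s > 0; !!b. b \<in> Basis ==> (q - p) \<bullet> b = s; \<beta> > 0;
    (LBINT z:cbox p q. \<phi> z) <= \<beta> ^ DIM('a); x \<in> cbox p q; y \<in> cbox p q|] ==> abs (g x i - g y i) <= C * (s + \<beta>)"
  and top: "!!x. x \<in> U ==> g x \<in> topspace (Euclidean_space m)"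
  and E: "E \<subseteq> U" "E \<in> null_sets lborel" and \<delta>: "\<delta> > 0" and e: "e > 0"
 shows "\<exists>W. fine_cover m DIM('a) \<delta> e (g ` E) W"
proof -
 let ?n = "DIM('a)"
 have n0: "?n > 0" by (rule DIM_positive)
 have Ub [measurable]: "U \<in> sets borel" using U(1) by simp
 \<comment> \<open>The indicator adds the volume \<open>s ^ n\<close> of a cube to its mass, so that
   the \<open>n\<close>-th root of the mass dominates the side as well.\<close>
 define f where "f z = \<phi> z + indicator U z" for z
 have iU: "L1 (indicat_real U)" by (rule integrable_indicator_bounded[OF U(2)]) simp
 have f: "L1 f" "!!z. 0 <= f z" unfolding f_def using \<phi> iU by auto
 define A where "A = (real m * (2 * C)) ^ ?n"
 have A: "A >= 0" using C by (simp add: A_def)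
 \<comment> \<open>One bound serves two ends: the sum of the powers must be at most
   \<open>e\<close>, and each single diameter at most \<open>\<delta>\<close>.\<close>
 define e' where "e' = min e (\<delta> ^ ?n) / (A + 1)"
 have e': "e' > 0" "A * e' <= e" "A * e' <= \<delta> ^ ?n"
 proof -
  have m0: "min e (\<delta> ^ ?n) > 0" using e \<delta> by simp
  then show "e' > 0" using A by (simp add: e'_def)
  then have "A * e' <= (A + 1) * e'" by simp
  also have "... = min e (\<delta> ^ ?n)" using A by (simp add: e'_def)
  finally show "A * e' <= e" "A * e' <= \<delta> ^ ?n" by auto
 qed
 obtain V0 where V0: "open V0" "E \<subseteq> V0" "(LBINT z:V0. f z) < e'" by (rule small_open_nbhd[OF f E(2) e'(1)])
 define V where "V = V0 \<inter> U"
 have V: "open V" "E \<subseteq> V" "V \<subseteq> U" using V0 U E by (auto simp: V_def)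
 have Vb [measurable]: "V \<in> sets borel" using V(1) by simp
 have "(LBINT z:V. f z) <= (LBINT z:V0. f z)"
  using f V0(1) by (intro set_integral_mono_set_nonneg) (auto simp: V_def)
 then have Ve: "(LBINT z:V. f z) <= e'" using V0(3) by linarith
 obtain r where r: "r > 0" "U \<subseteq> cball 0 r" using bounded_subset_ballD[OF U(2), of 0] ball_subset_cball by (metis order_trans)
 have "cball (0::'a) r \<subseteq> cbox (- r *\<^sub>R One) (r *\<^sub>R One)"
 proof
  fix z :: 'a assume "z \<in> cball 0 r"
  then have "abs (z \<bullet> i) <= r" if "i \<in> Basis" for i using Basis_le_norm[OF that, of z] by simp
  then show "z \<in> cbox (- r *\<^sub>R One) (r *\<^sub>R One)" by (simp add: mem_box abs_le_iff minus_le_iff)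
 qed
 then have EQ: "E \<subseteq> cbox (- r *\<^sub>R One) (r *\<^sub>R One)" using E(1) r(2) by blast
 have ne: "box (- r *\<^sub>R One) (r *\<^sub>R One :: 'a) ~= {}" using r(1) by (simp add: box_ne_empty)
 \<comment> \<open>With this gauge every cube of the covering lies in \<open>V\<close>, because its
   distinguished point is in \<open>E\<close> and hence in \<open>V\<close>.\<close>
 have ga: "gauge (%x. if x \<in> V then V else UNIV)" using V(1) by (auto simp: gauge_def)
 obtain \<D> where \<D>: "countable \<D>" "\<Union>\<D> \<subseteq> cbox (- r *\<^sub>R One) (r *\<^sub>R One)"
  "!!K. K \<in> \<D> ==> interior K ~= {} & (\<exists>c d. K = cbox c d)"
  "pairwise (%A B. interior A \<inter> interior B = {}) \<D>"
  "!!K. K \<in> \<D> ==> \<exists>x \<in> E \<inter> K. K \<subseteq> (if x \<in> V then V else UNIV)"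
  "!!u v. cbox u v \<in> \<D> ==> \<exists>n. \<forall>i \<in> Basis. v \<bullet> i - u \<bullet> i = (r *\<^sub>R One \<bullet> i - (- r *\<^sub>R One) \<bullet> i) / 2^n"
  "E \<subseteq> \<Union>\<D>"
  by (rule covering_lemma[OF EQ ne ga]) blast
 have KV: "K \<subseteq> V" if "K \<in> \<D>" for K using \<D>(5)[OF that] V(2) by (auto split: if_splits)
 have one: "ediam m (g ` K) ^ ?n <= ennreal (A * (LBINT z:interior K. f z))" "ediam m (g ` K) <= ennreal \<delta>"
  if K: "K \<in> \<D>" for K
 proof -
  obtain c d where cd: "K = cbox c d" using \<D>(3)[OF K] by blast
  obtain k where k: "!!i. i \<in> Basis ==> d \<bullet> i - c \<bullet> i = (r *\<^sub>R One \<bullet> i - (- r *\<^sub>R One) \<bullet> i) / 2^k" using \<D>(6) K cd by blast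
  define s where "s = 2 * r / 2 ^ k"
  have s: "s > 0" using r(1) by (simp add: s_def)
  have side: "(d - c) \<bullet> i = s" if "i \<in> Basis" for i using k[OF that] that by (simp add: inner_diff_left s_def)
  have KU: "cbox c d \<subseteq> U" using KV[OF K] V(3) cd by blast
  have vol: "vol (cbox c d) = s ^ ?n" using s side by (intro cube_volume) auto
  have \<phi>K: "set_integrable lborel (cbox c d) \<phi>" by (rule set_integrable_lborel[OF \<phi>(1)]) simp
  have I0: "0 <= (LBINT z:cbox c d. \<phi> z)" by (rule set_integral_nonneg'[OF \<phi>(2)])
  have If: "(LBINT z:cbox c d. f z) = (LBINT z:cbox c d. \<phi> z) + s ^ ?n"
  proof -
   have "(LBINT z:cbox c d. f z) = (LBINT z:cbox c d. \<phi> z + 1)"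
    unfolding set_integral_def using KU by (intro Bochner_Integration.integral_cong) (auto simp: f_def indicator_def)
   also have "... = (LBINT z:cbox c d. \<phi> z) + (LBINT z:cbox c d. 1)"
    by (rule set_integral_add(2)[OF \<phi>K set_integrable_const_cbox])
   also have "(LBINT z:cbox c d. 1::real) = s ^ ?n" using vol by (simp add: set_integral_def)
   finally show ?thesis .
  qed
  define \<beta> where "\<beta> = root ?n ((LBINT z:cbox c d. \<phi> z) + s ^ ?n)"
  have pos: "0 < (LBINT z:cbox c d. \<phi> z) + s ^ ?n" using I0 s by (simp add: add_nonneg_pos)
  have \<beta>: "\<beta> > 0" "\<beta> ^ ?n = (LBINT z:cbox c d. \<phi> z) + s ^ ?n"
   using pos n0 by (simp_all add: \<beta>_def)
  have s\<beta>: "s <= \<beta>" by (rule power_le_imp_le_base[of s "?n - 1"]) (use \<beta> I0 n0 in auto)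
  have osc1: "abs (g x i - g y i) <= 2 * C * \<beta>" if "i < m" "x \<in> K" "y \<in> K" for i x y
  proof -
   have "abs (g x i - g y i) <= C * (s + \<beta>)"
    by (rule osc[OF that(1) KU s side \<beta>(1)]) (use that \<beta>(2) s cd in auto)
   also have "... <= C * (2 * \<beta>)" using C s\<beta> by (intro mult_left_mono) auto
   finally show ?thesis by simp
  qed
  have diam: "ediam m (g ` K) <= ennreal (real m * (2 * C) * \<beta>)"
  proof (rule ediam_le, clarify)
   fix x y assume xy: "x \<in> K" "y \<in> K"
   have "L2_set (%i. g x i - g y i) {..<m} <= (\<Sum>i<m. abs (g x i - g y i))" by (rule L2_set_le_sum_abs)
   also have "... <= (\<Sum>i<m. 2 * C * \<beta>)" using osc1 xy by (intro sum_mono) auto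
   finally show "L2_set (%i. g x i - g y i) {..<m} <= real m * (2 * C) * \<beta>" by simp
  qed
  have pw: "(real m * (2 * C) * \<beta>) ^ ?n = A * (LBINT z:cbox c d. f z)"
   by (simp only: power_mult_distrib[of "real m * (2 * C)"] A_def \<beta>(2) If)
  have "ediam m (g ` K) ^ ?n <= ennreal (real m * (2 * C) * \<beta>) ^ ?n" using diam by (intro power_mono) auto
  also have "... = ennreal ((real m * (2 * C) * \<beta>) ^ ?n)" using C \<beta>(1) by (intro ennreal_power) auto
  also have "... = ennreal (A * (LBINT z:interior K. f z))"
   unfolding pw set_integral_interior_cbox[OF f(1)] by (simp add: cd interior_cbox)
  finally show "ediam m (g ` K) ^ ?n <= ennreal (A * (LBINT z:interior K. f z))" .
  have "(real m * (2 * C) * \<beta>) ^ ?n <= A * (LBINT z:V. f z)"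
   unfolding pw using KV[OF K] cd A f by (intro mult_left_mono set_integral_mono_set_nonneg) auto
  also have "... <= A * e'" using Ve A by (intro mult_left_mono)
  also have "... <= \<delta> ^ ?n" by (rule e'(3))
  finally have "real m * (2 * C) * \<beta> <= \<delta>"
   using \<delta> n0 C \<beta>(1) by (simp add: power_mono_iff)
  then show "ediam m (g ` K) <= ennreal \<delta>" using diam by (elim order_trans) (rule ennreal_leI)
 qed
 define T where "T = to_nat_on \<D> ` \<D>"
 define Kf where "Kf i = from_nat_into \<D> i" for i
 have KT: "Kf i \<in> \<D>" if "i \<in> T" for i using that \<D>(1) by (auto simp: T_def Kf_def)
 have Kinj: "i = j" if "i \<in> T" "j \<in> T" "Kf i = Kf j" for i j using that to_nat_on_from_nat_into unfolding T_def Kf_def by metis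
 define W where "W i = (if i \<in> T then g ` Kf i else {})" for i
 have emp: "ediam m {} = 0" by (simp add: ediam_def bot_ennreal)
 have cover: "g ` E \<subseteq> (\<Union>i. W i)"
 proof
  fix y assume "y \<in> g ` E"
  then obtain x where x: "x \<in> E" "y = g x" by blast
  then obtain K where K: "K \<in> \<D>" "x \<in> K" using \<D>(7) by blast
  then have "to_nat_on \<D> K \<in> T" "Kf (to_nat_on \<D> K) = K" using \<D>(1) by (auto simp: T_def Kf_def)
  then have "y \<in> W (to_nat_on \<D> K)" using x K by (simp add: W_def)
  then show "y \<in> (\<Union>i. W i)" by blast
 qed
 have sum: "(\<Sum>i. ediam m (W i) ^ ?n) <= ennreal e"
  unfolding suminf_eq_SUP
 proof (rule SUP_least)
  fix N
  let ?F = "{..<N} \<inter> T"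
  have "(\<Sum>i<N. ediam m (W i) ^ ?n) = (\<Sum>i\<in>?F. ediam m (W i) ^ ?n)"
   using n0 by (intro sum.mono_neutral_right) (auto simp: W_def emp)
  also have "... <= (\<Sum>i\<in>?F. ennreal (A * (LBINT z:interior (Kf i). f z)))"
   using one(1) KT by (intro sum_mono) (auto simp: W_def)
  also have "... = ennreal (\<Sum>i\<in>?F. A * (LBINT z:interior (Kf i). f z))"
   using A f by (intro sum_ennreal) (auto intro!: mult_nonneg_nonneg set_integral_nonneg')
  \<comment> \<open>Closed cubes share faces. Their interiors are disjoint and carry the same mass,
    so integrals are added over interiors.\<close>
  also have "(\<Sum>i\<in>?F. A * (LBINT z:interior (Kf i). f z)) = A * (LBINT z:(\<Union>i\<in>?F. interior (Kf i)). f z)"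
  proof -
   have "disjoint_family_on (%i. interior (Kf i)) ?F"
    unfolding disjoint_family_on_def
   proof (intro ballI impI)
    fix i j assume ij: "i \<in> ?F" "j \<in> ?F" "i ~= j"
    then have "Kf i ~= Kf j" using Kinj by blast
    then show "interior (Kf i) \<inter> interior (Kf j) = {}" using \<D>(4) KT ij unfolding pairwise_def by blast
   qed
   then have "(LBINT z:(\<Union>i\<in>?F. interior (Kf i)). f z) = (\<Sum>i\<in>?F. LBINT z:interior (Kf i). f z)"
    by (intro set_integral_finite_Union set_integrable_lborel[OF f(1)]) auto
   then show ?thesis by (simp add: sum_distrib_left)
  qed
  also have "... <= A * (LBINT z:V. f z)"
  proof (intro mult_left_mono A set_integral_mono_set_nonneg f)
   show "(\<Union>i\<in>?F. interior (Kf i)) \<subseteq> V" using KV KT interior_subset by blast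
  qed auto
  also have "... <= A * e'" using Ve A by (intro mult_left_mono)
  also have "... <= e" by (rule e'(2))
  finally show "(\<Sum>i<N. ediam m (W i) ^ ?n) <= ennreal e" by (simp add: ennreal_leI)
 qed
 have "W i \<subseteq> topspace (Euclidean_space m) & ediam m (W i) <= ennreal \<delta>" for i
  using one(2) KT[of i] KV[of "Kf i"] V(3) top by (auto simp: W_def emp)
 with cover sum show ?thesis unfolding fine_cover_def by blast
qed

text \<open>The weight at \<open>a * s + d\<close> is compared with the integrable quantity
  \<open>s ^ n * ln (1 + s) ^ (2 n)\<close>. The factor \<open>a\<close> comes from undoing the
  cut-off, the shift \<open>d\<close> from subtracting a slope in the differentiability
  argument.\<close>

lemma osc_weight_affine_le:
 assumes M: "M > 0" and a: "a >= 0" and d: "d >= 0" and n: "n >= 2"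
 obtains C where "!!s. s >= 0 ==> osc_weight n M (a * s + d) <= C * (1 + s ^ n * ln (1 + s) ^ (2 * n))"
proof -
 define c where "c = ln (1 + (a + d) / M)"
 have c: "c >= 0" using a d M by (simp add: c_def)
 define C1 where "C1 = osc_weight n M (a * 2 + d)"
 define C2 where "C2 = (a + d) ^ n * (4 + 3 * c) ^ (2 * n)"
 have C1: "C1 >= 0" unfolding C1_def using M a d by (intro osc_weight_nonneg) auto
 have C2: "C2 >= 0" unfolding C2_def using c a d by simp
 have "osc_weight n M (a * s + d) <= (C1 + C2) * (1 + s ^ n * ln (1 + s) ^ (2 * n))" if s: "s >= 0" for s
 proof -
  let ?L = "ln (1 + s)"
  have L0: "0 <= s ^ n * ?L ^ (2 * n)" using s by simp
  show ?thesis
  proof (cases "s <= 2")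
   case True
   have "osc_weight n M (a * s + d) <= C1"
    unfolding C1_def using True s a d M by (intro osc_weight_mono) (auto intro: mult_left_mono)
   also have "... <= (C1 + C2) * 1" using C2 by simp
   also have "... <= (C1 + C2) * (1 + s ^ n * ?L ^ (2 * n))" using C1 C2 L0 by (intro mult_left_mono) auto
   finally show ?thesis .
  next
   case False
   \<comment> \<open>For \<open>s > 2\<close> the logarithm is at least 1, so constants can be
     absorbed into it; smaller \<open>s\<close> are covered by the value of the weight at
     \<open>s = 2\<close>.\<close>
   have "exp 1 <= 1 + s" using False exp_le by linarith
   then have L1: "?L >= 1" using s by (subst ln_ge_iff) auto
   have p0: "0 < 1 + (a + d) / M" using a d M by (intro add_pos_nonneg) auto
   have ads: "a * s + d <= (a + d) * s" using False d mult_left_mono[of 1 s d] by (simp add: algebra_simps)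
   have "1 + (a * s + d) / M <= (1 + s) * (1 + (a + d) / M)"
   proof -
    have "(a * s + d) / M <= (1 + s) * ((a + d) / M)"
     using ads a d s M by (simp add: divide_right_mono field_simps)
    then show ?thesis using s by (simp add: algebra_simps)
   qed
   then have "ln (1 + (a * s + d) / M) <= ln ((1 + s) * (1 + (a + d) / M))"
    using s a d M p0 by (subst ln_le_cancel_iff) (auto intro!: add_pos_nonneg mult_pos_pos)
   also have "... = ?L + c" unfolding c_def using s p0 by (intro ln_mult_pos) auto
   finally have "1 + 3 * ln (1 + (a * s + d) / M) <= 1 + 3 * ?L + 3 * c" by linarith
   also have "... <= (4 + 3 * c) * ?L" using L1 c mult_left_mono[of 1 ?L "3 * c"] by (simp add: algebra_simps)
   finally have 1: "1 + 3 * ln (1 + (a * s + d) / M) <= (4 + 3 * c) * ?L" .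
   have 0: "0 <= ln (1 + (a * s + d) / M)" using s a d M by auto
   have "osc_weight n M (a * s + d) = (a * s + d) ^ n * (1 + 3 * ln (1 + (a * s + d) / M)) ^ (2 * n)"
    using n by (simp add: osc_weight_def)
   also have "... <= ((a + d) * s) ^ n * ((4 + 3 * c) * ?L) ^ (2 * n)"
    using 0 1 ads a d s by (intro mult_mono power_mono) auto
   also have "... = C2 * (s ^ n * ?L ^ (2 * n))" by (simp add: C2_def power_mult_distrib)
   also have "... <= (C1 + C2) * (1 + s ^ n * ?L ^ (2 * n))" using C1 C2 L0 by (intro mult_mono) auto
   finally show ?thesis .
  qed
 qed
 then show ?thesis by (rule that)
qed

lemma bump_ge:
 assumes "r > 0" "z \<in> ball x (r / 2)"
 shows "exp (- (4 / 3)) <= bump x r z"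
proof -
 have "norm (z - x) / r <= 1 / 2" using assms by (simp add: dist_norm norm_minus_commute field_simps)
 then have "(norm (z - x) / r)\<^sup>2 <= (1 / 2)\<^sup>2" using assms by (intro power_mono) auto
 then have t: "1 - (norm (z - x) / r)\<^sup>2 >= 3 / 4" by (simp add: power2_eq_square)
 then have "1 / (1 - (norm (z - x) / r)\<^sup>2) <= 1 / (3 / 4)" by (intro divide_left_mono) auto
 then show ?thesis using t by (simp add: bump_def flat_exp_def)
qed

section \<open>Curves of exponentially integrable distortion\<close>

lemma abs_det_le:
 fixes A :: "real^'n^'n"
 assumes "!!i j. abs (A $ i $ j) <= 1"
 shows "abs (det A) <= real (card {p. p permutes (UNIV :: 'n set)})"
proof -
 have "abs (det A) <= (\<Sum>p | p permutes (UNIV :: 'n set). abs (of_int (sign p) * (\<Prod>i\<in>UNIV. A $ i $ p i)))"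
  unfolding det_def by (rule sum_abs)
 also have "... <= (\<Sum>p | p permutes (UNIV :: 'n set). 1)"
 proof (rule sum_mono)
  fix p assume "p \<in> {p. p permutes (UNIV :: 'n set)}"
  have "abs (of_int (sign p) :: real) = 1" by (simp add: sign_def)
  moreover have "abs (\<Prod>i\<in>UNIV. A $ i $ p i) <= 1" unfolding abs_prod using assms by (intro prod_le_1) auto
  ultimately show "abs (of_int (sign p) * (\<Prod>i\<in>UNIV. A $ i $ p i)) <= 1" by (simp add: abs_mult)
 qed
 finally show ?thesis by simp
qed

lemma member_abs_le_L2_set: "i < (m::nat) ==> abs (x i) <= L2_set x {..<m}"
proof -
 assume "i < m"
 then have "abs (x i) <= L2_set (%i. abs (x i)) {..<m}" by (intro member_le_L2_set) auto
 then show ?thesis by (simp add: L2_set_def)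
qed

text \<open>Every column is divided by its Euclidean norm, making the tuple admissible in the
  supremum, and multilinearity restores the norms. No factor depending on \<open>m\<close>
  arises.\<close>

lemma form_at_le_comass:
 fixes \<omega> :: "'n::{finite,wellorder} form"
 assumes c: "!!I p. I \<in> multi_indices m ==> p \<in> topspace (Euclidean_space m) ==> \<omega> I p = c I"
  and p: "p \<in> topspace (Euclidean_space m)"
 shows "abs (form_at m c A) <= comass m \<omega> p * (\<Prod>j\<in>UNIV. L2_set (%i. A i $ j) {..<m})"
proof -
 have fa: "form_apply m \<omega> p v = (\<Sum>I\<in>multi_indices m. c I * det (\<chi> k j. v j (I k)))" for v :: "'n => nat => real"
  unfolding form_apply_def using c p by (intro sum.cong) auto
 have fin: "finite (multi_indices m :: ('n => nat) set)"
  by (rule finite_subset[of _ "UNIV \<rightarrow>\<^sub>E {..<m}"]) (auto simp: multi_indices_def intro!: finite_PiE)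
 define X where "X = {abs (form_apply m \<omega> p v) | v. \<forall>j. v j \<in> topspace (Euclidean_space m) & L2_set (v j) {..<m} <= 1}"
 have bdd: "bdd_above X"
 proof (rule bdd_aboveI)
  fix y assume "y \<in> X"
  then obtain v where v: "y = abs (form_apply m \<omega> p v)" "!!j. L2_set (v j) {..<m} <= 1" by (auto simp: X_def)
  have "y <= (\<Sum>I\<in>multi_indices m. abs (c I * det (\<chi> k j. v j (I k))))" unfolding v(1) fa by (rule sum_abs)
  also have "... <= (\<Sum>I\<in>(multi_indices m :: ('n => nat) set). abs (c I) * real (card {p. p permutes (UNIV :: 'n set)}))"
   unfolding abs_mult
  proof (intro sum_mono mult_left_mono abs_det_le)
   fix I :: "'n => nat" and k j assume "I \<in> multi_indices m"
   then have "abs (v j (I k)) <= 1" by (rule order_trans[OF member_abs_le_L2_set[OF multi_indices_less] v(2)])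
   then show "abs ((\<chi> k j. v j (I k)) $ k $ j) <= 1" by simp
  qed auto
  finally show "y <= (\<Sum>I\<in>(multi_indices m :: ('n => nat) set). abs (c I) * real (card {p. p permutes (UNIV :: 'n set)}))" .
 qed
 define t where "t j = L2_set (%i. A i $ j) {..<m}" for j
 \<comment> \<open>A zero column stays zero, since division by zero gives 0; the identity
   \<open>A i $ j = t j * v j i\<close> then holds for every column.\<close>
 define v where "v j i = (if i < m then A i $ j / t j else 0)" for j i
 have t0: "A i $ j = t j * v j i" if "i < m" for i j
  using member_abs_le_L2_set[OF that, of "%i. A i $ j"] that by (cases "t j = 0") (auto simp: v_def t_def)
 have v1: "L2_set (v j) {..<m} <= 1" for j
 proof -
  have "L2_set (v j) {..<m} = L2_set (%i. inverse (t j) * A i $ j) {..<m}" by (intro L2_set_cong) (auto simp: v_def divide_inverse)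
  also have "... = inverse (t j) * t j" unfolding t_def by (rule L2_set_right_distrib[symmetric]) (simp add: L2_set_nonneg)
  also have "... <= 1" by (cases "t j = 0") simp_all
  finally show ?thesis .
 qed
 have "det (\<chi> k j. A (I k) $ j) = (\<Prod>j\<in>UNIV. t j) * det (\<chi> k j. v j (I k))" if I: "I \<in> multi_indices m" for I :: "'n => nat"
 proof -
  have "det (\<chi> k j. A (I k) $ j) = det (transpose (\<chi> k j. A (I k) $ j))" by (rule det_transpose[symmetric])
  also have "transpose (\<chi> k j. A (I k) $ j) = (\<chi> j. t j *s (\<chi> k. v j (I k)))"
   using t0[OF multi_indices_less[OF I]] by (simp add: transpose_def vec_eq_iff)
  also have "det ... = (\<Prod>j\<in>UNIV. t j) * det (\<chi> j. (\<chi> k. v j (I k)))" by (rule det_rows_mul)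
  also have "det (\<chi> j. (\<chi> k. v j (I k))) = det (transpose (\<chi> k j. v j (I k)))" by (simp add: transpose_def)
  also have "... = det (\<chi> k j. v j (I k))" by (rule det_transpose)
  finally show ?thesis .
 qed
 then have "form_at m c A = (\<Prod>j\<in>UNIV. t j) * form_apply m \<omega> p v"
  by (simp add: form_at_def fa sum_distrib_left mult_ac)
 moreover have "abs (form_apply m \<omega> p v) <= comass m \<omega> p"
  unfolding comass_def X_def[symmetric]
 proof (rule cSup_upper[OF _ bdd])
  have "v j \<in> topspace (Euclidean_space m)" for j by (simp add: v_def topspace_Euclidean_space)
  then show "abs (form_apply m \<omega> p v) \<in> X" using v1 by (auto simp: X_def)
 qed
 moreover have "(\<Prod>j\<in>UNIV. t j) >= 0" by (intro prod_nonneg) (simp add: t_def L2_set_nonneg)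
 ultimately have "abs (form_at m c A) <= (\<Prod>j\<in>UNIV. t j) * comass m \<omega> p" by (simp add: abs_mult mult_left_mono)
 then show ?thesis by (simp add: t_def mult.commute)
qed

lemma op_norm_le:
 fixes A :: "nat => real^'n"
 shows "L2_set (%i. A i \<bullet> w) {..<m} <= op_norm m A * norm w" "0 <= op_norm m A"
proof -
 have bdd: "bdd_above ((%h. L2_set (%i. A i \<bullet> h) {..<m}) ` cball 0 1)"
 proof (rule bdd_aboveI2)
  fix h :: "real^'n" assume h: "h \<in> cball 0 1"
  have "L2_set (%i. A i \<bullet> h) {..<m} <= (\<Sum>i<m. abs (A i \<bullet> h))" by (rule L2_set_le_sum_abs)
  also have "... <= (\<Sum>i<m. norm (A i) * 1)"
   using h by (intro sum_mono order_trans[OF Cauchy_Schwarz_ineq2] mult_left_mono) auto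
  finally show "L2_set (%i. A i \<bullet> h) {..<m} <= (\<Sum>i<m. norm (A i) * 1)" .
 qed
 have up: "L2_set (%i. A i \<bullet> h) {..<m} <= op_norm m A" if "h \<in> cball 0 1" for h
  unfolding op_norm_def using that by (intro cSUP_upper[OF _ bdd])
 show "0 <= op_norm m A" by (rule order_trans[OF L2_set_nonneg up[of 0]]) simp
 show "L2_set (%i. A i \<bullet> w) {..<m} <= op_norm m A * norm w"
 proof (cases "w = 0")
  case False
  have "L2_set (%i. A i \<bullet> w) {..<m} = norm w * L2_set (%i. A i \<bullet> (w /\<^sub>R norm w)) {..<m}"
   using False by (simp add: L2_set_right_distrib mult.assoc[symmetric])
  also have "... <= norm w * op_norm m A" using False by (intro mult_left_mono up) auto
  finally show ?thesis by (simp add: mult.commute)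
 qed (simp add: L2_set_def)
qed

section \<open>Passage from Lebesgue to Borel functions\<close>

lemma borel_representative:
 fixes g :: "'a::euclidean_space => real"
 assumes g: "g absolutely_integrable_on S" and S: "S \<in> sets borel"
 obtains g' where "L1 g'" "!!x. x \<notin> S ==> g' x = 0" "AE x. x \<in> S --> g' x = g x"
proof -
 let ?h = "%x. indicator S x *\<^sub>R g x"
 have h: "integrable lebesgue ?h" using g by (simp add: set_integrable_def)
 then obtain h' where h': "h' \<in> borel_measurable lborel" "AE x. ?h x = h' x"
  using completion_ex_borel_measurable_real[of ?h lborel] by auto
 define g' where "g' x = indicator S x * h' x" for x
 have gm: "g' \<in> borel_measurable lborel" unfolding g'_def using h'(1) S by measurable
 have ae: "AE x. ?h x = g' x" using h'(2) by eventually_elim (auto simp: g'_def indicator_def)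
 have "integrable lebesgue g'"
  using h ae by (subst integrable_cong_AE[of g' lebesgue ?h]) (auto intro!: measurable_completion gm simp: AE_completion_iff elim: eventually_mono)
 then have 1: "L1 g'" using integrable_completion[OF gm] by simp
 show ?thesis
 proof (rule that[OF 1])
  show "g' x = 0" if "x \<notin> S" for x using that by (simp add: g'_def)
  show "AE x. x \<in> S --> g' x = g x" using ae by eventually_elim auto
 qed
qed

lemma lebesgue_integral_representative:
 fixes g g' \<theta> :: "'a::euclidean_space => real"
 assumes g: "g absolutely_integrable_on S" and S: "S \<subseteq> \<Omega>"
  and g': "L1 g'" "!!x. x \<notin> S ==> g' x = 0" "AE x. x \<in> S --> g' x = g x"
  and \<theta>: "continuous_on UNIV \<theta>" "!!x. x \<notin> S ==> \<theta> x = 0"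
 shows "(LINT x:\<Omega>|lebesgue. g x * \<theta> x) = (LBINT x. g' x * \<theta> x)"
proof -
 let ?h = "%x. indicator S x *\<^sub>R g x"
 have "integrable lebesgue ?h" using g by (simp add: set_integrable_def)
 then have hm: "?h \<in> borel_measurable lebesgue" by auto
 have \<theta>m: "\<theta> \<in> borel_measurable lborel" using borel_measurable_continuous_onI[OF \<theta>(1)] by simp
 have g'm: "(%x. g' x * \<theta> x) \<in> borel_measurable lborel" using g'(1) \<theta>m by (intro borel_measurable_times) auto
 have "(LINT x:\<Omega>|lebesgue. g x * \<theta> x) = (\<integral>x. ?h x * \<theta> x \<partial>lebesgue)"
  unfolding set_integral_def using S \<theta>(2) by (intro Bochner_Integration.integral_cong) (auto simp: indicator_def)
 also have "... = (\<integral>x. g' x * \<theta> x \<partial>lebesgue)"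
 proof (rule integral_cong_AE)
  show "(%x. ?h x * \<theta> x) \<in> borel_measurable lebesgue"
   using hm measurable_completion[OF \<theta>m] by (rule borel_measurable_times)
  show "(%x. g' x * \<theta> x) \<in> borel_measurable lebesgue" by (rule measurable_completion[OF g'm])
  have "AE x. ?h x * \<theta> x = g' x * \<theta> x"
   using g'(3) by eventually_elim (use g'(2) in \<open>auto simp: indicator_def\<close>)
  then show "AE x in lebesgue. ?h x * \<theta> x = g' x * \<theta> x" by (rule AE_completion)
 qed
 also have "... = (LBINT x. g' x * \<theta> x)" by (rule integral_completion[OF g'm])
 finally show ?thesis .
qed

text \<open>The data after the target geometry has been reduced to a coefficient family
  \<open>c\<close> and its constant comass \<open>\<kappa>\<close>, with a real-valued distortion
  \<open>k\<close> for which the bounds are required almost everywhere.\<close>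

locale exp_distortion =
 fixes m :: nat and \<Omega> :: "(real^'n::{finite,wellorder}) set" and f :: "real^'n::_ => nat => real"
  and D :: "real^'n::_ => nat => real^'n::_" and c :: "('n => nat) => real" and \<kappa> lam :: real and k :: "real^'n::_ => real"
 assumes \<Omega>: "open \<Omega>" and W: "W11_loc \<Omega> m f D"
  and J: "locally_integrable \<Omega> (%x. form_at m c (D x))"
  and k: "k \<in> borel_measurable (lebesgue_on \<Omega>)"
  and distortion: "AE x in lebesgue. x \<in> \<Omega> --> 1 <= k x & \<kappa> * op_norm m (D x) ^ CARD('n) <= k x * form_at m c (D x)"
  and \<kappa>: "\<kappa> > 0" and fb: "!!A. abs (form_at m c A) <= \<kappa> * (\<Prod>j\<in>UNIV. L2_set (%i. A i $ j) {..<m})"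
  and lam: "exp_const TYPE(real^'n::_) <= lam" and ek: "locally_integrable \<Omega> (%x. exp (lam * k x))"
begin

text \<open>The limit is taken with the original components of \<open>f\<close> on all of
  \<open>\<Omega>\<close>. All local constructions therefore produce the same function, and no
  patching is required.\<close>

definition rep :: "nat => real^'n::_ => real" where
 "rep i x = lim (%l. LINT z:\<Omega>|lebesgue. f z i * mker (1 / real (Suc l)) x z)"



lemma f_absolutely_integrable: "i < m ==> compact S ==> S \<subseteq> \<Omega> ==> (%x. f x i) absolutely_integrable_on S"
 and D_absolutely_integrable: "i < m ==> compact S ==> S \<subseteq> \<Omega> ==> (%x. D x i $ j) absolutely_integrable_on S"
 using W by (auto simp: W11_loc_def locally_integrable_def)

lemma borel_data:
 assumes S: "cball x0 R \<subseteq> \<Omega>"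
 obtains F E where "!!i. i < m ==> wgrad (ball x0 R) (F i) (E i)"
  "!!i x. i < m ==> x \<notin> cball x0 R ==> F i x = 0 & E i x = 0"
  "AE x. x \<in> cball x0 R --> (\<forall>i<m. F i x = f x i & E i x = D x i)"
proof -
 let ?S = "cball x0 R"
 define F where "F i = (SOME g'. L1 g' & (\<forall>x. x \<notin> ?S --> g' x = 0) & (AE x. x \<in> ?S --> g' x = f x i))" for i
 define G where "G i j = (SOME g'. L1 g' & (\<forall>x. x \<notin> ?S --> g' x = 0) & (AE x. x \<in> ?S --> g' x = D x i $ j))" for i j
 have ex: "\<exists>g'. L1 g' & (\<forall>x. x \<notin> ?S --> g' x = 0) & (AE x. x \<in> ?S --> g' x = g x)"
  if g: "g absolutely_integrable_on ?S" for g :: "real^'n::_ => real"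
  by (rule borel_representative[OF g]) auto
 have F: "L1 (F i)" "x \<notin> ?S ==> F i x = 0" "AE x. x \<in> ?S --> F i x = f x i" if i: "i < m" for i x
  using someI_ex[OF ex[OF f_absolutely_integrable[OF i compact_cball S]], folded F_def] by auto
 have G: "L1 (G i j)" "x \<notin> ?S ==> G i j x = 0" "AE x. x \<in> ?S --> G i j x = D x i $ j" if i: "i < m" for i j x
  using someI_ex[OF ex[OF D_absolutely_integrable[OF i compact_cball S]], folded G_def] by auto
 define E where "E i x = (\<chi> j. G i j x)" for i x
 have Ei: "L1 (E i)" if i: "i < m" for i
 proof -
  have "E i = (%x. \<Sum>j\<in>UNIV. G i j x *\<^sub>R axis j 1)"
   by (rule ext) (simp add: E_def vec_eq_iff axis_def if_distrib cong: if_cong)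
  then show ?thesis using G(1)[OF i] by (auto intro!: Bochner_Integration.integrable_sum integrable_scaleR_left)
 qed
 show ?thesis
 proof (rule that[of F E])
  fix i assume i: "i < m"
  have "(LBINT x. F i x * (tgrad \<phi> x \<bullet> b)) = - (LBINT x. (E i x \<bullet> b) * \<phi> x)"
   if \<phi>: "test_function (ball x0 R) \<phi>" and b: "b \<in> Basis" for \<phi> b
  proof -
   obtain j where j: "b = axis j 1" using b by (auto simp: Basis_vec_def)
   have BS: "ball x0 R \<subseteq> ?S" by auto
   have \<phi>\<Omega>: "test_function \<Omega> \<phi>" using \<phi> BS S unfolding test_function_def by blast
   have wk: "(LINT x:\<Omega>|lebesgue. f x i * (tgrad \<phi> x \<bullet> b)) = - (LINT x:\<Omega>|lebesgue. D x i $ j * \<phi> x)"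
    using W i \<phi>\<Omega> unfolding tgrad_inner_Basis[OF b] by (auto simp: W11_loc_def weak_partial_deriv_def j)
   have out: "\<phi> x = 0" "tgrad \<phi> x \<bullet> b = 0" if "x \<notin> ?S" for x
    using test_function_outside[OF \<phi>, of x] that BS by auto
   have 1: "(LINT x:\<Omega>|lebesgue. f x i * (tgrad \<phi> x \<bullet> b)) = (LBINT x. F i x * (tgrad \<phi> x \<bullet> b))"
    by (rule lebesgue_integral_representative[OF f_absolutely_integrable[OF i compact_cball S] S F(1)[OF i] F(2)[OF i] F(3)[OF i] _ out(2)])
     (auto intro!: continuous_on_inner continuous_on_tgrad[OF test_functionD[OF \<phi>]] continuous_on_const)
   have 2: "(LINT x:\<Omega>|lebesgue. D x i $ j * \<phi> x) = (LBINT x. G i j x * \<phi> x)"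
    by (rule lebesgue_integral_representative[OF D_absolutely_integrable[OF i compact_cball S] S G(1)[OF i] G(2)[OF i] G(3)[OF i]
      C_diff_continuous[OF test_functionD[OF \<phi>]] out(1)])
   show ?thesis using wk unfolding 1 2 by (simp add: E_def j inner_axis)
  qed
  then show "wgrad (ball x0 R) (F i) (E i)" using F(1)[OF i] Ei[OF i] by (auto simp: wgrad_def)
 next
  fix i x assume "i < m" "x \<notin> ?S"
  then show "F i x = 0 & E i x = 0" using F(2) G(2) by (simp add: E_def vec_eq_iff)
 next
  have "AE x. x \<in> ?S --> (F i x = f x i & E i x = D x i)" if i: "i < m" for i
  proof -
   have "AE x. \<forall>j. x \<in> ?S --> G i j x = D x i $ j" unfolding AE_all_countable using G(3)[OF i] by blast
   then show ?thesis using F(3)[OF i] by eventually_elim (auto simp: E_def vec_eq_iff)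
  qed
  then have "AE x. \<forall>i\<in>{..<m}. x \<in> ?S --> (F i x = f x i & E i x = D x i)"
   by (subst AE_ball_countable) auto
  then show "AE x. x \<in> ?S --> (\<forall>i<m. F i x = f x i & E i x = D x i)" by eventually_elim auto
 qed
qed

text \<open>The interface between the integrability and the regularity results. Every threshold
  \<open>M\<close> and shift \<open>d\<close> is demanded because differentiability uses small
  thresholds and subtracts arbitrary slopes.\<close>

definition dominated :: "(real^'n::_) set => (nat => real^'n::_ => real^'n::_) => (real^'n::_ => real) => bool" where
 "dominated B E u \<longleftrightarrow> u \<in> borel_funs & (\<forall>x. 0 <= u x) &
  (AE x. x \<in> B --> (\<forall>i<m. norm (E i x) <= u x)) &
  (\<forall>M d. M > 0 --> d >= 0 --> L1 (%x. indicator B x * osc_weight CARD('n) M (u x + d)))"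

lemma dominated_dim1:
 assumes n: "CARD('n) = 1" and E: "!!i. i < m ==> L1 (E i)"
 shows "dominated (ball x0 R) E (%x. \<Sum>i<m. norm (E i x))"
proof -
 have u: "L1 (%x. \<Sum>i<m. norm (E i x))" using E by auto
 have "norm (E i x) <= (\<Sum>i<m. norm (E i x))" if "i < m" for i x using that by (intro member_le_sum) auto
 moreover have "L1 (%x. indicator (ball x0 R) x * osc_weight CARD('n) M ((\<Sum>i<m. norm (E i x)) + d))" for M d
 proof -
  have "L1 (%x. indicator (ball x0 R) x *\<^sub>R (\<Sum>i<m. norm (E i x)))"
   using integrable_mult_indicator[OF _ u, of "ball x0 R"] by simp
  moreover have "L1 (%x. d * indicat_real (ball x0 R) x)"
   by (intro integrable_mult_right integrable_indicator_bounded) auto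
  ultimately have "L1 (%x. indicator (ball x0 R) x *\<^sub>R (\<Sum>i<m. norm (E i x)) + d * indicat_real (ball x0 R) x)"
   by (rule Bochner_Integration.integrable_add)
  then show ?thesis by (simp add: osc_weight_def n algebra_simps)
 qed
 ultimately show ?thesis using u unfolding dominated_def by (auto intro: sum_nonneg measurable_L1)
qed

text \<open>Logarithmic integrability is available for the gradient multiplied by a bump; on the
  ball of half the radius the bump is bounded below and can be divided out.\<close>

lemma dominated_higher_dim:
 assumes n: "CARD('n) >= 2" and R: "R > 0" and S: "cball x0 R \<subseteq> \<Omega>"
  and wg: "!!i. i < m ==> wgrad (ball x0 R) (F i) (E i)"
  and off: "!!i x. i < m ==> x \<notin> cball x0 R ==> F i x = 0 & E i x = 0"
  and ae: "AE x. x \<in> cball x0 R --> (\<forall>i<m. F i x = f x i & E i x = D x i)"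
 obtains r u where "0 < r" "r <= R" "dominated (ball x0 r) E u"
proof -
 let ?n = "CARD('n)" and ?S = "cball x0 R" and ?T = "TYPE(real^'n::_)"
 let ?J = "%x. form_at m c (%i. E i x)"
 have Sm [measurable]: "?S \<in> sets borel" by simp
 have J0: "?J x = 0" if "x \<notin> ?S" for x using off that by (intro form_at_zero) auto
 have JD: "form_at m c (%i. E i x) = form_at m c (D x)" if "\<forall>i<m. F i x = f x i & E i x = D x i" for x
  using that by (auto simp: form_at_def multi_indices_less intro!: sum.cong)
 have Em: "E i \<in> borel_funs" if "i < m" for i using wg[OF that] by (auto simp: wgrad_def dest: measurable_L1)
 have Jm [measurable]: "?J \<in> borel_funs"
 proof (rule measurable_form_at)
  show "(%x. E i x $ j) \<in> borel_funs" if "i < m" for i j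
  proof -
   have "(%x. E i x \<bullet> axis j 1) \<in> borel_funs" using Em[OF that] by (intro borel_measurable_inner) auto
   then show ?thesis by (simp add: inner_axis)
  qed
 qed
 have Ji: "L1 ?J"
 proof -
  have "(%x. form_at m c (D x)) absolutely_integrable_on ?S" using J S by (simp add: locally_integrable_def)
  then have "integrable lebesgue (%x. indicator ?S x *\<^sub>R form_at m c (D x))" by (simp add: set_integrable_def)
  moreover have "AE x in lebesgue. indicator ?S x *\<^sub>R form_at m c (D x) = ?J x"
   using AE_completion[OF ae] by eventually_elim (use J0 JD in \<open>auto simp: indicator_def\<close>)
  ultimately have "integrable lebesgue ?J"
   by (subst integrable_cong_AE[of ?J lebesgue "%x. indicator ?S x *\<^sub>R form_at m c (D x)"]) (auto intro!: measurable_completion elim: eventually_mono)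
  then show ?thesis using integrable_completion[of ?J lborel] by simp
 qed
 obtain k' where k': "k' \<in> borel_funs" "!!x. 1 <= k' x" "AE x. x \<in> ?S --> k' x = k x"
 proof -
  have "(%x. indicator \<Omega> x *\<^sub>R k x) \<in> borel_measurable lebesgue"
   using k \<Omega> by (subst borel_measurable_restrict_space_iff[symmetric]) auto
  then obtain k0 where k0: "k0 \<in> borel_measurable lborel" "AE x. indicator \<Omega> x *\<^sub>R k x = k0 x"
   using completion_ex_borel_measurable_real[of "%x. indicator \<Omega> x *\<^sub>R k x" lborel] by auto
  show thesis
  proof (rule that[of "%x. max 1 (k0 x)"])
   show "(%x. max 1 (k0 x)) \<in> borel_funs" using k0(1) by simp
   have "AE x. x \<in> \<Omega> --> 1 <= k x" using distortion unfolding AE_completion_iff by eventually_elim auto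
   then show "AE x. x \<in> ?S --> max 1 (k0 x) = k x" using k0(2)
    by eventually_elim (use S in \<open>auto simp: indicator_def\<close>)
  qed simp
 qed
 note [measurable] = k'(1)
 \<comment> \<open>The distortion inequality is turned into an equality: \<open>u ^ n\<close> is
   \<open>k'\<close> times the pullback over \<open>\<kappa>\<close> almost everywhere on the ball,
   and \<open>u\<close> is Borel although the operator norm is known only through Lebesgue
   data.\<close>
 define u where "u x = indicator ?S x * root ?n (k' x * (max 0 (?J x) / \<kappa>))" for x
 have um [measurable]: "u \<in> borel_funs" unfolding u_def by measurable
 have u0: "0 <= u x" for x
  using k'(2)[of x] \<kappa> by (simp add: u_def)
 let ?k = "%x. (\<forall>i<m. E i x = D x i) & 0 <= ?J x & op_norm m (D x) <= u x & k' x = k x"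
 have key: "AE x. x \<in> ?S --> ?k x"
  using ae k'(3) distortion[unfolded AE_completion_iff]
 proof (eventually_elim, intro impI)
  fix x assume 1: "x \<in> ?S --> (\<forall>i<m. F i x = f x i & E i x = D x i)" "x \<in> ?S --> k' x = k x"
   "x \<in> \<Omega> --> 1 <= k x & \<kappa> * op_norm m (D x) ^ ?n <= k x * form_at m c (D x)" and x: "x \<in> ?S"
  have d: "1 <= k x" "\<kappa> * op_norm m (D x) ^ ?n <= k x * ?J x" "k' x = k x" using 1 x S JD[of x] by auto
  have o: "0 <= op_norm m (D x)" by (rule op_norm_le(2))
  have "0 <= k x * ?J x" by (rule order_trans[OF _ d(2)]) (use \<kappa> o in simp)
  then have J0: "0 <= ?J x" using d(1) by (simp add: zero_le_mult_iff)
  have "op_norm m (D x) ^ ?n <= k' x * (max 0 (?J x) / \<kappa>)" using d J0 \<kappa> by (simp add: field_simps)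
  then have "root ?n (op_norm m (D x) ^ ?n) <= root ?n (k' x * (max 0 (?J x) / \<kappa>))" by (intro real_root_le_mono) auto
  then have "op_norm m (D x) <= u x" using o x by (simp add: real_root_power_cancel u_def)
  then show "?k x" using 1 x J0 by auto
 qed
 have Du: "AE x. \<forall>w. L2_set (%i. E i x \<bullet> w) {..<m} <= u x * norm w"
  using key
 proof (eventually_elim, intro allI)
  fix x w assume 1: "x \<in> ?S --> ?k x"
  show "L2_set (%i. E i x \<bullet> w) {..<m} <= u x * norm w"
  proof (cases "x \<in> ?S")
   case True
   then have "L2_set (%i. E i x \<bullet> w) {..<m} = L2_set (%i. D x i \<bullet> w) {..<m}" using 1 by (intro L2_set_cong) auto
   also have "... <= op_norm m (D x) * norm w" by (rule op_norm_le(1))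
   also have "... <= u x * norm w" using 1 True by (intro mult_right_mono) auto
   finally show ?thesis .
  next
   case False
   then have "L2_set (%i. E i x \<bullet> w) {..<m} = 0" using off by (subst L2_set_eq_0_iff) auto
   then show ?thesis using u0[of x] by simp
  qed
 qed
 have uK: "AE x. u x ^ ?n <= k' x * (?J x / \<kappa>)"
  using key
 proof eventually_elim
  case (elim x)
  note 1 = elim
  show ?case
  proof (cases "x \<in> ?S")
   case True
   then show ?thesis using 1 k'(2)[of x] \<kappa> by (simp add: u_def)
  next
   case False
   then show ?thesis using J0[OF False] by (simp add: u_def power_0_left)
  qed
 qed
 have eK: "L1 (%x. indicator ?S x * exp (exp_const ?T * k' x))"
 proof -
  have "(%x. exp (lam * k x)) absolutely_integrable_on ?S" using ek S by (simp add: locally_integrable_def)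
  then have 1: "integrable lebesgue (%x. indicator ?S x *\<^sub>R exp (lam * k x))" by (simp add: set_integrable_def)
  have m: "(%x. indicator ?S x * exp (exp_const ?T * k' x)) \<in> borel_measurable lborel" by measurable
  have "integrable lebesgue (%x. indicator ?S x * exp (exp_const ?T * k' x))"
  proof (rule integrable_dominated[OF 1 measurable_completion[OF m]])
   show "AE x in lebesgue. norm (indicator ?S x * exp (exp_const ?T * k' x)) <= norm (indicator ?S x *\<^sub>R exp (lam * k x))"
    using AE_completion[OF k'(3)]
   proof eventually_elim
    case (elim x)
    note x = elim
    have "exp (exp_const ?T * k' x) <= exp (lam * k' x)" using lam k'(2)[of x] by (simp add: mult_right_mono)
    then show ?case
     using x by (auto simp: indicator_def)
   qed
  qed
  then show ?thesis using integrable_completion[OF m] by simp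
 qed
 \<comment> \<open>The cube of half-side \<open>r\<close> lies in the ball of radius
   \<open>n * r = R / 2\<close>.\<close>
 define r where "r = R / (2 * real ?n)"
 have r: "r > 0" "real ?n * r < R" "r <= R" using R n by (auto simp: r_def field_simps)
 let ?p = "x0 - r *\<^sub>R One" and ?q = "x0 + r *\<^sub>R One"
 have bx: "cball x0 r \<subseteq> cbox ?p ?q"
 proof
  fix z assume "z \<in> cball x0 r"
  then have "abs ((z - x0) \<bullet> i) <= r" if "i \<in> Basis" for i
   using Basis_le_norm[OF that, of "z - x0"] by (simp add: dist_norm norm_minus_commute)
  then show "z \<in> cbox ?p ?q" by (fastforce simp: mem_box inner_diff_left inner_add_left abs_le_iff)
 qed
 have bx2: "cbox ?p ?q \<subseteq> ball x0 R"
 proof -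
  have "cball x0 (real DIM(real^'n::_) * r) \<subseteq> ball x0 R" using r by (auto simp: subset_eq)
  then show ?thesis using mem_cube_subset_ball[of r x0] r(1) by (meson less_imp_le order_trans)
 qed
 define s where "s x = bump x0 r x * u x" for x
 have li: "L1 (%x. s x ^ ?n * ln (1 + s x) ^ (2 * ?n))"
  unfolding s_def
  by (rule local_log_integrability[OF n fb \<kappa> r(1) bx bx2 wg _ _ um u0 Du k'(1,2) Ji uK eK]) (use off in \<open>auto simp: u_def\<close>)
 have s0: "0 <= s x" for x using u0[of x] bump_nonneg[of x0 r x] by (simp add: s_def)
 let ?B = "ball x0 (r / 2)"
 have "dominated ?B E u"
  unfolding dominated_def
 proof (intro conjI allI impI um u0)
  show "AE x. x \<in> ?B --> (\<forall>i<m. norm (E i x) <= u x)"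
   using Du
   by eventually_elim (intro impI allI, rule norm_le_of_L2_le[OF _ _ u0])
  fix M d :: real assume M: "M > 0" and d: "d >= 0"
  \<comment> \<open>The reciprocal of the lower bound of the bump on the half ball: there
    \<open>1 - 1/4 = 3/4\<close> enters the exponent \<open>-1 / (3/4)\<close>.\<close>
  define a where "a = exp (4 / 3 :: real)"
  obtain C where C: "!!s. s >= 0 ==> osc_weight ?n M (a * s + d) <= C * (1 + s ^ ?n * ln (1 + s) ^ (2 * ?n))"
   using osc_weight_affine_le[OF M _ d n, of a] by (auto simp: a_def)
  have iB: "L1 (indicat_real ?B)" by (rule integrable_indicator_bounded) auto
  have [measurable]: "?B \<in> sets borel" by simp
  have om: "(%x. osc_weight ?n M (u x + d)) \<in> borel_funs"
   by (rule measurable_compose[OF _ measurable_osc_weight]) measurable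
  show "L1 (%x. indicator ?B x * osc_weight ?n M (u x + d))"
  proof (rule integrable_majorant)
   show "L1 (%x. abs (C * (indicator ?B x + s x ^ ?n * ln (1 + s x) ^ (2 * ?n))))" using iB li by auto
   show "abs (indicator ?B x * osc_weight ?n M (u x + d)) <= abs (C * (indicator ?B x + s x ^ ?n * ln (1 + s x) ^ (2 * ?n)))" for x
   proof (cases "x \<in> ?B")
    case True
    have "1 = a * exp (- (4/3))" by (simp add: a_def exp_add[symmetric])
    also have "... <= a * bump x0 r x" using bump_ge[OF r(1) True] by (intro mult_left_mono) (auto simp: a_def)
    finally have "1 * u x <= a * bump x0 r x * u x" using u0 by (intro mult_right_mono)
    then have "u x + d <= a * s x + d" by (simp add: s_def mult.assoc)
    then have "osc_weight ?n M (u x + d) <= osc_weight ?n M (a * s x + d)" using u0[of x] d M by (intro osc_weight_mono) auto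
    also have "... <= C * (1 + s x ^ ?n * ln (1 + s x) ^ (2 * ?n))" by (rule C[OF s0])
    finally have "osc_weight ?n M (u x + d) <= C * (1 + s x ^ ?n * ln (1 + s x) ^ (2 * ?n))" .
    moreover have "0 <= osc_weight ?n M (u x + d)" using u0[of x] d M by (intro osc_weight_nonneg) auto
    ultimately show ?thesis using True by simp
   qed simp
  qed (use om in measurable)
 qed
 with r show ?thesis by (intro that[of "r/2" u]) auto
qed

end

lemma wgrad_subset: "wgrad U g G ==> V \<subseteq> U ==> wgrad V g G"
 unfolding wgrad_def test_function_def by blast

context exp_distortion
begin

definition rep_map :: "real^'n::_ => nat => real" where
 "rep_map x i = (if i < m then rep i x else 0)"

text \<open>All conclusions in a form that passes to countable unions; property (N) is stated
  through covers because small covers of countably many images combine.\<close>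

definition regular_on :: "(real^'n::_) set => bool" where
 "regular_on B \<longleftrightarrow> open B & B \<subseteq> \<Omega> &
  (AE x. x \<in> B --> (\<forall>i<m. rep i x = f x i)) & (\<forall>i<m. continuous_on B (rep i)) &
  (AE x. x \<in> B --> (\<forall>i<m. (rep i has_derivative (%w. D x i \<bullet> w)) (at x))) &
  (\<forall>E \<delta> e. E \<subseteq> B --> E \<in> null_sets lborel --> \<delta> > 0 --> e > 0 --> (\<exists>W. fine_cover m CARD('n) \<delta> e (rep_map ` E) W))"

lemma regular_if_dominated:
 assumes r: "r > 0" "r <= R" and S: "cball x0 R \<subseteq> \<Omega>"
  and wg: "!!i. i < m ==> wgrad (ball x0 R) (F i) (E i)"
  and ae: "AE x. x \<in> cball x0 R --> (\<forall>i<m. F i x = f x i & E i x = D x i)"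
  and dom: "dominated (ball x0 r) E u"
 shows "regular_on (ball x0 r)"
proof -
 let ?n = "CARD('n)"
 have Dn: "DIM(real^'n::_) = ?n" by simp
 define B where "B = ball x0 r"
 have Bb: "open B" "bounded B" by (simp_all add: B_def)
 have BR: "B \<subseteq> ball x0 R" "B \<subseteq> cball x0 R" using r by (auto simp: B_def)
 have B\<Omega>: "B \<subseteq> \<Omega>" using BR S by blast
 have Bm [measurable]: "B \<in> sets borel" by (simp add: B_def)
 have um [measurable]: "u \<in> borel_funs" and u0: "!!x. 0 <= u x"
  and uE: "AE x. x \<in> B --> (\<forall>i<m. norm (E i x) <= u x)"
  and u\<Phi>: "!!M d. M > 0 ==> d >= 0 ==> L1 (%x. indicator B x * osc_weight ?n M (u x + d))"
  using dom by (auto simp: dominated_def B_def)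
 \<comment> \<open>The data are cut down to \<open>B\<close>, where the domination holds; the slope
   0 puts them in the form of \<open>wgrad_minus_linear\<close>.\<close>
 define F' where "F' i z = indicator B z * (F i z - 0 \<bullet> z)" for i z
 define E' where "E' i z = indicator B z *\<^sub>R (E i z - 0)" for i z
 define v where "v z = indicator B z * u z" for z
 have wg': "wgrad B (F' i) (E' i)" if "i < m" for i
  unfolding F'_def E'_def by (rule wgrad_minus_linear[OF wgrad_subset[OF wg[OF that] BR(1)] Bb])
 have vm [measurable]: "v \<in> borel_funs" unfolding v_def by measurable
 have v0: "0 <= v z" for z using u0[of z] by (simp add: v_def)
 have E'v: "AE z. norm (E' i z) <= v z" if "i < m" for i
  using uE by eventually_elim (use that in \<open>auto simp: E'_def v_def indicator_def\<close>)
 have n0: "?n >= 1" by (simp add: Suc_leI)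
 have \<Phi>v: "L1 (%z. osc_weight ?n M (v z))" if M: "M > 0" for M
 proof -
  have "(%z. osc_weight ?n M (v z)) = (%z. indicator B z * osc_weight ?n M (u z + 0))"
   by (rule ext) (auto simp: v_def indicator_def osc_weight_0)
  then show ?thesis using u\<Phi>[OF M, of 0] by simp
 qed
 have \<Phi>v': "L1 (%z. indicator B z * osc_weight ?n M (v z + d))" if M: "M > 0" and d: "d >= 0" for M d
 proof -
  have "(%z. indicator B z * osc_weight ?n M (v z + d)) = (%z. indicator B z * osc_weight ?n M (u z + d))"
   by (rule ext) (auto simp: v_def indicator_def)
  then show ?thesis using u\<Phi>[OF M d] by simp
 qed
 have vi: "L1 v"
 proof (rule integrable_majorant)
  have "L1 (indicat_real B)" by (rule integrable_indicator_bounded[OF Bb(2)]) simp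
  then show "L1 (%z. indicat_real B z + osc_weight ?n 1 (v z))" using \<Phi>v[of 1] by auto
  show "abs (v z) <= indicat_real B z + osc_weight ?n 1 (v z)" for z
  proof (cases "z \<in> B")
   case True
   have o: "0 <= osc_weight ?n 1 (v z)" by (rule osc_weight_nonneg[OF _ v0]) simp
   have "v z <= 1 + osc_weight ?n 1 (v z)"
   proof (cases "?n = 1 \<or> v z <= 1")
    case True
    then show ?thesis using o by (auto simp: osc_weight_def)
   next
    case False
    have "v z ^ 1 <= v z ^ ?n" using False n0 by (intro power_increasing) auto
    also have "... = v z ^ ?n * 1" by simp
    also have "... <= osc_weight ?n 1 (v z)"
     unfolding osc_weight_def using False v0[of z] by (auto intro!: mult_left_mono one_le_power)
    finally show ?thesis by simp
   qed
   then show ?thesis using True v0[of z] o by simp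
  qed (simp add: v_def osc_weight_0)
 qed simp
 have F'f: "AE x. x \<in> B --> (\<forall>i<m. F' i x = f x i & E' i x = D x i)"
  using ae by eventually_elim (use BR(2) in \<open>auto simp: F'_def E'_def\<close>)
 have po: "x \<in> B ==> (%l. mol (1 / real (Suc l)) (F' i) x) \<longlonglongrightarrow> prec (F' i) x" "continuous_on B (prec (F' i))"
  "AE x. x \<in> B --> prec (F' i) x = F' i x" if i: "i < m" for i x
  using prec_oscillation[OF wg'[OF i] Bb(1) vi v0 E'v[OF i], unfolded Dn, OF \<Phi>v[of 1]] by simp_all
 \<comment> \<open>For small radii the kernel lives inside \<open>B\<close>, so mollifying the Borel
   version there agrees with the integral of the original component over
   \<open>\<Omega>\<close>.\<close>
 have rp: "rep i x = prec (F' i) x" if i: "i < m" and x: "x \<in> B" for i x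
 proof -
  obtain d where d: "d > 0" "ball x d \<subseteq> B" using x Bb(1) by (meson open_contains_ball)
  have fB: "(%x. f x i) absolutely_integrable_on B"
   by (rule set_integrable_subset[OF f_absolutely_integrable[OF i compact_cball S]]) (use BR in auto)
  have F'i: "L1 (F' i)" using wg'[OF i] by (simp add: wgrad_def)
  have F'0: "F' i z = 0" if "z \<notin> B" for z using that by (simp add: F'_def)
  have F'e: "AE x. x \<in> B --> F' i x = f x i" using F'f by eventually_elim (use i in blast)
  from eventually_inverse_Suc_less[OF d(1)] have "\<forall>\<^sub>F l in sequentially. mol (1 / real (Suc l)) (F' i) x = (LINT z:\<Omega>|lebesgue. f z i * mker (1 / real (Suc l)) x z)"
  proof eventually_elim
   case (elim l)
   note l = elim
   have "ball x (1 / real (Suc l)) \<subseteq> ball x d" using l by (intro subset_ball) simp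
   then have sub: "ball x (1 / real (Suc l)) \<subseteq> B" using d(2) by blast
   have mk0: "mker (1 / real (Suc l)) x z = 0" if "z \<notin> B" for z using that sub by (intro mker_eq_0) auto
   show ?case
    unfolding mol_def by (rule lebesgue_integral_representative[OF fB B\<Omega> F'i F'0 F'e continuous_on_mker mk0, symmetric])
  qed
  from Lim_transform_eventually[OF po(1)[OF i x] this] show ?thesis unfolding rep_def by (rule limI)
 qed
 have cont: "continuous_on B (rep i)" if i: "i < m" for i
  using po(2)[OF i] rp[OF i] by (simp cong: continuous_on_cong)
 have eqF: "AE x. x \<in> B --> rep i x = F' i x" if i: "i < m" for i
  using po(3)[OF i] by eventually_elim (use rp[OF i] in simp)
 have all: "AE x. x \<in> B --> (\<forall>i<m. P i x)" if "!!i. i < m ==> AE x. x \<in> B --> P i x" for P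
 proof -
  have "AE x. \<forall>i\<in>{..<m}. x \<in> B --> P i x" using that by (subst AE_ball_countable) auto
  then show ?thesis by eventually_elim auto
 qed
 have 1: "AE x. x \<in> B --> (\<forall>i<m. rep i x = f x i)"
 proof -
  have "AE x. x \<in> B --> (\<forall>i<m. rep i x = F' i x)" by (rule all) (rule eqF)
  then show ?thesis using F'f by eventually_elim auto
 qed
 have 2: "AE x. x \<in> B --> (\<forall>i<m. (rep i has_derivative (%w. D x i \<bullet> w)) (at x))"
 proof (rule all)
  fix i assume i: "i < m"
  have "AE x. x \<in> B --> (rep i has_derivative (%w. E' i x \<bullet> w)) (at x)"
   by (rule representative_differentiable[OF wg'[OF i] Bb vm v0 E'v[OF i] _ eqF[OF i] cont[OF i]])
    (simp only: Dn \<Phi>v')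
  then show "AE x. x \<in> B --> (rep i has_derivative (%w. D x i \<bullet> w)) (at x)"
   using F'f by eventually_elim (use i in auto)
 qed
 have 3: "\<exists>W. fine_cover m ?n \<delta> e (rep_map ` N) W"
  if N: "N \<subseteq> B" "N \<in> null_sets lborel" and de: "\<delta> > 0" "e > 0" for N \<delta> e
 proof -
  let ?C = "2 * osc_const TYPE(real^'n::_)"
  have "\<exists>W. fine_cover m DIM(real^'n::_) \<delta> e (rep_map ` N) W"
  proof (rule fine_cover_image_null_set[OF Bb \<Phi>v[of 1] osc_weight_nonneg[OF _ v0] _ _ _ N de])
   show "rep_map x \<in> topspace (Euclidean_space m)" for x by (simp add: rep_map_def topspace_Euclidean_space)
   show "?C >= 0" by simp
   fix p q s \<beta> i x y assume i: "i < m" and Q: "cbox p q \<subseteq> B" and s: "(s::real) > 0" "!!b. b \<in> Basis ==> (q - p) \<bullet> b = s"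
    and \<beta>: "(\<beta>::real) > 0" and le: "(LBINT z:cbox p q. osc_weight ?n 1 (v z)) <= \<beta> ^ DIM(real^'n::_)"
    and xy: "x \<in> cbox p q" "y \<in> cbox p q"
   have "abs (rep i x - rep i y) <= 2 * (osc_const TYPE(real^'n::_) * (s * 1 + \<beta>))"
    by (rule representative_oscillation[OF wg'[OF i] Bb(1) vi v0 E'v[OF i] _ _ eqF[OF i] cont[OF i] Q s \<beta> _ xy])
     (use le \<Phi>v[of 1] in \<open>simp_all only: Dn zero_less_one\<close>)
   also have "... = ?C * (s + \<beta>)" by (simp only: mult.assoc mult_1_right)
   finally show "abs (rep_map x i - rep_map y i) <= ?C * (s + \<beta>)" using i by (simp only: rep_map_def if_True)
  qed auto
  then show ?thesis by (simp only: Dn)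
 qed
 show ?thesis unfolding regular_on_def B_def[symmetric] using Bb(1) B\<Omega> 1 2 3 cont by blast
qed

lemma locally_regular:
 assumes x0: "x0 \<in> \<Omega>"
 obtains B where "x0 \<in> B" "regular_on B"
proof -
 obtain R where R: "R > 0" "cball x0 R \<subseteq> \<Omega>" using x0 \<Omega> by (meson open_contains_cball)
 obtain F E where FE: "!!i. i < m ==> wgrad (ball x0 R) (F i) (E i)"
  "!!i x. i < m ==> x \<notin> cball x0 R ==> F i x = 0 & E i x = 0"
  "AE x. x \<in> cball x0 R --> (\<forall>i<m. F i x = f x i & E i x = D x i)"
  by (rule borel_data[OF R(2)]) blast
 obtain r u where ru: "0 < r" "r <= R" "dominated (ball x0 r) E u"
 proof (cases "CARD('n) = 1")
  case True
  have "dominated (ball x0 R) E (%x. \<Sum>i<m. norm (E i x))"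
   by (rule dominated_dim1[OF True]) (use FE(1) in \<open>simp add: wgrad_def\<close>)
  then show thesis using R(1) by (intro that[of R]) auto
 next
  case False
  have "CARD('n) > 0" by simp
  then have n: "CARD('n) >= 2" using False by linarith
  show thesis by (rule dominated_higher_dim[OF n R FE]) (auto intro: that)
 qed
 have "regular_on (ball x0 r)" by (rule regular_if_dominated[OF ru(1,2) R(2) FE(1) FE(3) ru(3)])
 then show ?thesis using ru(1) by (intro that[of "ball x0 r"]) auto
qed

lemma regular_cover:
 shows "\<exists>B :: nat => (real^'n::_) set. \<Omega> = (\<Union>j. B j) & (\<forall>j. regular_on (B j))"
proof -
 let ?F = "{B. regular_on B}"
 have op: "open B" if "B \<in> ?F" for B using that by (auto simp: regular_on_def)
 obtain F' where F': "F' \<subseteq> ?F" "countable F'" "\<Union>F' = \<Union>?F" using Lindelof[of ?F] op by metis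
 have un: "\<Union>?F = \<Omega>"
 proof
  show "\<Omega> \<subseteq> \<Union>?F"
  proof
   fix x assume "x \<in> \<Omega>"
   then obtain B where "x \<in> B" "regular_on B" by (rule locally_regular)
   then show "x \<in> \<Union>?F" by blast
  qed
 qed (auto simp: regular_on_def)
 \<comment> \<open>The empty set is adjoined so that the countable cover can always be enumerated by
   naturals.\<close>
 have re: "regular_on {}" by (auto simp: regular_on_def fine_cover_def intro!: exI[of _ "%_. {}"])
  (auto simp: ediam_def bot_ennreal power_0_left)
 define G where "G = insert {} F'"
 have G: "countable G" "G ~= {}" using F'(2) by (auto simp: G_def)
 show ?thesis
 proof (intro exI[of _ "from_nat_into G"] conjI allI)
  show "\<Omega> = (\<Union>j. from_nat_into G j)" using un F'(3) range_from_nat_into[OF G(2,1)] by (auto simp: G_def)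
  show "regular_on (from_nat_into G j)" for j using from_nat_into[OF G(2), of j] F'(1) re by (auto simp: G_def)
 qed
qed

lemma regular_representative:
 shows "AE x in lebesgue_on \<Omega>. rep_map x = f x"
  and "continuous_map (top_of_set \<Omega>) (Euclidean_space m) rep_map"
  and "AE x in lebesgue_on \<Omega>. differentiable_target m rep_map x"
  and "lusin_N \<Omega> m rep_map"
proof -
 obtain B :: "nat => (real^'n::_) set" where B: "\<Omega> = (\<Union>j. B j)" "\<forall>j. regular_on (B j)" using regular_cover by (elim exE conjE)

 have \<Omega>s: "\<Omega> \<inter> space lebesgue \<in> sets lebesgue" using \<Omega> by auto
 have AEall: "AE x in lebesgue_on \<Omega>. P x" if "!!j. AE x. x \<in> B j --> P x" for P
 proof -
  have "AE x. \<forall>j. x \<in> B j --> P x" unfolding AE_all_countable using that by blast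
  then have "AE x. x \<in> \<Omega> --> P x" by eventually_elim (use B(1) in blast)
  then show ?thesis unfolding AE_restrict_space_iff[OF \<Omega>s] by (rule AE_completion)
 qed
 show "AE x in lebesgue_on \<Omega>. rep_map x = f x"
 proof (rule AEall)
  fix j
  have "AE x. x \<in> B j --> (\<forall>i<m. rep i x = f x i)" using spec[OF B(2), of j] by (simp add: regular_on_def)
  then show "AE x. x \<in> B j --> rep_map x = f x"
  proof (eventually_elim, intro impI ext)
   fix x i assume 1: "x \<in> B j --> (\<forall>i<m. rep i x = f x i)" and x: "x \<in> B j"
   have "x \<in> \<Omega>" using x B(1) by blast
   then have "f x \<in> topspace (Euclidean_space m)" using W by (auto simp: W11_loc_def)
   then show "rep_map x i = f x i" using 1 x by (auto simp: rep_map_def topspace_Euclidean_space)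
  qed
 qed
 have "continuous_on (\<Union>j. B j) (rep i)" if "i < m" for i
  using B(2) that by (intro continuous_on_open_UN) (auto simp: regular_on_def)
 then have "continuous_on \<Omega> (rep i)" if "i < m" for i using that by (simp only: B(1)[symmetric])
 then have "continuous_on \<Omega> (%x. rep_map x i)" for i
  by (cases "i < m") (simp_all add: rep_map_def)
 moreover have "rep_map x i = 0" if "m <= i" for x i using that by (simp add: rep_map_def)
 ultimately show "continuous_map (top_of_set \<Omega>) (Euclidean_space m) rep_map"
  unfolding Euclidean_space_def continuous_map_in_subtopology continuous_map_componentwise_UNIV
  by auto
 show "AE x in lebesgue_on \<Omega>. differentiable_target m rep_map x"
 proof (rule AEall)
  fix j
  have "AE x. x \<in> B j --> (\<forall>i<m. (rep i has_derivative (%w. D x i \<bullet> w)) (at x))"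
   using spec[OF B(2), of j] by (simp add: regular_on_def)
  then show "AE x. x \<in> B j --> differentiable_target m rep_map x"
  proof (eventually_elim, intro impI)
   fix x assume 1: "x \<in> B j --> (\<forall>i<m. (rep i has_derivative (%w. D x i \<bullet> w)) (at x))" and x: "x \<in> B j"
   let ?d = "%h. \<Sum>i<m. abs (rep i (x + h) - rep i x - D x i \<bullet> h) / norm h" and ?L = "%h. L2_set (%i. rep_map (x + h) i - rep_map x i - D x i \<bullet> h) {..<m}"
   have lim: "((%h. abs (rep i (x + h) - rep i x - D x i \<bullet> h) / norm h) \<longlongrightarrow> 0) (at 0)" if "i < m" for i
    using 1 x that by (auto simp: has_derivative_at)
   have "((%h. ?L h / norm h) \<longlongrightarrow> 0) (at 0)"
   proof (rule tendsto_sandwich)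
    show "\<forall>\<^sub>F h in at 0. 0 <= ?L h / norm h"
     by (intro always_eventually allI divide_nonneg_nonneg L2_set_nonneg norm_ge_zero)
    show "\<forall>\<^sub>F h in at 0. ?L h / norm h
      <= (?d h)"
    proof (intro always_eventually allI)
     fix h
     have "?L h <= (\<Sum>i<m. abs (rep_map (x + h) i - rep_map x i - D x i \<bullet> h))"
      by (rule L2_set_le_sum_abs)
     also have "... = (\<Sum>i<m. abs (rep i (x + h) - rep i x - D x i \<bullet> h))" by (simp add: rep_map_def)
     finally show "?L h / norm h
      <= (?d h)"
      unfolding sum_divide_distrib[symmetric] by (rule divide_right_mono) simp
    qed
    have "((%h. \<Sum>i<m. abs (rep i (x + h) - rep i x - D x i \<bullet> h) / norm h) \<longlongrightarrow> (\<Sum>i<m. 0)) (at 0)"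
     using lim by (intro tendsto_sum) auto
    then show "((%h. \<Sum>i<m. abs (rep i (x + h) - rep i x - D x i \<bullet> h) / norm h) \<longlongrightarrow> 0) (at 0)" by simp
   qed simp
   then show "differentiable_target m rep_map x" unfolding differentiable_target_def by blast
  qed
 qed
 show "lusin_N \<Omega> m rep_map"
  unfolding lusin_N_def
 proof (intro allI impI, elim conjE)
  fix E assume E: "E \<subseteq> \<Omega>" "E \<in> null_sets lebesgue"
  \<comment> \<open>Covers are available for Borel null sets; a Lebesgue null set is contained in
    one.\<close>
  then obtain N where N: "N \<in> null_sets lborel" "E \<subseteq> N" unfolding null_sets_completion_iff2 by blast
  show "hausdorff_measure m CARD('n) (rep_map ` E) = 0"
  proof (rule hausdorff_measure_eq_0)
   fix \<delta> e :: real assume \<delta>: "\<delta> > 0" and e: "e > 0"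
   have "\<exists>W. fine_cover m CARD('n) \<delta> e (rep_map ` (N \<inter> B j)) W" if "e > 0" for j e
   proof -
    have "B j \<in> sets lborel" using spec[OF B(2), of j] by (auto simp: regular_on_def)
    then have "N \<inter> B j \<in> null_sets lborel" using N(1) null_set_Int2 by blast
    moreover have "\<forall>E \<delta> e. E \<subseteq> B j --> E \<in> null_sets lborel --> \<delta> > 0 --> e > 0 --> (\<exists>W. fine_cover m CARD('n) \<delta> e (rep_map ` E) W)"
     using spec[OF B(2), of j] unfolding regular_on_def by (elim conjE)
    ultimately show ?thesis using \<delta> that by simp
   qed
   from fine_cover_UN[OF e this]
   obtain V where V: "fine_cover m CARD('n) \<delta> e (\<Union>j. rep_map ` (N \<inter> B j)) V" ..
   have "rep_map ` E \<subseteq> (\<Union>j. rep_map ` (N \<inter> B j))"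
   proof (rule image_subsetI)
    fix x assume x: "x \<in> E"
    then have "x \<in> (\<Union>j. B j)" using E(1) by (simp only: B(1)[symmetric] subset_iff)
    then show "rep_map x \<in> (\<Union>j. rep_map ` (N \<inter> B j))" using x N(2) by blast
   qed
   then have "fine_cover m CARD('n) \<delta> e (rep_map ` E) V" using V order_trans unfolding fine_cover_def by (elim conjE) (intro conjI, rule order_trans)
   then show "\<exists>W. fine_cover m CARD('n) \<delta> e (rep_map ` E) W" by blast
  qed
 qed
qed

end

theorem theorem1p4:
  shows "\<exists>c2 > (0::real).
    \<forall>(m::nat) (\<Omega> :: (real ^ 'n::{finite,wellorder}) set) (\<omega> :: 'n form)
      (f :: real ^ 'n::_ \<Rightarrow> nat \<Rightarrow> real) (K :: real ^ 'n::_ \<Rightarrow> ereal).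
      CARD('n) \<le> m \<longrightarrow>
      open \<Omega> \<longrightarrow> connected \<Omega> \<longrightarrow> \<Omega> \<noteq> {} \<longrightarrow>
      volume_form m \<omega> \<longrightarrow> constant_coefficients m \<omega> \<longrightarrow>
      finite_distortion_curve \<Omega> m \<omega> f K \<longrightarrow>
      (\<exists>lam > c2. locally_integrable \<Omega> (\<lambda>x. exp (lam * real_of_ereal (K x)))) \<longrightarrow>
      (\<exists>g. (AE x in lebesgue_on \<Omega>. g x = f x) \<and>
           continuous_map (top_of_set \<Omega>) (Euclidean_space m) g \<and>
           (AE x in lebesgue_on \<Omega>. differentiable_target m g x) \<and>
           lusin_N \<Omega> m g)"
proof (intro exI[of _ "exp_const TYPE(real^'n::_)"] conjI allI impI)
 show "exp_const TYPE(real^'n::_) > 0"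
  by (rule less_le_trans[OF _ exp_const_ge]) simp
 fix m :: nat and \<Omega> :: "(real ^ 'n::_) set" and \<omega> :: "'n form" and f :: "real ^ 'n::_ => nat => real" and K :: "real ^ 'n::_ => ereal"
 assume \<Omega>: "open \<Omega>" "\<Omega> ~= {}" and vf: "volume_form m \<omega>" and cc: "constant_coefficients m \<omega>"
  and fd: "finite_distortion_curve \<Omega> m \<omega> f K"
  and "\<exists>lam > exp_const TYPE(real^'n::_). locally_integrable \<Omega> (%x. exp (lam * real_of_ereal (K x)))"
 then obtain lam where lam: "lam > exp_const TYPE(real^'n::_)" "locally_integrable \<Omega> (%x. exp (lam * real_of_ereal (K x)))" by blast
 let ?T = "topspace (Euclidean_space m)"
 have o: "(%_. 0) \<in> ?T" by (simp add: topspace_Euclidean_space)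
 \<comment> \<open>The coefficients are constant, so their values at the origin represent them at
   every point of the target.\<close>
 define c where "c I = \<omega> I (%_. 0)" for I
 have c: "\<omega> I p = c I" if "I \<in> multi_indices m" "p \<in> ?T" for I p
  using cc that o unfolding constant_coefficients_def c_def by metis
 have fa: "form_apply m \<omega> p v = form_at m c (%i. \<chi> j. v j i)" if "p \<in> ?T" for p v
  unfolding form_apply_def form_at_def using c that by (intro sum.cong) auto
 define \<kappa> where "\<kappa> = comass m \<omega> (%_. 0)"
 have com: "comass m \<omega> p = \<kappa>" if "p \<in> ?T" for p unfolding \<kappa>_def comass_def fa[OF that] fa[OF o] ..
 have fb: "abs (form_at m c A) <= \<kappa> * (\<Prod>j\<in>UNIV. L2_set (%i. A i $ j) {..<m})" for A
  unfolding \<kappa>_def by (rule form_at_le_comass[OF c o])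
 \<comment> \<open>The form is nonzero on some tuple at the origin, and the comass inequality then
   excludes \<open>\<kappa> <= 0\<close>, because the product of column norms is
   nonnegative.\<close>
 have \<kappa>: "\<kappa> > 0"
 proof -
  obtain v where v: "form_apply m \<omega> (%_. 0) v ~= 0" using vf o by (auto simp: volume_form_def)
  let ?A = "%i. \<chi> j. v j i"
  have "0 < abs (form_at m c ?A)" using v fa[OF o] by simp
  also have "... <= \<kappa> * (\<Prod>j\<in>UNIV. L2_set (%i. ?A i $ j) {..<m})" by (rule fb)
  finally have "0 < \<kappa> * (\<Prod>j\<in>UNIV. L2_set (%i. ?A i $ j) {..<m})" .
  moreover have "0 <= (\<Prod>j\<in>UNIV. L2_set (%i. ?A i $ j) {..<m})" by (intro prod_nonneg) (simp add: L2_set_nonneg)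
  ultimately show ?thesis by (auto simp: zero_less_mult_iff)
 qed
 obtain D where D: "W11_loc \<Omega> m f D" "locally_integrable \<Omega> (star_pullback m \<omega> f D)"
  "K \<in> borel_measurable (lebesgue_on \<Omega>)" "\<forall>x\<in>\<Omega>. 1 <= K x" "AE x in lebesgue_on \<Omega>. K x < \<infinity>"
  "AE x in lebesgue_on \<Omega>. ereal (comass m \<omega> (f x) * op_norm m (D x) ^ CARD('n)) <= K x * ereal (star_pullback m \<omega> f D x)"
  using fd unfolding finite_distortion_curve_def by blast
 have fT: "f x \<in> ?T" if "x \<in> \<Omega>" for x using D(1) that by (auto simp: W11_loc_def)
 have sp: "star_pullback m \<omega> f D x = form_at m c (D x)" if "x \<in> \<Omega>" for x
  unfolding star_pullback_def fa[OF fT[OF that]] by (simp add: form_at_def)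
 have \<Omega>s: "\<Omega> \<inter> space lebesgue \<in> sets lebesgue" using \<Omega>(1) by auto
 interpret exp_distortion m \<Omega> f D c \<kappa> lam "%x. real_of_ereal (K x)"
 proof
  show "locally_integrable \<Omega> (%x. form_at m c (D x))"
   unfolding locally_integrable_def
  proof (intro allI impI, elim conjE)
   fix C assume C: "compact C" "C \<subseteq> \<Omega>"
   then have "star_pullback m \<omega> f D absolutely_integrable_on C" using D(2) by (simp add: locally_integrable_def)
   moreover have "(%x. indicator C x *\<^sub>R star_pullback m \<omega> f D x) = (%x. indicator C x *\<^sub>R form_at m c (D x))"
    using C(2) sp by (auto simp: indicator_def fun_eq_iff)
   ultimately show "(%x. form_at m c (D x)) absolutely_integrable_on C" by (simp add: set_integrable_def)
  qed
  show "(%x. real_of_ereal (K x)) \<in> borel_measurable (lebesgue_on \<Omega>)"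
   using D(3) by (rule borel_measurable_real_of_ereal)
  show "AE x in lebesgue. x \<in> \<Omega> --> 1 <= real_of_ereal (K x) &
   \<kappa> * op_norm m (D x) ^ CARD('n) <= real_of_ereal (K x) * form_at m c (D x)"
   using D(5,6) unfolding AE_restrict_space_iff[OF \<Omega>s]
  proof (eventually_elim, intro impI)
   fix x assume 1: "x \<in> \<Omega> --> K x < \<infinity>"
    "x \<in> \<Omega> --> ereal (comass m \<omega> (f x) * op_norm m (D x) ^ CARD('n)) <= K x * ereal (star_pullback m \<omega> f D x)" and x: "x \<in> \<Omega>"
   have K1: "1 <= K x" "K x < \<infinity>" using 1 x D(4) by auto
   then obtain k where k: "K x = ereal k" by (cases "K x") auto
   have "ereal (\<kappa> * op_norm m (D x) ^ CARD('n)) <= ereal (k * form_at m c (D x))"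
    using 1(2) x by (simp add: k sp[OF x] com[OF fT[OF x]])
   then show "1 <= real_of_ereal (K x) & \<kappa> * op_norm m (D x) ^ CARD('n) <= real_of_ereal (K x) * form_at m c (D x)"
    using K1 by (simp add: k one_ereal_def)
  qed
 qed (use \<Omega>(1) D(1) \<kappa> fb lam in auto)
 show "\<exists>g. (AE x in lebesgue_on \<Omega>. g x = f x) &
     continuous_map (top_of_set \<Omega>) (Euclidean_space m) g &
     (AE x in lebesgue_on \<Omega>. differentiable_target m g x) &
     lusin_N \<Omega> m g"
  using regular_representative by blast
qed

end
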